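(* Let $E_1,\dots,E_\mu$ be $E$-functions satisfying a differential system $\frac{d}{dz}E_i=\sum_{j=1}^\mu A_{i,j}E_j$ ($1\le i\le\mu$) with $A_{i,j}\in\overline{\mathbb{Q}}(z)$. Let $\xi$ be a nonzero algebraic number which is not a pole of any $A_{i,j}$. Then the homogeneous transcendence degree of $E_1(\xi),\dots,E_\mu(\xi)$ over $\overline{\mathbb{Q}}$ equals the homogeneous transcendence degree of $E_1,\dots,E_\mu$ over $\overline{\mathbb{Q}}(z)$.
   Context: An $E$-function is a holonomic power series $\sum_{n\ge0}\frac{a_n}{n!}z^n$ with coefficients $a_n$ in some number field $K\subset\mathbb{C}$ such that there is $C>0$ with, for all $n$, all conjugates of $a_n$ of absolute value $\le C^n$ and a positive integer $d_n\le C^n$ making $d_na_0,\dots,d_na_n$ algebraic integers; it defines an entire function. For elements $x_1,\dots,x_\mu$ of a field extension $L$ of a field $k$, let $I\subset k[T_1,\dots,T_\mu]$ be the ideal generated by the homogeneous polynomials $P$ with $P(x_1,\dots,x_\mu)=0$; the homogeneous transcendence degree of $x_1,\dots,x_\mu$ over $k$ is the dimension of the projective scheme $\operatorname{Proj}(k[T_1,\dots,T_\mu]/I)\subset\mathbb{P}^{\mu-1}_k$ (equivalently, if $x_j\neq0$, the transcendence degree over $k$ of $k(x_1/x_j,\dots,x_\mu/x_j)$). *)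

theory Defs
  imports "HOL-Analysis.Analysis" "HOL-Computational_Algebra.Polynomial"
begin

definition number_field :: "complex set \<Rightarrow> bool" where
  "number_field K \<longleftrightarrow>
     0 \<in> K \<and> 1 \<in> K \<and>
     (\<forall>x\<in>K. \<forall>y\<in>K. x + y \<in> K \<and> x * y \<in> K \<and> - x \<in> K) \<and>
     (\<forall>x\<in>K. x \<noteq> 0 \<longrightarrow> inverse x \<in> K) \<and>
     (\<exists>B. finite B \<and> B \<subseteq> K \<and> (\<forall>x\<in>K. \<exists>q. x = (\<Sum>b\<in>B. of_rat (q b) * b)))"

text \<open>Field embeddings of K into the complex numbers; the conjugates of a in K are
  the values sigma a for such embeddings sigma.\<close>
definition field_embedding :: "complex set \<Rightarrow> (complex \<Rightarrow> complex) \<Rightarrow> bool" where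
  "field_embedding K \<sigma> \<longleftrightarrow> \<sigma> 1 = 1 \<and>
     (\<forall>x\<in>K. \<forall>y\<in>K. \<sigma> (x + y) = \<sigma> x + \<sigma> y \<and> \<sigma> (x * y) = \<sigma> x * \<sigma> y)"

definition alg_poly :: "complex poly \<Rightarrow> bool" where
  "alg_poly p \<longleftrightarrow> (\<forall>i. algebraic (coeff p i))"

definition holonomic :: "(complex \<Rightarrow> complex) \<Rightarrow> bool" where
  "holonomic f \<longleftrightarrow> (\<exists>r p. (\<forall>k\<le>r. alg_poly (p k)) \<and> (\<exists>k\<le>r. p k \<noteq> 0) \<and>
      (\<forall>z. (\<Sum>k\<le>r. poly (p k) z * (deriv ^^ k) f z) = 0))"

definition E_function :: "(complex \<Rightarrow> complex) \<Rightarrow> bool" where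
  "E_function f \<longleftrightarrow>
     (\<exists>a K C. number_field K \<and> (\<forall>n. a n \<in> K) \<and> C > (0::real) \<and>
        (\<forall>\<sigma> n. field_embedding K \<sigma> \<longrightarrow> cmod (\<sigma> (a n)) \<le> C ^ n) \<and>
        (\<forall>n. \<exists>d::nat. d > 0 \<and> real d \<le> C ^ n \<and> (\<forall>k\<le>n. algebraic_int (of_nat d * a k))) \<and>
        (\<forall>z. (\<lambda>n. a n / of_nat (fact n) * z ^ n) sums f z) \<and>
        holonomic f)"

text \<open>A multivariate polynomial in the variables T_i, i in S, is represented by its
  coefficient function on exponent vectors (alpha :: nat => nat), with finite support.
  hom_poly S c: c is a nonzero homogeneous polynomial in the variables indexed by S.\<close>
definition hom_poly :: "nat set \<Rightarrow> ((nat \<Rightarrow> nat) \<Rightarrow> 'a::zero) \<Rightarrow> bool" where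
  "hom_poly S c \<longleftrightarrow> finite {\<alpha>. c \<alpha> \<noteq> 0} \<and> (\<exists>\<alpha>. c \<alpha> \<noteq> 0) \<and>
     (\<forall>\<alpha>. c \<alpha> \<noteq> 0 \<longrightarrow> (\<forall>i. i \<notin> S \<longrightarrow> \<alpha> i = 0)) \<and>
     (\<exists>d. \<forall>\<alpha>. c \<alpha> \<noteq> 0 \<longrightarrow> (\<Sum>i\<in>S. \<alpha> i) = d)"

definition hom_indep_num :: "nat set \<Rightarrow> (nat \<Rightarrow> complex) \<Rightarrow> bool" where
  "hom_indep_num S x \<longleftrightarrow>
     \<not> (\<exists>c. hom_poly S c \<and> (\<forall>\<alpha>. algebraic (c \<alpha>)) \<and>
           (\<Sum>\<alpha>\<in>{\<alpha>. c \<alpha> \<noteq> 0}. c \<alpha> * (\<Prod>i\<in>S. x i ^ \<alpha> i)) = 0)"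

text \<open>Functions f_i (i in S) are homogeneously algebraically independent over Qbar(z):
  no nonzero homogeneous polynomial with coefficients in Qbar(z) vanishes at them
  (after clearing denominators: coefficients in Qbar[z]).\<close>
definition hom_indep_fun :: "nat set \<Rightarrow> (nat \<Rightarrow> complex \<Rightarrow> complex) \<Rightarrow> bool" where
  "hom_indep_fun S f \<longleftrightarrow>
     \<not> (\<exists>c. hom_poly S c \<and> (\<forall>\<alpha>. alg_poly (c \<alpha>)) \<and>
           (\<forall>z. (\<Sum>\<alpha>\<in>{\<alpha>. c \<alpha> \<noteq> 0}. poly (c \<alpha>) z * (\<Prod>i\<in>S. f i z ^ \<alpha> i)) = 0))"

text \<open>Homogeneous transcendence degree of x_0,...,x_(mu-1): the dimension of the
  projective variety Proj(k[T]/I), i.e. (maximal number of homogeneously independent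
  x_i) - 1; this is -1 iff all x_i vanish (empty scheme).\<close>
definition hom_trdeg_num :: "nat \<Rightarrow> (nat \<Rightarrow> complex) \<Rightarrow> int" where
  "hom_trdeg_num \<mu> x = int (Max {card S | S. S \<subseteq> {..<\<mu>} \<and> hom_indep_num S x}) - 1"

definition hom_trdeg_fun :: "nat \<Rightarrow> (nat \<Rightarrow> complex \<Rightarrow> complex) \<Rightarrow> int" where
  "hom_trdeg_fun \<mu> f = int (Max {card S | S. S \<subseteq> {..<\<mu>} \<and> hom_indep_fun S f}) - 1"

end

theory Submission
  imports Defs "Jordan_Normal_Form.Schur_Decomposition" "HOL-Complex_Analysis.Complex_Analysis"
begin

text \<open>A relation between the functions, divided by the largest common power of $z - \xi$ in its coefficients,
  specialises to a nontrivial relation between the values; so the values have at most the rank of the functions.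

  Conversely, suppose that $r \ge 2$ of the functions are homogeneously independent while any $r$ of the values are
  dependent over a number field $K$. The monomials of degree $N$ in the functions solve a linear system that is regular
  at $\xi$, and at least const $N^{r-1}$ of them are linearly independent over $K(z)$, whereas their values at $\xi$
  span a $K$-space of dimension $O(N^{r-2})$. This contradicts the linear Siegel-Shidlovskii bound: the rank of the
  functions is at most $[K:Q]$ times the dimension of the span of the values.

  For that bound, relations between the functions are first eliminated one at a time, which after division by powers of
  $z - \xi$ creates no pole at $\xi$. Siegel's lemma then gives polynomials $P_i$ for which $\sum P_i f_i$ vanishes to
  high order at $0$; differentiating it repeatedly and evaluating at $\xi$ gives small linear forms in the values, and
  Shidlovskii's zero estimate provides enough independent ones. If the values spanned too small a space, a nonzero
  determinant in $K$ would be smaller than the Liouville inequality permits.\<close>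

section \<open>Determinants over commutative rings\<close>

text \<open>The linear bound overshoots by the factor [K:Q], and this loss is harmless: in degree N
  it compares ranks of order N^(r-1) and N^(r-2), so any factor independent of N is absorbed. For
  this K has to be fixed before N grows, which is possible because the variables have finitely many
  r-element subsets and one relation is taken for each. The exponent r - 2 forces r to be at least
  2; rank 1 rests on uniqueness for the linear system, since a solution that vanishes at the regular
  point \<xi> vanishes identically. The delicate point of the zero estimate is that its constant
  must not depend on the degree of the approximating polynomials: minors of a dependent family of
  rows are proportional to elements of a finite-dimensional space fixed by the system. Linear
  algebra is done over rings instead of their fraction fields, with denominators carried along as
  nonzero multipliers. Functions are formal power series, expanded at 0 for the arithmetic and at
  \<xi> for the evaluation; analysis enters only in comparing functions with their series and in
  bounding values by coefficient sums.\<close>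

definition fdet :: "nat \<Rightarrow> (nat \<Rightarrow> nat \<Rightarrow> 'a::comm_ring_1) \<Rightarrow> 'a" where
  "fdet n M = Determinant.det (mat n n (\<lambda>(i,j). M i j))"

text \<open>Matrices are bare index functions with the size as a parameter, so that a minor with
  selected rows or a replaced column is a composition of functions and needs no dimension
  proof.\<close>

definition fcof :: "nat \<Rightarrow> (nat \<Rightarrow> nat \<Rightarrow> 'a::comm_ring_1) \<Rightarrow> nat \<Rightarrow> nat \<Rightarrow> 'a" where
  "fcof n M i j = (-1) ^ (i + j) * fdet (n - 1) (\<lambda>i' j'. M (if i' < i then i' else Suc i') (if j' < j then j' else Suc j'))"

lemma permutes_less_upt: "(p :: nat \<Rightarrow> nat) permutes {0..<n} \<Longrightarrow> i < n \<Longrightarrow> p i < n"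
  using permutes_in_image[of p "{0..<n}" i] by simp

lemma fdet_sum: "fdet n M = (\<Sum>p | p permutes {0..<n}. signof p * (\<Prod>i = 0..<n. M i (p i)))"
  unfolding fdet_def
  by (subst det_def'[of _ n], simp, intro sum.cong refl arg_cong2[where f="(*)"] prod.cong)
     (auto simp: permutes_less_upt)

lemma fdet_cong: "(\<And>i j. i < n \<Longrightarrow> j < n \<Longrightarrow> M i j = M' i j) \<Longrightarrow> fdet n M = fdet n M'"
  unfolding fdet_def by (intro arg_cong[where f="Determinant.det"]) auto

lemma cofactor_mat: "i < n \<Longrightarrow> j < n \<Longrightarrow> cofactor (mat n n (\<lambda>(i,j). M i j)) i j = fcof n M i j"
  unfolding cofactor_def fcof_def fdet_def mat_delete_def
  by (intro arg_cong2[where f="(*)"] refl arg_cong[where f="Determinant.det"]) auto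

lemma fdet_transpose: "fdet n (\<lambda>i j. M j i) = fdet n M"
proof -
  have "mat n n (\<lambda>(i,j). M j i) = transpose_mat (mat n n (\<lambda>(i,j). M i j))" by auto
  then show ?thesis unfolding fdet_def by (simp add: det_transpose[of _ n])
qed

lemma fdet_id: "fdet n (\<lambda>i j. if i = j then 1 else 0) = (1 :: 'a::comm_ring_1)"
proof -
  have "mat n n (\<lambda>(i,j). if i = j then 1 else 0) = (1\<^sub>m n :: 'a mat)" by auto
  then show ?thesis unfolding fdet_def by (metis det_one)
qed

lemma fdet_mult: "fdet n (\<lambda>i j. \<Sum>k<n. A i k * B k j) = fdet n A * fdet n B"
proof -
  have "mat n n (\<lambda>(i,j). \<Sum>k<n. A i k * B k j) = mat n n (\<lambda>(i,j). A i j) * mat n n (\<lambda>(i,j). B i j)"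
    by (auto simp: scalar_prod_def lessThan_atLeast0)
  then show ?thesis unfolding fdet_def by (simp add: det_mult[of _ n])
qed

lemma fdet_scale: "fdet n (\<lambda>i j. c * M i j) = c ^ n * fdet n M"
proof -
  have "mat n n (\<lambda>(i,j). c * M i j) = c \<cdot>\<^sub>m mat n n (\<lambda>(i,j). M i j)" by auto
  then show ?thesis unfolding fdet_def by simp
qed

lemma fdet_hom:
  assumes "\<And>x y. h (x + y) = h x + h y" "\<And>x y. h (x * y) = h x * h y" "h 1 = 1" "h 0 = 0"
  shows "fdet n (\<lambda>i j. h (M i j)) = h (fdet n M)"
proof -
  interpret comm_ring_hom h by standard (use assms in auto)
  have "mat n n (\<lambda>(i,j). h (M i j)) = map_mat h (mat n n (\<lambda>(i,j). M i j))" by auto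
  then show ?thesis unfolding fdet_def by (simp add: hom_det)
qed

text \<open>The adjugate identity applied to a vector, without division. Small or vanishing linear
  forms thereby force the determinant times each coordinate to be small or to vanish, over power
  series as well as over numbers.\<close>

lemma cramer_right:
  assumes "i < n"
  shows "(\<Sum>j<n. fcof n M j i * (\<Sum>k<n. M j k * x k)) = fdet n M * x i"
proof -
  let ?A = "mat n n (\<lambda>(i,j). M i j)" and ?x = "vec n x"
  have A: "?A \<in> carrier_mat n n" by simp
  have *: "adj_mat ?A * ?A = Determinant.det ?A \<cdot>\<^sub>m 1\<^sub>m n" and c: "adj_mat ?A \<in> carrier_mat n n"
    using adj_mat[OF A] by auto
  have e: "adj_mat ?A $$ (i,j) = fcof n M j i" if "j < n" for j
    using assms that by (simp add: adj_mat_def cofactor_mat)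
  have s: "(\<Sum>j<n. fcof n M j i * M j k) = (if i = k then fdet n M else 0)" if "k < n" for k
  proof -
    have "(adj_mat ?A * ?A) $$ (i,k) = (\<Sum>j<n. fcof n M j i * M j k)"
      using c assms that by (auto simp: scalar_prod_def lessThan_atLeast0 e intro!: sum.cong)
    then show ?thesis unfolding * using assms that by (auto simp: fdet_def)
  qed
  have "(\<Sum>j<n. fcof n M j i * (\<Sum>k<n. M j k * x k)) = (\<Sum>k<n. (\<Sum>j<n. fcof n M j i * M j k) * x k)"
    by (simp add: sum_distrib_left sum_distrib_right mult.assoc) (rule sum.swap)
  also have "\<dots> = (\<Sum>k<n. (if i = k then fdet n M else 0) * x k)" by (intro sum.cong) (auto simp: s)
  also have "\<dots> = fdet n M * x i" using assms by (simp add: if_distrib[of "\<lambda>u. u * _"] cong: if_cong)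
  finally show ?thesis .
qed

lemma fcof_transpose: "fcof n (\<lambda>i j. M j i) i j = fcof n M j i"
proof -
  have "fdet (n - 1) (\<lambda>i' j'. M (if j' < j then j' else Suc j') (if i' < i then i' else Suc i'))
      = fdet (n - 1) (\<lambda>i' j'. M (if i' < j then i' else Suc i') (if j' < i then j' else Suc j'))"
    by (rule fdet_transpose)
  then show ?thesis unfolding fcof_def by (simp only: add.commute[of i j])
qed

lemma cramer_left:
  assumes "i < n"
  shows "(\<Sum>j<n. fcof n M i j * (\<Sum>k<n. x k * M k j)) = fdet n M * x i"
  using cramer_right[OF assms, of "\<lambda>i j. M j i" x] by (simp add: fcof_transpose[of n M] fdet_transpose[of n M] mult.commute)

text \<open>Cofactors along a column do not involve that column, so the expansion uses the cofactors
  of the unmodified matrix.\<close>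

lemma fdet_replace_col:
  assumes "c < n"
  shows "fdet n (\<lambda>i j. if j = c then r i else M i j) = (\<Sum>i<n. r i * fcof n M i c)"
proof -
  let ?M = "\<lambda>i j. if j = c then r i else M i j"
  let ?A = "mat n n (\<lambda>(i,j). ?M i j)"
  have cf: "fcof n ?M i c = fcof n M i c" for i
    unfolding fcof_def by (intro arg_cong2[where f="(*)"] refl fdet_cong) auto
  have "fdet n ?M = (\<Sum>i<n. ?A $$ (i,c) * cofactor ?A i c)"
    unfolding fdet_def by (rule laplace_expansion_column) (use assms in auto)
  also have "\<dots> = (\<Sum>i<n. r i * fcof n M i c)"
    by (intro sum.cong refl) (use assms cf in \<open>simp add: cofactor_mat\<close>)
  finally show ?thesis .
qed

lemma fdet_replace_row:
  assumes "c < n"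
  shows "fdet n (\<lambda>i j. if i = c then r j else M i j) = (\<Sum>j<n. r j * fcof n M c j)"
proof -
  have "fdet n (\<lambda>i j. if i = c then r j else M i j) = fdet n (\<lambda>i j. if j = c then r i else M j i)"
    by (rule fdet_transpose)
  also have "\<dots> = (\<Sum>j<n. r j * fcof n M c j)"
    using fdet_replace_col[OF assms, of r "\<lambda>i j. M j i"] by (simp only: fcof_transpose[of n M])
  finally show ?thesis .
qed

lemma fdet_zero_kernel:
  fixes M :: "nat \<Rightarrow> nat \<Rightarrow> 'a::idom"
  assumes "fdet n M = 0"
  shows "\<exists>x. (\<exists>i<n. x i \<noteq> 0) \<and> (\<forall>i<n. (\<Sum>j<n. M i j * x j) = 0)"
proof -
  let ?A = "mat n n (\<lambda>(i,j). M i j)"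
  obtain v where v: "v \<in> carrier_vec n" "v \<noteq> 0\<^sub>v n" "?A *\<^sub>v v = 0\<^sub>v n"
    using assms det_0_iff_vec_prod_zero[of ?A n] unfolding fdet_def by auto
  have "(\<Sum>j<n. M i j * vec_index v j) = 0" if "i < n" for i
  proof -
    have "vec_index (?A *\<^sub>v v) i = (\<Sum>j<n. M i j * vec_index v j)"
      using that v(1) by (auto simp: scalar_prod_def lessThan_atLeast0)
    then show ?thesis using v(3) that by simp
  qed
  moreover have "\<exists>i<n. vec_index v i \<noteq> 0" using v(1,2) by (metis carrier_vecD eq_vecI index_zero_vec)
  ultimately show ?thesis by blast
qed

lemma fdet_nonzero_kernel:
  fixes M :: "nat \<Rightarrow> nat \<Rightarrow> 'a::idom"
  assumes "fdet n M \<noteq> 0" "\<And>i. i < n \<Longrightarrow> (\<Sum>j<n. M i j * x j) = 0" "i < n"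
  shows "x i = 0"
  using cramer_right[OF assms(3), of M x] assms by simp

text \<open>If no row enlarges a nonzero minor on the first t columns, the cofactors of the missing
  row annihilate every row. Their last entry is the nonzero minor itself, which contradicts the
  trivial kernel.\<close>

lemma select_rows:
  fixes v :: "nat \<Rightarrow> nat \<Rightarrow> 'a::comm_ring_1"
  assumes ker: "\<And>w. (\<And>k. k < N \<Longrightarrow> (\<Sum>i<s. v k i * w i) = 0) \<Longrightarrow> (\<And>i. i < s \<Longrightarrow> w i = 0)"
  shows "\<exists>\<kappa>. (\<forall>j<s. \<kappa> j < N) \<and> fdet s (\<lambda>j i. v (\<kappa> j) i) \<noteq> 0"
proof -
  have "\<exists>\<kappa>. (\<forall>j<t. \<kappa> j < N) \<and> fdet t (\<lambda>j i. v (\<kappa> j) i) \<noteq> 0" if "t \<le> s" for t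
    using that
  proof (induction t)
    case 0
    have "fdet 0 (\<lambda>j i. v 0 i) = 1" by (simp add: fdet_sum)
    then show ?case by (intro exI[of _ "\<lambda>_. 0"]) simp
  next
    case (Suc t)
    then obtain \<kappa> where \<kappa>: "\<forall>j<t. \<kappa> j < N" "fdet t (\<lambda>j i. v (\<kappa> j) i) \<noteq> 0" by auto
    let ?M = "\<lambda>j i. v (\<kappa> j) i"
    \<comment> \<open>The cofactors of row t of the bordered matrix, extended by zero to all s
      columns; they do not depend on the content of row t.\<close>
    let ?c = "\<lambda>i. if i \<le> t then fcof (Suc t) ?M t i else 0"
    have ct: "fcof (Suc t) ?M t t = fdet t ?M"
      unfolding fcof_def by (simp add: power_add flip: power_mult_distrib) (rule fdet_cong, simp)
    show ?case
    proof (rule ccontr)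
      assume no: "\<not> ?case"
      have z: "(\<Sum>i<s. v k i * ?c i) = 0" if "k < N" for k
      proof -
        have "fdet (Suc t) (\<lambda>j i. if j = t then v k i else ?M j i) = fdet (Suc t) (\<lambda>j i. v ((\<kappa>(t := k)) j) i)"
          by (intro fdet_cong) auto
        also have "\<dots> = 0"
        proof (rule ccontr)
          assume "fdet (Suc t) (\<lambda>j i. v ((\<kappa>(t := k)) j) i) \<noteq> 0"
          moreover have "\<forall>j<Suc t. (\<kappa>(t := k)) j < N" using \<kappa>(1) that by (auto simp: less_Suc_eq)
          ultimately show False using no by blast
        qed
        finally have e: "(\<Sum>i<Suc t. v k i * fcof (Suc t) ?M t i) = 0" by (simp only: fdet_replace_row[OF lessI])
        have "(\<Sum>i<s. v k i * ?c i) = (\<Sum>i<Suc t. v k i * ?c i)"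
          by (rule sum.mono_neutral_right) (use Suc.prems in auto)
        also have "\<dots> = (\<Sum>i<Suc t. v k i * fcof (Suc t) ?M t i)" by (intro sum.cong) auto
        finally show ?thesis using e by simp
      qed
      have "?c t = 0" by (rule ker[of ?c t]) (use z Suc.prems in auto)
      then show False using ct \<kappa>(2) by simp
    qed
  qed
  then show ?thesis by blast
qed

section \<open>Linear dependence over subrings\<close>

definition is_subring :: "'a::comm_ring_1 set \<Rightarrow> bool" where
  "is_subring S \<longleftrightarrow> 0 \<in> S \<and> 1 \<in> S \<and> (\<forall>x\<in>S. \<forall>y\<in>S. x + y \<in> S \<and> x * y \<in> S \<and> - x \<in> S)"

lemma is_subringD:
  assumes "is_subring S"
  shows "0 \<in> S" "1 \<in> S" "x \<in> S \<Longrightarrow> y \<in> S \<Longrightarrow> x + y \<in> S" "x \<in> S \<Longrightarrow> y \<in> S \<Longrightarrow> x * y \<in> S"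
    "x \<in> S \<Longrightarrow> - x \<in> S" "x \<in> S \<Longrightarrow> y \<in> S \<Longrightarrow> x - y \<in> S"
  using assms unfolding is_subring_def by (blast, blast, blast, blast, blast, metis diff_conv_add_uminus)

lemma is_subring_sum: "is_subring S \<Longrightarrow> (\<And>i. i \<in> I \<Longrightarrow> f i \<in> S) \<Longrightarrow> sum f I \<in> S"
  by (induction I rule: infinite_finite_induct) (auto simp: is_subringD)

lemma is_subring_prod: "is_subring S \<Longrightarrow> (\<And>i. i \<in> I \<Longrightarrow> f i \<in> S) \<Longrightarrow> prod f I \<in> S"
  by (induction I rule: infinite_finite_induct) (auto simp: is_subringD)

lemma is_subring_power: "is_subring S \<Longrightarrow> x \<in> S \<Longrightarrow> x ^ n \<in> S"
  by (induction n) (auto simp: is_subringD)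

lemma is_subring_of_nat: "is_subring S \<Longrightarrow> of_nat n \<in> S"
  by (induction n) (auto simp: is_subringD)

lemma is_subring_of_int: "is_subring S \<Longrightarrow> of_int n \<in> S"
  by (cases n) (auto simp: is_subringD is_subring_of_nat simp del: of_nat_Suc)

lemma is_subring_fdet:
  assumes "is_subring S" "\<And>i j. i < n \<Longrightarrow> j < n \<Longrightarrow> M i j \<in> S"
  shows "fdet n M \<in> S"
  unfolding fdet_sum
  by (intro is_subring_sum is_subringD(4) is_subring_prod assms)
     (auto simp: sign_def permutes_less_upt assms is_subringD)

text \<open>Fraction-free Gaussian elimination: equations are multiplied by the pivot instead of
  being divided by it, so the solution stays in the ring S.\<close>

lemma underdetermined:
  fixes A :: "'i \<Rightarrow> 'j \<Rightarrow> 'a::idom"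
  assumes S: "is_subring S" and I: "finite I" and J: "finite J" "card I < card J"
    and A: "\<And>i j. i \<in> I \<Longrightarrow> j \<in> J \<Longrightarrow> A i j \<in> S"
  shows "\<exists>x. (\<forall>j. x j \<in> S) \<and> (\<exists>j\<in>J. x j \<noteq> 0) \<and> (\<forall>i\<in>I. (\<Sum>j\<in>J. A i j * x j) = 0)"
  using I J A
proof (induction I arbitrary: J A rule: finite_induct)
  case empty
  then show ?case by (intro exI[of _ "\<lambda>_. 1"]) (use S in \<open>auto simp: is_subringD card_gt_0_iff\<close>)
next
  case (insert m I)
  show ?case
  proof (cases "\<forall>j\<in>J. A m j = 0")
    case True
    have "card I < card J" using insert.prems insert.hyps by simp
    then obtain x where "\<forall>j. x j \<in> S" "\<exists>j\<in>J. x j \<noteq> 0" "\<forall>i\<in>I. (\<Sum>j\<in>J. A i j * x j) = 0"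
      using insert.IH[OF insert.prems(1), of A] insert.prems(3) by auto
    then show ?thesis using True by (intro exI[of _ x]) auto
  next
    case False
    then obtain j0 where j0: "j0 \<in> J" "A m j0 \<noteq> 0" by blast
    let ?p = "A m j0" and ?J = "J - {j0}"
    let ?A = "\<lambda>i j. ?p * A i j - A i j0 * A m j"
    have "card I < card ?J" using insert.prems insert.hyps j0 by simp
    moreover have "?A i j \<in> S" if "i \<in> I" "j \<in> ?J" for i j
      using that insert.prems(3) j0 by (intro is_subringD(6)[OF S] is_subringD(4)[OF S]) auto
    ultimately obtain x where x: "\<forall>j. x j \<in> S" "\<exists>j\<in>?J. x j \<noteq> 0"
      "\<forall>i\<in>I. (\<Sum>j\<in>?J. ?A i j * x j) = 0"
      using insert.IH[of ?J ?A] insert.prems(1) by auto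
    \<comment> \<open>Scaling the other unknowns by the pivot lets the pivot unknown be solved for
      without a quotient.\<close>
    let ?y = "\<lambda>j. if j = j0 then - (\<Sum>j\<in>?J. A m j * x j) else ?p * x j"
    have yS: "?y j \<in> S" for j
      using x(1) insert.prems(3) j0
      by (auto intro!: is_subringD(5)[OF S] is_subringD(4)[OF S] is_subring_sum[OF S])
    have y0: "\<exists>j\<in>J. ?y j \<noteq> 0" using x(2) j0 by auto
    have split: "(\<Sum>j\<in>J. A i j * ?y j) = - A i j0 * (\<Sum>j\<in>?J. A m j * x j) + ?p * (\<Sum>j\<in>?J. A i j * x j)" for i
    proof -
      have "(\<Sum>j\<in>J. A i j * ?y j) = A i j0 * ?y j0 + (\<Sum>j\<in>?J. A i j * ?y j)"
        using j0 insert.prems(1) by (simp add: sum.remove)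
      also have "(\<Sum>j\<in>?J. A i j * ?y j) = ?p * (\<Sum>j\<in>?J. A i j * x j)"
        unfolding sum_distrib_left by (intro sum.cong) (auto simp: mult_ac)
      finally show ?thesis by simp
    qed
    have "(\<Sum>j\<in>J. A i j * ?y j) = 0" if "i \<in> insert m I" for i
    proof (cases "i = m")
      case True then show ?thesis unfolding split by simp
    next
      case False
      then have "(\<Sum>j\<in>?J. ?A i j * x j) = 0" using that x(3) by auto
      then show ?thesis unfolding split
        by (simp add: left_diff_distrib sum_subtractf sum_distrib_left mult.assoc sum_negf)
    qed
    then show ?thesis using yS y0 by (intro exI[of _ ?y] conjI allI ballI)
  qed
qed

text \<open>Independence over a domain S is the same as independence over its fraction field; with S
  = K[z] it expresses independence over K(z) inside the ring of power series.\<close>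

definition indep_over :: "'a::idom set \<Rightarrow> 'j set \<Rightarrow> ('j \<Rightarrow> 'a) \<Rightarrow> bool" where
  "indep_over S J \<phi> \<longleftrightarrow> (\<forall>c. (\<forall>j\<in>J. c j \<in> S) \<and> (\<Sum>j\<in>J. c j * \<phi> j) = 0 \<longrightarrow> (\<forall>j\<in>J. c j = 0))"

lemma indep_overD:
  assumes "indep_over S J \<phi>" "\<And>j. j \<in> J \<Longrightarrow> c j \<in> S" "(\<Sum>j\<in>J. c j * \<phi> j) = 0" "j \<in> J"
  shows "c j = 0"
  using assms(1)[unfolded indep_over_def, THEN spec, of c] assms(2-4) by blast

text \<open>The dimension inequality over the fraction field, \<open>d\<close> being the denominator
  with which \<phi> j is expressed by the \<psi> k. With more \<phi> than \<psi> the coefficient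
  equations have a nonzero solution, and scaling it by the denominators gives a relation between the
  \<phi>.\<close>

lemma card_indep_le:
  fixes \<phi> :: "'j \<Rightarrow> 'a::idom"
  assumes S: "is_subring S" and fin: "finite J" "finite I" and ind: "indep_over S J \<phi>"
    and span: "\<And>j. j \<in> J \<Longrightarrow> \<exists>d c. d \<in> S \<and> d \<noteq> 0 \<and> (\<forall>k\<in>I. c k \<in> S) \<and> d * \<phi> j = (\<Sum>k\<in>I. c k * \<psi> k)"
  shows "card J \<le> card I"
proof (rule ccontr)
  assume "\<not> card J \<le> card I"
  obtain d c where dc: "\<And>j. j \<in> J \<Longrightarrow> d j \<in> S \<and> d j \<noteq> 0 \<and> (\<forall>k\<in>I. c j k \<in> S) \<and> d j * \<phi> j = (\<Sum>k\<in>I. c j k * \<psi> k)"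
    using span by metis
  obtain x where x: "\<forall>j. x j \<in> S" "\<exists>j\<in>J. x j \<noteq> 0" "\<forall>k\<in>I. (\<Sum>j\<in>J. c j k * x j) = 0"
    using underdetermined[OF S fin(2,1), of "\<lambda>k j. c j k"] dc \<open>\<not> card J \<le> card I\<close> by auto
  have "(\<Sum>j\<in>J. (x j * d j) * \<phi> j) = (\<Sum>j\<in>J. x j * (\<Sum>k\<in>I. c j k * \<psi> k))"
    by (intro sum.cong) (auto simp: mult.assoc dc)
  also have "\<dots> = (\<Sum>k\<in>I. \<Sum>j\<in>J. x j * (c j k * \<psi> k))"
    unfolding sum_distrib_left by (rule sum.swap)
  also have "\<dots> = (\<Sum>k\<in>I. (\<Sum>j\<in>J. c j k * x j) * \<psi> k)"
    by (simp add: sum_distrib_left mult_ac)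
  also have "\<dots> = 0" using x(3) by simp
  finally have "(\<Sum>j\<in>J. (x j * d j) * \<phi> j) = 0" .
  from indep_overD[OF ind _ this] have "\<forall>j\<in>J. x j * d j = 0"
    using x(1) dc is_subringD(4)[OF S] by blast
  then show False using x(2) dc by auto
qed

text \<open>Enlarging a maximal independent subset by j produces a relation whose coefficient at j
  cannot vanish; that coefficient is the denominator \<open>d\<close>.\<close>

lemma max_indep_exists:
  fixes \<phi> :: "'j \<Rightarrow> 'a::idom"
  assumes S: "is_subring S" and fin: "finite J"
  shows "\<exists>J0\<subseteq>J. indep_over S J0 \<phi> \<and> (\<forall>j\<in>J. \<exists>d c. d \<in> S \<and> d \<noteq> 0 \<and> (\<forall>k\<in>J0. c k \<in> S) \<and> d * \<phi> j = (\<Sum>k\<in>J0. c k * \<phi> k))"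
proof -
  define F where "F = {J0. J0 \<subseteq> J \<and> indep_over S J0 \<phi>}"
  have "finite F" using fin by (simp add: F_def)
  moreover have "{} \<in> F" by (simp add: indep_over_def F_def)
  ultimately obtain J0 where J0F: "J0 \<in> F" and mx: "\<And>J1. J1 \<in> F \<Longrightarrow> J0 \<subseteq> J1 \<Longrightarrow> J1 = J0"
    using finite_has_maximal2[of F "{}"] by metis
  then have J0: "J0 \<subseteq> J" "indep_over S J0 \<phi>" by (auto simp: F_def)
  have finJ0: "finite J0" using J0 fin finite_subset by auto
  have "\<exists>d c. d \<in> S \<and> d \<noteq> 0 \<and> (\<forall>k\<in>J0. c k \<in> S) \<and> d * \<phi> j = (\<Sum>k\<in>J0. c k * \<phi> k)" if "j \<in> J" for j
  proof (cases "j \<in> J0")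
    case True
    show ?thesis
      by (rule exI[of _ 1], rule exI[of _ "\<lambda>k. if k = j then 1 else 0"])
         (use True finJ0 S in \<open>auto simp: is_subringD if_distrib[of "\<lambda>u. u * _"] sum.delta cong: if_cong\<close>)
  next
    case False
    then have "\<not> indep_over S (insert j J0) \<phi>" using mx[of "insert j J0"] J0(1) that unfolding F_def by blast
    then obtain c where c: "\<forall>k\<in>insert j J0. c k \<in> S" "(\<Sum>k\<in>insert j J0. c k * \<phi> k) = 0" "\<exists>k\<in>insert j J0. c k \<noteq> 0"
      unfolding indep_over_def by auto
    have s: "c j * \<phi> j + (\<Sum>k\<in>J0. c k * \<phi> k) = 0" using c(2) False finJ0 by simp
    have "c j \<noteq> 0"
    proof
      assume "c j = 0"
      then have "(\<Sum>k\<in>J0. c k * \<phi> k) = 0" using s by simp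
      from indep_overD[OF J0(2) _ this] have "\<forall>k\<in>J0. c k = 0" using c(1) by blast
      then show False using c(3) \<open>c j = 0\<close> by auto
    qed
    moreover have "c j * \<phi> j = (\<Sum>k\<in>J0. (- c k) * \<phi> k)" using s by (simp add: sum_negf eq_neg_iff_add_eq_0)
    moreover have "\<forall>k\<in>J0. - c k \<in> S" "c j \<in> S" using c(1) is_subringD(5)[OF S] by blast+
    ultimately show ?thesis
      using \<open>c j \<noteq> 0\<close> by (intro exI[of _ "c j"] exI[of _ "\<lambda>k. - c k"] conjI)
  qed
  then have "\<forall>j\<in>J. \<exists>d c. d \<in> S \<and> d \<noteq> 0 \<and> (\<forall>k\<in>J0. c k \<in> S) \<and> d * \<phi> j = (\<Sum>k\<in>J0. c k * \<phi> k)" by (rule ballI)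
  with J0 show ?thesis by (intro exI[of _ J0] conjI)
qed

section \<open>Number fields and algebraic integers\<close>

lemma vs_QC: "vector_space (\<lambda>(q::rat) (x::complex). of_rat q * x)"
  by standard (auto simp: algebra_simps of_rat_add of_rat_mult)

text \<open>Complex numbers as a rational vector space and, below, as a module over the integers: a
  number field is a finitely generated \<open>QC.span\<close>, and an algebraic integer stabilises a
  finitely generated \<open>ZC.span\<close>.\<close>

interpretation QC: vector_space "\<lambda>(q::rat) (x::complex). of_rat q * x"
  by (rule vs_QC)

interpretation ZC: Modules.module "\<lambda>(k::int) (x::complex). of_int k * x"
  by standard (auto simp: algebra_simps)

lemma QC_span_mult:
  assumes g: "\<And>b c. b \<in> B \<Longrightarrow> c \<in> C \<Longrightarrow> b * c \<in> QC.span G" and x: "x \<in> QC.span B" and y: "y \<in> QC.span C"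
  shows "x * y \<in> QC.span G"
proof -
  have 1: "b * y \<in> QC.span G" if "b \<in> B" for b
    using y
  proof (induction rule: QC.span_induct_alt)
    case base then show ?case by (simp add: QC.span_zero)
  next
    case (step q z v)
    have "of_rat q * (b * z) + b * v \<in> QC.span G"
      using step g[OF that step.hyps(1)] by (intro QC.span_add QC.span_scale) auto
    then show ?case by (simp add: algebra_simps)
  qed
  show ?thesis using x
  proof (induction rule: QC.span_induct_alt)
    case base then show ?case by (simp add: QC.span_zero)
  next
    case (step q z v)
    have "of_rat q * (z * y) + v * y \<in> QC.span G"
      using step 1[OF step.hyps(1)] by (intro QC.span_add QC.span_scale) auto
    then show ?case by (simp add: algebra_simps)
  qed
qed

lemma ZC_span_mult:
  assumes g: "\<And>b c. b \<in> B \<Longrightarrow> c \<in> C \<Longrightarrow> b * c \<in> ZC.span G" and x: "x \<in> ZC.span B" and y: "y \<in> ZC.span C"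
  shows "x * y \<in> ZC.span G"
proof -
  have 1: "b * y \<in> ZC.span G" if "b \<in> B" for b
    using y
  proof (induction rule: ZC.span_induct_alt)
    case base then show ?case by (simp add: ZC.span_zero)
  next
    case (step q z v)
    have "of_int q * (b * z) + b * v \<in> ZC.span G"
      using step g[OF that step.hyps(1)] by (intro ZC.span_add ZC.span_scale) auto
    then show ?case by (simp add: algebra_simps)
  qed
  show ?thesis using x
  proof (induction rule: ZC.span_induct_alt)
    case base then show ?case by (simp add: ZC.span_zero)
  next
    case (step q z v)
    have "of_int q * (z * y) + v * y \<in> ZC.span G"
      using step 1[OF step.hyps(1)] by (intro ZC.span_add ZC.span_scale) auto
    then show ?case by (simp add: algebra_simps)
  qed
qed

lemma number_field_subring: "number_field K \<Longrightarrow> is_subring K"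
  unfolding number_field_def is_subring_def by blast

lemma number_field_inverse: "number_field K \<Longrightarrow> x \<in> K \<Longrightarrow> inverse x \<in> K"
  unfolding number_field_def by (cases "x = 0") auto

lemma number_field_divide: "number_field K \<Longrightarrow> x \<in> K \<Longrightarrow> y \<in> K \<Longrightarrow> x / y \<in> K"
  unfolding divide_inverse by (intro is_subringD(4) number_field_subring number_field_inverse)

lemma number_field_of_rat:
  assumes K: "number_field K"
  shows "of_rat q \<in> K"
proof -
  obtain a b where q: "q = of_int a / of_int b" by (metis Fract_of_int_quotient quotient_of_div surj_pair)
  have "of_rat q = (of_int a / of_int b :: complex)" by (simp add: q of_rat_divide)
  then show ?thesis using number_field_divide[OF K] is_subring_of_int[OF number_field_subring[OF K]] by simp
qed

lemma number_field_spanE: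
  assumes K: "number_field K"
  obtains B where "finite B" "QC.span B = K"
proof -
  obtain B where B: "finite B" "B \<subseteq> K" "\<forall>x\<in>K. \<exists>q. x = (\<Sum>b\<in>B. of_rat (q b) * b)"
    using K unfolding number_field_def by blast
  note S = is_subringD[OF number_field_subring[OF K]]
  have "QC.subspace K"
    by (rule QC.subspaceI) (use S number_field_of_rat[OF K] in auto)
  then have "QC.span B \<subseteq> K" using B(2) by (rule QC.span_minimal[rotated])
  moreover have "K \<subseteq> QC.span B"
  proof
    fix x assume "x \<in> K"
    then obtain q where "x = (\<Sum>b\<in>B. of_rat (q b) * b)" using B(3) by blast
    then show "x \<in> QC.span B" by (simp add: QC.span_sum QC.span_scale QC.span_base)
  qed
  ultimately show ?thesis using that B(1) by blast
qed

text \<open>A finite-dimensional Q-algebra without zero divisors is a field: multiplication by a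
  nonzero x maps a basis to an independent set of the same size, which therefore spans and reaches
  1.\<close>

lemma number_field_spanI:
  assumes fin: "finite B" and one: "1 \<in> QC.span B"
    and mult: "\<And>b c. b \<in> B \<Longrightarrow> c \<in> B \<Longrightarrow> b * c \<in> QC.span B"
  shows "number_field (QC.span B)"
proof -
  let ?A = "QC.span B"
  have m: "x * y \<in> ?A" if "x \<in> ?A" "y \<in> ?A" for x y using QC_span_mult[OF mult that] .
  obtain C where C: "C \<subseteq> B" "QC.independent C" "B \<subseteq> QC.span C"
    using QC.maximal_independent_subset[of B] by blast
  have spC: "QC.span C = ?A" using C by (metis QC.span_mono QC.span_span subset_antisym)
  have finC: "finite C" using C(1) fin finite_subset by blast
  have inv: "inverse x \<in> ?A" if x: "x \<in> ?A" "x \<noteq> 0" for x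
  proof -
    have inj: "inj_on ((*) x) C" using x(2) by (auto simp: inj_on_def)
    have ind: "QC.independent ((*) x ` C)"
      unfolding QC.independent_explicit_module
    proof (intro allI impI)
      fix t u v assume t: "finite t" "t \<subseteq> (*) x ` C" "(\<Sum>v\<in>t. of_rat (u v) * v) = 0" "v \<in> t"
      then obtain t' where t': "t' \<subseteq> C" "t = (*) x ` t'" by (meson subset_imageE)
      have f': "finite t'" using t'(1) finC finite_subset by blast
      have "(\<Sum>v\<in>t. of_rat (u v) * v) = x * (\<Sum>v\<in>t'. of_rat (u (x * v)) * v)"
        unfolding t'(2) by (subst sum.reindex[OF inj_on_subset[OF inj t'(1)]]) (simp add: sum_distrib_left mult_ac)
      then have "(\<Sum>v\<in>t'. of_rat (u (x * v)) * v) = 0" using t(3) x(2) by simp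
      then have "u (x * v) = 0" if "v \<in> t'" for v
        using C(2)[unfolded QC.independent_explicit_module, THEN spec, of t', THEN spec, of "\<lambda>v. u (x * v)", THEN spec, of v] f' t'(1) that by simp
      then show "u v = 0" using t(4) t'(2) by auto
    qed
    have sub: "(*) x ` C \<subseteq> ?A" using m[OF x(1)] C(1) QC.span_base by blast
    \<comment> \<open>An element outside the span of x C would enlarge x C to an independent set
      with more elements than the spanning set C.\<close>
    have "?A \<subseteq> QC.span ((*) x ` C)"
    proof (rule ccontr)
      assume "\<not> ?A \<subseteq> QC.span ((*) x ` C)"
      then obtain a where a: "a \<in> ?A" "a \<notin> QC.span ((*) x ` C)" by blast
      have "QC.independent (insert a ((*) x ` C))" using QC.independent_insertI[OF a(2) ind] .
      moreover have "insert a ((*) x ` C) \<subseteq> QC.span C" using a(1) sub spC by blast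
      ultimately have "card (insert a ((*) x ` C)) \<le> card C"
        using QC.independent_span_bound[OF finC] by blast
      moreover have "a \<notin> (*) x ` C" using a(2) QC.span_base[of a "(*) x ` C"] by metis
      then have "card (insert a ((*) x ` C)) = Suc (card C)"
        using finC card_image[OF inj] card_insert_disjoint[OF finite_imageI[OF finC]] by metis
      ultimately show False by simp
    qed
    then have "1 \<in> QC.span ((*) x ` C)" using one by blast
    then obtain u where "1 = (\<Sum>v\<in>(*) x ` C. of_rat (u v) * v)"
      using QC.span_finite[of "(*) x ` C"] finC by auto
    also have "\<dots> = x * (\<Sum>v\<in>C. of_rat (u (x * v)) * v)"
      by (subst sum.reindex[OF inj]) (simp add: sum_distrib_left mult_ac)
    finally have "inverse x = (\<Sum>v\<in>C. of_rat (u (x * v)) * v)" using x(2)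
      by (metis inverse_unique)
    also have "\<dots> \<in> ?A" using C(1) by (intro QC.span_sum QC.span_scale QC.span_base) auto
    finally show ?thesis .
  qed
  have "\<exists>q. x = (\<Sum>b\<in>B. of_rat (q b) * b)" if "x \<in> ?A" for x
    using that by (subst (asm) QC.span_finite[OF fin]) auto
  then show ?thesis
    unfolding number_field_def
    using one m inv fin QC.span_superset[of B]
    by (auto intro: QC.span_zero QC.span_add QC.span_neg)
qed

text \<open>The products of generators span an algebra that contains both fields, and the criterion
  for finite-dimensional algebras makes it a field.\<close>

lemma number_field_compositum:
  assumes K: "number_field K" and L: "number_field L"
  shows "\<exists>M. number_field M \<and> K \<subseteq> M \<and> L \<subseteq> M"
proof -
  obtain B where B: "finite B" "QC.span B = K" by (rule number_field_spanE[OF K])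
  obtain C where C: "finite C" "QC.span C = L" by (rule number_field_spanE[OF L])
  define G where "G = (\<lambda>(b,c). b * c) ` (B \<times> C)"
  have G: "b * c \<in> QC.span G" if "b \<in> B" "c \<in> C" for b c
    using that by (intro QC.span_base) (auto simp: G_def)
  have G': "x * y \<in> QC.span G" if "x \<in> K" "y \<in> L" for x y
    using QC_span_mult[of B C G x y] G that B C by auto
  have o: "1 \<in> K" "1 \<in> L" using is_subringD(2) number_field_subring K L by auto
  have "b * c \<in> QC.span G" if g: "b \<in> G" "c \<in> G" for b c
  proof -
    obtain b1 c1 b2 c2 where e: "b = b1 * c1" "c = b2 * c2" "b1 \<in> B" "b2 \<in> B" "c1 \<in> C" "c2 \<in> C"
      using g by (auto simp: G_def)
    have "b1 * b2 \<in> K" "c1 * c2 \<in> L" using e B C QC.span_base is_subringD(4) number_field_subring K L by metis+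
    then show ?thesis using G'[of "b1 * b2" "c1 * c2"] by (simp add: e mult_ac)
  qed
  then have "number_field (QC.span G)"
    using number_field_spanI[of G] G'[OF o] B C by (simp add: G_def)
  moreover have "K \<subseteq> QC.span G" "L \<subseteq> QC.span G" using G'[OF _ o(2)] G'[OF o(1)] by auto
  ultimately show ?thesis by blast
qed

text \<open>The equation of x rewrites its d-th power by lower powers, so the powers below d span an
  algebra.\<close>

lemma number_field_adjoin:
  assumes x: "algebraic x"
  shows "\<exists>K. number_field K \<and> x \<in> K"
proof -
  obtain p where p: "\<forall>i. coeff p i \<in> \<int>" "p \<noteq> 0" "poly p x = 0" using x unfolding algebraic_def by blast
  define d where "d = degree p"
  define G where "G = (\<lambda>k. x ^ k) ` {..<d}"
  have d: "d > 0"
  proof (rule ccontr)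
    assume "\<not> d > 0"
    then obtain a where "p = [:a:]" unfolding d_def by (metis degree_eq_zeroE neq0_conv)
    then show False using p by auto
  qed
  have "\<forall>i. \<exists>k. coeff p i = of_int k" using p(1) by (metis Ints_cases)
  then obtain a where a: "\<And>i. coeff p i = of_int (a i)" by metis
  have ad: "(of_int (a d) :: complex) \<noteq> 0" using p(2) by (simp flip: a add: d_def)
  have "0 = (\<Sum>k\<le>d. of_int (a k) * x ^ k)" using p(3) by (simp add: poly_altdef d_def a)
  also have "\<dots> = (\<Sum>k<d. of_int (a k) * x ^ k) + of_int (a d) * x ^ d"
    by (simp add: lessThan_Suc_atMost[symmetric])
  finally have "x ^ d = - (\<Sum>k<d. of_int (a k) * x ^ k) / of_int (a d)" using ad by (simp add: field_simps eq_neg_iff_add_eq_0)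
  also have "\<dots> = (\<Sum>k<d. of_rat (- (of_int (a k) / of_int (a d))) * x ^ k)"
    by (simp add: sum_divide_distrib of_rat_minus of_rat_divide sum_negf)
  also have "\<dots> \<in> QC.span G" by (intro QC.span_sum QC.span_scale QC.span_base) (auto simp: G_def)
  finally have xd: "x ^ d \<in> QC.span G" .
  have xk: "x ^ k \<in> QC.span G" if "k \<le> d" for k
    using that xd by (cases "k = d") (auto intro!: QC.span_base simp: G_def)
  have xs: "x * y \<in> QC.span G" if "y \<in> QC.span G" for y
  proof (rule QC_span_mult[of "{x}" G])
    fix b c assume "b \<in> {x}" "c \<in> G"
    then obtain k where "b = x" "c = x ^ k" "k < d" by (auto simp: G_def)
    then show "b * c \<in> QC.span G" using xk[of "Suc k"] by simp
  qed (use that QC.span_base in auto)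
  have xm: "x ^ m \<in> QC.span G" for m
    by (induction m) (use xk[of 0] xs in auto)
  have "number_field (QC.span G)"
    by (rule number_field_spanI) (use xm[of 0] xm in \<open>auto simp: G_def power_add[symmetric]\<close>)
  then show ?thesis using xm[of 1] by auto
qed

lemma number_field_common:
  assumes "finite F" "\<And>L. L \<in> F \<Longrightarrow> number_field L" "finite X" "\<And>x. x \<in> X \<Longrightarrow> algebraic x"
  shows "\<exists>K. number_field K \<and> \<Union>F \<subseteq> K \<and> X \<subseteq> K"
proof -
  have 1: "\<exists>K. number_field K \<and> X \<subseteq> K" using assms(3,4)
  proof (induction X rule: finite_induct)
    case empty
    have "algebraic (0::complex)" by simp
    from number_field_adjoin[OF this] show ?case by auto
  next
    case (insert x X)
    then obtain K L where "number_field K" "X \<subseteq> K" "number_field L" "x \<in> L"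
      using number_field_adjoin[of x] by blast
    then show ?case using number_field_compositum[of K L] by auto
  qed
  show ?thesis using assms(1,2)
  proof (induction F rule: finite_induct)
    case empty show ?case using 1 by simp
  next
    case (insert L F)
    then obtain K where K: "number_field K" "\<Union>F \<subseteq> K" "X \<subseteq> K" by auto
    moreover have "number_field L" using insert by simp
    ultimately obtain M where "number_field M" "K \<subseteq> M" "L \<subseteq> M" using number_field_compositum[of K L] by auto
    then show ?case using K by (intro exI[of _ M]) auto
  qed
qed

section \<open>Algebraic integers as eigenvalues of integer matrices\<close>

lemma integral_eigenvalue:
  fixes M :: "nat \<Rightarrow> nat \<Rightarrow> int" and v :: "nat \<Rightarrow> complex"
  assumes "\<And>j. j < n \<Longrightarrow> (\<Sum>k<n. of_int (M j k) * v k) = e * v j" "i < n" "v i \<noteq> 0"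
  shows "algebraic_int e"
proof -
  let ?A = "mat n n (\<lambda>(i,j). M i j)"
  let ?B = "map_mat of_int ?A :: complex mat"
  have A: "?A \<in> carrier_mat n n" and B: "?B \<in> carrier_mat n n" by auto
  have "?B *\<^sub>v vec n v = e \<cdot>\<^sub>v vec n v"
    using assms(1) by (intro eq_vecI) (auto simp: scalar_prod_def lessThan_atLeast0)
  moreover have "vec n v \<noteq> 0\<^sub>v n" using assms(2,3) by (metis index_vec index_zero_vec(1))
  ultimately have "eigenvalue ?B e" unfolding eigenvalue_def eigenvector_def by (intro exI[of _ "vec n v"]) auto
  then have "poly (char_poly ?B) e = 0" using eigenvalue_root_char_poly[OF B] by simp
  moreover have "char_poly ?B = map_poly of_int (char_poly ?A)"
    by (rule of_int_hom.char_poly_hom[OF A])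
  moreover have "monic (char_poly ?A)" using degree_monic_char_poly[OF A] by simp
  ultimately show ?thesis
    unfolding algebraic_int_altdef_ipoly by (intro exI[of _ "char_poly ?A"]) auto
qed

text \<open>Multiplication by e on the generators is an integer matrix that has the vector of
  generators as an eigenvector with eigenvalue e; \<open>g0\<close> guarantees that this vector is
  not zero.\<close>

lemma algebraic_int_stable_lattice:
  assumes fin: "finite G" and g: "\<And>g. g \<in> G \<Longrightarrow> e * g \<in> ZC.span G" and nz: "g0 \<in> G" "g0 \<noteq> 0"
  shows "algebraic_int e"
proof -
  obtain \<gamma> where \<gamma>: "bij_betw \<gamma> {..<card G} G" using ex_bij_betw_nat_finite[OF fin] by (metis lessThan_atLeast0)
  have "\<exists>m. e * \<gamma> j = (\<Sum>k<card G. of_int (m k) * \<gamma> k)" if "j < card G" for j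
  proof -
    have "e * \<gamma> j \<in> ZC.span G" using g \<gamma> that by (auto simp: bij_betw_def)
    then obtain u where "e * \<gamma> j = (\<Sum>v\<in>G. of_int (u v) * v)"
      using ZC.span_finite[OF fin] by auto
    also have "\<dots> = (\<Sum>k<card G. of_int (u (\<gamma> k)) * \<gamma> k)"
      by (rule sum.reindex_bij_betw[OF \<gamma>, symmetric])
    finally show ?thesis by (intro exI[of _ "\<lambda>k. u (\<gamma> k)"])
  qed
  then obtain m where m: "\<And>j. j < card G \<Longrightarrow> e * \<gamma> j = (\<Sum>k<card G. of_int (m j k) * \<gamma> k)" by metis
  obtain i where "i < card G" "\<gamma> i = g0" using nz(1) \<gamma> by (metis bij_betw_imp_surj_on imageE lessThan_iff)
  then show ?thesis using integral_eigenvalue[of "card G" m \<gamma> e i] m nz(2) by simp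
qed

text \<open>The lattice spanned by the products x^i y^j below the two degrees is stable under x and
  under y, hence under their sum and their product.\<close>

lemma algebraic_int_closure:
  assumes x: "algebraic_int (x::complex)" and y: "algebraic_int y"
  shows "algebraic_int (x + y)" "algebraic_int (x * y)"
proof -
  have pw: "\<exists>d>0. (x ^ d \<in> ZC.span ((\<lambda>k. x ^ k) ` {..<d}))" if x: "algebraic_int x" for x :: complex
  proof -
    obtain p where p: "lead_coeff p = 1" "\<forall>i. coeff p i \<in> \<int>" "poly p x = 0" using x by (auto simp: algebraic_int.simps)
    define d where "d = degree p"
    have d: "d > 0"
    proof (rule ccontr)
      assume "\<not> d > 0"
      then obtain a where "p = [:a:]" unfolding d_def by (metis degree_eq_zeroE neq0_conv)
      then show False using p by auto
    qed
    have "\<forall>i. \<exists>k. coeff p i = of_int k" using p(2) by (metis Ints_cases)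
    then obtain a where a: "\<And>i. coeff p i = of_int (a i)" by metis
    have "0 = (\<Sum>k\<le>d. of_int (a k) * x ^ k)" using p(3) by (simp add: poly_altdef d_def a)
    also have "\<dots> = (\<Sum>k<d. of_int (a k) * x ^ k) + x ^ d"
      using p(1) by (simp add: lessThan_Suc_atMost[symmetric] flip: a) (simp add: d_def)
    finally have "x ^ d = (\<Sum>k<d. of_int (- a k) * x ^ k)" by (simp add: sum_negf eq_neg_iff_add_eq_0 add.commute)
    also have "\<dots> \<in> ZC.span ((\<lambda>k. x ^ k) ` {..<d})" by (intro ZC.span_sum ZC.span_scale ZC.span_base) auto
    finally show ?thesis using d by blast
  qed
  obtain m n where m: "m > 0" "x ^ m \<in> ZC.span ((\<lambda>k. x ^ k) ` {..<m})"
    and n: "n > 0" "y ^ n \<in> ZC.span ((\<lambda>k. y ^ k) ` {..<n})" using pw[OF x] pw[OF y] by blast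
  define G where "G = (\<lambda>(i,j). x ^ i * y ^ j) ` ({..<m} \<times> {..<n})"
  have xG: "x ^ i * y ^ j \<in> ZC.span G" if "i \<le> m" "j < n" for i j
  proof (cases "i = m")
    case True
    show ?thesis unfolding True
      by (rule ZC_span_mult[OF _ m(2), of "{y ^ j}"]) (use that in \<open>auto simp: G_def intro!: ZC.span_base\<close>)
  next
    case False then show ?thesis using that by (intro ZC.span_base) (auto simp: G_def)
  qed
  have yG: "x ^ i * y ^ j \<in> ZC.span G" if "i < m" "j \<le> n" for i j
  proof (cases "j = n")
    case True
    show ?thesis unfolding True
      by (rule ZC_span_mult[OF _ _ n(2), of "{x ^ i}"]) (use that in \<open>auto simp: G_def intro!: ZC.span_base\<close>)
  next
    case False then show ?thesis using that by (intro ZC.span_base) (auto simp: G_def)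
  qed
  have xg: "x * g \<in> ZC.span G" and yg: "y * g \<in> ZC.span G" if "g \<in> G" for g
    using that xG[of "Suc _"] yG[of _ "Suc _"] by (auto simp: G_def mult_ac)
  have fin: "finite G" by (simp add: G_def)
  have 1: "1 \<in> G" unfolding G_def using m n by (intro image_eqI[of _ _ "(0,0)"]) auto
  show "algebraic_int (x + y)"
    by (rule algebraic_int_stable_lattice[OF fin _ 1]) (use xg yg in \<open>simp_all add: distrib_right ZC.span_add\<close>)
  show "algebraic_int (x * y)"
  proof (rule algebraic_int_stable_lattice[OF fin _ 1])
    fix g assume "g \<in> G"
    then have "x * (y * g) \<in> ZC.span G"
      using ZC_span_mult[of "{x}" G G x "y * g"] xg yg ZC.span_base by auto
    then show "x * y * g \<in> ZC.span G" by (simp add: mult.assoc)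
  qed simp
qed

lemma algebraic_int_sum: "(\<And>i. i \<in> I \<Longrightarrow> algebraic_int (f i :: complex)) \<Longrightarrow> algebraic_int (sum f I)"
  by (induction I rule: infinite_finite_induct) (auto intro: algebraic_int_closure)

text \<open>By Schur triangularisation: the trace is invariant under similarity and becomes the sum
  of the diagonal, which lists the roots of the characteristic polynomial with multiplicity. Each
  root has an eigenvector; these need not form a basis.\<close>

lemma complex_trace_eigenvalues:
  fixes M :: "nat \<Rightarrow> nat \<Rightarrow> complex"
  shows "\<exists>es. (\<Sum>i<n. M i i) = (\<Sum>i<n. es i) \<and>
    (\<forall>i<n. \<exists>v. (\<exists>j<n. v j \<noteq> 0) \<and> (\<forall>j<n. (\<Sum>k<n. M j k * v k) = es i * v j))"
proof -
  let ?A = "mat n n (\<lambda>(i,j). M i j)"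
  have A: "?A \<in> carrier_mat n n" by simp
  obtain es where es: "char_poly ?A = (\<Prod>a\<leftarrow>es. [:- a, 1:])" "length es = n"
    using char_poly_factorized[OF A] by blast
  obtain B P Q where BPQ: "schur_decomposition ?A es = (B,P,Q)" by (cases "schur_decomposition ?A es") auto
  have sim: "similar_mat_wit ?A B P Q" and dg: "diag_mat B = es"
    using schur_decomposition[OF A es(1) BPQ] by auto
  have c: "B \<in> carrier_mat n n" "P \<in> carrier_mat n n" "Q \<in> carrier_mat n n" "Q * P = 1\<^sub>m n" "?A = P * B * Q"
    using sim A unfolding similar_mat_wit_def Let_def by auto
  have pr: "(X * Y) $$ (i,j) = (\<Sum>k<n. X $$ (i,k) * Y $$ (k,j))"
    if "X \<in> carrier_mat n n" "Y \<in> carrier_mat n n" "i < n" "j < n" for X Y :: "complex mat" and i j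
    using that by (auto simp: scalar_prod_def lessThan_atLeast0)
  have "(\<Sum>i<n. M i i) = (\<Sum>i<n. (P * B * Q) $$ (i,i))" unfolding c(5)[symmetric] by simp
  also have "\<dots> = (\<Sum>i<n. \<Sum>k<n. (P * B) $$ (i,k) * Q $$ (k,i))"
    using c by (intro sum.cong refl pr) auto
  also have "\<dots> = (\<Sum>k<n. \<Sum>i<n. Q $$ (k,i) * (P * B) $$ (i,k))"
    by (subst sum.swap) (simp add: mult.commute)
  also have "\<dots> = (\<Sum>k<n. (Q * (P * B)) $$ (k,k))"
    using c by (intro sum.cong refl pr[symmetric]) auto
  also have "Q * (P * B) = B" using assoc_mult_mat[OF c(3,2,1)] c(4) left_mult_one_mat[OF c(1)] by simp
  also have "(\<Sum>k<n. B $$ (k,k)) = (\<Sum>k<n. es ! k)"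
    using c(1) es(2) unfolding dg[symmetric] diag_mat_def by (intro sum.cong) auto
  finally have ftrace: "(\<Sum>i<n. M i i) = (\<Sum>k<n. es ! k)" .
  have "\<exists>v. (\<exists>j<n. v j \<noteq> 0) \<and> (\<forall>j<n. (\<Sum>k<n. M j k * v k) = es ! i * v j)" if i: "i < n" for i
  proof -
    have "poly (char_poly ?A) (es ! i) = 0"
      unfolding es(1) poly_prod_list using i es(2) by (auto simp: prod_list_zero_iff intro!: image_eqI[of _ _ "es ! i"])
    then have "eigenvalue ?A (es ! i)" using eigenvalue_root_char_poly[OF A] by simp
    then obtain v where v: "v \<in> carrier_vec n" "v \<noteq> 0\<^sub>v n" "?A *\<^sub>v v = (es ! i) \<cdot>\<^sub>v v"
      unfolding eigenvalue_def eigenvector_def by auto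
    have "\<exists>j<n. vec_index v j \<noteq> 0" using v(1,2) by (metis carrier_vecD eq_vecI index_zero_vec)
    moreover have "(\<Sum>k<n. M j k * vec_index v k) = es ! i * vec_index v j" if "j < n" for j
    proof -
      have "vec_index (?A *\<^sub>v v) j = (\<Sum>k<n. M j k * vec_index v k)"
        using that v(1) by (auto simp: scalar_prod_def lessThan_atLeast0)
      then show ?thesis using v(1,3) that by simp
    qed
    ultimately show ?thesis by (intro exI[of _ "vec_index v"]) blast
  qed
  then show ?thesis using ftrace by (intro exI[of _ "\<lambda>i. es ! i"]) blast
qed

section \<open>The size of elements of a number field\<close>

lemma field_embedding_facts:
  assumes K: "number_field K" and \<sigma>: "field_embedding K \<sigma>"
  shows "\<sigma> 0 = 0" "\<sigma> 1 = 1" "x \<in> K \<Longrightarrow> y \<in> K \<Longrightarrow> \<sigma> (x + y) = \<sigma> x + \<sigma> y"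
    "x \<in> K \<Longrightarrow> y \<in> K \<Longrightarrow> \<sigma> (x * y) = \<sigma> x * \<sigma> y" "\<sigma> (of_rat q) = of_rat q"
proof -
  note S = is_subringD[OF number_field_subring[OF K]]
  show add: "\<sigma> (x + y) = \<sigma> x + \<sigma> y" if "x \<in> K" "y \<in> K" for x y
    using \<sigma> that unfolding field_embedding_def by blast
  show mult: "\<sigma> (x * y) = \<sigma> x * \<sigma> y" if "x \<in> K" "y \<in> K" for x y
    using \<sigma> that unfolding field_embedding_def by blast
  show one: "\<sigma> 1 = 1" using \<sigma> unfolding field_embedding_def by blast
  show zero: "\<sigma> 0 = 0" using add[of 0 0] S by simp
  have nat: "\<sigma> (of_nat n) = of_nat n" for n
  proof (induction n)
    case (Suc n)
    have "\<sigma> (1 + of_nat n) = \<sigma> 1 + \<sigma> (of_nat n)"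
      using S is_subring_of_nat[OF number_field_subring[OF K]] by (intro add)
    then show ?case using Suc one by simp
  qed (simp add: zero)
  have neg: "\<sigma> (- x) = - \<sigma> x" if "x \<in> K" for x
    using add[OF that S(5)[OF that]] zero by (simp add: eq_neg_iff_add_eq_0 add.commute)
  have int: "\<sigma> (of_int n) = of_int n" for n
    using nat neg[OF is_subring_of_nat[OF number_field_subring[OF K]]] by (cases n) (auto simp del: of_nat_Suc)
  obtain a b where ab: "q = of_int a / of_int b" "b > 0" by (metis Fract_of_int_quotient quotient_of_div surj_pair quotient_of_denom_pos)
  have q: "of_rat q = (of_int a / of_int b :: complex)" by (simp add: ab of_rat_divide)
  have "\<sigma> (of_int b * of_rat q) = of_int b * \<sigma> (of_rat q)"
    using mult[OF is_subring_of_int[OF number_field_subring[OF K]] number_field_of_rat[OF K]] by (simp add: int)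
  moreover have "of_int b * of_rat q = (of_int a :: complex)" using ab(2) by (simp add: q)
  ultimately show "\<sigma> (of_rat q) = of_rat q" using ab(2) by (simp add: int q field_simps)
qed

lemma field_embedding_sum:
  assumes K: "number_field K" and \<sigma>: "field_embedding K \<sigma>" and f: "\<And>i. i \<in> I \<Longrightarrow> f i \<in> K"
  shows "\<sigma> (sum f I) = (\<Sum>i\<in>I. \<sigma> (f i))"
  using f
proof (induction I rule: infinite_finite_induct)
  case (insert i I)
  then show ?case
    using field_embedding_facts(3)[OF K \<sigma>, of "f i" "sum f I"] is_subring_sum[OF number_field_subring[OF K], of I f] by simp
qed (auto simp: field_embedding_facts[OF K \<sigma>])

lemma field_embedding_power:
  assumes K: "number_field K" and \<sigma>: "field_embedding K \<sigma>" and x: "x \<in> K"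
  shows "\<sigma> (x ^ n) = \<sigma> x ^ n"
  by (induction n) (use field_embedding_facts[OF K \<sigma>] x is_subring_power[OF number_field_subring[OF K] x] in auto)

lemma common_denominator_rat:
  "finite F \<Longrightarrow> \<exists>d::nat. d > 0 \<and> (\<forall>q\<in>F. of_nat d * (q::rat) \<in> \<int>)"
proof (induction F rule: finite_induct)
  case (insert q F)
  then obtain d :: nat where d: "d > 0" "\<forall>q\<in>F. of_nat d * q \<in> \<int>" by blast
  obtain a b where q: "q = of_int a / of_int b" "b > 0" by (metis quotient_of_div surj_pair quotient_of_denom_pos)
  have "of_nat (nat b) * q = of_int a" using q by simp
  then have "of_nat (d * nat b) * q \<in> \<int>" by (simp add: mult.assoc)
  moreover have "of_nat (d * nat b) * r \<in> \<int>" if "r \<in> F" for r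
    using Ints_mult[of "of_nat (nat b)" "of_nat d * r"] d(2) that by (simp add: mult_ac)
  ultimately show ?case using d(1) q(2) by (intro exI[of _ "d * nat b"]) auto
qed auto

lemma norm_fdet_le:
  fixes M :: "nat \<Rightarrow> nat \<Rightarrow> 'a::{real_normed_algebra_1, comm_ring_1}"
  assumes "\<And>i j. i < n \<Longrightarrow> j < n \<Longrightarrow> norm (M i j) \<le> b"
  shows "norm (fdet n M) \<le> fact n * b ^ n"
proof -
  have "norm (signof p * (\<Prod>i = 0..<n. M i (p i))) \<le> b ^ n" if "p permutes {0..<n}" for p
  proof -
    have "norm (signof p * (\<Prod>i = 0..<n. M i (p i))) = norm (\<Prod>i = 0..<n. M i (p i))"
      by (simp add: sign_def)
    also have "\<dots> \<le> (\<Prod>i = 0..<n. norm (M i (p i)))" by (rule norm_prod_le)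
    also have "\<dots> \<le> (\<Prod>i = 0..<n. b)"
      by (intro prod_mono) (use assms permutes_less_upt[OF that] in auto)
    finally show ?thesis by simp
  qed
  then have "norm (fdet n M) \<le> (\<Sum>p | p permutes {0..<n}. b ^ n)"
    unfolding fdet_sum by (intro order_trans[OF norm_sum] sum_mono) auto
  also have "\<dots> = fact n * b ^ n" by (simp add: card_permutations)
  finally show ?thesis .
qed

lemma norm_fcof_le:
  fixes M :: "nat \<Rightarrow> nat \<Rightarrow> 'a::{real_normed_algebra_1, comm_ring_1}"
  assumes "\<And>i j. i < n \<Longrightarrow> j < n \<Longrightarrow> norm (M i j) \<le> b"
  shows "norm (fcof n M i j) \<le> fact (n - 1) * b ^ (n - 1)"
proof -
  have "norm (fcof n M i j) \<le> norm ((-1::'a) ^ (i + j)) * norm (fdet (n - 1) (\<lambda>i' j'. M (if i' < i then i' else Suc i') (if j' < j then j' else Suc j')))"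
    unfolding fcof_def by (rule norm_mult_ineq)
  also have "norm ((-1::'a) ^ (i + j)) = 1" by (cases "even (i + j)") auto
  also have "1 * norm (fdet (n - 1) (\<lambda>i' j'. M (if i' < i then i' else Suc i') (if j' < j then j' else Suc j'))) \<le> fact (n - 1) * b ^ (n - 1)"
    unfolding mult_1_left by (rule norm_fdet_le) (intro assms; auto)
  finally show ?thesis .
qed

lemma cmod_of_rat: "cmod (of_rat q) = \<bar>real_of_rat q\<bar>"
proof -
  obtain a b where q: "q = of_int a / of_int b" by (metis quotient_of_div surj_pair)
  show ?thesis unfolding q by (simp add: of_rat_divide norm_divide)
qed

declare abs_of_rat [simp del]

text \<open>K with a Q-basis \<omega> of h = [K:Q] elements. Sizes, integrality and traces are all
  read off from coordinates and from the matrices of multiplication; the basis is forgotten once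
  \<open>sized_field\<close> is established.\<close>

locale number_field_basis =
  fixes K :: "complex set" and h :: nat and \<omega> :: "nat \<Rightarrow> complex"
  assumes K: "number_field K"
    and \<omega>K: "i < h \<Longrightarrow> \<omega> i \<in> K"
    and \<omega>_indep: "(\<Sum>i<h. of_rat (q i) * \<omega> i) = 0 \<Longrightarrow> i < h \<Longrightarrow> q i = 0"
    and \<omega>_span: "x \<in> K \<Longrightarrow> \<exists>q. x = (\<Sum>i<h. of_rat (q i) * \<omega> i)"
begin

section \<open>Coordinates and multiplication matrices\<close>

lemmas KS = is_subringD[OF number_field_subring[OF K]]
lemmas Ksum = is_subring_sum[OF number_field_subring[OF K]]
lemmas Krat = number_field_of_rat[OF K]

definition coord :: "complex \<Rightarrow> nat \<Rightarrow> rat" where "coord x = (SOME q. x = (\<Sum>i<h. of_rat (q i) * \<omega> i))"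

lemma coord_eq: "x \<in> K \<Longrightarrow> (\<Sum>i<h. of_rat (coord x i) * \<omega> i) = x"
proof -
  assume "x \<in> K"
  then have "x = (\<Sum>i<h. of_rat ((SOME q. x = (\<Sum>i<h. of_rat (q i) * \<omega> i)) i) * \<omega> i)"
    by (intro someI_ex[OF \<omega>_span])
  then show ?thesis unfolding coord_def by (rule sym)
qed

lemma coord_unique:
  assumes "x = (\<Sum>i<h. of_rat (q i) * \<omega> i)" "i < h"
  shows "coord x i = q i"
proof -
  have "x \<in> K" unfolding assms(1) by (intro Ksum KS Krat \<omega>K) auto
  then have "(\<Sum>i<h. of_rat (coord x i - q i) * \<omega> i) = 0"
    using coord_eq[of x] assms(1) by (simp add: of_rat_diff left_diff_distrib sum_subtractf)
  then show ?thesis using \<omega>_indep[of "\<lambda>i. coord x i - q i" i] assms(2) by simp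
qed

lemma coord_add: "x \<in> K \<Longrightarrow> y \<in> K \<Longrightarrow> i < h \<Longrightarrow> coord (x + y) i = coord x i + coord y i"
  by (intro coord_unique[of _ "\<lambda>i. coord x i + coord y i"])
     (auto simp: of_rat_add distrib_right sum.distrib coord_eq)

lemma coord_scale: "x \<in> K \<Longrightarrow> i < h \<Longrightarrow> coord (of_rat q * x) i = q * coord x i"
proof (intro coord_unique[of _ "\<lambda>i. q * coord x i"])
  assume "x \<in> K"
  have "(\<Sum>i<h. of_rat (q * coord x i) * \<omega> i) = of_rat q * (\<Sum>i<h. of_rat (coord x i) * \<omega> i)"
    by (simp add: of_rat_mult sum_distrib_left mult_ac)
  also have "\<dots> = of_rat q * x" unfolding coord_eq[OF \<open>x \<in> K\<close>] by (rule refl)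
  finally show "of_rat q * x = (\<Sum>i<h. of_rat (q * coord x i) * \<omega> i)" by (rule sym)
qed

lemma coord_zero: "i < h \<Longrightarrow> coord 0 i = 0"
  using coord_scale[of 0 i 0] KS(1) by simp

lemma coord_sum: "(\<And>j. j \<in> J \<Longrightarrow> f j \<in> K) \<Longrightarrow> i < h \<Longrightarrow> coord (sum f J) i = (\<Sum>j\<in>J. coord (f j) i)"
  by (induction J rule: infinite_finite_induct) (auto simp: coord_zero coord_add Ksum)

lemma h_pos: "h > 0"
proof (rule ccontr)
  assume "\<not> h > 0"
  then show False using coord_eq[OF KS(2)] by simp
qed

text \<open>Row j lists the coordinates of x \<omega> j. The vector \<omega> is then an eigenvector
  with eigenvalue x, and the matrix of x y is the matrix of y times the matrix of x.\<close>

definition mulmat :: "complex \<Rightarrow> nat \<Rightarrow> nat \<Rightarrow> rat" where "mulmat x j i = coord (x * \<omega> j) i"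

lemma mulmat_eq: "x \<in> K \<Longrightarrow> j < h \<Longrightarrow> (\<Sum>i<h. of_rat (mulmat x j i) * \<omega> i) = x * \<omega> j"
  unfolding mulmat_def by (intro coord_eq KS \<omega>K)

lemma mulmat_add: "x \<in> K \<Longrightarrow> y \<in> K \<Longrightarrow> j < h \<Longrightarrow> i < h \<Longrightarrow> mulmat (x + y) j i = mulmat x j i + mulmat y j i"
  unfolding mulmat_def distrib_right by (intro coord_add KS \<omega>K)

lemma mulmat_scale: "x \<in> K \<Longrightarrow> j < h \<Longrightarrow> i < h \<Longrightarrow> mulmat (of_rat q * x) j i = q * mulmat x j i"
  unfolding mulmat_def mult.assoc by (intro coord_scale KS \<omega>K)

lemma coord_mult:
  assumes "x \<in> K" "y \<in> K" "i < h"
  shows "coord (x * y) i = (\<Sum>j<h. coord y j * mulmat x j i)"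
proof (rule coord_unique[OF _ assms(3)])
  have "x * y = (\<Sum>j<h. of_rat (coord y j) * (x * \<omega> j))"
    by (subst coord_eq[OF assms(2), symmetric]) (simp add: sum_distrib_left mult_ac)
  also have "\<dots> = (\<Sum>j<h. of_rat (coord y j) * (\<Sum>i<h. of_rat (mulmat x j i) * \<omega> i))"
    by (intro sum.cong refl) (use mulmat_eq assms in auto)
  also have "\<dots> = (\<Sum>i<h. \<Sum>j<h. of_rat (coord y j) * (of_rat (mulmat x j i) * \<omega> i))"
    unfolding sum_distrib_left by (rule sum.swap)
  also have "\<dots> = (\<Sum>i<h. of_rat (\<Sum>j<h. coord y j * mulmat x j i) * \<omega> i)"
    by (rule sum.cong[OF refl]) (simp add: of_rat_sum of_rat_mult sum_distrib_left mult_ac)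
  finally show "x * y = (\<Sum>i<h. of_rat (\<Sum>j<h. coord y j * mulmat x j i) * \<omega> i)" .
qed

lemma mulmat_mult:
  assumes "x \<in> K" "y \<in> K" "j < h" "i < h"
  shows "mulmat (x * y) j i = (\<Sum>k<h. mulmat y j k * mulmat x k i)"
  using coord_mult[of x "y * \<omega> j" i] assms by (simp add: mulmat_def mult.assoc KS \<omega>K)

lemma mulmat_decomp:
  assumes "x \<in> K" "j < h" "i < h"
  shows "mulmat x j i = (\<Sum>k<h. coord x k * mulmat (\<omega> k) j i)"
proof -
  have "mulmat x j i = coord (\<omega> j * x) i" by (simp add: mulmat_def mult.commute)
  also have "\<dots> = (\<Sum>k<h. coord x k * mulmat (\<omega> j) k i)" using assms by (intro coord_mult \<omega>K)
  also have "\<dots> = (\<Sum>k<h. coord x k * mulmat (\<omega> k) j i)" by (simp add: mulmat_def mult.commute)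
  finally show ?thesis .
qed

text \<open>Bounds the basis elements and the structure constants of multiplication. Scaling the
  coordinate sum by it makes \<open>nrm\<close> dominate the absolute value and be
  submultiplicative.\<close>

definition \<kappa> :: real where
  "\<kappa> = (\<Sum>i<h. \<Sum>j<h. \<Sum>k<h. \<bar>real_of_rat (mulmat (\<omega> i) j k)\<bar>) + (\<Sum>i<h. cmod (\<omega> i)) + 1"

text \<open>A size on K that takes the place of the house. It is not normalised:
  \<open>nrm 1\<close> may exceed 1, which is why the factor \<open>nrm 1\<close> appears in later
  bounds for products.\<close>

definition nrm :: "complex \<Rightarrow> real" where "nrm x = \<kappa> * (\<Sum>i<h. \<bar>real_of_rat (coord x i)\<bar>)"

lemma \<kappa>_ge: "\<kappa> \<ge> 1" "i < h \<Longrightarrow> cmod (\<omega> i) \<le> \<kappa>" "i < h \<Longrightarrow> j < h \<Longrightarrow> (\<Sum>k<h. \<bar>real_of_rat (mulmat (\<omega> i) j k)\<bar>) \<le> \<kappa>"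
proof -
  let ?t = "\<lambda>i j. \<Sum>k<h. \<bar>real_of_rat (mulmat (\<omega> i) j k)\<bar>"
  have a: "0 \<le> (\<Sum>i<h. \<Sum>j<h. ?t i j)" "0 \<le> (\<Sum>i<h. cmod (\<omega> i))" by (auto intro!: sum_nonneg)
  show "\<kappa> \<ge> 1" using a by (simp add: \<kappa>_def)
  show "cmod (\<omega> i) \<le> \<kappa>" if "i < h"
    using a member_le_sum[of i "{..<h}" "\<lambda>i. cmod (\<omega> i)"] that by (simp add: \<kappa>_def)
  show "?t i j \<le> \<kappa>" if "i < h" "j < h"
  proof -
    have "?t i j \<le> (\<Sum>j<h. ?t i j)" by (rule member_le_sum) (use that in \<open>auto intro!: sum_nonneg\<close>)
    also have "\<dots> \<le> (\<Sum>i<h. \<Sum>j<h. ?t i j)" by (rule member_le_sum) (use that in \<open>auto intro!: sum_nonneg\<close>)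
    finally show ?thesis using a by (simp add: \<kappa>_def)
  qed
qed

lemma nrm_nonneg: "0 \<le> nrm x" unfolding nrm_def using \<kappa>_ge by (intro mult_nonneg_nonneg sum_nonneg) auto

lemma coord_le_nrm: "i < h \<Longrightarrow> \<bar>real_of_rat (coord x i)\<bar> \<le> nrm x"
proof -
  assume i: "i < h"
  have "\<bar>real_of_rat (coord x i)\<bar> \<le> (\<Sum>i<h. \<bar>real_of_rat (coord x i)\<bar>)" using i by (intro member_le_sum) auto
  also have "\<dots> = 1 * (\<Sum>i<h. \<bar>real_of_rat (coord x i)\<bar>)" by simp
  also have "\<dots> \<le> nrm x" unfolding nrm_def using \<kappa>_ge(1) by (intro mult_right_mono sum_nonneg) auto
  finally show ?thesis .
qed

lemma nrm_add: "x \<in> K \<Longrightarrow> y \<in> K \<Longrightarrow> nrm (x + y) \<le> nrm x + nrm y"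
  unfolding nrm_def distrib_left[symmetric] sum.distrib[symmetric]
  using \<kappa>_ge(1) by (intro mult_left_mono sum_mono) (auto simp: coord_add of_rat_add abs_triangle_ineq)

lemma nrm_scale: "x \<in> K \<Longrightarrow> nrm (of_rat q * x) = \<bar>real_of_rat q\<bar> * nrm x"
  unfolding nrm_def by (simp add: coord_scale of_rat_mult abs_mult sum_distrib_left mult.left_commute cong: sum.cong_simp)

lemma cmod_le_nrm:
  assumes "x \<in> K" shows "cmod x \<le> nrm x"
proof -
  have "cmod x \<le> (\<Sum>i<h. cmod (of_rat (coord x i) * \<omega> i))"
    by (subst coord_eq[OF assms, symmetric]) (rule norm_sum)
  also have "\<dots> \<le> (\<Sum>i<h. \<bar>real_of_rat (coord x i)\<bar> * \<kappa>)"
    by (intro sum_mono) (auto simp: norm_mult cmod_of_rat intro!: mult_mono \<kappa>_ge)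
  finally show ?thesis by (simp add: nrm_def sum_distrib_left mult.commute)
qed

lemma nrm_mult:
  assumes "x \<in> K" "y \<in> K" shows "nrm (x * y) \<le> nrm x * nrm y"
proof -
  let ?x = "\<lambda>i. \<bar>real_of_rat (coord x i)\<bar>" and ?y = "\<lambda>i. \<bar>real_of_rat (coord y i)\<bar>"
    and ?m = "\<lambda>i j k. \<bar>real_of_rat (mulmat (\<omega> i) j k)\<bar>"
  have "\<bar>real_of_rat (coord (x * y) k)\<bar> \<le> (\<Sum>j<h. \<Sum>i<h. ?y j * (?x i * ?m i j k))" if "k < h" for k
  proof -
    have "coord (x * y) k = (\<Sum>j<h. \<Sum>i<h. coord y j * (coord x i * mulmat (\<omega> i) j k))"
      using coord_mult[OF assms that] mulmat_decomp[OF assms(1)] that by (simp add: sum_distrib_left)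
    then have "\<bar>real_of_rat (coord (x * y) k)\<bar> = \<bar>\<Sum>j<h. \<Sum>i<h. real_of_rat (coord y j) * (real_of_rat (coord x i) * real_of_rat (mulmat (\<omega> i) j k))\<bar>"
      by (simp add: of_rat_sum of_rat_mult)
    also have "\<dots> \<le> (\<Sum>j<h. \<Sum>i<h. \<bar>real_of_rat (coord y j) * (real_of_rat (coord x i) * real_of_rat (mulmat (\<omega> i) j k))\<bar>)"
      by (intro order_trans[OF sum_abs] sum_mono sum_abs)
    finally show ?thesis by (simp add: abs_mult)
  qed
  then have "(\<Sum>k<h. \<bar>real_of_rat (coord (x * y) k)\<bar>) \<le> (\<Sum>k<h. \<Sum>j<h. \<Sum>i<h. ?y j * (?x i * ?m i j k))"
    by (intro sum_mono) auto
  also have "\<dots> = (\<Sum>j<h. \<Sum>i<h. \<Sum>k<h. ?y j * (?x i * ?m i j k))"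
    by (subst sum.swap, rule sum.cong[OF refl]) (rule sum.swap)
  also have "\<dots> \<le> (\<Sum>j<h. \<Sum>i<h. ?y j * (?x i * \<kappa>))"
    unfolding sum_distrib_left[symmetric] by (intro sum_mono mult_left_mono \<kappa>_ge) auto
  also have "\<dots> = \<kappa> * ((\<Sum>i<h. ?x i) * (\<Sum>j<h. ?y j))"
    by (simp add: sum_distrib_left sum_distrib_right mult_ac)
  finally have "\<kappa> * (\<Sum>k<h. \<bar>real_of_rat (coord (x * y) k)\<bar>) \<le> \<kappa> * (\<kappa> * ((\<Sum>i<h. ?x i) * (\<Sum>j<h. ?y j)))"
    using \<kappa>_ge(1) by (intro mult_left_mono) auto
  then show ?thesis by (simp add: nrm_def mult_ac)
qed

text \<open>The multiplier ring of the lattice spanned by \<omega>, an order of K. Testing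
  integrality on multiplication matrices makes closure under products immediate and turns the
  determinant of multiplication into an integer.\<close>

definition R :: "complex set" where "R = {x\<in>K. \<forall>j<h. \<forall>i<h. mulmat x j i \<in> \<int>}"

lemma R_subring: "is_subring R"
  unfolding is_subring_def
proof (intro conjI ballI)
  have m0: "mulmat 0 j i = 0" if "i < h" for i j using that by (simp add: mulmat_def coord_zero)
  show "0 \<in> R" using KS by (auto simp: R_def m0)
  have "mulmat 1 j i = (if i = j then 1 else 0)" if "i < h" "j < h" for i j
    unfolding mulmat_def using that
    by (intro coord_unique) (auto simp: if_distrib[of of_rat] if_distrib[of "\<lambda>u. u * _"] sum.delta cong: if_cong)
  then show "1 \<in> R" using KS by (auto simp: R_def)
  fix x y assume xy: "x \<in> R" "y \<in> R"
  then have k: "x \<in> K" "y \<in> K" by (auto simp: R_def)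
  show "x + y \<in> R" using xy k KS by (auto simp: R_def mulmat_add)
  have "mulmat (x * y) j i \<in> \<int>" if "j < h" "i < h" for i j
    unfolding mulmat_mult[OF k that] using xy that by (auto simp: R_def intro!: Ints_sum Ints_mult)
  then show "x * y \<in> R" using k KS by (auto simp: R_def)
  have "mulmat (- x) j i = - mulmat x j i" if "j < h" "i < h" for i j
    using mulmat_scale[OF k(1) that, of "-1"] by simp
  then show "- x \<in> R" using xy k KS by (auto simp: R_def)
qed

lemma denominator:
  assumes "x \<in> K" shows "\<exists>d::nat. d > 0 \<and> of_nat d * x \<in> R"
proof -
  obtain d :: nat where d: "d > 0" "\<forall>q\<in>(\<lambda>(j,i). mulmat x j i) ` ({..<h} \<times> {..<h}). of_nat d * q \<in> \<int>"
    using common_denominator_rat[of "(\<lambda>(j,i). mulmat x j i) ` ({..<h} \<times> {..<h})"] by auto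
  have "mulmat (of_nat d * x) j i = of_nat d * mulmat x j i" if "j < h" "i < h" for i j
    using mulmat_scale[OF assms that, of "of_nat d"] by simp
  then have "of_nat d * x \<in> R" using d assms KS is_subring_of_nat[OF number_field_subring[OF K]] by (auto simp: R_def)
  then show ?thesis using d(1) by blast
qed

lemma mulmat_le_nrm:
  assumes "x \<in> K" "j < h" "i < h"
  shows "\<bar>real_of_rat (mulmat x j i)\<bar> \<le> nrm x * (\<Sum>j<h. nrm (\<omega> j))"
proof -
  have "\<bar>real_of_rat (mulmat x j i)\<bar> \<le> nrm (x * \<omega> j)" unfolding mulmat_def using assms by (intro coord_le_nrm)
  also have "\<dots> \<le> nrm x * nrm (\<omega> j)" using assms by (intro nrm_mult \<omega>K)
  also have "\<dots> \<le> nrm x * (\<Sum>j<h. nrm (\<omega> j))"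
    using assms by (intro mult_left_mono nrm_nonneg member_le_sum) (auto intro: nrm_nonneg)
  finally show ?thesis .
qed

lemma \<omega>_nz: "i < h \<Longrightarrow> \<omega> i \<noteq> 0"
proof
  assume i: "i < h" "\<omega> i = 0"
  have "(\<Sum>j<h. of_rat (if j = i then 1 else 0) * \<omega> j) = 0"
    using i by (intro sum.neutral) auto
  from \<omega>_indep[OF this i(1)] show False by simp
qed

text \<open>The determinant of multiplication by x is the norm of x, here a nonzero integer. Since
  \<omega> is an eigenvector for x, Cramer's rule writes this determinant times \<omega> 0 as x
  times a combination of cofactors, which have size at most a constant times \<open>nrm x\<close> to
  the power h - 1. The cofactors play the part of the other conjugates.\<close>

lemma liouville: "\<exists>c\<ge>1. \<forall>x\<in>R. x \<noteq> 0 \<longrightarrow> 1 \<le> c * cmod x * nrm x ^ (h - 1)"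
proof -
  define W where "W = (\<Sum>j<h. nrm (\<omega> j))"
  have W0: "W \<ge> 0" unfolding W_def by (intro sum_nonneg nrm_nonneg)
  \<comment> \<open>Division by the absolute value of \<omega> 0 accounts for reading Cramer's rule
    at the coordinate 0.\<close>
  define c where "c = (\<Sum>j<h. fact (h - 1) * W ^ (h - 1) * cmod (\<omega> j)) / cmod (\<omega> 0)"
  have cS: "c * cmod (\<omega> 0) = (\<Sum>j<h. fact (h - 1) * W ^ (h - 1) * cmod (\<omega> j))"
    using \<omega>_nz[OF h_pos] by (simp add: c_def)
  have main: "1 \<le> c * cmod x * nrm x ^ (h - 1)" if x: "x \<in> R" "x \<noteq> 0" for x
  proof -
    have xK: "x \<in> K" using x by (simp add: R_def)
    \<comment> \<open>A left null vector v would make x times the nonzero element with coordinates v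
      vanish.\<close>
    have dz: "fdet h (mulmat x) \<noteq> 0"
    proof
      assume "fdet h (mulmat x) = 0"
      then have "fdet h (\<lambda>i j. mulmat x j i) = 0" by (simp only: fdet_transpose[of h "mulmat x"])
      then obtain v where v: "\<exists>i<h. v i \<noteq> 0" "\<forall>i<h. (\<Sum>j<h. mulmat x j i * v j) = 0"
        using fdet_zero_kernel[of h "\<lambda>i j. mulmat x j i"] by blast
      have "x * (\<Sum>j<h. of_rat (v j) * \<omega> j) = (\<Sum>j<h. of_rat (v j) * (x * \<omega> j))"
        by (simp add: sum_distrib_left mult_ac)
      also have "\<dots> = (\<Sum>j<h. of_rat (v j) * (\<Sum>i<h. of_rat (mulmat x j i) * \<omega> i))"
        by (intro sum.cong refl) (use mulmat_eq xK in auto)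
      also have "\<dots> = (\<Sum>i<h. \<Sum>j<h. of_rat (v j) * (of_rat (mulmat x j i) * \<omega> i))"
        unfolding sum_distrib_left by (rule sum.swap)
      also have "\<dots> = (\<Sum>i<h. of_rat (\<Sum>j<h. mulmat x j i * v j) * \<omega> i)"
        by (rule sum.cong[OF refl]) (simp add: of_rat_sum of_rat_mult sum_distrib_left mult_ac)
      also have "\<dots> = 0" using v(2) by simp
      finally have "(\<Sum>j<h. of_rat (v j) * \<omega> j) = 0" using x(2) by simp
      then show False using v(1) \<omega>_indep[of v] by blast
    qed
    have "mulmat x j i \<in> \<int>" if "j < h" "i < h" for i j using x(1) that by (auto simp: R_def)
    then have "fdet h (mulmat x) \<in> \<int>"
      by (intro is_subring_fdet) (auto simp: is_subring_def)
    then obtain k where k: "fdet h (mulmat x) = of_int k" by (auto elim: Ints_cases)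
    let ?M = "\<lambda>j i. of_rat (mulmat x j i) :: complex"
    have dM: "fdet h ?M = of_int k"
      using fdet_hom[of "of_rat :: rat \<Rightarrow> complex" h "mulmat x"] k by (simp add: of_rat_add of_rat_mult)
    have "k \<noteq> 0" using dz k by auto
    then have k1: "1 \<le> cmod (fdet h ?M)" unfolding dM by simp
    have cb: "cmod (fcof h ?M j 0) \<le> fact (h - 1) * (nrm x * W) ^ (h - 1)" for j
      by (rule norm_fcof_le) (use mulmat_le_nrm[OF xK] in \<open>auto simp: W_def cmod_of_rat\<close>)
    have "fdet h ?M * \<omega> 0 = (\<Sum>j<h. fcof h ?M j 0 * (\<Sum>k<h. ?M j k * \<omega> k))"
      using cramer_right[OF h_pos, of ?M \<omega>] by simp
    also have "\<dots> = x * (\<Sum>j<h. fcof h ?M j 0 * \<omega> j)"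
      using mulmat_eq[OF xK] by (simp add: sum_distrib_left mult_ac)
    finally have e: "fdet h ?M * \<omega> 0 = x * (\<Sum>j<h. fcof h ?M j 0 * \<omega> j)" .
    have "cmod (\<omega> 0) \<le> cmod (fdet h ?M) * cmod (\<omega> 0)" using mult_right_mono[OF k1, of "cmod (\<omega> 0)"] by simp
    also have "\<dots> = cmod x * cmod (\<Sum>j<h. fcof h ?M j 0 * \<omega> j)" using e by (metis norm_mult)
    also have "\<dots> \<le> cmod x * (\<Sum>j<h. (fact (h - 1) * (nrm x * W) ^ (h - 1)) * cmod (\<omega> j))"
      using cb by (intro mult_left_mono order_trans[OF norm_sum] sum_mono) (auto simp: norm_mult intro!: mult_right_mono)
    also have "\<dots> = cmod x * nrm x ^ (h - 1) * (c * cmod (\<omega> 0))"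
      unfolding cS by (simp add: power_mult_distrib sum_distrib_left mult_ac)
    also have "\<dots> = (c * cmod x * nrm x ^ (h - 1)) * cmod (\<omega> 0)"
      by (simp add: mult_ac)
    finally show ?thesis using \<omega>_nz[OF h_pos] by simp
  qed
  have "1 \<le> max 1 c * cmod x * nrm x ^ (h - 1)" if x: "x \<in> R" "x \<noteq> 0" for x
  proof -
    have "c * (cmod x * nrm x ^ (h - 1)) \<le> max 1 c * (cmod x * nrm x ^ (h - 1))"
      by (intro mult_right_mono) (auto simp: nrm_nonneg)
    then show ?thesis using main[OF x] by (simp add: mult.assoc)
  qed
  then show ?thesis by (intro exI[of _ "max 1 c"]) auto
qed

end

section \<open>Traces and embeddings\<close>

context number_field_basis begin

definition rat_linear :: "(complex \<Rightarrow> complex) \<Rightarrow> bool" where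
  "rat_linear \<phi> \<longleftrightarrow> (\<forall>x\<in>K. \<forall>y\<in>K. \<phi> (x + y) = \<phi> x + \<phi> y) \<and> (\<forall>q. \<forall>x\<in>K. \<phi> (of_rat q * x) = of_rat q * \<phi> x)"

lemma rat_linear_sum:
  assumes "rat_linear \<phi>" "\<And>i. i \<in> I \<Longrightarrow> f i \<in> K"
  shows "\<phi> (sum f I) = (\<Sum>i\<in>I. \<phi> (f i))"
proof -
  have z: "\<phi> 0 = 0" using assms(1) KS(1) unfolding rat_linear_def by (metis add_cancel_right_left)
  show ?thesis using assms(2)
  proof (induction I rule: infinite_finite_induct)
    case (insert i I)
    then show ?case using assms(1) Ksum[of I f] unfolding rat_linear_def by simp
  qed (auto simp: z)
qed

lemma R_algebraic_int: "x \<in> R \<Longrightarrow> algebraic_int x"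
proof -
  assume x: "x \<in> R"
  then have xK: "x \<in> K" by (simp add: R_def)
  have "\<exists>m. mulmat x j i = of_int m" if "j < h" "i < h" for j i
  proof -
    have "mulmat x j i \<in> \<int>" using x that by (auto simp: R_def)
    then show ?thesis by (metis Ints_cases)
  qed
  then obtain m where m: "\<And>j i. j < h \<Longrightarrow> i < h \<Longrightarrow> mulmat x j i = of_int (m j i)" by metis
  show ?thesis
  proof (rule integral_eigenvalue[of h m \<omega> x 0])
    fix j assume "j < h"
    then show "(\<Sum>k<h. of_int (m j k) * \<omega> k) = x * \<omega> j" using mulmat_eq[OF xK, of j] by (simp add: m)
  qed (use \<omega>_nz h_pos in auto)
qed

lemma K_algebraic: "x \<in> K \<Longrightarrow> algebraic x"
proof -
  assume "x \<in> K"
  then obtain d :: nat where d: "d > 0" "of_nat d * x \<in> R" using denominator by blast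
  then have "algebraic (of_nat d * x)" using R_algebraic_int by blast
  then obtain p where p: "\<forall>i. coeff p i \<in> \<int>" "p \<noteq> 0" "poly p (of_nat d * x) = 0" unfolding algebraic_def by blast
  let ?q = "pcompose p [:0, of_nat d:]"
  have "coeff ?q i \<in> \<int>" for i using p(1) by (simp add: coeff_pcompose_linear)
  moreover have "?q \<noteq> 0" using p(2) d(1) by (simp add: pcompose_eq_0_iff)
  moreover have "poly ?q x = 0" using p(3) by (simp add: poly_pcompose mult.commute)
  ultimately show ?thesis unfolding algebraic_def by blast
qed

text \<open>\<phi> is annihilated by p evaluated at multiplication by b. When a root \<rho> of p is
  split off, either \<phi> is already an eigenfunctional for \<rho>, or \<phi> (b y) - \<rho> \<phi>
  y is a nonzero functional annihilated by the remaining factor. Eigenvalues for other multipliers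
  survive because multiplications commute, so the refinement can be repeated with further elements
  b.\<close>

lemma refine_eigenfunctional:
  assumes b: "b \<in> K"
  shows "degree p \<le> n \<Longrightarrow> p \<noteq> 0 \<Longrightarrow> rat_linear \<phi> \<Longrightarrow> \<exists>y\<in>K. \<phi> y \<noteq> 0 \<Longrightarrow>
    (\<forall>y\<in>K. (\<Sum>k\<le>n. coeff p k * \<phi> (b ^ k * y)) = 0) \<Longrightarrow>
    \<exists>\<rho> \<psi>. rat_linear \<psi> \<and> (\<exists>y\<in>K. \<psi> y \<noteq> 0) \<and> (\<forall>y\<in>K. \<psi> (b * y) = \<rho> * \<psi> y) \<and>
      (\<forall>x e. x \<in> K \<longrightarrow> (\<forall>y\<in>K. \<phi> (x * y) = e * \<phi> y) \<longrightarrow> (\<forall>y\<in>K. \<psi> (x * y) = e * \<psi> y))"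
proof (induction n arbitrary: p \<phi>)
  case 0
  then obtain a where "p = [:a:]" by (metis degree_eq_zeroE le_zero_eq)
  then show ?case using 0 by auto
next
  case (Suc n)
  obtain y0 where y0: "y0 \<in> K" "\<phi> y0 \<noteq> 0" using Suc.prems(4) by blast
  show ?case
  proof (cases "degree p = 0")
    case True
    then obtain a where a: "p = [:a:]" by (metis degree_eq_zeroE)
    have "(\<Sum>k\<le>Suc n. coeff p k * \<phi> (b ^ k * y0)) = a * \<phi> y0"
      unfolding sum.atMost_Suc_shift a by simp
    then show ?thesis using Suc.prems(2,5) y0 a by auto
  next
    case False
    then obtain \<rho> where "poly p \<rho> = 0" by (metis Fundamental_Theorem_Algebra.fundamental_theorem_of_algebra constant_degree)
    then obtain q where q: "p = [:-\<rho>, 1:] * q" by (metis poly_eq_0_iff_dvd dvdE)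
    have qz: "q \<noteq> 0" using q Suc.prems(2) by auto
    have dq: "degree q \<le> n" 
    proof -
      have "degree p = degree [:-\<rho>, 1:] + degree q" unfolding q by (rule degree_mult_eq) (use qz in auto)
      then show ?thesis using Suc.prems(1) by simp
    qed
    define \<phi>1 where "\<phi>1 = (\<lambda>y. \<phi> (b * y) - \<rho> * \<phi> y)"
    have lin1: "rat_linear \<phi>1"
      unfolding rat_linear_def
    proof (intro conjI allI ballI)
      fix x y assume "x \<in> K" "y \<in> K"
      then have "\<phi> (b * x + b * y) = \<phi> (b * x) + \<phi> (b * y)" "\<phi> (x + y) = \<phi> x + \<phi> y"
        using Suc.prems(3) KS b unfolding rat_linear_def by auto
      then show "\<phi>1 (x + y) = \<phi>1 x + \<phi>1 y" by (simp add: \<phi>1_def algebra_simps)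
    next
      fix r x assume "x \<in> K"
      then have "\<phi> (of_rat r * (b * x)) = of_rat r * \<phi> (b * x)" "\<phi> (of_rat r * x) = of_rat r * \<phi> x"
        using Suc.prems(3) KS b unfolding rat_linear_def by auto
      then show "\<phi>1 (of_rat r * x) = of_rat r * \<phi>1 x" by (simp add: \<phi>1_def algebra_simps)
    qed
    have s1: "(\<Sum>k\<le>n. coeff q k * \<phi>1 (b ^ k * y)) = 0" if y: "y \<in> K" for y
    proof -
      have "0 = (\<Sum>k\<le>Suc n. coeff p k * \<phi> (b ^ k * y))" using Suc.prems(5) y by simp
      also have "\<dots> = (\<Sum>k\<le>Suc n. - \<rho> * coeff q k * \<phi> (b ^ k * y)) + (\<Sum>k\<le>Suc n. coeff (pCons 0 q) k * \<phi> (b ^ k * y))"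
        by (simp add: q sum.distrib[symmetric] algebra_simps del: sum.atMost_Suc)
      also have "(\<Sum>k\<le>Suc n. coeff (pCons 0 q) k * \<phi> (b ^ k * y)) = (\<Sum>k\<le>n. coeff q k * \<phi> (b * (b ^ k * y)))"
        unfolding sum.atMost_Suc_shift by (simp add: mult.assoc)
      also have "(\<Sum>k\<le>Suc n. - \<rho> * coeff q k * \<phi> (b ^ k * y)) = (\<Sum>k\<le>n. - \<rho> * coeff q k * \<phi> (b ^ k * y))"
        using dq by (simp add: coeff_eq_0)
      finally show ?thesis unfolding \<phi>1_def by (simp add: algebra_simps sum_subtractf sum_negf)
    qed
    show ?thesis
    proof (cases "\<exists>y\<in>K. \<phi>1 y \<noteq> 0")
      case False
      then show ?thesis using Suc.prems(3,4) by (intro exI[of _ \<rho>] exI[of _ \<phi>]) (auto simp: \<phi>1_def)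
    next
      case True
      have lift: "\<forall>y\<in>K. \<phi>1 (x * y) = e * \<phi>1 y" if "x \<in> K" "\<forall>y\<in>K. \<phi> (x * y) = e * \<phi> y" for x e
      proof
        fix y assume "y \<in> K"
        then have "\<phi> (x * (b * y)) = e * \<phi> (b * y)" "\<phi> (x * y) = e * \<phi> y" using that b KS by auto
        then show "\<phi>1 (x * y) = e * \<phi>1 y" by (simp add: \<phi>1_def algebra_simps)
      qed
      obtain \<rho>' \<psi> where "rat_linear \<psi>" "\<exists>y\<in>K. \<psi> y \<noteq> 0" "\<forall>y\<in>K. \<psi> (b * y) = \<rho>' * \<psi> y"
        "\<forall>x e. x \<in> K \<longrightarrow> (\<forall>y\<in>K. \<phi>1 (x * y) = e * \<phi>1 y) \<longrightarrow> (\<forall>y\<in>K. \<psi> (x * y) = e * \<psi> y)"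
        using Suc.IH[OF dq qz lin1 True] s1 by blast
      then show ?thesis using lift by (intro exI[of _ \<rho>'] exI[of _ \<psi>]) simp
    qed
  qed
qed

text \<open>An eigenvector of multiplication by $x$ is refined to a functional that is an eigenvector of all
  multiplications; its eigenvalues form the embedding.\<close>
lemma eigen_embedding:
  assumes x: "x \<in> K" and v: "\<exists>j<h. v j \<noteq> 0" "\<And>j. j < h \<Longrightarrow> (\<Sum>k<h. of_rat (mulmat x j k) * v k) = e * v j"
  shows "\<exists>\<sigma>. field_embedding K \<sigma> \<and> \<sigma> x = e"
proof -
  \<comment> \<open>The functional with value v j at \<omega> j; the eigenvector equation says that
    multiplication by x acts on it by the scalar e.\<close>
  define \<phi>0 where "\<phi>0 = (\<lambda>y. \<Sum>j<h. of_rat (coord y j) * v j)"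
  have l0: "rat_linear \<phi>0"
    unfolding rat_linear_def
  proof (intro conjI allI ballI)
    fix x y assume "x \<in> K" "y \<in> K"
    then show "\<phi>0 (x + y) = \<phi>0 x + \<phi>0 y"
      by (simp add: \<phi>0_def coord_add of_rat_add distrib_right sum.distrib)
  next
    fix q x assume "x \<in> K"
    then show "\<phi>0 (of_rat q * x) = of_rat q * \<phi>0 x"
      unfolding \<phi>0_def sum_distrib_left by (intro sum.cong refl) (simp add: coord_scale of_rat_mult)
  qed
  have n0: "\<exists>y\<in>K. \<phi>0 y \<noteq> 0"
  proof -
    obtain j where j: "j < h" "v j \<noteq> 0" using v(1) by blast
    have "coord (\<omega> j) i = (if i = j then 1 else 0)" if "i < h" for i
      using that j by (intro coord_unique) (auto simp: if_distrib[of of_rat] if_distrib[of "\<lambda>u. u * _"] sum.delta cong: if_cong)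
    then have "\<phi>0 (\<omega> j) = (\<Sum>i<h. of_rat (if i = j then 1 else 0) * v i)" unfolding \<phi>0_def by (intro sum.cong) auto
    also have "\<dots> = v j" using j by (simp add: if_distrib[of of_rat] if_distrib[of "\<lambda>u. u * _"] sum.delta cong: if_cong)
    finally show ?thesis using j \<omega>K by (intro bexI[of _ "\<omega> j"]) auto
  qed
  have e0: "\<phi>0 (x * y) = e * \<phi>0 y" if "y \<in> K" for y
  proof -
    have "\<phi>0 (x * y) = (\<Sum>i<h. \<Sum>j<h. of_rat (coord y j) * (of_rat (mulmat x j i) * v i))"
      unfolding \<phi>0_def by (rule sum.cong[OF refl]) (simp add: coord_mult x that of_rat_sum of_rat_mult sum_distrib_left mult_ac)
    also have "\<dots> = (\<Sum>j<h. \<Sum>i<h. of_rat (coord y j) * (of_rat (mulmat x j i) * v i))" by (rule sum.swap)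
    also have "\<dots> = (\<Sum>j<h. of_rat (coord y j) * (e * v j))"
      by (rule sum.cong[OF refl]) (simp add: v(2)[symmetric] sum_distrib_left)
    finally show ?thesis by (simp add: \<phi>0_def sum_distrib_left mult_ac)
  qed
  \<comment> \<open>Each step m turns one more basis element into a multiplier that acts by a
    scalar, while x keeps its eigenvalue e.\<close>
  have "\<exists>\<psi>. rat_linear \<psi> \<and> (\<exists>y\<in>K. \<psi> y \<noteq> 0) \<and> (\<forall>y\<in>K. \<psi> (x * y) = e * \<psi> y) \<and>
      (\<forall>i<m. \<exists>\<rho>. \<forall>y\<in>K. \<psi> (\<omega> i * y) = \<rho> * \<psi> y)" if "m \<le> h" for m
    using that
  proof (induction m)
    case 0 then show ?case using l0 n0 e0 by (intro exI[of _ \<phi>0]) auto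
  next
    case (Suc m)
    then obtain \<psi> where \<psi>: "rat_linear \<psi>" "\<exists>y\<in>K. \<psi> y \<noteq> 0" "\<forall>y\<in>K. \<psi> (x * y) = e * \<psi> y"
      "\<forall>i<m. \<exists>\<rho>. \<forall>y\<in>K. \<psi> (\<omega> i * y) = \<rho> * \<psi> y" by auto
    have b: "\<omega> m \<in> K" using \<omega>K Suc.prems by simp
    obtain p where p: "\<forall>i. coeff p i \<in> \<int>" "p \<noteq> 0" "poly p (\<omega> m) = 0"
      using K_algebraic[OF b] unfolding algebraic_def by blast
    have "(\<Sum>k\<le>degree p. coeff p k * \<psi> (\<omega> m ^ k * y)) = 0" if y: "y \<in> K" for y
    proof -
      have "coeff p k * \<psi> (\<omega> m ^ k * y) = \<psi> (coeff p k * (\<omega> m ^ k * y))" for k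
      proof -
        obtain a where a: "coeff p k = of_int a" using p(1) by (metis Ints_cases)
        have "\<omega> m ^ k * y \<in> K" using is_subring_power[OF number_field_subring[OF K] b] y KS by auto
        then have "\<psi> (of_rat (of_int a) * (\<omega> m ^ k * y)) = of_rat (of_int a) * \<psi> (\<omega> m ^ k * y)"
          using \<psi>(1) unfolding rat_linear_def by blast
        then show ?thesis by (simp add: a)
      qed
      then have "(\<Sum>k\<le>degree p. coeff p k * \<psi> (\<omega> m ^ k * y)) = (\<Sum>k\<le>degree p. \<psi> (coeff p k * (\<omega> m ^ k * y)))" by simp
      also have "\<dots> = \<psi> (\<Sum>k\<le>degree p. coeff p k * (\<omega> m ^ k * y))"
        using p(1) y KS is_subring_power[OF number_field_subring[OF K] b] is_subring_of_int[OF number_field_subring[OF K]]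
        by (intro rat_linear_sum[OF \<psi>(1), symmetric] KS(4)) (metis Ints_cases, auto)
      also have "(\<Sum>k\<le>degree p. coeff p k * (\<omega> m ^ k * y)) = poly p (\<omega> m) * y"
        by (simp add: poly_altdef sum_distrib_left sum_distrib_right mult_ac)
      also have "\<psi> \<dots> = 0" using p(3) rat_linear_sum[OF \<psi>(1), of "{}"] by simp
      finally show ?thesis .
    qed
    then obtain \<rho> \<psi>' where \<psi>': "rat_linear \<psi>'" "\<exists>y\<in>K. \<psi>' y \<noteq> 0" "\<forall>y\<in>K. \<psi>' (\<omega> m * y) = \<rho> * \<psi>' y"
      "\<And>x e. x \<in> K \<Longrightarrow> (\<forall>y\<in>K. \<psi> (x * y) = e * \<psi> y) \<Longrightarrow> (\<forall>y\<in>K. \<psi>' (x * y) = e * \<psi>' y)"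
      using refine_eigenfunctional[OF b order_refl p(2) \<psi>(1,2)] by blast
    have "\<exists>\<rho>. \<forall>y\<in>K. \<psi>' (\<omega> i * y) = \<rho> * \<psi>' y" if i: "i < Suc m" for i
    proof (cases "i = m")
      case True then show ?thesis using \<psi>'(3) by blast
    next
      case False
      then obtain \<rho> where "\<forall>y\<in>K. \<psi> (\<omega> i * y) = \<rho> * \<psi> y" using \<psi>(4) i by (metis less_SucE)
      then show ?thesis using \<psi>'(4)[of "\<omega> i" \<rho>] \<omega>K i Suc.prems by auto
    qed
    then show ?case using \<psi>'(1,2) \<psi>'(4)[OF x \<psi>(3)] by blast
  qed
  then obtain \<psi> where \<psi>: "rat_linear \<psi>" "\<exists>y\<in>K. \<psi> y \<noteq> 0" "\<forall>y\<in>K. \<psi> (x * y) = e * \<psi> y"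
    "\<forall>i<h. \<exists>\<rho>. \<forall>y\<in>K. \<psi> (\<omega> i * y) = \<rho> * \<psi> y" by blast
  obtain \<rho> where \<rho>: "\<And>i y. i < h \<Longrightarrow> y \<in> K \<Longrightarrow> \<psi> (\<omega> i * y) = \<rho> i * \<psi> y" using \<psi>(4) by metis
  \<comment> \<open>The linear extension of the eigenvalues on the basis. At a point where \<psi> is
    nonzero, the eigenvalue equations yield additivity and multiplicativity.\<close>
  define s where "s = (\<lambda>b. \<Sum>i<h. of_rat (coord b i) * \<rho> i)"
  have s: "\<psi> (b * y) = s b * \<psi> y" if "b \<in> K" "y \<in> K" for b y
  proof -
    have "\<psi> (b * y) = \<psi> (\<Sum>i<h. of_rat (coord b i) * (\<omega> i * y))"
      by (subst coord_eq[OF that(1), symmetric]) (simp add: sum_distrib_left sum_distrib_right mult_ac)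
    also have "\<dots> = (\<Sum>i<h. \<psi> (of_rat (coord b i) * (\<omega> i * y)))"
      by (rule rat_linear_sum[OF \<psi>(1)]) (use that \<omega>K KS Krat in auto)
    also have "\<dots> = (\<Sum>i<h. of_rat (coord b i) * (\<rho> i * \<psi> y))"
    proof (rule sum.cong[OF refl])
      fix i assume i: "i \<in> {..<h}"
      then have "\<omega> i * y \<in> K" using \<omega>K KS that by auto
      then show "\<psi> (of_rat (coord b i) * (\<omega> i * y)) = of_rat (coord b i) * (\<rho> i * \<psi> y)"
        using \<psi>(1) \<rho>[of i y] i that unfolding rat_linear_def by simp
    qed
    finally show ?thesis by (simp add: s_def sum_distrib_left sum_distrib_right mult_ac)
  qed
  obtain y0 where y0: "y0 \<in> K" "\<psi> y0 \<noteq> 0" using \<psi>(2) by blast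
  have "s 1 = 1" using s[OF KS(2) y0(1)] y0(2) by simp
  moreover have "s (a + b) = s a + s b \<and> s (a * b) = s a * s b" if ab: "a \<in> K" "b \<in> K" for a b
  proof
    have "s (a + b) * \<psi> y0 = \<psi> (a * y0 + b * y0)" using s[of "a + b" y0] ab y0 KS by (simp add: distrib_right)
    also have "\<dots> = \<psi> (a * y0) + \<psi> (b * y0)" using \<psi>(1) ab y0 KS unfolding rat_linear_def by blast
    also have "\<dots> = (s a + s b) * \<psi> y0" using s ab y0 by (simp add: distrib_right)
    finally show "s (a + b) = s a + s b" using y0 by simp
    have "s (a * b) * \<psi> y0 = \<psi> (a * (b * y0))" using s[of "a * b" y0] ab y0 KS by (simp add: mult.assoc)
    also have "\<dots> = s a * s b * \<psi> y0" using s ab y0 KS by simp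
    finally show "s (a * b) = s a * s b" using y0 by simp
  qed
  ultimately have "field_embedding K s" unfolding field_embedding_def by blast
  moreover have "s x = e" using s[OF x y0(1)] \<psi>(3) y0 by simp
  ultimately show ?thesis by blast
qed

definition ftrace :: "complex \<Rightarrow> rat" where "ftrace x = (\<Sum>j<h. mulmat x j j)"

text \<open>Every eigenvalue of multiplication by x is the value at x of an embedding, so bounds and
  integrality of the conjugates pass to the trace. The list may use an embedding several
  times.\<close>

lemma trace_embeddings:
  assumes x: "x \<in> K"
  shows "\<exists>es. of_rat (ftrace x) = (\<Sum>i<h. es i :: complex) \<and> (\<forall>i<h. \<exists>\<sigma>. field_embedding K \<sigma> \<and> \<sigma> x = es i)"
proof -
  obtain es where es: "(\<Sum>i<h. of_rat (mulmat x i i)) = (\<Sum>i<h. es i :: complex)"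
    "\<forall>i<h. \<exists>v. (\<exists>j<h. v j \<noteq> 0) \<and> (\<forall>j<h. (\<Sum>k<h. of_rat (mulmat x j k) * v k) = es i * v j)"
    using complex_trace_eigenvalues[where n = h and M = "\<lambda>j k. of_rat (mulmat x j k)"] by blast
  have "\<exists>\<sigma>. field_embedding K \<sigma> \<and> \<sigma> x = es i" if i: "i < h" for i
  proof -
    obtain v where v: "\<exists>j<h. v j \<noteq> 0" "\<forall>j<h. (\<Sum>k<h. of_rat (mulmat x j k) * v k) = es i * v j"
      using es(2) i by blast
    then show ?thesis using eigen_embedding[OF x, of v "es i"] by blast
  qed
  then show ?thesis using es(1) by (intro exI[of _ es]) (auto simp: ftrace_def of_rat_sum)
qed

lemma ftrace_bound:
  assumes x: "x \<in> K" and X: "\<And>\<sigma>. field_embedding K \<sigma> \<Longrightarrow> cmod (\<sigma> x) \<le> X"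
  shows "\<bar>real_of_rat (ftrace x)\<bar> \<le> real h * X"
proof -
  obtain es where es: "of_rat (ftrace x) = (\<Sum>i<h. es i :: complex)" "\<forall>i<h. \<exists>\<sigma>. field_embedding K \<sigma> \<and> \<sigma> x = es i"
    using trace_embeddings[OF x] by blast
  have "\<bar>real_of_rat (ftrace x)\<bar> = cmod (\<Sum>i<h. es i)" by (simp flip: cmod_of_rat add: es(1))
  also have "\<dots> \<le> (\<Sum>i<h. X)" using es(2) X by (intro order_trans[OF norm_sum] sum_mono) fastforce
  finally show ?thesis by simp
qed

text \<open>Embeddings fix rational numbers, hence all eigenvalues satisfy the monic integer
  equation of x, and a rational algebraic integer is an integer.\<close>

lemma ftrace_integral:
  assumes x: "x \<in> K" and ai: "algebraic_int x"
  shows "ftrace x \<in> \<int>"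
proof -
  obtain es where es: "of_rat (ftrace x) = (\<Sum>i<h. es i :: complex)" "\<forall>i<h. \<exists>\<sigma>. field_embedding K \<sigma> \<and> \<sigma> x = es i"
    using trace_embeddings[OF x] by blast
  obtain p where p: "lead_coeff p = 1" "\<forall>i. coeff p i \<in> \<int>" "poly p x = 0" using ai by (auto simp: algebraic_int.simps)
  have "\<exists>a. coeff p k = of_int a" for k using p(2) by (metis Ints_cases)
  then obtain a where a: "\<And>k. coeff p k = of_rat (of_int (a k))" by (metis of_rat_of_int_eq)
  have "algebraic_int (es i)" if i: "i < h" for i
  proof -
    obtain \<sigma> where \<sigma>: "field_embedding K \<sigma>" "\<sigma> x = es i" using es(2) i by blast
    note F = field_embedding_facts[OF K \<sigma>(1)]
    have "0 = \<sigma> (poly p x)" using p(3) F by simp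
    also have "\<dots> = (\<Sum>k\<le>degree p. \<sigma> (coeff p k * x ^ k))"
      unfolding poly_altdef a
      by (rule field_embedding_sum[OF K \<sigma>(1)]) (intro KS(4) Krat is_subring_power[OF number_field_subring[OF K]] x)
    also have "\<dots> = (\<Sum>k\<le>degree p. coeff p k * es i ^ k)"
      unfolding a
      by (rule sum.cong[OF refl])
         (use F(4)[OF Krat is_subring_power[OF number_field_subring[OF K] x]] F(5) field_embedding_power[OF K \<sigma>(1) x] \<sigma>(2) in \<open>simp del: of_rat_of_int_eq\<close>)
    also have "\<dots> = poly p (es i)" by (simp add: poly_altdef)
    finally show ?thesis using p by (auto simp: algebraic_int.simps intro!: exI[of _ p])
  qed
  then have "algebraic_int (of_rat (ftrace x) :: complex)" unfolding es(1) by (intro algebraic_int_sum) auto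
  then have "(of_rat (ftrace x) :: complex) \<in> \<int>" using rational_algebraic_int_is_int[of "of_rat (ftrace x) :: complex"] by simp
  then obtain k where "(of_rat (ftrace x) :: complex) = of_rat (of_int k)" by (metis Ints_cases of_rat_of_int_eq)
  then have "ftrace x = of_int k" by (simp only: of_rat_eq_iff)
  then show ?thesis by simp
qed

lemma ftrace_sum_right: "y \<in> K \<Longrightarrow> ftrace (x * y) = (\<Sum>i<h. coord x i * ftrace (\<omega> i * y))" if x: "x \<in> K" for x y
proof -
  assume y: "y \<in> K"
  have "mulmat (x * y) j j = (\<Sum>i<h. coord x i * mulmat (\<omega> i * y) j j)" if "j < h" for j
  proof -
    have "mulmat (x * y) j j = coord (\<Sum>i<h. of_rat (coord x i) * (\<omega> i * y * \<omega> j)) j"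
      unfolding mulmat_def by (subst coord_eq[OF x, symmetric]) (simp add: sum_distrib_left sum_distrib_right mult_ac)
    also have "\<dots> = (\<Sum>i<h. coord (of_rat (coord x i) * (\<omega> i * y * \<omega> j)) j)"
      by (rule coord_sum) (use that KS Krat \<omega>K y in auto)
    also have "\<dots> = (\<Sum>i<h. coord x i * mulmat (\<omega> i * y) j j)"
      unfolding mulmat_def by (intro sum.cong refl coord_scale) (use that KS \<omega>K y in auto)
    finally show ?thesis .
  qed
  then have "ftrace (x * y) = (\<Sum>j<h. \<Sum>i<h. coord x i * mulmat (\<omega> i * y) j j)" by (simp add: ftrace_def)
  also have "\<dots> = (\<Sum>i<h. \<Sum>j<h. coord x i * mulmat (\<omega> i * y) j j)" by (rule sum.swap)
  finally show ?thesis by (simp add: ftrace_def sum_distrib_left)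
qed

section \<open>The trace form\<close>

definition gram :: "nat \<Rightarrow> nat \<Rightarrow> rat" where "gram i j = ftrace (\<omega> i * \<omega> j)"

text \<open>A nonzero y in the radical of the trace form is orthogonal to its inverse, so the trace
  of 1 would be 0; but that trace is h.\<close>

lemma gram_nonsingular: "fdet h gram \<noteq> 0"
proof
  assume "fdet h gram = 0"
  then obtain v where v: "\<exists>i<h. v i \<noteq> 0" "\<forall>i<h. (\<Sum>j<h. gram i j * v j) = 0" using fdet_zero_kernel by blast
  define y where "y = (\<Sum>j<h. of_rat (v j) * \<omega> j)"
  have yK: "y \<in> K" unfolding y_def by (intro Ksum KS Krat \<omega>K) auto
  have y0: "y \<noteq> 0" using v(1) \<omega>_indep[of v] unfolding y_def by blast
  have cdy: "coord y j = v j" if "j < h" for j by (rule coord_unique[OF y_def that])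
  have "ftrace (\<omega> i * y) = 0" if i: "i < h" for i
  proof -
    have "ftrace (y * \<omega> i) = (\<Sum>j<h. coord y j * ftrace (\<omega> j * \<omega> i))" using ftrace_sum_right[OF yK \<omega>K[OF i]] .
    also have "\<dots> = (\<Sum>j<h. gram i j * v j)" by (simp add: gram_def cdy mult.commute)
    finally show ?thesis using v(2) i by (simp add: mult.commute)
  qed
  then have "ftrace (inverse y * y) = 0" using ftrace_sum_right[OF number_field_inverse[OF K yK] yK] by simp
  then have "ftrace 1 = 0" using y0 by simp
  moreover have "mulmat 1 j j = 1" if "j < h" for j
  proof -
    have "coord (\<omega> j) j = (if j = j then 1 else 0)"
      using that by (intro coord_unique[of _ "\<lambda>i. if i = j then 1 else 0"]) (auto simp: if_distrib[of of_rat] if_distrib[of "\<lambda>u. u * _"] sum.delta cong: if_cong)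
    then show ?thesis by (simp add: mulmat_def)
  qed
  ultimately show False using h_pos by (simp add: ftrace_def)
qed

text \<open>Inverting the Gram matrix recovers coordinates as fixed rational combinations of traces,
  which converts information on conjugates into information on coordinates.\<close>

lemma coord_from_traces:
  assumes x: "x \<in> K" and i: "i < h"
  shows "coord x i = (\<Sum>j<h. fcof h gram i j / fdet h gram * ftrace (x * \<omega> j))"
proof -
  have "(\<Sum>j<h. fcof h gram i j * ftrace (x * \<omega> j)) = (\<Sum>j<h. fcof h gram i j * (\<Sum>k<h. coord x k * gram k j))"
    by (intro sum.cong refl) (use ftrace_sum_right[OF x] \<omega>K in \<open>auto simp: gram_def\<close>)
  also have "\<dots> = fdet h gram * coord x i" by (rule cramer_left[OF i])
  finally show ?thesis using gram_nonsingular by (simp add: sum_divide_distrib[symmetric] field_simps)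
qed

text \<open>The eigenvalue equation for \<sigma> y is read at the basis element whose image has the
  largest absolute value and divided by that value, as in Gershgorin's bound.\<close>

lemma embedding_bound:
  assumes \<sigma>: "field_embedding K \<sigma>" and y: "y \<in> K"
  shows "cmod (\<sigma> y) \<le> (\<Sum>i<h. \<Sum>k<h. \<bar>real_of_rat (mulmat y i k)\<bar>)"
proof -
  note F = field_embedding_facts[OF K \<sigma>]
  define m where "m = Max ((\<lambda>i. cmod (\<sigma> (\<omega> i))) ` {..<h})"
  have fin: "finite ((\<lambda>i. cmod (\<sigma> (\<omega> i))) ` {..<h})" "(\<lambda>i. cmod (\<sigma> (\<omega> i))) ` {..<h} \<noteq> {}" using h_pos by auto
  obtain i where i: "i < h" "m = cmod (\<sigma> (\<omega> i))" using Max_in[OF fin] unfolding m_def by auto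
  have le: "cmod (\<sigma> (\<omega> k)) \<le> m" if "k < h" for k unfolding m_def using that fin by (intro Max_ge) auto
  have sx: "\<sigma> x = (\<Sum>k<h. of_rat (coord x k) * \<sigma> (\<omega> k))" if "x \<in> K" for x
  proof -
    have "\<sigma> x = \<sigma> (\<Sum>k<h. of_rat (coord x k) * \<omega> k)" by (simp only: coord_eq[OF that])
    also have "\<dots> = (\<Sum>k<h. \<sigma> (of_rat (coord x k) * \<omega> k))"
      by (rule field_embedding_sum[OF K \<sigma>]) (use KS Krat \<omega>K in auto)
    also have "\<dots> = (\<Sum>k<h. of_rat (coord x k) * \<sigma> (\<omega> k))"
      by (rule sum.cong[OF refl]) (use F(4)[OF Krat \<omega>K] F(5) in simp)
    finally show ?thesis .
  qed
  \<comment> \<open>If \<sigma> vanished on the whole basis it would vanish at 1.\<close>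
  have m0: "m > 0"
  proof (rule ccontr)
    assume "\<not> m > 0"
    then have "\<sigma> (\<omega> k) = 0" if "k < h" for k using le[OF that] by (metis norm_le_zero_iff order_trans not_le)
    then have "\<sigma> 1 = 0" using sx[OF KS(2)] by simp
    then show False using F(2) by simp
  qed
  have "cmod (\<sigma> y) * m = cmod (\<sigma> (y * \<omega> i))" using F(4)[OF y \<omega>K[OF i(1)]] by (simp add: i norm_mult)
  also have "\<dots> = cmod (\<Sum>k<h. of_rat (mulmat y i k) * \<sigma> (\<omega> k))"
    using sx[OF KS(4)[OF y \<omega>K[OF i(1)]]] by (simp add: mulmat_def)
  also have "\<dots> \<le> (\<Sum>k<h. \<bar>real_of_rat (mulmat y i k)\<bar> * m)"
    by (intro order_trans[OF norm_sum] sum_mono) (auto simp: norm_mult cmod_of_rat intro!: mult_left_mono le)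
  finally have "cmod (\<sigma> y) \<le> (\<Sum>k<h. \<bar>real_of_rat (mulmat y i k)\<bar>)" using m0 by (simp add: sum_distrib_right[symmetric])
  also have "\<dots> \<le> (\<Sum>i<h. \<Sum>k<h. \<bar>real_of_rat (mulmat y i k)\<bar>)"
    by (rule member_le_sum[where f = "\<lambda>i. \<Sum>k<h. \<bar>real_of_rat (mulmat y i k)\<bar>"]) (use i in \<open>auto intro!: sum_nonneg\<close>)
  finally show ?thesis .
qed

text \<open>Bounds for the conjugates of x bound the traces of x \<omega> j, and these determine the
  coordinates. The condition on E-functions speaks of conjugates and the later estimates of
  \<open>nrm\<close>; this is the bridge.\<close>

lemma nrm_le_house:
  "\<exists>c\<ge>1. \<forall>x\<in>K. \<forall>X\<ge>0. (\<forall>\<sigma>. field_embedding K \<sigma> \<longrightarrow> cmod (\<sigma> x) \<le> X) \<longrightarrow> nrm x \<le> c * X"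
proof -
  define W where "W = (\<lambda>j. \<Sum>i<h. \<Sum>k<h. \<bar>real_of_rat (mulmat (\<omega> j) i k)\<bar>)"
  have W0: "W j \<ge> 0" for j unfolding W_def by (intro sum_nonneg) auto
  define c where "c = \<kappa> * (\<Sum>i<h. \<Sum>j<h. \<bar>real_of_rat (fcof h gram i j / fdet h gram)\<bar> * (real h * W j))"
  have main: "nrm x \<le> c * X" if x: "x \<in> K" and X: "X \<ge> 0" "\<And>\<sigma>. field_embedding K \<sigma> \<Longrightarrow> cmod (\<sigma> x) \<le> X" for x X
  proof -
    have t: "\<bar>real_of_rat (ftrace (x * \<omega> j))\<bar> \<le> real h * (X * W j)" if j: "j < h" for j
    proof (rule ftrace_bound)
      show "x * \<omega> j \<in> K" using KS x \<omega>K j by auto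
      fix \<sigma> assume s: "field_embedding K \<sigma>"
      show "cmod (\<sigma> (x * \<omega> j)) \<le> X * W j"
        using field_embedding_facts(4)[OF K s x \<omega>K[OF j]] X s embedding_bound[OF s \<omega>K[OF j]] W0[of j]
        unfolding W_def by (auto simp: norm_mult intro!: mult_mono)
    qed
    have "\<bar>real_of_rat (coord x i)\<bar> \<le> (\<Sum>j<h. \<bar>real_of_rat (fcof h gram i j / fdet h gram)\<bar> * (real h * (X * W j)))" if i: "i < h" for i
      unfolding coord_from_traces[OF x i] of_rat_sum of_rat_mult
      by (intro order_trans[OF sum_abs] sum_mono) (auto simp only: abs_mult lessThan_iff intro!: mult_left_mono t)
    then have "nrm x \<le> \<kappa> * (\<Sum>i<h. \<Sum>j<h. \<bar>real_of_rat (fcof h gram i j / fdet h gram)\<bar> * (real h * (X * W j)))"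
      unfolding nrm_def using \<kappa>_ge(1) by (intro mult_left_mono sum_mono) auto
    also have "\<dots> = c * X" by (simp add: c_def sum_distrib_left sum_distrib_right mult_ac)
    finally show ?thesis .
  qed
  have "nrm x \<le> max 1 c * X" if "x \<in> K" "X \<ge> 0" "\<forall>\<sigma>. field_embedding K \<sigma> \<longrightarrow> cmod (\<sigma> x) \<le> X" for x X
  proof -
    have "c * X \<le> max 1 c * X" using that(2) by (intro mult_right_mono) auto
    then show ?thesis using main[OF that(1,2)] that(3) by (meson order_trans)
  qed
  then show ?thesis by (intro exI[of _ "max 1 c"]) auto
qed

text \<open>A dual lattice argument: the traces of an algebraic integer x against integral multiples
  of the basis are integers, so its coordinates have a denominator that depends only on K and the
  basis. The multiplication matrices of the basis contribute a second fixed factor.\<close>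

lemma algebraic_int_denominator: "\<exists>D::nat. D > 0 \<and> (\<forall>x\<in>K. algebraic_int x \<longrightarrow> of_nat D * x \<in> R)"
proof -
  have "\<exists>d::nat. d > 0 \<and> algebraic_int (of_nat d * \<omega> j)" if "j < h" for j
    using denominator[OF \<omega>K[OF that]] R_algebraic_int by blast
  then obtain e :: "nat \<Rightarrow> nat" where e: "\<And>j. j < h \<Longrightarrow> e j > 0 \<and> algebraic_int (of_nat (e j) * \<omega> j)" by metis
  \<comment> \<open>\<open>d1\<close> clears the inverse Gram matrix together with the multipliers
    that make the basis integral; \<open>d2\<close>, obtained next, clears the multiplication
    matrices of the basis.\<close>
  obtain d1 :: nat where d1: "d1 > 0" "\<forall>q\<in>(\<lambda>(i,j). fcof h gram i j / fdet h gram / of_nat (e j)) ` ({..<h} \<times> {..<h}). of_nat d1 * q \<in> \<int>"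
    using common_denominator_rat[of "(\<lambda>(i,j). fcof h gram i j / fdet h gram / of_nat (e j)) ` ({..<h} \<times> {..<h})"] by auto
  obtain d2 :: nat where d2: "d2 > 0" "\<forall>q\<in>(\<lambda>(k,j,i). mulmat (\<omega> k) j i) ` ({..<h} \<times> {..<h} \<times> {..<h}). of_nat d2 * q \<in> \<int>"
    using common_denominator_rat[of "(\<lambda>(k,j,i). mulmat (\<omega> k) j i) ` ({..<h} \<times> {..<h} \<times> {..<h})"] by auto
  have "of_nat (d1 * d2) * x \<in> R" if x: "x \<in> K" "algebraic_int x" for x
  proof -
    have t: "of_nat (e j) * ftrace (x * \<omega> j) \<in> \<int>" if j: "j < h" for j
    proof -
      have xj: "x * (of_nat (e j) * \<omega> j) \<in> K"
        using KS x \<omega>K j is_subring_of_nat[OF number_field_subring[OF K]] by auto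
      have "ftrace (x * (of_nat (e j) * \<omega> j)) \<in> \<int>"
        using ftrace_integral[OF xj] algebraic_int_closure(2)[OF x(2)] e[OF j] by blast
      moreover have "mulmat (x * (of_nat (e j) * \<omega> j)) i i = of_nat (e j) * mulmat (x * \<omega> j) i i" if "i < h" for i
        using mulmat_scale[of "x * \<omega> j" i i "of_nat (e j)"] KS x \<omega>K j that by (simp add: mult_ac)
      ultimately show ?thesis by (simp add: ftrace_def sum_distrib_left)
    qed
    have c: "of_nat d1 * coord x i \<in> \<int>" if i: "i < h" for i
    proof -
      have "of_nat d1 * coord x i = (\<Sum>j<h. (of_nat d1 * (fcof h gram i j / fdet h gram / of_nat (e j))) * (of_nat (e j) * ftrace (x * \<omega> j)))"
        
        unfolding coord_from_traces[OF x(1) i] sum_distrib_left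
      proof (intro sum.cong refl)
        fix j assume "j \<in> {..<h}"
        then have "of_nat (e j) \<noteq> (0::rat)" using e[of j] by simp
        then show "of_nat d1 * (fcof h gram i j / fdet h gram * ftrace (x * \<omega> j)) =
            of_nat d1 * (fcof h gram i j / fdet h gram / of_nat (e j)) * (of_nat (e j) * ftrace (x * \<omega> j))"
          by simp
      qed
      also have "\<dots> \<in> \<int>"
      proof (rule Ints_sum)
        fix j assume "j \<in> {..<h}"
        then have j: "j < h" by simp
        have "of_nat d1 * (fcof h gram i j / fdet h gram / of_nat (e j)) \<in> \<int>" using d1(2) i j by force
        then show "(of_nat d1 * (fcof h gram i j / fdet h gram / of_nat (e j))) * (of_nat (e j) * ftrace (x * \<omega> j)) \<in> \<int>"
          using t[OF j] by (rule Ints_mult)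
      qed
      finally show ?thesis .
    qed
    have "mulmat (of_nat (d1 * d2) * x) j i \<in> \<int>" if ji: "j < h" "i < h" for j i
    proof -
      have "mulmat (of_nat (d1 * d2) * x) j i = of_nat (d1 * d2) * mulmat x j i"
        using mulmat_scale[OF x(1) ji, of "of_nat (d1 * d2)"] by (simp only: of_rat_of_nat_eq)
      also have "\<dots> = (\<Sum>k<h. (of_nat d1 * coord x k) * (of_nat d2 * mulmat (\<omega> k) j i))"
        unfolding mulmat_decomp[OF x(1) ji] by (simp add: sum_distrib_left mult_ac)
      also have "\<dots> \<in> \<int>"
      proof (rule Ints_sum)
        fix k assume "k \<in> {..<h}"
        then have "of_nat d2 * mulmat (\<omega> k) j i \<in> \<int>" using d2(2) ji by force
        then show "(of_nat d1 * coord x k) * (of_nat d2 * mulmat (\<omega> k) j i) \<in> \<int>" using c[of k] \<open>k \<in> {..<h}\<close> by (intro Ints_mult[of "of_nat d1 * coord x k"]) auto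
      qed
      finally show ?thesis .
    qed
    then show ?thesis using KS x(1) is_subring_of_nat[OF number_field_subring[OF K]] by (auto simp: R_def)
  qed
  then show ?thesis using d1(1) d2(1) by (intro exI[of _ "d1 * d2"]) auto
qed

end

section \<open>Siegel's lemma\<close>

text \<open>Pigeonhole on the box of vectors with entries from 0 to X: each form takes values
  between -m and m, and the numerical hypothesis says that there are fewer value vectors than points
  of the box.\<close>

lemma siegel_int:
  fixes A :: "'i \<Rightarrow> 'j \<Rightarrow> int" and a X :: nat
  assumes fin: "finite I" "finite J" and A: "\<And>i j. i \<in> I \<Longrightarrow> j \<in> J \<Longrightarrow> \<bar>A i j\<bar> \<le> int a"
    and le: "(2 * card J * a * X + 1) ^ card I < (X + 1) ^ card J"
  shows "\<exists>x. (\<exists>j\<in>J. x j \<noteq> 0) \<and> (\<forall>j\<in>J. \<bar>x j\<bar> \<le> int X) \<and> (\<forall>i\<in>I. (\<Sum>j\<in>J. A i j * x j) = 0)"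
proof -
  define D where "D = J \<rightarrow>\<^sub>E {0..int X}"
  define m where "m = int (card J * a * X)"
  define f where "f = (\<lambda>x. \<lambda>i\<in>I. \<Sum>j\<in>J. A i j * x j)"
  have "f ` D \<subseteq> I \<rightarrow>\<^sub>E {-m..m}"
  proof
    fix y assume "y \<in> f ` D"
    then obtain x where x: "x \<in> D" "y = f x" by blast
    have "\<bar>\<Sum>j\<in>J. A i j * x j\<bar> \<le> m" if i: "i \<in> I" for i
    proof -
      have "\<bar>\<Sum>j\<in>J. A i j * x j\<bar> \<le> (\<Sum>j\<in>J. int a * int X)"
        using A[OF i] x(1) by (intro order_trans[OF sum_abs] sum_mono) (auto simp: abs_mult D_def PiE_iff intro!: mult_mono)
      then show ?thesis by (simp add: m_def mult_ac)
    qed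
    then show "y \<in> I \<rightarrow>\<^sub>E {-m..m}" by (auto simp: x(2) f_def abs_le_iff minus_le_iff)
  qed
  then have "card (f ` D) \<le> card (I \<rightarrow>\<^sub>E {-m..m})" by (intro card_mono finite_PiE fin) auto
  also have "\<dots> = (2 * card J * a * X + 1) ^ card I"
  proof -
    have "card {-m..m} = nat (2 * m + 1)" by simp
    also have "2 * m + 1 = int (2 * card J * a * X + 1)" by (simp add: m_def)
    finally have "card {-m..m} = 2 * card J * a * X + 1" by (simp only: nat_int)
    then show ?thesis by (simp add: card_funcsetE[OF fin(1)])
  qed
  also have "\<dots> < card D" 
  proof -
    have "card {0..int X} = X + 1" by (simp add: nat_add_distrib)
    then show ?thesis using le by (simp add: D_def card_funcsetE[OF fin(2)])
  qed
  finally have "\<not> inj_on f D" by (rule pigeonhole)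
  then obtain x y where xy: "x \<in> D" "y \<in> D" "f x = f y" "x \<noteq> y" by (auto simp: inj_on_def)
  have "\<exists>j\<in>J. x j \<noteq> y j" using xy(1,2,4) unfolding D_def by (metis PiE_ext)
  moreover have "\<bar>x j - y j\<bar> \<le> int X" if "j \<in> J" for j
  proof -
    have "x j \<in> {0..int X}" "y j \<in> {0..int X}" using xy(1,2) that by (auto simp: D_def PiE_iff)
    then show ?thesis by (auto simp: abs_le_iff)
  qed
  moreover have "(\<Sum>j\<in>J. A i j * (x j - y j)) = 0" if "i \<in> I" for i
    using fun_cong[OF xy(3), of i] that by (simp add: f_def right_diff_distrib sum_subtractf)
  ultimately show ?thesis by (intro exI[of _ "\<lambda>j. x j - y j"]) auto
qed

context number_field_basis begin

lemma nrm_zero: "nrm 0 = 0"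
  using nrm_scale[OF KS(1), of 0] by simp

lemma nrm_sum: "(\<And>i. i \<in> I \<Longrightarrow> f i \<in> K) \<Longrightarrow> nrm (sum f I) \<le> (\<Sum>i\<in>I. nrm (f i))"
proof (induction I rule: infinite_finite_induct)
  case (insert i I)
  then have "nrm (f i + sum f I) \<le> nrm (f i) + nrm (sum f I)" by (intro nrm_add Ksum) auto
  then show ?case using insert by fastforce
qed (auto simp: nrm_zero)

text \<open>Along the basis each equation over R splits into h integer equations and each unknown
  into h integer unknowns. The number q bounds the ratio of equations to surplus unknowns, which is
  the exponent in Siegel's lemma; \<open>c\<close> depends only on K and its basis.\<close>

lemma siegel:
  "\<exists>c\<ge>1. \<forall>L U q A a. 1 \<le> a \<longrightarrow> 1 \<le> q \<longrightarrow> L < U \<longrightarrow> L \<le> q * (U - L) \<longrightarrow>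
    (\<forall>l<L. \<forall>u<U. A l u \<in> R \<and> nrm (A l u) \<le> a) \<longrightarrow>
    (\<exists>x. (\<forall>u<U. x u \<in> R) \<and> (\<exists>u<U. x u \<noteq> 0) \<and> (\<forall>u<U. nrm (x u) \<le> c * (c * real U * a) ^ q) \<and>
      (\<forall>l<L. (\<Sum>u<U. A l u * x u) = 0))"
proof -
  define W where "W = (\<Sum>j<h. nrm (\<omega> j))"
  have W0: "W \<ge> 0" unfolding W_def by (intro sum_nonneg nrm_nonneg)
  obtain e :: "nat \<Rightarrow> nat" where e: "\<And>i. i < h \<Longrightarrow> e i > 0 \<and> of_nat (e i) * \<omega> i \<in> R"
    using denominator[OF \<omega>K] by metis
  \<comment> \<open>Unknowns will be sought as integer combinations of the numbers d0 \<omega> i,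
    which lie in R.\<close>
  define d0 where "d0 = (\<Prod>i<h. e i)"
  have d0: "d0 > 0" unfolding d0_def using e by (intro prod_pos) auto
  note RS = is_subringD[OF R_subring]
  have RK: "x \<in> K" if "x \<in> R" for x using that by (simp add: R_def)
  have d0R: "of_nat d0 * \<omega> i \<in> R" if i: "i < h" for i
  proof -
    have "d0 = (\<Prod>j\<in>{..<h} - {i}. e j) * e i" unfolding d0_def using i by (subst prod.remove[of _ i]) auto
    then have "of_nat d0 * \<omega> i = of_nat (\<Prod>j\<in>{..<h} - {i}. e j) * (of_nat (e i) * \<omega> i)" by (simp add: mult_ac)
    then show ?thesis using RS(4)[OF is_subring_of_nat[OF R_subring]] e[OF i] by metis
  qed
  define c where "c = Max {1, real d0 * W, 2 * real h * (W + 1) + 2}"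
  have c: "c \<ge> 1" "c \<ge> real d0 * W" "c \<ge> 2 * real h * (W + 1) + 2" unfolding c_def by auto
  have "\<exists>x. (\<forall>u<U. x u \<in> R) \<and> (\<exists>u<U. x u \<noteq> 0) \<and> (\<forall>u<U. nrm (x u) \<le> c * (c * real U * a) ^ q) \<and>
      (\<forall>l<L. (\<Sum>u<U. A l u * x u) = 0)"
    if a: "1 \<le> a" and q: "1 \<le> q" and LU: "L < U" "L \<le> q * (U - L)" and A: "\<forall>l<L. \<forall>u<U. A l u \<in> R \<and> nrm (A l u) \<le> a"
    for L U q :: nat and A :: "nat \<Rightarrow> nat \<Rightarrow> complex" and a :: real
  proof -
    define a' where "a' = nat \<lceil>a * W\<rceil>"
    have a'1: "a * W \<le> real a'" and a'2: "real a' \<le> a * W + 1"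
      using a W0 unfolding a'_def by (simp_all add: of_nat_nat real_nat_ceiling_ge)
    have "\<exists>k. mulmat (A l u) i j = of_int k" if "l < L" "u < U" "i < h" "j < h" for l u i j
    proof -
      have "mulmat (A l u) i j \<in> \<int>" using A that by (auto simp: R_def)
      then show ?thesis by (metis Ints_cases)
    qed
    then obtain m where m: "\<And>l u i j. l < L \<Longrightarrow> u < U \<Longrightarrow> i < h \<Longrightarrow> j < h \<Longrightarrow> mulmat (A l u) i j = of_int (m l u i j)"
      by metis
    let ?B = "\<lambda>(l,k) (u,i). m l u i k"
    let ?I = "{..<L} \<times> {..<h}" and ?J = "{..<U} \<times> {..<h}"
    \<comment> \<open>With X + 1 = b^q the box has b^(q U h) points, and the number of value vectors
      is at most ((b - 1) b^q)^(L h). The surplus b^(q (U - L) h) exceeds (b - 1)^(L h) by the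
      hypothesis on q.\<close>
    define b where "b = 2 * (U * h) * a' + 2"
    define X where "X = b ^ q - 1"
    have X1: "X + 1 = b ^ q" by (simp add: X_def b_def)
    have B: "\<bar>?B i j\<bar> \<le> int a'" if ij: "i \<in> ?I" "j \<in> ?J" for i j
    proof -
      obtain l k u i' where e: "i = (l,k)" "j = (u,i')" "l < L" "k < h" "u < U" "i' < h" using ij by auto
      have "\<bar>real_of_rat (mulmat (A l u) i' k)\<bar> \<le> nrm (A l u) * W"
        unfolding W_def using A e RK by (intro mulmat_le_nrm) auto
      also have "\<dots> \<le> a * W" using A e W0 by (intro mult_right_mono) auto
      finally have "\<bar>real_of_int (m l u i' k)\<bar> \<le> real a'" using a'1 m[of l u i' k] e by simp
      then show ?thesis unfolding e prod.case by linarith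
    qed
    have "(2 * card ?J * a' * X + 1) ^ card ?I < (X + 1) ^ card ?J"
    proof -
      have "2 * card ?J * a' * X + 1 \<le> (b - 1) * (X + 1)" by (simp add: b_def algebra_simps)
      then have "(2 * card ?J * a' * X + 1) ^ card ?I \<le> ((b - 1) * b ^ q) ^ (L * h)"
        unfolding X1 by (simp add: power_mono)
      also have "\<dots> = (b - 1) ^ (L * h) * b ^ (q * (L * h))"
        by (simp add: power_mult_distrib power_mult)
      also have "\<dots> < b ^ (q * (U - L) * h) * b ^ (q * (L * h))"
      proof -
        have "(b - 1) ^ (L * h) < b ^ (q * (U - L) * h)"
        proof (cases "L = 0")
          case True
          have "q * (U - L) * h \<ge> 1" using q LU h_pos by simp
          then have "1 < b ^ (q * (U - L) * h)" by (intro one_less_power) (auto simp: b_def)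
          then show ?thesis using True by simp
        next
          case False
          have "(b - 1) ^ (L * h) < b ^ (L * h)" using False h_pos by (intro power_strict_mono) (auto simp: b_def)
          also have "\<dots> \<le> b ^ (q * (U - L) * h)" using LU(2) by (intro power_increasing mult_right_mono) (auto simp: b_def)
          finally show ?thesis .
        qed
        then show ?thesis by (simp add: b_def)
      qed
      also have "\<dots> = (X + 1) ^ card ?J"
      proof -
        obtain k where k: "U = L + k" using LU(1) less_imp_add_positive by blast
        have "q * (U - L) * h + q * (L * h) = q * (U * h)" by (simp add: k algebra_simps)
        then show ?thesis unfolding X1 by (simp flip: power_add power_mult)
      qed
      finally show ?thesis .
    qed
    from siegel_int[of ?I ?J ?B a' X, OF _ _ B this]
    obtain z where z: "\<exists>j\<in>?J. z j \<noteq> 0" "\<forall>j\<in>?J. \<bar>z j\<bar> \<le> int X" "\<forall>i\<in>?I. (\<Sum>j\<in>?J. ?B i j * z j) = 0" by auto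
    define x where "x = (\<lambda>u. \<Sum>i<h. of_int (z (u,i)) * (of_nat d0 * \<omega> i))"
    have xR: "x u \<in> R" for u
      unfolding x_def by (intro is_subring_sum[OF R_subring] RS(4) is_subring_of_int[OF R_subring] d0R) auto
    have x0: "\<exists>u<U. x u \<noteq> 0"
    proof -
      obtain u i where ui: "u < U" "i < h" "z (u,i) \<noteq> 0" using z(1) by auto
      have "x u \<noteq> 0"
      proof
        assume "x u = 0"
        then have "(\<Sum>i<h. of_rat (of_int (z (u,i)) * of_nat d0) * \<omega> i) = 0" by (simp add: x_def of_rat_mult mult_ac)
        from \<omega>_indep[OF this ui(2)] show False using ui d0 by simp
      qed
      then show ?thesis using ui by blast
    qed
    have bb: "real b \<le> c * real U * a"
    proof -
      have "real b = 2 * (real U * real h) * real a' + 2" by (simp add: b_def)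
      also have "\<dots> \<le> 2 * (real U * real h) * (a * W + a) + 2 * (real U * a)"
        using a'2 a LU mult_mono[of 1 "real U" 1 a] by (intro add_mono mult_left_mono) auto
      also have "\<dots> = (2 * real h * (W + 1) + 2) * (real U * a)" by (simp add: algebra_simps)
      also have "\<dots> \<le> c * (real U * a)" using c a by (intro mult_right_mono) auto
      finally show ?thesis by (simp add: mult_ac)
    qed
    have xn: "nrm (x u) \<le> c * (c * real U * a) ^ q" if u: "u < U" for u
    proof -
      have "nrm (x u) \<le> (\<Sum>i<h. nrm (of_int (z (u,i)) * (of_nat d0 * \<omega> i)))"
        unfolding x_def by (intro nrm_sum) (use d0R RK KS is_subring_of_int[OF number_field_subring[OF K]] in auto)
      also have "\<dots> = (\<Sum>i<h. \<bar>of_int (z (u,i))\<bar> * (of_nat d0 * nrm (\<omega> i)))"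
      proof (rule sum.cong[OF refl])
        fix i assume "i \<in> {..<h}"
        then have i: "\<omega> i \<in> K" using \<omega>K by auto
        have "of_int (z (u,i)) * (of_nat d0 * \<omega> i) = of_rat (of_int (z (u,i)) * of_nat d0) * \<omega> i" by (simp add: of_rat_mult)
        then show "nrm (of_int (z (u,i)) * (of_nat d0 * \<omega> i)) = \<bar>of_int (z (u,i))\<bar> * (of_nat d0 * nrm (\<omega> i))"
          using nrm_scale[OF i, of "of_int (z (u,i)) * of_nat d0"] by (simp add: of_rat_mult abs_mult mult_ac)
      qed
      also have "\<dots> \<le> (\<Sum>i<h. real X * (of_nat d0 * nrm (\<omega> i)))"
      proof (intro sum_mono mult_right_mono)
        fix i assume "i \<in> {..<h}"
        then have "\<bar>z (u,i)\<bar> \<le> int X" using z(2) u by auto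
        then show "\<bar>of_int (z (u,i))\<bar> \<le> real X" by linarith
      qed (auto intro: mult_nonneg_nonneg nrm_nonneg)
      also have "\<dots> = real X * (real d0 * W)" by (simp add: W_def sum_distrib_left)
      also have "\<dots> \<le> real b ^ q * c"
      proof (intro mult_mono c)
        have "X \<le> b ^ q" by (simp add: X_def)
        then show "real X \<le> real b ^ q" by (metis of_nat_le_iff of_nat_power)
      qed (use W0 in auto)
      also have "\<dots> \<le> (c * real U * a) ^ q * c" using bb c by (intro mult_right_mono power_mono) auto
      finally show ?thesis by (simp add: mult_ac)
    qed
    have "(\<Sum>u<U. A l u * x u) = 0" if l: "l < L" for l
    proof -
      have "(\<Sum>u<U. A l u * x u) = (\<Sum>u<U. \<Sum>i<h. of_nat d0 * of_int (z (u,i)) * (A l u * \<omega> i))"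
        by (simp add: x_def sum_distrib_left mult_ac)
      also have "\<dots> = (\<Sum>u<U. \<Sum>i<h. \<Sum>k<h. of_nat d0 * of_int (z (u,i)) * (of_int (m l u i k) * \<omega> k))"
      proof (intro sum.cong refl)
        fix u i assume "u \<in> {..<U}" "i \<in> {..<h}"
        then have ui: "u < U" "i < h" by auto
        have "A l u * \<omega> i = (\<Sum>k<h. of_rat (mulmat (A l u) i k) * \<omega> k)" using mulmat_eq[of "A l u" i] A ui l RK by auto
        also have "\<dots> = (\<Sum>k<h. of_int (m l u i k) * \<omega> k)" by (intro sum.cong refl) (use m l ui in auto)
        finally show "of_nat d0 * of_int (z (u,i)) * (A l u * \<omega> i) = (\<Sum>k<h. of_nat d0 * of_int (z (u,i)) * (of_int (m l u i k) * \<omega> k))"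
          by (simp add: sum_distrib_left)
      qed
      also have "\<dots> = (\<Sum>j\<in>?J. \<Sum>k<h. of_nat d0 * of_int (z j) * (of_int (?B (l,k) j) * \<omega> k))"
        by (subst sum.cartesian_product) (simp add: case_prod_unfold)
      also have "\<dots> = (\<Sum>k<h. \<Sum>j\<in>?J. of_nat d0 * of_int (z j) * (of_int (?B (l,k) j) * \<omega> k))" by (rule sum.swap)
      also have "\<dots> = (\<Sum>k<h. of_nat d0 * of_int (\<Sum>j\<in>?J. ?B (l,k) j * z j) * \<omega> k)"
        by (rule sum.cong[OF refl]) (simp add: sum_distrib_left sum_distrib_right mult_ac)
      also have "\<dots> = 0"
      proof (rule sum.neutral, intro ballI)
        fix k assume "k \<in> {..<h}"
        then have "(\<Sum>j\<in>?J. ?B (l,k) j * z j) = 0" using z(3)[rule_format, of "(l,k)"] l by auto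
        then show "of_nat d0 * of_int (\<Sum>j\<in>?J. ?B (l,k) j * z j) * \<omega> k = 0" by simp
      qed
      finally show ?thesis .
    qed
    then show ?thesis using xR x0 xn by (intro exI[of _ x]) auto
  qed
  then show ?thesis using c(1) by (intro exI[of _ c]) auto
qed

end

text \<open>$R$ is an order of $K$ and nrm is comparable to the house, the largest absolute value of a conjugate;
  $h$ is the degree of $K$.\<close>
locale sized_field =
  fixes K R :: "complex set" and nrm :: "complex \<Rightarrow> real" and h :: nat
  assumes K: "number_field K"
    and R_subring: "is_subring R" and R_sub: "R \<subseteq> K"
    and nrm_nonneg: "0 \<le> nrm x"
    and nrm_add: "x \<in> K \<Longrightarrow> y \<in> K \<Longrightarrow> nrm (x + y) \<le> nrm x + nrm y"
    and nrm_mult: "x \<in> K \<Longrightarrow> y \<in> K \<Longrightarrow> nrm (x * y) \<le> nrm x * nrm y"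
    and nrm_scale: "x \<in> K \<Longrightarrow> nrm (of_rat q * x) = \<bar>real_of_rat q\<bar> * nrm x"
    and cmod_le_nrm: "x \<in> K \<Longrightarrow> cmod x \<le> nrm x"
    and h_pos: "h > 0"
    and liouville: "\<exists>c\<ge>1. \<forall>x\<in>R. x \<noteq> 0 \<longrightarrow> 1 \<le> c * cmod x * nrm x ^ (h - 1)"
    and denominator: "x \<in> K \<Longrightarrow> \<exists>d::nat. d > 0 \<and> of_nat d * x \<in> R"
    and algebraic_int_denominator: "\<exists>D::nat. D > 0 \<and> (\<forall>x\<in>K. algebraic_int x \<longrightarrow> of_nat D * x \<in> R)"
    and nrm_le_house: "\<exists>c\<ge>1. \<forall>x\<in>K. \<forall>X\<ge>0. (\<forall>\<sigma>. field_embedding K \<sigma> \<longrightarrow> cmod (\<sigma> x) \<le> X) \<longrightarrow> nrm x \<le> c * X"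
    and K_algebraic: "x \<in> K \<Longrightarrow> algebraic x"
    and siegel: "\<exists>c\<ge>1. \<forall>L U q A a. 1 \<le> a \<longrightarrow> 1 \<le> q \<longrightarrow> L < U \<longrightarrow> L \<le> q * (U - L) \<longrightarrow>
    (\<forall>l<L. \<forall>u<U. A l u \<in> R \<and> nrm (A l u) \<le> a) \<longrightarrow>
    (\<exists>x. (\<forall>u<U. x u \<in> R) \<and> (\<exists>u<U. x u \<noteq> 0) \<and> (\<forall>u<U. nrm (x u) \<le> c * (c * real U * a) ^ q) \<and>
      (\<forall>l<L. (\<Sum>u<U. A l u * x u) = 0))"

text \<open>A Q-basis is extracted from a finite spanning set, and its length is the degree h. From
  here on K is accessed through \<open>sized_field\<close> and the elementary closure properties of
  number fields.\<close>

theorem number_field_sized: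
  assumes K: "number_field K"
  shows "\<exists>R nrm h. sized_field K R nrm h"
proof -
  obtain B where B: "finite B" "QC.span B = K" by (rule number_field_spanE[OF K])
  obtain C where C: "C \<subseteq> B" "QC.independent C" "B \<subseteq> QC.span C"
    using QC.maximal_independent_subset[of B] by blast
  have spC: "QC.span C = K" using C B by (metis QC.span_mono QC.span_span subset_antisym)
  have finC: "finite C" using C(1) B(1) finite_subset by blast
  obtain \<omega> where \<omega>: "bij_betw \<omega> {..<card C} C" using ex_bij_betw_nat_finite[OF finC] by (metis lessThan_atLeast0)
  have \<omega>C: "\<omega> i \<in> C" if "i < card C" for i using \<omega> that by (auto simp: bij_betw_def)
  interpret number_field_basis K "card C" \<omega>
  proof
    show "number_field K" by (rule K)
    show "\<omega> i \<in> K" if "i < card C" for i using \<omega>C[OF that] spC QC.span_base by blast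
    show "q i = 0" if q: "(\<Sum>i<card C. of_rat (q i) * \<omega> i) = 0" and i: "i < card C" for q i
    proof -
      let ?u = "\<lambda>v. q (inv_into {..<card C} \<omega> v)"
      have inv: "inv_into {..<card C} \<omega> (\<omega> k) = k" if "k < card C" for k
        using \<omega> that by (simp add: bij_betw_def inv_into_f_f)
      have "(\<Sum>v\<in>C. of_rat (?u v) * v) = (\<Sum>k<card C. of_rat (?u (\<omega> k)) * \<omega> k)"
        by (rule sum.reindex_bij_betw[OF \<omega>, symmetric])
      also have "\<dots> = 0" using q inv by simp
      finally have "?u (\<omega> i) = 0"
        using C(2)[unfolded QC.independent_explicit_module, THEN spec, of C, THEN spec, of ?u, THEN spec, of "\<omega> i"] finC \<omega>C[OF i] by simp
      then show ?thesis using inv[OF i] by simp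
    qed
    show "\<exists>q. x = (\<Sum>i<card C. of_rat (q i) * \<omega> i)" if xK: "x \<in> K" for x
    proof -
      obtain u where "x = (\<Sum>v\<in>C. of_rat (u v) * v)" using xK spC QC.span_finite[OF finC] by auto
      also have "\<dots> = (\<Sum>k<card C. of_rat (u (\<omega> k)) * \<omega> k)"
        by (rule sum.reindex_bij_betw[OF \<omega>, symmetric])
      finally show ?thesis by (intro exI[of _ "\<lambda>k. u (\<omega> k)"])
    qed
  qed
  have "sized_field K R nrm (card C)"
    by (rule sized_field.intro)
       (rule K R_subring nrm_nonneg nrm_add nrm_mult nrm_scale cmod_le_nrm h_pos liouville denominator
         algebraic_int_denominator nrm_le_house K_algebraic siegel | simp add: R_def)+
  then show ?thesis by blast
qed

section \<open>Formal solutions of linear differential systems\<close>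

text \<open>The expansion of a polynomial in powers of z - a. It is an injective ring homomorphism
  that commutes with derivation, so one polynomial system acts on formal solutions at every point;
  at a = 0 it is the usual embedding.\<close>

definition taylor :: "complex \<Rightarrow> complex poly \<Rightarrow> complex fps" where
  "taylor a p = fps_of_poly (pcompose p [:a, 1:])"

lemma taylor_add: "taylor a (p + q) = taylor a p + taylor a q"
  by (simp add: taylor_def pcompose_add fps_of_poly_add)
lemma taylor_mult: "taylor a (p * q) = taylor a p * taylor a q"
  by (simp add: taylor_def pcompose_mult fps_of_poly_mult)
lemma taylor_0 [simp]: "taylor a 0 = 0" by (simp add: taylor_def)
lemma taylor_1 [simp]: "taylor a 1 = 1" by (simp add: taylor_def pcompose_1)
lemma taylor_uminus: "taylor a (- p) = - taylor a p" by (simp add: taylor_def pcompose_uminus fps_of_poly_uminus)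
lemma taylor_diff: "taylor a (p - q) = taylor a p - taylor a q" by (simp add: taylor_def pcompose_diff fps_of_poly_diff)
lemma taylor_sum: "taylor a (sum f I) = (\<Sum>i\<in>I. taylor a (f i))"
  by (induction I rule: infinite_finite_induct) (auto simp: taylor_add)
lemma taylor_smult: "taylor a (Polynomial.smult c p) = fps_const c * taylor a p"
  by (simp add: taylor_def pcompose_smult fps_of_poly_smult)
lemma taylor_deriv: "fps_deriv (taylor a p) = taylor a (pderiv p)"
  by (simp add: taylor_def pderiv_pcompose pderiv_pCons flip: fps_of_poly_pderiv)
lemma taylor_nth_0: "fps_nth (taylor a p) 0 = poly p a"
  by (simp add: taylor_def flip: poly_0_coeff_0) (simp add: poly_pcompose)
lemma taylor_eq_0_iff [simp]: "taylor a p = 0 \<longleftrightarrow> p = 0"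
  by (simp add: taylor_def pcompose_eq_0_iff)
lemma taylor_zero_point: "taylor 0 p = fps_of_poly p"
  by (simp add: taylor_def pcompose_idR)
lemma fdet_taylor: "fdet n (\<lambda>i j. taylor a (M i j)) = taylor a (fdet n M)"
  by (rule fdet_hom) (auto simp: taylor_add taylor_mult)

lemma taylor_order_dvd:
  assumes "\<And>k. k < m \<Longrightarrow> fps_nth (taylor a p) k = 0"
  shows "[:-a, 1:] ^ m dvd p"
proof -
  let ?r = "pcompose p [:a, 1:]"
  have "monom 1 m dvd ?r"
    unfolding monom_1_dvd_iff' using assms by (simp add: taylor_def)
  then obtain q where q: "?r = monom 1 m * q" by (elim dvdE)
  have "p = pcompose ?r [:-a, 1:]"
    by (simp add: pcompose_assoc[symmetric] pcompose_pCons pcompose_idR)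
  also have "\<dots> = pcompose (monom 1 m) [:-a, 1:] * pcompose q [:-a, 1:]" by (simp add: q pcompose_mult)
  also have "pcompose (monom 1 m) [:-a, 1:] = [:-a, 1:] ^ m"
    by (simp add: monom_altdef pcompose_hom.hom_power pcompose_pCons)
  finally show ?thesis by (metis dvd_triv_left)
qed

text \<open>Powers of two different linear factors are coprime. This will be confronted with a
  determinant that would vanish too much at 0 and at \<xi> together.\<close>

lemma order_two_points:
  fixes p :: "complex poly"
  assumes "p \<noteq> 0" "[:-a, 1:] ^ k dvd p" "[:-b, 1:] ^ l dvd p" "a \<noteq> b"
  shows "k + l \<le> degree p"
proof -
  obtain q where q: "p = [:-a, 1:] ^ k * q" using assms(2) by (elim dvdE)
  have qz: "q \<noteq> 0" using q assms(1) by auto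
  have "Polynomial.order b ([:-a, 1:] ^ k) = 0" using assms(4) by (intro order_0I) (simp add: poly_power)
  then have "Polynomial.order b p = Polynomial.order b q" using assms(1) unfolding q by (subst order_mult) auto
  then have "l \<le> degree q" using assms(1,3) order_divides[of b l p] order_degree[OF qz, of b] by auto
  moreover have "degree p = k + degree q" using qz by (simp add: q degree_mult_eq degree_power_eq)
  ultimately show ?thesis by simp
qed

section \<open>Orders of vanishing in finite-dimensional spaces of power series\<close>

lemma fps_low_mult:
  fixes f g :: "'a::comm_ring_1 fps"
  assumes "\<And>k. k < m \<Longrightarrow> fps_nth g k = 0" "k < m"
  shows "fps_nth (f * g) k = 0"
  unfolding fps_mult_nth by (intro sum.neutral) (use assms in auto)

lemma fps_low_sum:
  assumes "\<And>i. i \<in> I \<Longrightarrow> fps_nth (f i) k = 0"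
  shows "fps_nth (sum f I) k = 0"
  unfolding fps_sum_nth using assms by (intro sum.neutral) auto

lemma vs_FC: "vector_space (\<lambda>(c::complex) (f::complex fps). fps_const c * f)"
  by standard (auto simp: algebra_simps fps_const_add[symmetric] fps_const_mult[symmetric] simp del: fps_const_add fps_const_mult)

interpretation FC: vector_space "\<lambda>(c::complex) (f::complex fps). fps_const c * f"
  by (rule vs_FC)

lemma FC_span_mult:
  assumes g: "\<And>b c. b \<in> B \<Longrightarrow> c \<in> C \<Longrightarrow> b * c \<in> FC.span G" and x: "x \<in> FC.span B" and y: "y \<in> FC.span C"
  shows "x * y \<in> FC.span G"
proof -
  have 1: "b * y \<in> FC.span G" if "b \<in> B" for b
    using y
  proof (induction rule: FC.span_induct_alt)
    case base then show ?case by (simp add: FC.span_zero)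
  next
    case (step q z v)
    have "fps_const q * (b * z) + b * v \<in> FC.span G"
      using step g[OF that step.hyps(1)] by (intro FC.span_add FC.span_scale) auto
    then show ?case by (simp add: algebra_simps)
  qed
  show ?thesis using x
  proof (induction rule: FC.span_induct_alt)
    case base then show ?case by (simp add: FC.span_zero)
  next
    case (step q z v)
    have "fps_const q * (z * y) + v * y \<in> FC.span G"
      using step 1[OF step.hyps(1)] by (intro FC.span_add FC.span_scale) auto
    then show ?case by (simp add: algebra_simps)
  qed
qed

text \<open>When \<phi> is adjoined, an element outside the old span can be scaled to have
  coefficient 1 at \<phi>. Two such elements of order above the old bound c differ by an element of
  the old span of order above c, so they coincide: at most one order above c is added.\<close>

lemma subdegree_bound_span:
  assumes "finite (\<Phi> :: complex fps set)"
  shows "\<exists>c. \<forall>g\<in>FC.span \<Phi>. g \<noteq> 0 \<longrightarrow> subdegree g \<le> c"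
  using assms
proof (induction \<Phi> rule: finite_induct)
  case empty then show ?case by simp
next
  case (insert \<phi> \<Phi>)
  then obtain c where c: "\<And>g. g \<in> FC.span \<Phi> \<Longrightarrow> g \<noteq> 0 \<Longrightarrow> subdegree g \<le> c" by blast
  define good where "good = (\<lambda>u. u - \<phi> \<in> FC.span \<Phi> \<and> u \<noteq> 0 \<and> subdegree u > c)"
  have uniq: "u = u'" if "good u" "good u'" for u u'
  proof (rule ccontr)
    assume ne: "u \<noteq> u'"
    have "(u - \<phi>) - (u' - \<phi>) \<in> FC.span \<Phi>" by (rule FC.span_diff) (use that in \<open>auto simp: good_def\<close>)
    then have le: "subdegree (u - u') \<le> c" using c[of "u - u'"] ne by simp
    have "fps_nth (u - u') k = 0" if "k \<le> c" for k
    proof -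
      have ku: "k < subdegree u" and ku': "k < subdegree u'" using that \<open>good u\<close> \<open>good u'\<close> by (auto simp: good_def)
      show ?thesis using nth_less_subdegree_zero[OF ku] nth_less_subdegree_zero[OF ku'] by simp
    qed
    then show False using le ne by (metis nth_subdegree_nonzero right_minus_eq)
  qed
  obtain u0 where u0: "\<And>u. good u \<Longrightarrow> u = u0" using uniq by blast
  have "subdegree g \<le> max c (subdegree u0)" if g: "g \<in> FC.span (insert \<phi> \<Phi>)" "g \<noteq> 0" for g
  proof (rule ccontr)
    assume big: "\<not> subdegree g \<le> max c (subdegree u0)"
    obtain k where k: "g - fps_const k * \<phi> \<in> FC.span \<Phi>" using g(1) unfolding FC.span_insert by blast
    have k0: "k \<noteq> 0"
    proof
      assume "k = 0"
      then have "g \<in> FC.span \<Phi>" using k by simp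
      then show False using c[of g] g(2) big by simp
    qed
    define u where "u = fps_const (inverse k) * g"
    have "fps_const (inverse k) * (g - fps_const k * \<phi>) \<in> FC.span \<Phi>" using k by (rule FC.span_scale)
    moreover have "fps_const (inverse k) * (g - fps_const k * \<phi>) = u - \<phi>"
    proof -
      have "fps_const (inverse k) * (fps_const k * \<phi>) = \<phi>"
        using k0 by (simp flip: mult.assoc)
      then show ?thesis by (simp add: u_def right_diff_distrib)
    qed
    moreover have "subdegree u = subdegree g" "u \<noteq> 0" using k0 g(2) by (auto simp: u_def)
    ultimately have "good u" using big by (auto simp: good_def)
    then have "u = u0" by (rule u0)
    then show False using \<open>subdegree u = subdegree g\<close> big by simp
  qed
  then show ?case by blast
qed

text \<open>Over the polynomials \<Phi> has a maximal independent subset, in terms of which a fixed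
  multiple D of each element of \<Phi> has polynomial coordinates. If a tuple b of polynomials is
  proportional to a tuple w from the constant span of \<Phi>, then b is proportional to the tuple of
  coordinates of D w at one member of that subset, and these have degree bounded in terms of \<Phi>
  and \<xi>.\<close>

lemma bounded_degree_ratio:
  assumes fin: "finite (\<Phi> :: complex fps set)"
  shows "\<exists>c. \<forall>n w b. (\<forall>l<n. w l \<in> FC.span \<Phi>) \<longrightarrow> (\<exists>l<n. w l \<noteq> 0) \<longrightarrow>
      (\<forall>l<n. \<forall>l'<n. taylor \<xi> (b l) * w l' = taylor \<xi> (b l') * w l) \<longrightarrow>
      (\<exists>p. (\<forall>l<n. degree (p l) \<le> c) \<and> (\<exists>l<n. p l \<noteq> 0) \<and> (\<forall>l<(n::nat). \<forall>l'<n. p l * b l' = p l' * b l))"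
proof -
  let ?S = "range (taylor \<xi>)"
  have S: "is_subring ?S"
    unfolding is_subring_def by (auto simp flip: taylor_add taylor_mult taylor_uminus taylor_0[of \<xi>] taylor_1[of \<xi>] simp del: taylor_0 taylor_1)
  obtain J0 where J0: "J0 \<subseteq> \<Phi>" "indep_over ?S J0 (\<lambda>x. x)"
    "\<forall>j\<in>\<Phi>. \<exists>d c. d \<in> ?S \<and> d \<noteq> 0 \<and> (\<forall>k\<in>J0. c k \<in> ?S) \<and> d * j = (\<Sum>k\<in>J0. c k * k)"
    using max_indep_exists[OF S fin, of "\<lambda>x. x"] by blast
  have finJ: "finite J0" using J0(1) fin finite_subset by blast
  obtain d c where dc: "\<And>j. j \<in> \<Phi> \<Longrightarrow> d j \<in> ?S \<and> d j \<noteq> 0 \<and> (\<forall>k\<in>J0. c j k \<in> ?S) \<and> d j * j = (\<Sum>k\<in>J0. c j k * k)"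
  proof -
    obtain d where d: "\<forall>j\<in>\<Phi>. \<exists>c. d j \<in> ?S \<and> d j \<noteq> 0 \<and> (\<forall>k\<in>J0. c k \<in> ?S) \<and> d j * j = (\<Sum>k\<in>J0. c k * k)"
      using bchoice[OF J0(3)] by (elim exE)
    obtain c where c: "\<forall>j\<in>\<Phi>. d j \<in> ?S \<and> d j \<noteq> 0 \<and> (\<forall>k\<in>J0. c j k \<in> ?S) \<and> d j * j = (\<Sum>k\<in>J0. c j k * k)"
      using bchoice[OF d] by (elim exE)
    show ?thesis by (rule that[of d c]) (rule bspec[OF c])
  qed
  \<comment> \<open>One denominator for all of \<Phi>; the polynomials \<open>C j k\<close> below
    adjust the individual denominators to it.\<close>
  define D where "D = (\<Prod>j\<in>\<Phi>. d j)"
  have D0: "D \<noteq> 0" unfolding D_def using dc fin by (subst prod_zero_iff) auto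
  have ex: "\<exists>C. \<forall>k\<in>J0. taylor \<xi> (C k) = (\<Prod>i\<in>\<Phi>-{j}. d i) * c j k" if j: "j \<in> \<Phi>" for j
  proof -
    have "(\<Prod>i\<in>\<Phi>-{j}. d i) * c j k \<in> ?S" if "k \<in> J0" for k
      using dc j that by (intro is_subringD(4)[OF S] is_subring_prod[OF S]) auto
    then have "\<forall>k. \<exists>p. k \<in> J0 \<longrightarrow> taylor \<xi> p = (\<Prod>i\<in>\<Phi>-{j}. d i) * c j k" by (metis imageE)
    then show ?thesis by (metis choice_iff)
  qed
  then obtain C where C: "\<And>j k. j \<in> \<Phi> \<Longrightarrow> k \<in> J0 \<Longrightarrow> taylor \<xi> (C j k) = (\<Prod>i\<in>\<Phi>-{j}. d i) * c j k" by metis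
  have DC: "D * j = (\<Sum>k\<in>J0. taylor \<xi> (C j k) * k)" if j: "j \<in> \<Phi>" for j
  proof -
    have "D * j = (\<Prod>i\<in>\<Phi>-{j}. d i) * (d j * j)" unfolding D_def using j fin by (simp add: prod.remove mult_ac)
    also have "\<dots> = (\<Prod>i\<in>\<Phi>-{j}. d i) * (\<Sum>k\<in>J0. c j k * k)" using dc[OF j] by simp
    also have "\<dots> = (\<Sum>k\<in>J0. taylor \<xi> (C j k) * k)"
      unfolding sum_distrib_left by (rule sum.cong[OF refl]) (simp add: C[OF j] mult_ac)
    finally show ?thesis .
  qed
  define N where "N = (\<Sum>j\<in>\<Phi>. \<Sum>k\<in>J0. degree (C j k))"
  have degC: "degree (C j k) \<le> N" if "j \<in> \<Phi>" "k \<in> J0" for j k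
  proof -
    have "degree (C j k) \<le> (\<Sum>k\<in>J0. degree (C j k))" by (rule member_le_sum) (use that finJ in auto)
    also have "\<dots> \<le> N" unfolding N_def by (rule member_le_sum[where f = "\<lambda>j. \<Sum>k\<in>J0. degree (C j k)"]) (use that fin in auto)
    finally show ?thesis .
  qed
  have "\<exists>p. (\<forall>l<n. degree (p l) \<le> N) \<and> (\<exists>l<n. p l \<noteq> 0) \<and> (\<forall>l<n. \<forall>l'<n. p l * b l' = p l' * b l)"
    if w: "\<forall>l<n. w l \<in> FC.span \<Phi>" "\<exists>l<n. w l \<noteq> 0" and r: "\<forall>l<n. \<forall>l'<n. taylor \<xi> (b l) * w l' = taylor \<xi> (b l') * w l"
    for n :: nat and w b
  proof -
    have "\<exists>u. w l = (\<Sum>j\<in>\<Phi>. fps_const (u j) * j)" if "l < n" for l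
      using w(1) that FC.span_finite[OF fin] by auto
    then obtain u where u: "\<And>l. l < n \<Longrightarrow> w l = (\<Sum>j\<in>\<Phi>. fps_const (u l j) * j)" by metis
    define U where "U = (\<lambda>l k. \<Sum>j\<in>\<Phi>. Polynomial.smult (u l j) (C j k))"
    have degU: "degree (U l k) \<le> N" if "k \<in> J0" for l k
      unfolding U_def by (intro degree_sum_le fin) (use degC that in \<open>auto intro: order_trans[OF degree_smult_le]\<close>)
    have DU: "D * w l = (\<Sum>k\<in>J0. taylor \<xi> (U l k) * k)" if "l < n" for l
    proof -
      have "D * w l = (\<Sum>j\<in>\<Phi>. fps_const (u l j) * (D * j))" unfolding u[OF that] sum_distrib_left by (intro sum.cong refl) (simp add: mult_ac)
      also have "\<dots> = (\<Sum>j\<in>\<Phi>. \<Sum>k\<in>J0. fps_const (u l j) * (taylor \<xi> (C j k) * k))"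
        by (rule sum.cong[OF refl]) (simp add: DC sum_distrib_left)
      also have "\<dots> = (\<Sum>k\<in>J0. \<Sum>j\<in>\<Phi>. fps_const (u l j) * (taylor \<xi> (C j k) * k))" by (rule sum.swap)
      also have "\<dots> = (\<Sum>k\<in>J0. taylor \<xi> (U l k) * k)"
        unfolding U_def taylor_sum taylor_smult sum_distrib_right by (intro sum.cong refl) (simp add: mult_ac)
      finally show ?thesis .
    qed
    have rel: "b l * U l' k = b l' * U l k" if l: "l < n" "l' < n" and k: "k \<in> J0" for l l' k
    proof -
      have "(\<Sum>k\<in>J0. taylor \<xi> (b l * U l' k - b l' * U l k) * k) =
          taylor \<xi> (b l) * (\<Sum>k\<in>J0. taylor \<xi> (U l' k) * k) - taylor \<xi> (b l') * (\<Sum>k\<in>J0. taylor \<xi> (U l k) * k)"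
        by (simp add: taylor_diff taylor_mult left_diff_distrib right_diff_distrib sum_subtractf sum_distrib_left mult_ac)
      also have "\<dots> = D * (taylor \<xi> (b l) * w l' - taylor \<xi> (b l') * w l)"
        unfolding DU[OF l(1), symmetric] DU[OF l(2), symmetric] by (simp add: algebra_simps)
      also have "\<dots> = 0" using r l by simp
      finally have "(\<Sum>k\<in>J0. taylor \<xi> (b l * U l' k - b l' * U l k) * k) = 0" .
      from indep_overD[OF J0(2) _ this k] have "taylor \<xi> (b l * U l' k - b l' * U l k) = 0" by simp
      then show ?thesis by simp
    qed
    obtain l0 where l0: "l0 < n" "w l0 \<noteq> 0" using w(2) by blast
    \<comment> \<open>A coordinate in which the tuple is not identically zero supplies the
      representative of bounded degree.\<close>
    have "\<exists>k0\<in>J0. U l0 k0 \<noteq> 0"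
    proof (rule ccontr)
      assume "\<not> ?thesis"
      then have "D * w l0 = 0" using DU[OF l0(1)] by simp
      then show False using D0 l0 by simp
    qed
    then obtain k0 where k0: "k0 \<in> J0" "U l0 k0 \<noteq> 0" by blast
    show ?thesis
      by (rule exI[of _ "\<lambda>l. U l k0"]) (use degU k0 l0 rel in \<open>auto simp: mult.commute\<close>)
  qed
  then show ?thesis by blast
qed

text \<open>Comparison of coefficients in y' = A y: since A has no pole, every initial vector v
  determines the remaining coefficients.\<close>

fun ode_coeff :: "nat \<Rightarrow> (nat \<Rightarrow> nat \<Rightarrow> complex fps) \<Rightarrow> (nat \<Rightarrow> complex) \<Rightarrow> nat \<Rightarrow> nat \<Rightarrow> complex" where
  "ode_coeff n A v 0 i = v i"
| "ode_coeff n A v (Suc k) i = (\<Sum>j<n. \<Sum>m\<le>k. fps_nth (A i j) m * ode_coeff n A v (k - m) j) / of_nat (Suc k)"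

lemma fps_ode_exists:
  fixes A :: "nat \<Rightarrow> nat \<Rightarrow> complex fps"
  shows "\<exists>y. (\<forall>i. fps_deriv (y i) = (\<Sum>j<n. A i j * y j)) \<and> (\<forall>i. fps_nth (y i) 0 = v i)"
proof (intro exI conjI allI)
  let ?y = "\<lambda>i. Abs_fps (\<lambda>k. ode_coeff n A v k i)"
  show "fps_nth (?y i) 0 = v i" for i by simp
  show "fps_deriv (?y i) = (\<Sum>j<n. A i j * ?y j)" for i
  proof (rule fps_ext)
    fix k
    have "of_nat (Suc k) * ode_coeff n A v (Suc k) i = (\<Sum>j<n. \<Sum>m\<le>k. fps_nth (A i j) m * ode_coeff n A v (k - m) j)"
      by (simp del: of_nat_Suc)
    then show "fps_nth (fps_deriv (?y i)) k = fps_nth (\<Sum>j<n. A i j * ?y j) k"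
      by (simp add: fps_sum_nth fps_mult_nth atLeast0AtMost)
  qed
qed

text \<open>After multiplication by z the lowest coefficients of the two sides are the two orders of
  vanishing times the same nonzero product.\<close>

lemma fps_same_subdegree:
  fixes \<delta> w :: "complex fps"
  assumes "\<delta> \<noteq> 0" "w \<noteq> 0" "fps_deriv \<delta> * w = \<delta> * fps_deriv w"
  shows "subdegree w = subdegree \<delta>"
proof -
  let ?d = "subdegree \<delta>" and ?e = "subdegree w"
  have X: "fps_nth (fps_X * fps_deriv f) k = of_nat k * fps_nth f k" for f :: "complex fps" and k
    by (cases k) auto
  have nth: "fps_nth (f * g) (d + e) = fps_nth f d * fps_nth g e"
    if "\<And>k. k < d \<Longrightarrow> fps_nth f k = 0" "\<And>k. k < e \<Longrightarrow> fps_nth g k = 0" for f g :: "complex fps" and d e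
  proof -
    have "fps_nth (f * g) (d + e) = (\<Sum>i\<in>{0..d + e}. fps_nth f i * fps_nth g (d + e - i))" by (simp add: fps_mult_nth)
    also have "\<dots> = (\<Sum>i\<in>{d}. fps_nth f i * fps_nth g (d + e - i))"
    proof (rule sum.mono_neutral_right)
      show "\<forall>i\<in>{0..d + e} - {d}. fps_nth f i * fps_nth g (d + e - i) = 0"
      proof
        fix i assume "i \<in> {0..d + e} - {d}"
        then have "i < d \<or> d + e - i < e" by auto
        then show "fps_nth f i * fps_nth g (d + e - i) = 0" using that by auto
      qed
    qed auto
    finally show ?thesis by simp
  qed
  have "(fps_X * fps_deriv \<delta>) * w = \<delta> * (fps_X * fps_deriv w)" using assms(3) by (simp add: mult_ac)
  moreover have "fps_nth ((fps_X * fps_deriv \<delta>) * w) (?d + ?e) = of_nat ?d * fps_nth \<delta> ?d * fps_nth w ?e"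
    by (subst nth) (auto simp: X)
  moreover have "fps_nth (\<delta> * (fps_X * fps_deriv w)) (?d + ?e) = fps_nth \<delta> ?d * (of_nat ?e * fps_nth w ?e)"
    by (subst nth) (auto simp: X)
  moreover have "fps_nth \<delta> ?d \<noteq> 0" "fps_nth w ?e \<noteq> 0" using assms by auto
  ultimately show ?thesis by (simp add: mult_ac)
qed

text \<open>Subtracting the multiple of \<delta> that cancels the coefficient of v at the order of
  \<delta> leaves a solution of the same equation; if nonzero, its order would have to be that of
  \<delta>.\<close>

lemma fps_log_deriv_eq:
  fixes \<delta> v :: "complex fps"
  assumes "\<delta> \<noteq> 0" "fps_deriv \<delta> * v = \<delta> * fps_deriv v"
  shows "\<exists>c. v = fps_const c * \<delta>"
proof -
  let ?d = "subdegree \<delta>"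
  define c where "c = fps_nth v ?d / fps_nth \<delta> ?d"
  define w where "w = v - fps_const c * \<delta>"
  have nz: "fps_nth \<delta> ?d \<noteq> 0" using assms by auto
  have "fps_nth w ?d = 0" using nz by (simp add: w_def c_def)
  moreover have "fps_deriv \<delta> * w = \<delta> * fps_deriv w" using assms(2) by (simp add: w_def algebra_simps)
  ultimately have "w = 0" using fps_same_subdegree[OF assms(1), of w] by (metis nth_subdegree_nonzero)
  then show ?thesis by (intro exI[of _ c]) (simp add: w_def)
qed

lemma mat_adj: "k < n \<Longrightarrow> i < n \<Longrightarrow> (\<Sum>j<n. M k j * fcof n M i j) = (if k = i then fdet n M else 0)"
proof -
  assume k: "k < n" "i < n"
  have "(\<Sum>l<n. (if l = k then 1 else 0) * M l j) = M k j" for j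
    using k by (simp add: if_distrib[of "\<lambda>u. u * _"] sum.delta cong: if_cong)
  then have "(\<Sum>j<n. fcof n M i j * M k j) = fdet n M * (if i = k then 1 else 0)"
    using cramer_left[OF k(2), of M "\<lambda>l. if l = k then 1 else 0"] by simp
  then show ?thesis by (auto simp: mult.commute)
qed

lemma solution_constants:
  fixes M :: "nat \<Rightarrow> nat \<Rightarrow> complex fps"
  assumes dz: "fdet m M \<noteq> 0" and g: "g \<noteq> 0"
    and M: "\<And>k j. k < m \<Longrightarrow> j < m \<Longrightarrow> g * fps_deriv (M k j) = (\<Sum>i<m. G k i * M i j)"
    and r: "\<And>k. k < m \<Longrightarrow> g * fps_deriv (r k) = (\<Sum>i<m. G k i * r i)"
  shows "\<exists>c. \<forall>k<m. r k = (\<Sum>j<m. M k j * fps_const (c j))"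
proof -
  define \<delta> where "\<delta> = fdet m M"
  define v where "v = (\<lambda>j. \<Sum>i<m. fcof m M i j * r i)"
  have e: "\<delta> * r k = (\<Sum>j<m. M k j * v j)" if k: "k < m" for k
  proof -
    have "(\<Sum>j<m. M k j * v j) = (\<Sum>j<m. \<Sum>i<m. M k j * fcof m M i j * r i)" by (simp add: v_def sum_distrib_left mult_ac)
    also have "\<dots> = (\<Sum>i<m. \<Sum>j<m. M k j * fcof m M i j * r i)" by (rule sum.swap)
    also have "\<dots> = (\<Sum>i<m. (if k = i then \<delta> else 0) * r i)"
      by (rule sum.cong[OF refl]) (simp add: mat_adj k \<delta>_def flip: sum_distrib_right)
    also have "\<dots> = \<delta> * r k" using k by (simp add: if_distrib[of "\<lambda>u. u * _"] cong: if_cong)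
    finally show ?thesis by simp
  qed
  have e': "fps_deriv \<delta> * r k = (\<Sum>j<m. M k j * fps_deriv (v j))" if k: "k < m" for k
  proof -
    have 1: "fps_deriv \<delta> * r k + \<delta> * fps_deriv (r k) = (\<Sum>j<m. fps_deriv (M k j) * v j) + (\<Sum>j<m. M k j * fps_deriv (v j))"
      using arg_cong[OF e[OF k], of fps_deriv] by (simp add: fps_deriv_sum sum.distrib algebra_simps)
    have "g * (\<Sum>j<m. fps_deriv (M k j) * v j) = (\<Sum>j<m. \<Sum>i<m. G k i * (M i j * v j))"
      unfolding sum_distrib_left
      by (rule sum.cong[OF refl]) (simp add: M[OF k] sum_distrib_right mult.assoc flip: mult.assoc[of g])
    also have "\<dots> = (\<Sum>i<m. \<Sum>j<m. G k i * (M i j * v j))" by (rule sum.swap)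
    also have "\<dots> = (\<Sum>i<m. G k i * (\<delta> * r i))" by (rule sum.cong[OF refl]) (simp add: e sum_distrib_left)
    also have "\<dots> = \<delta> * (g * fps_deriv (r k))" unfolding r[OF k] by (simp add: sum_distrib_left mult_ac)
    finally have 2: "g * (\<Sum>j<m. fps_deriv (M k j) * v j) = g * (\<delta> * fps_deriv (r k))" by (simp add: mult_ac)
    then have "(\<Sum>j<m. fps_deriv (M k j) * v j) = \<delta> * fps_deriv (r k)" using g by simp
    then show ?thesis using 1 by simp
  qed
  have "fps_deriv \<delta> * v j = \<delta> * fps_deriv (v j)" if j: "j < m" for j
  proof -
    have "fps_deriv \<delta> * v j - \<delta> * fps_deriv (v j) = 0"
    proof (rule fdet_nonzero_kernel[OF dz _ j])
      fix k assume k: "k < m"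
      have "(\<Sum>j<m. M k j * (fps_deriv \<delta> * v j - \<delta> * fps_deriv (v j))) =
        fps_deriv \<delta> * (\<Sum>j<m. M k j * v j) - \<delta> * (\<Sum>j<m. M k j * fps_deriv (v j))"
        by (simp add: right_diff_distrib sum_subtractf sum_distrib_left mult_ac)
      also have "\<dots> = 0" unfolding e[OF k, symmetric] e'[OF k, symmetric] by (simp add: mult_ac)
      finally show "(\<Sum>j<m. M k j * (fps_deriv \<delta> * v j - \<delta> * fps_deriv (v j))) = 0" .
    qed
    then show ?thesis by simp
  qed
  then have "\<forall>j. \<exists>c. j < m \<longrightarrow> v j = fps_const c * \<delta>" using fps_log_deriv_eq[of \<delta>] dz by (auto simp: \<delta>_def)
  then obtain c where c: "\<And>j. j < m \<Longrightarrow> v j = fps_const (c j) * \<delta>" by metis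
  have "r k = (\<Sum>j<m. M k j * fps_const (c j))" if k: "k < m" for k
  proof -
    have "\<delta> * r k = \<delta> * (\<Sum>j<m. M k j * fps_const (c j))"
      unfolding e[OF k] sum_distrib_left by (rule sum.cong[OF refl]) (simp add: c mult_ac)
    then show ?thesis using dz by (simp add: \<delta>_def)
  qed
  then show ?thesis by blast
qed

text \<open>Products of m elements of X. For finite X they are a finite spanning set for all
  determinants of size m with entries in the span of X.\<close>

fun prods :: "nat \<Rightarrow> complex fps set \<Rightarrow> complex fps set" where
  "prods 0 X = {1}"
| "prods (Suc m) X = (\<lambda>(a,b). a * b) ` (prods m X \<times> X)"

lemma finite_prods: "finite X \<Longrightarrow> finite (prods m X)"
  by (induction m) auto

lemma prod_in_span_prods: "(\<And>j. j < m \<Longrightarrow> u j \<in> FC.span X) \<Longrightarrow> (\<Prod>j<m. u j) \<in> FC.span (prods m X)"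
proof (induction m)
  case 0 show ?case by (simp add: FC.span_base)
next
  case (Suc m)
  have "(\<Prod>j<m. u j) * u m \<in> FC.span (prods (Suc m) X)"
    by (rule FC_span_mult[of "prods m X" X]) (use Suc in \<open>auto intro!: FC.span_base\<close>)
  then show ?case by simp
qed

lemma fdet_in_span_prods:
  assumes "\<And>i j. i < m \<Longrightarrow> j < m \<Longrightarrow> M i j \<in> FC.span X"
  shows "fdet m M \<in> FC.span (prods m X)"
  unfolding fdet_sum
proof (rule FC.span_sum)
  fix p assume p: "p \<in> {p. p permutes {0..<m}}"
  have "(\<Prod>i<m. M i (p i)) \<in> FC.span (prods m X)"
    by (rule prod_in_span_prods) (use assms permutes_less_upt p in auto)
  then have "fps_const (of_int (sign p)) * (\<Prod>i<m. M i (p i)) \<in> FC.span (prods m X)" by (rule FC.span_scale)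
  then show "signof p * (\<Prod>i = 0..<m. M i (p i)) \<in> FC.span (prods m X)"
    by (simp add: lessThan_atLeast0 fps_of_int)
qed

section \<open>Shidlovskii's zero estimate\<close>

definition row_deriv :: "nat \<Rightarrow> complex poly \<Rightarrow> (nat \<Rightarrow> nat \<Rightarrow> complex poly) \<Rightarrow> (nat \<Rightarrow> complex poly) \<Rightarrow> nat \<Rightarrow> complex poly" where
  "row_deriv n T B P i = T * pderiv (P i) + (\<Sum>j<n. P j * B j i)"

text \<open>Coefficients of the form $\sum P_i f_i$ after $k$ applications of $T\,d/dz$, where $T f_j' = \sum B_{ji} f_i$.\<close>
definition rows :: "nat \<Rightarrow> complex poly \<Rightarrow> (nat \<Rightarrow> nat \<Rightarrow> complex poly) \<Rightarrow> (nat \<Rightarrow> complex poly) \<Rightarrow> nat \<Rightarrow> nat \<Rightarrow> complex poly" where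
  "rows n T B P k = (row_deriv n T B ^^ k) P"

lemma rows_0 [simp]: "rows n T B P 0 = P" by (simp add: rows_def)
lemma rows_Suc: "rows n T B P (Suc k) i = T * pderiv (rows n T B P k i) + (\<Sum>j<n. rows n T B P k j * B j i)"
  by (simp add: rows_def row_deriv_def)

text \<open>An application of T d/dz to a form passes from row k to row k + 1. The centre a is
  arbitrary, so the same rows serve the given functions at 0 and formal solutions at \<xi>.\<close>

lemma form_deriv:
  assumes y: "\<And>i. i < n \<Longrightarrow> taylor a T * fps_deriv (y i) = (\<Sum>j<n. taylor a (B i j) * y j)"
  shows "taylor a T * fps_deriv (\<Sum>i<n. taylor a (rows n T B P k i) * y i) = (\<Sum>i<n. taylor a (rows n T B P (Suc k) i) * y i)"
proof -
  let ?p = "\<lambda>i. taylor a (rows n T B P k i)" and ?p' = "\<lambda>i. taylor a (pderiv (rows n T B P k i))"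
  have "taylor a T * fps_deriv (\<Sum>i<n. ?p i * y i) = (\<Sum>i<n. taylor a T * ?p' i * y i) + (\<Sum>i<n. ?p i * (taylor a T * fps_deriv (y i)))"
    by (simp add: fps_deriv_sum taylor_deriv sum_distrib_left sum.distrib algebra_simps)
  also have "(\<Sum>i<n. ?p i * (taylor a T * fps_deriv (y i))) = (\<Sum>i<n. \<Sum>j<n. ?p i * (taylor a (B i j) * y j))"
    by (rule sum.cong[OF refl]) (simp add: y sum_distrib_left)
  also have "\<dots> = (\<Sum>j<n. \<Sum>i<n. ?p i * (taylor a (B i j) * y j))" by (rule sum.swap)
  also have "(\<Sum>i<n. taylor a T * ?p' i * y i) + (\<Sum>j<n. \<Sum>i<n. ?p i * (taylor a (B i j) * y j)) = (\<Sum>i<n. taylor a (rows n T B P (Suc k) i) * y i)"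
    unfolding rows_Suc taylor_add taylor_mult taylor_sum sum.distrib[symmetric] distrib_right sum_distrib_right
    by (rule sum.cong[OF refl]) (simp add: mult_ac)
  finally show ?thesis .
qed

lemma rows_degree:
  assumes e: "degree T \<le> e" "\<And>i j. i < n \<Longrightarrow> j < n \<Longrightarrow> degree (B i j) \<le> e" and P: "\<And>i. i < n \<Longrightarrow> degree (P i) \<le> M" "i < n"
  shows "degree (rows n T B P k i) \<le> M + k * e"
  using P(2)
proof (induction k arbitrary: i)
  case 0 then show ?case using P(1) by simp
next
  case (Suc k)
  have "degree (T * pderiv (rows n T B P k i)) \<le> M + Suc k * e"
  proof -
    have "degree (T * pderiv (rows n T B P k i)) \<le> degree T + degree (pderiv (rows n T B P k i))" by (rule degree_mult_le)
    also have "\<dots> \<le> e + (M + k * e)" using e(1) Suc.IH[OF Suc.prems] by (intro add_mono) (auto simp: degree_pderiv)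
    finally show ?thesis by simp
  qed
  moreover have "degree (\<Sum>j<n. rows n T B P k j * B j i) \<le> M + Suc k * e"
  proof (rule degree_sum_le)
    fix j assume "j \<in> {..<n}"
    then have j: "j < n" by simp
    have "degree (rows n T B P k j * B j i) \<le> degree (rows n T B P k j) + degree (B j i)" by (rule degree_mult_le)
    also have "\<dots> \<le> (M + k * e) + e" using Suc.IH[OF j] e(2)[OF j Suc.prems] by (intro add_mono)
    finally show "degree (rows n T B P k j * B j i) \<le> M + Suc k * e" by simp
  qed simp
  ultimately show ?case unfolding rows_Suc by (rule degree_add_le)
qed

lemma rows_in_subring:
  assumes S: "is_subring S" and "T \<in> S" "\<And>i j. i < n \<Longrightarrow> j < n \<Longrightarrow> B i j \<in> S" "\<And>p. p \<in> S \<Longrightarrow> pderiv p \<in> S"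
    and "\<And>i. i < n \<Longrightarrow> P i \<in> S" "i < n"
  shows "rows n T B P k i \<in> S"
  using assms(6)
proof (induction k arbitrary: i)
  case (Suc k)
  then show ?case unfolding rows_Suc
    by (intro is_subringD(3)[OF S] is_subringD(4)[OF S] is_subring_sum[OF S] assms) auto
qed (use assms in auto)

lemma degree_fdet_le:
  fixes M :: "nat \<Rightarrow> nat \<Rightarrow> complex poly"
  assumes "\<And>i j. i < n \<Longrightarrow> j < n \<Longrightarrow> degree (M i j) \<le> b"
  shows "degree (fdet n M) \<le> n * b"
  unfolding fdet_sum
proof (rule degree_sum_le)
  show "finite {p. p permutes {0..<n}}" by (simp add: finite_permutations)
  fix p assume p: "p \<in> {p. p permutes {0..<n}}"
  have "degree (signof p * (\<Prod>i = 0..<n. M i (p i))) = degree (\<Prod>i = 0..<n. M i (p i))"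
    by (simp add: sign_def)
  also have "\<dots> \<le> (\<Sum>i = 0..<n. degree (M i (p i)))" using degree_prod_sum_le[of "{0..<n}" "\<lambda>i. M i (p i)"] by simp
  also have "\<dots> \<le> (\<Sum>i = 0..<n. b)" by (intro sum_mono) (use assms permutes_less_upt p in auto)
  finally show "degree (signof p * (\<Prod>i = 0..<n. M i (p i))) \<le> n * b" by simp
qed

text \<open>Shidlovskii's rank argument: a relation-closed set of rows is proportional to the image of a constant matrix
  under the inverse of a fundamental solution, so ratios of its minors have bounded degree.\<close>
lemma bounded_minor_ratio:
  fixes T :: "complex poly" and B :: "nat \<Rightarrow> nat \<Rightarrow> complex poly"
  assumes T\<xi>: "poly T \<xi> \<noteq> 0"
  shows "\<exists>c. \<forall>P \<iota> q b. 0 < m \<longrightarrow> (\<forall>j<m. \<iota> j < n) \<longrightarrow> fdet m (\<lambda>k j. rows n T B P k (\<iota> j)) \<noteq> 0 \<longrightarrow>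
     q m \<noteq> 0 \<longrightarrow> (\<forall>i<n. (\<Sum>k<Suc m. q k * rows n T B P k i) = 0) \<longrightarrow>
     (\<forall>l<n. b l = fdet m (\<lambda>k j. if j = 0 then rows n T B P k l else rows n T B P k (\<iota> j))) \<longrightarrow>
     (\<exists>p. (\<forall>l<n. degree (p l) \<le> c) \<and> (\<exists>l<n. p l \<noteq> 0) \<and> (\<forall>l<n. \<forall>l'<n. p l * b l' = p l' * b l))"
proof -
  have T0: "fps_nth (taylor \<xi> T) 0 \<noteq> 0" using T\<xi> by (simp add: taylor_nth_0)
  define A where "A = (\<lambda>i j. taylor \<xi> (B i j) * inverse (taylor \<xi> T))"
  \<comment> \<open>The columns of a fundamental matrix at the regular point \<xi>, normalised to
    the identity there and fixed before the polynomials P are introduced.\<close>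
  have "\<forall>l. \<exists>y. (\<forall>i. fps_deriv (y i) = (\<Sum>j<n. A i j * y j)) \<and> (\<forall>i. fps_nth (y i) 0 = (if i = l then 1 else 0))"
    by (intro allI fps_ode_exists)
  then obtain Y0 where Y0: "\<forall>l. (\<forall>i. fps_deriv (Y0 l i) = (\<Sum>j<n. A i j * Y0 l j)) \<and> (\<forall>i. fps_nth (Y0 l i) 0 = (if i = l then 1 else 0))"
    using choice by (elim exE choice[elim_format])
  define Y where "Y = (\<lambda>i l. Y0 l i)"
  have Y: "taylor \<xi> T * fps_deriv (Y i l) = (\<Sum>j<n. taylor \<xi> (B i j) * Y j l)" for i l
  proof -
    have u: "taylor \<xi> T * inverse (taylor \<xi> T) = 1" using T0 by (rule inverse_mult_eq_1')
    have "taylor \<xi> T * fps_deriv (Y i l) = (\<Sum>j<n. (taylor \<xi> T * inverse (taylor \<xi> T)) * (taylor \<xi> (B i j) * Y j l))"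
      using Y0 by (simp add: Y_def A_def sum_distrib_left mult_ac)
    then show ?thesis by (simp add: u)
  qed
  define dY where "dY = fdet n Y"
  have "fps_nth dY 0 = fdet n (\<lambda>i l. fps_nth (Y i l) 0)"
    unfolding dY_def by (rule fdet_hom[symmetric]) auto
  also have "\<dots> = 1" using Y0 fdet_id[of n] by (simp add: Y_def)
  finally have dY0: "dY \<noteq> 0" by auto
  \<comment> \<open>The adjugate entries of Y depend on the system and \<xi> alone. The bound c is
    drawn from them and from m, which makes it independent of P.\<close>
  define X where "X = (\<lambda>(i,l). fcof n Y i l) ` ({..<n} \<times> {..<n})"
  have "finite (prods m X)" by (rule finite_prods) (simp add: X_def)
  from bounded_degree_ratio[OF this, of \<xi>] obtain c where
    c: "\<forall>(N::nat) w b. (\<forall>l<N. w l \<in> FC.span (prods m X)) \<longrightarrow> (\<exists>l<N. w l \<noteq> 0) \<longrightarrow>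
      (\<forall>l<N. \<forall>l'<N. taylor \<xi> (b l) * w l' = taylor \<xi> (b l') * w l) \<longrightarrow>
      (\<exists>p. (\<forall>l<N. degree (p l) \<le> c) \<and> (\<exists>l<N. p l \<noteq> 0) \<and> (\<forall>l<N. \<forall>l'<N. p l * b l' = p l' * b l))" by (elim exE)
  show ?thesis
  proof (rule exI[of _ c], intro allI impI)
    fix P \<iota> q b
    assume m: "0 < m" and \<iota>: "\<forall>j<m. \<iota> j < n" and nz: "fdet m (\<lambda>k j. rows n T B P k (\<iota> j)) \<noteq> 0"
      and q: "q m \<noteq> 0" and dep: "\<forall>i<n. (\<Sum>k<Suc m. q k * rows n T B P k i) = 0"
      and b: "\<forall>l<n. b l = fdet m (\<lambda>k j. if j = 0 then rows n T B P k l else rows n T B P k (\<iota> j))"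
    define p where "p = (\<lambda>k i. taylor \<xi> (rows n T B P k i))"
    \<comment> \<open>The forms evaluated on the fundamental solutions, that is, the rows multiplied
      by Y.\<close>
    define Rm where "Rm = (\<lambda>k l. \<Sum>i<n. p k i * Y i l)"
    have step: "taylor \<xi> T * fps_deriv (Rm k l) = Rm (Suc k) l" for k l
      unfolding Rm_def p_def by (rule form_deriv) (rule Y)
    have Rdep: "taylor \<xi> (q m) * Rm m l = (\<Sum>k<m. - taylor \<xi> (q k) * Rm k l)" for l
    proof -
      have "(\<Sum>k<Suc m. taylor \<xi> (q k) * Rm k l) = (\<Sum>k<Suc m. \<Sum>i<n. taylor \<xi> (q k) * p k i * Y i l)"
        by (simp add: Rm_def sum_distrib_left mult_ac)
      also have "\<dots> = (\<Sum>i<n. \<Sum>k<Suc m. taylor \<xi> (q k) * p k i * Y i l)" by (rule sum.swap)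
      also have "\<dots> = (\<Sum>i<n. taylor \<xi> (\<Sum>k<Suc m. q k * rows n T B P k i) * Y i l)"
        unfolding p_def taylor_sum taylor_mult sum_distrib_right ..
      also have "\<dots> = 0" using dep by simp
      finally have "(\<Sum>k<m. taylor \<xi> (q k) * Rm k l) + taylor \<xi> (q m) * Rm m l = 0" by simp
      then have "taylor \<xi> (q m) * Rm m l = - (\<Sum>k<m. taylor \<xi> (q k) * Rm k l)" by (simp add: eq_neg_iff_add_eq_0 add.commute)
      then show ?thesis by (simp add: sum_negf)
    qed
    \<comment> \<open>The first m rows are independent and Y is nonsingular, so m columns of the
      product form a nonsingular matrix.\<close>
    have "\<exists>\<Lambda>. (\<forall>j<m. \<Lambda> j < n) \<and> fdet m (\<lambda>j k. Rm k (\<Lambda> j)) \<noteq> 0"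
    proof (rule select_rows)
      fix x i assume x: "\<And>l. l < n \<Longrightarrow> (\<Sum>k<m. Rm k l * x k) = 0" and i: "i < m"
      have xp: "(\<Sum>k<m. p k i * x k) = 0" if i: "i < n" for i
      proof -
        have "(\<Sum>i<n. (\<Sum>k<m. p k i * x k) * Y i l) = 0" if l: "l < n" for l
        proof -
          have "(\<Sum>i<n. (\<Sum>k<m. p k i * x k) * Y i l) = (\<Sum>i<n. \<Sum>k<m. p k i * Y i l * x k)"
            by (simp add: sum_distrib_left mult_ac)
          also have "\<dots> = (\<Sum>k<m. \<Sum>i<n. p k i * Y i l * x k)" by (rule sum.swap)
          also have "\<dots> = (\<Sum>k<m. Rm k l * x k)" by (simp add: Rm_def sum_distrib_right)
          finally show ?thesis using x[OF l] by simp
        qed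
        then have "dY * (\<Sum>k<m. p k i * x k) = 0"
          using cramer_left[OF i, of Y "\<lambda>i. \<Sum>k<m. p k i * x k"] by (simp add: dY_def)
        then show ?thesis using dY0 by simp
      qed
      have d: "fdet m (\<lambda>j k. p k (\<iota> j)) \<noteq> 0"
      proof -
        have "fdet m (\<lambda>j k. p k (\<iota> j)) = fdet m (\<lambda>k j. p k (\<iota> j))" by (rule fdet_transpose)
        also have "\<dots> = taylor \<xi> (fdet m (\<lambda>k j. rows n T B P k (\<iota> j)))" unfolding p_def by (rule fdet_taylor)
        finally show ?thesis using nz by simp
      qed
      show "x i = 0" by (rule fdet_nonzero_kernel[OF d _ i]) (use xp \<iota> in auto)
    qed
    then obtain \<Lambda> where \<Lambda>: "\<forall>j<m. \<Lambda> j < n" "fdet m (\<lambda>j k. Rm k (\<Lambda> j)) \<noteq> 0" by blast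
    define M where "M = (\<lambda>k j. Rm k (\<Lambda> j))"
    have dM: "fdet m M \<noteq> 0" using \<Lambda>(2) fdet_transpose[of m M] unfolding M_def by simp
    \<comment> \<open>The companion matrix of the relation q, multiplied by the coefficient of row
      m: T d/dz shifts the rows, and the last shift is expressed through the relation.\<close>
    define G where "G = (\<lambda>k k'. if Suc k < m then (if k' = Suc k then taylor \<xi> (q m) else 0) else - taylor \<xi> (q k'))"
    have ode: "(taylor \<xi> (q m) * taylor \<xi> T) * fps_deriv (Rm k l) = (\<Sum>k'<m. G k k' * Rm k' l)" if k: "k < m" for k l
    proof -
      have "(taylor \<xi> (q m) * taylor \<xi> T) * fps_deriv (Rm k l) = taylor \<xi> (q m) * Rm (Suc k) l"
        using step[of k l] by (simp add: mult_ac)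
      also have "\<dots> = (\<Sum>k'<m. G k k' * Rm k' l)"
      proof (cases "Suc k < m")
        case True
        then show ?thesis by (simp add: G_def if_distrib[of "\<lambda>u. u * _"] cong: if_cong)
      next
        case False
        then have "Suc k = m" using k by simp
        then show ?thesis using Rdep[of l] by (simp add: G_def)
      qed
      finally show ?thesis .
    qed
    have "\<exists>c. \<forall>k<m. Rm k l = (\<Sum>j<m. M k j * fps_const (c j))" for l
      by (rule solution_constants[OF dM, of "taylor \<xi> (q m) * taylor \<xi> T" G]) (use ode q T\<xi> in \<open>auto simp: M_def\<close>)
    then have "\<forall>l. \<exists>c. \<forall>k<m. Rm k l = (\<Sum>j<m. M k j * fps_const (c j))" by blast
    from choice[OF this] obtain cc where cc: "\<And>k l. k < m \<Longrightarrow> Rm k l = (\<Sum>j<m. M k j * fps_const (cc l j))" by auto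
    \<comment> \<open>All columns of \<open>Rm\<close> are constant combinations of the selected
      ones. Hence the rows are M times a constant matrix times the inverse of Y, and V is the
      product of the last two factors multiplied by det Y.\<close>
    define V where "V = (\<lambda>j i. \<Sum>l<n. fps_const (cc l j) * fcof n Y i l)"
    have V: "dY * p k i = (\<Sum>j<m. M k j * V j i)" if k: "k < m" and i: "i < n" for k i
    proof -
      have "dY * p k i = (\<Sum>l<n. fcof n Y i l * Rm k l)"
        unfolding Rm_def dY_def using cramer_left[OF i, of Y "p k"] by simp
      also have "\<dots> = (\<Sum>l<n. \<Sum>j<m. M k j * (fps_const (cc l j) * fcof n Y i l))"
        by (rule sum.cong[OF refl]) (simp add: cc[OF k] sum_distrib_left mult_ac)
      also have "\<dots> = (\<Sum>j<m. \<Sum>l<n. M k j * (fps_const (cc l j) * fcof n Y i l))" by (rule sum.swap)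
      finally show ?thesis by (simp add: V_def sum_distrib_left)
    qed
    \<comment> \<open>Up to the common factor det M / (det Y)^m the minors b of the rows are these
      minors of V, which lie in the fixed finite-dimensional space.\<close>
    define w where "w = (\<lambda>l. fdet m (\<lambda>k j. V k (if j = 0 then l else \<iota> j)))"
    have wspan: "w l \<in> FC.span (prods m X)" if l: "l < n" for l
      unfolding w_def
    proof (rule fdet_in_span_prods)
      fix k j assume "k < m" "j < m"
      then have i: "(if j = 0 then l else \<iota> j) < n" using l \<iota> by auto
      show "V k (if j = 0 then l else \<iota> j) \<in> FC.span X"
        unfolding V_def by (intro FC.span_sum FC.span_scale FC.span_base) (use i in \<open>auto simp: X_def\<close>)
    qed
    have bw: "dY ^ m * taylor \<xi> (b l) = fdet m M * w l" if l: "l < n" for l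
    proof -
      have "taylor \<xi> (b l) = fdet m (\<lambda>k j. p k (if j = 0 then l else \<iota> j))"
        unfolding b[rule_format, OF l] p_def fdet_taylor[symmetric] by (rule fdet_cong) auto
      then have "dY ^ m * taylor \<xi> (b l) = fdet m (\<lambda>k j. dY * p k (if j = 0 then l else \<iota> j))" by (simp only: fdet_scale)
      also have "\<dots> = fdet m (\<lambda>k j. \<Sum>j'<m. M k j' * V j' (if j = 0 then l else \<iota> j))"
        by (rule fdet_cong) (use V l \<iota> in auto)
      also have "\<dots> = fdet m M * w l" unfolding w_def by (rule fdet_mult)
      finally show ?thesis .
    qed
    have nz': "\<exists>l<n. w l \<noteq> 0"
    proof (intro exI conjI notI)
      show "\<iota> 0 < n" using \<iota> m by simp
      assume "w (\<iota> 0) = 0"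
      then have "b (\<iota> 0) = 0" using bw[of "\<iota> 0"] dY0 \<iota> m by simp
      moreover have "b (\<iota> 0) = fdet m (\<lambda>k j. rows n T B P k (\<iota> j))"
        using b \<iota> m by (auto intro!: fdet_cong)
      ultimately show False using nz by simp
    qed
    have cross: "taylor \<xi> (b l) * w l' = taylor \<xi> (b l') * w l" if l: "l < n" "l' < n" for l l'
    proof -
      have "(dY ^ m * fdet m M) * (taylor \<xi> (b l) * w l') = (dY ^ m * taylor \<xi> (b l)) * (fdet m M * w l')" by (simp add: mult_ac)
      also have "\<dots> = (fdet m M * w l) * (dY ^ m * taylor \<xi> (b l'))" unfolding bw[OF l(1)] bw[OF l(2)] by (simp add: mult_ac)
      also have "\<dots> = (dY ^ m * fdet m M) * (taylor \<xi> (b l') * w l)" by (simp add: mult_ac)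
      finally show ?thesis using dY0 dM by simp
    qed
    show "\<exists>p. (\<forall>l<n. degree (p l) \<le> c) \<and> (\<exists>l<n. p l \<noteq> 0) \<and> (\<forall>l<n. \<forall>l'<n. p l * b l' = p l' * b l)"
      using c[THEN spec, of n, THEN spec, of w, THEN spec, of b] wspan nz' cross by simp
  qed
qed

text \<open>Each application of T d/dz costs at most one order of vanishing.\<close>

lemma forms_order_at_0:
  fixes f :: "nat \<Rightarrow> complex fps"
  assumes f: "\<And>i. i < n \<Longrightarrow> fps_of_poly T * fps_deriv (f i) = (\<Sum>j<n. fps_of_poly (B i j) * f j)"
    and R0: "\<And>k. k < L \<Longrightarrow> fps_nth (\<Sum>i<n. fps_of_poly (P i) * f i) k = 0" and j: "j + k < L"
  shows "fps_nth (\<Sum>i<n. fps_of_poly (rows n T B P k i) * f i) j = 0"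
  using j
proof (induction k arbitrary: j)
  case 0 then show ?case using R0 by simp
next
  case (Suc k)
  let ?R = "\<lambda>k. \<Sum>i<n. fps_of_poly (rows n T B P k i) * f i"
  have "?R (Suc k) = fps_of_poly T * fps_deriv (?R k)"
    using form_deriv[of n 0 T f B P k] f by (simp add: taylor_zero_point)
  moreover have "fps_nth (fps_deriv (?R k)) i = 0" if "i < L - Suc k" for i
    using Suc.IH[of "Suc i"] that by simp
  ultimately show ?case using fps_low_mult[of "L - Suc k" "fps_deriv (?R k)" j "fps_of_poly T"] Suc.prems by simp
qed

text \<open>T is invertible near \<xi>, so derivatives of one form are combinations of later forms.
  The coefficient j of form k is thereby governed by the constant terms of the forms k to k + j, and
  these are the given values.\<close>

lemma forms_order_at_point:
  fixes y :: "nat \<Rightarrow> complex fps"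
  assumes T: "poly T \<xi> \<noteq> 0" and y: "\<And>i. i < n \<Longrightarrow> taylor \<xi> T * fps_deriv (y i) = (\<Sum>j<n. taylor \<xi> (B i j) * y j)"
    and v: "\<And>k. k < W \<Longrightarrow> (\<Sum>i<n. poly (rows n T B P k i) \<xi> * fps_nth (y i) 0) = 0" and jk: "j + k < W"
  shows "fps_nth (\<Sum>i<n. taylor \<xi> (rows n T B P k i) * y i) j = 0"
  using jk
proof (induction j arbitrary: k rule: less_induct)
  case (less j)
  let ?R = "\<lambda>k. \<Sum>i<n. taylor \<xi> (rows n T B P k i) * y i"
  show ?case
  proof (cases j)
    case 0
    then show ?thesis using v[of k] less.prems by (simp add: fps_sum_nth taylor_nth_0)
  next
    case (Suc i)
    have T0: "fps_nth (taylor \<xi> T) 0 \<noteq> 0" using T by (simp add: taylor_nth_0)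
    have "inverse (taylor \<xi> T) * (taylor \<xi> T * fps_deriv (?R k)) = fps_deriv (?R k)"
      unfolding mult.assoc[symmetric] inverse_mult_eq_1[OF T0] by simp
    then have e: "fps_deriv (?R k) = inverse (taylor \<xi> T) * ?R (Suc k)"
      using form_deriv[of n \<xi> T y B P k] y by simp
    have "fps_nth (inverse (taylor \<xi> T) * ?R (Suc k)) i = 0"
      by (rule fps_low_mult[of "Suc i"]) (use less.IH[of _ "Suc k"] less.prems Suc in auto)
    then have "fps_nth (fps_deriv (?R k)) i = 0" using e by simp
    then show ?thesis using Suc by (simp del: of_nat_Suc)
  qed
qed

text \<open>The conclusion says that the rows considered have rank n at \<xi>. The determinant of
  the first n rows is nonzero, since a dependence would yield a nonzero combination of the functions
  with coefficients of bounded degree and too high an order at 0. A common null vector v at \<xi>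
  starts a formal solution on which the forms vanish to high order, and the determinant would have
  more zeros at 0 and \<xi> together than its degree allows.\<close>

theorem zero_estimate:
  fixes T :: "complex poly" and B :: "nat \<Rightarrow> nat \<Rightarrow> complex poly" and f :: "nat \<Rightarrow> complex fps"
  assumes n: "n > 0" and T\<xi>: "poly T \<xi> \<noteq> 0" and \<xi>: "\<xi> \<noteq> 0"
    and f: "\<And>i. i < n \<Longrightarrow> fps_of_poly T * fps_deriv (f i) = (\<Sum>j<n. fps_of_poly (B i j) * f j)"
    and S: "is_subring S" "T \<in> S" "\<And>i j. i < n \<Longrightarrow> j < n \<Longrightarrow> B i j \<in> S" "\<And>p. p \<in> S \<Longrightarrow> pderiv p \<in> S"
    and ind: "indep_over (fps_of_poly ` S) {..<n} f"
  shows "\<exists>c0. \<forall>P M L. (\<forall>i<n. P i \<in> S \<and> degree (P i) \<le> M) \<longrightarrow> (\<exists>i<n. P i \<noteq> 0) \<longrightarrow>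
     (\<forall>k<L. fps_nth (\<Sum>i<n. fps_of_poly (P i) * f i) k = 0) \<longrightarrow> (n - 1) * M + c0 < L \<longrightarrow>
     (\<forall>v. (\<forall>k<n * M + c0 - L. (\<Sum>i<n. poly (rows n T B P k i) \<xi> * v i) = 0) \<longrightarrow> (\<forall>i<n. v i = 0))"
proof -
  define e where "e = degree T + (\<Sum>i<n. \<Sum>j<n. degree (B i j))"
  have eT: "degree T \<le> e" by (simp add: e_def)
  have eB: "degree (B i j) \<le> e" if "i < n" "j < n" for i j
  proof -
    have "degree (B i j) \<le> (\<Sum>j<n. degree (B i j))" by (rule member_le_sum) (use that in auto)
    also have "\<dots> \<le> (\<Sum>i<n. \<Sum>j<n. degree (B i j))"
      by (rule member_le_sum[where f = "\<lambda>i. \<Sum>j<n. degree (B i j)"]) (use that in auto)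
    finally show ?thesis by (simp add: e_def)
  qed
  have indD: "\<forall>i<n. c i = 0" if "\<And>i. i < n \<Longrightarrow> c i \<in> S" "(\<Sum>i<n. fps_of_poly (c i) * f i) = 0" for c
    using indep_overD[OF ind, of "\<lambda>i. fps_of_poly (c i)"] that by auto
  have "\<forall>m. \<exists>c. \<forall>P \<iota> q b. 0 < m \<longrightarrow> (\<forall>j<m. \<iota> j < n) \<longrightarrow> fdet m (\<lambda>k j. rows n T B P k (\<iota> j)) \<noteq> 0 \<longrightarrow>
     q m \<noteq> 0 \<longrightarrow> (\<forall>i<n. (\<Sum>k<Suc m. q k * rows n T B P k i) = 0) \<longrightarrow>
     (\<forall>l<n. b l = fdet m (\<lambda>k j. if j = 0 then rows n T B P k l else rows n T B P k (\<iota> j))) \<longrightarrow>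
     (\<exists>p. (\<forall>l<n. degree (p l) \<le> c) \<and> (\<exists>l<n. p l \<noteq> 0) \<and> (\<forall>l<n. \<forall>l'<n. p l * b l' = p l' * b l))"
    by (intro allI bounded_minor_ratio[OF T\<xi>])
  from choice[OF this] obtain c1 where c1: "\<forall>m P \<iota> q b. 0 < m \<longrightarrow> (\<forall>j<m. \<iota> j < n) \<longrightarrow> fdet m (\<lambda>k j. rows n T B P k (\<iota> j)) \<noteq> 0 \<longrightarrow>
     q m \<noteq> 0 \<longrightarrow> (\<forall>i<n. (\<Sum>k<Suc m. q k * rows n T B P k i) = 0) \<longrightarrow>
     (\<forall>l<n. b l = fdet m (\<lambda>k j. if j = 0 then rows n T B P k l else rows n T B P k (\<iota> j))) \<longrightarrow>
     (\<exists>p. (\<forall>l<n. degree (p l) \<le> c1 m) \<and> (\<exists>l<n. p l \<noteq> 0) \<and> (\<forall>l<n. \<forall>l'<n. p l * b l' = p l' * b l))"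
    by (elim exE)
  \<comment> \<open>The number m of independent rows before the first dependent one will be below n
    but is unknown in advance; the sum covers all cases.\<close>
  define C1 where "C1 = (\<Sum>m<n. c1 m)"
  have c1C: "c1 m \<le> C1" if "m < n" for m unfolding C1_def by (rule member_le_sum) (use that in auto)
  \<comment> \<open>These products span all combinations of the f l with polynomial coefficients of
    degree at most C1, so the orders at 0 of such combinations are bounded by a constant
    \<open>c2\<close>.\<close>
  define \<Phi> where "\<Phi> = (\<lambda>(k,l). fps_X ^ k * f l) ` ({..C1} \<times> {..<n})"
  have "finite \<Phi>" by (simp add: \<Phi>_def)
  from subdegree_bound_span[OF this] obtain c2 where c2: "\<And>g. g \<in> FC.span \<Phi> \<Longrightarrow> g \<noteq> 0 \<Longrightarrow> subdegree g \<le> c2" by blast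
  have combo: "(\<Sum>l<n. fps_of_poly (p l) * f l) \<in> FC.span \<Phi>" if "\<forall>l<n. degree (p l) \<le> C1" for p
  proof -
    have "fps_of_poly (p l) * f l = (\<Sum>k\<le>C1. fps_const (coeff (p l) k) * (fps_X ^ k * f l))" if l: "l < n" for l
    proof -
      have "fps_of_poly (p l) = fps_of_poly (\<Sum>k\<le>C1. monom (coeff (p l) k) k)"
        using poly_as_sum_of_monoms'[of "p l" C1] \<open>\<forall>l<n. degree (p l) \<le> C1\<close> l by simp
      also have "\<dots> = (\<Sum>k\<le>C1. fps_const (coeff (p l) k) * fps_X ^ k)"
        by (simp add: fps_of_poly_sum fps_of_poly_monom)
      finally show ?thesis by (simp add: sum_distrib_right mult.assoc)
    qed
    then have "(\<Sum>l<n. fps_of_poly (p l) * f l) = (\<Sum>l<n. \<Sum>k\<le>C1. fps_const (coeff (p l) k) * (fps_X ^ k * f l))" by simp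
    also have "\<dots> \<in> FC.span \<Phi>" by (intro FC.span_sum FC.span_scale FC.span_base) (auto simp: \<Phi>_def)
    finally show ?thesis .
  qed
  have f0: "f 0 \<noteq> 0"
  proof
    assume "f 0 = 0"
    then have "(\<Sum>i<n. fps_of_poly (if i = 0 then 1 else 0) * f i) = 0"
      by (intro sum.neutral) auto
    moreover have "(if i = 0 then 1 else 0) \<in> S" for i :: nat using is_subringD(1,2)[OF S(1)] by simp
    ultimately have "\<forall>i<n. (if i = 0 then 1 else 0 :: complex poly) = 0" using indD[of "\<lambda>i. if i = 0 then 1 else 0"] by blast
    then show False using n by auto
  qed
  define s0 where "s0 = subdegree (f 0)"
  \<comment> \<open>The terms pay for the degrees gained in n rows of n derivations, for n orders
    lost at each of the two points, for the order of f 0 and for \<open>c2\<close>; the final 1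
    makes the comparisons strict.\<close>
  define c0 where "c0 = n * (n * e) + 2 * n + s0 + c2 + 1"
  have main: "\<forall>i<n. v i = 0"
    if P: "\<forall>i<n. P i \<in> S \<and> degree (P i) \<le> M" "\<exists>i<n. P i \<noteq> 0"
      and R: "\<forall>k<L. fps_nth (\<Sum>i<n. fps_of_poly (P i) * f i) k = 0" and L: "(n - 1) * M + c0 < L"
      and v: "\<forall>k<n * M + c0 - L. (\<Sum>i<n. poly (rows n T B P k i) \<xi> * v i) = 0" for P M L v
  proof -
    let ?r = "rows n T B P"
    have rS: "?r k i \<in> S" if "i < n" for k i by (rule rows_in_subring) (use S P that in auto)
    have rd: "degree (?r k i) \<le> M + n * e" if "i < n" "k < n" for k i
    proof -
      have "degree (?r k i) \<le> M + k * e" by (rule rows_degree) (use eT eB P that in auto)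
      also have "\<dots> \<le> M + n * e" using that by simp
      finally show ?thesis .
    qed
    define F where "F = (\<lambda>k. \<Sum>i<n. fps_of_poly (?r k i) * f i)"
    have Flow: "fps_nth (F k) j = 0" if "j + k < L" for j k
      unfolding F_def by (rule forms_order_at_0) (use f R that in auto)
    have \<Delta>: "fdet n ?r \<noteq> 0"
    proof
      assume "fdet n ?r = 0"
      then have "fdet n (\<lambda>i k. ?r k i) = 0" by (simp only: fdet_transpose[of n ?r])
      then obtain q0 where q0: "\<exists>k<n. q0 k \<noteq> 0" "\<forall>i<n. (\<Sum>k<n. ?r k i * q0 k) = 0"
        using fdet_zero_kernel by blast
      define dep where "dep = (\<lambda>m. \<exists>q. (\<exists>k<m. q k \<noteq> 0) \<and> (\<forall>i<n. (\<Sum>k<m. q k * ?r k i) = 0))"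
      have "dep n" unfolding dep_def using q0 by (intro exI[of _ q0]) (simp add: mult.commute)
      \<comment> \<open>With m1 = m + 1 minimal, the first m rows are independent and row m is the
        first dependent one, so its coefficient in the relation is nonzero.\<close>
      define m1 where "m1 = (LEAST m. dep m)"
      have m1: "dep m1" "m1 \<le> n" "\<And>k. k < m1 \<Longrightarrow> \<not> dep k"
        unfolding m1_def using \<open>dep n\<close> by (auto intro: LeastI Least_le dest: not_less_Least)
      obtain q where q: "\<exists>k<m1. q k \<noteq> 0" "\<forall>i<n. (\<Sum>k<m1. q k * ?r k i) = 0" using m1(1) unfolding dep_def by blast
      have "m1 \<noteq> 0" using q(1) by auto
      then obtain m where m: "m1 = Suc m" using not0_implies_Suc by blast
      have mn: "m < n" using m1(2) m by simp
      have ndep: "\<not> dep m" using m1(3) m by simp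
      have qm: "q m \<noteq> 0"
      proof
        assume "q m = 0"
        then have "dep m" unfolding dep_def using q m by (intro exI[of _ q]) (auto simp: less_Suc_eq)
        then show False using ndep by simp
      qed
      have m0: "0 < m"
      proof (rule ccontr)
        assume "\<not> 0 < m"
        then have "\<forall>i<n. P i = 0" using q(2) qm m by simp
        then show False using P(2) by blast
      qed
      have "\<exists>\<iota>. (\<forall>j<m. \<iota> j < n) \<and> fdet m (\<lambda>j k. ?r k (\<iota> j)) \<noteq> 0"
      proof (rule select_rows)
        fix x i assume x: "\<And>l. l < n \<Longrightarrow> (\<Sum>k<m. ?r k l * x k) = 0" and i: "i < m"
        show "x i = 0"
        proof (rule ccontr)
          assume "x i \<noteq> 0"
          then have "dep m" unfolding dep_def using x i by (intro exI[of _ x]) (auto simp: mult.commute)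
          then show False using ndep by simp
        qed
      qed
      then obtain \<iota> where \<iota>: "\<forall>j<m. \<iota> j < n" "fdet m (\<lambda>j k. ?r k (\<iota> j)) \<noteq> 0" by blast
      have \<iota>': "fdet m (\<lambda>k j. ?r k (\<iota> j)) \<noteq> 0"
        using \<iota>(2) fdet_transpose[of m "\<lambda>k j. ?r k (\<iota> j)"] by simp
      \<comment> \<open>Column \<iota> 0 of the nonzero minor is replaced by column l; for l =
        \<iota> 0 the minor itself returns.\<close>
      define b where "b = (\<lambda>l. fdet m (\<lambda>k j. if j = 0 then ?r k l else ?r k (\<iota> j)))"
      obtain p where p: "\<forall>l<n. degree (p l) \<le> c1 m" "\<exists>l<n. p l \<noteq> 0" "\<forall>l<n. \<forall>l'<n. p l * b l' = p l' * b l"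
      proof -
        have bl: "\<forall>l<n. b l = fdet m (\<lambda>k j. if j = 0 then ?r k l else ?r k (\<iota> j))" by (simp add: b_def)
        have ql: "\<forall>i<n. (\<Sum>k<Suc m. q k * ?r k i) = 0" using q(2) m by simp
        have "\<exists>p. (\<forall>l<n. degree (p l) \<le> c1 m) \<and> (\<exists>l<n. p l \<noteq> 0) \<and> (\<forall>l<n. \<forall>l'<n. p l * b l' = p l' * b l)"
          by (rule c1[THEN spec, of m, THEN spec, of P, THEN spec, of \<iota>, THEN spec, of q, THEN spec, of b,
                THEN mp, OF m0, THEN mp, OF \<iota>(1), THEN mp, OF \<iota>', THEN mp, OF qm, THEN mp, OF ql, THEN mp, OF bl])
        then show ?thesis using that by blast
      qed
      have b0: "b (\<iota> 0) \<noteq> 0"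
      proof -
        have "b (\<iota> 0) = fdet m (\<lambda>k j. ?r k (\<iota> j))" unfolding b_def by (rule fdet_cong) auto
        then show ?thesis using \<iota>' by simp
      qed
      have \<iota>0: "\<iota> 0 < n" using \<iota> m0 by simp
      have bS: "b l \<in> S" if "l < n" for l
        unfolding b_def by (rule is_subring_fdet[OF S(1)]) (use rS \<iota> that in auto)
      have bdeg: "degree (b (\<iota> 0)) \<le> m * (M + n * e)"
        unfolding b_def by (rule degree_fdet_le) (use rd \<iota> mn \<iota>0 in auto)
      \<comment> \<open>Expansion along the replaced column exhibits this form as a combination of
        the first m forms, so it inherits their vanishing at 0. It is nonzero because the f l are
        independent over S.\<close>
      define Hf where "Hf = (\<Sum>l<n. fps_of_poly (b l) * f l)"
      have "Hf \<noteq> 0" using indD[of b] bS b0 \<iota>0 unfolding Hf_def by blast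
      have Hlow: "fps_nth Hf j = 0" if j: "j < L - n" for j
      proof -
        let ?c = "\<lambda>k. fcof m (\<lambda>k j. fps_of_poly (?r k (\<iota> j))) k 0"
        have "fps_of_poly (b l) = (\<Sum>k<m. fps_of_poly (?r k l) * ?c k)" for l
        proof -
          have "fps_of_poly (b l) = fdet m (\<lambda>k j. fps_of_poly (if j = 0 then ?r k l else ?r k (\<iota> j)))"
            unfolding b_def using fdet_taylor[of m 0 "\<lambda>k j. if j = 0 then ?r k l else ?r k (\<iota> j)"] by (simp add: taylor_zero_point)
          also have "\<dots> = fdet m (\<lambda>k j. if j = 0 then fps_of_poly (?r k l) else fps_of_poly (?r k (\<iota> j)))"
            by (rule fdet_cong) auto
          also have "\<dots> = (\<Sum>k<m. fps_of_poly (?r k l) * ?c k)" by (rule fdet_replace_col[OF m0])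
          finally show ?thesis .
        qed
        then have "Hf = (\<Sum>l<n. \<Sum>k<m. ?c k * (fps_of_poly (?r k l) * f l))"
          unfolding Hf_def by (simp add: sum_distrib_left mult_ac)
        also have "\<dots> = (\<Sum>k<m. \<Sum>l<n. ?c k * (fps_of_poly (?r k l) * f l))" by (rule sum.swap)
        also have "\<dots> = (\<Sum>k<m. ?c k * F k)" by (simp add: F_def sum_distrib_left)
        finally have e: "Hf = (\<Sum>k<m. ?c k * F k)" .
        show ?thesis unfolding e
          by (rule fps_low_sum, rule fps_low_mult[of "L - n"]) (use Flow j mn in auto)
      qed
      \<comment> \<open>The form \<open>Hf\<close> up to a rational factor, now with coefficients of
        bounded degree. Its order is at most \<open>c2\<close>, so the remaining vanishing of
        \<open>Hf\<close> has to come from the polynomial b (\<iota> 0), whose degree is too small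
        for it.\<close>
      define Gf where "Gf = (\<Sum>l<n. fps_of_poly (p l) * f l)"
      obtain l0 where l0: "l0 < n" "p l0 \<noteq> 0" using p(2) by blast
      have p0: "p (\<iota> 0) \<noteq> 0"
      proof
        assume "p (\<iota> 0) = 0"
        then have "p l0 * b (\<iota> 0) = 0" using p(3) l0(1) \<iota>0 by auto
        then show False using l0 b0 by simp
      qed
      have GH: "fps_of_poly (b (\<iota> 0)) * Gf = fps_of_poly (p (\<iota> 0)) * Hf"
        unfolding Gf_def Hf_def sum_distrib_left
      proof (rule sum.cong[OF refl])
        fix l assume "l \<in> {..<n}"
        then have "p (\<iota> 0) * b l = p l * b (\<iota> 0)" using p(3) \<iota>0 by simp
        then have "fps_of_poly (b (\<iota> 0) * p l) = fps_of_poly (p (\<iota> 0) * b l)" by (metis mult.commute)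
        then have "(fps_of_poly (b (\<iota> 0)) * fps_of_poly (p l)) * f l = (fps_of_poly (p (\<iota> 0)) * fps_of_poly (b l)) * f l"
          by (simp add: fps_of_poly_mult)
        then show "fps_of_poly (b (\<iota> 0)) * (fps_of_poly (p l) * f l) = fps_of_poly (p (\<iota> 0)) * (fps_of_poly (b l) * f l)"
          by (simp only: mult.assoc)
      qed
      have "Gf \<noteq> 0" using GH \<open>Hf \<noteq> 0\<close> p0 by auto
      have "subdegree Gf \<le> c2"
        unfolding Gf_def by (rule c2[OF combo]) (use p(1) c1C[OF mn] \<open>Gf \<noteq> 0\<close> in \<open>auto simp: Gf_def intro: order_trans\<close>)
      have "L - n \<le> subdegree Hf"
        using Hlow \<open>Hf \<noteq> 0\<close> by (metis not_le nth_subdegree_nonzero)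
      also have "\<dots> \<le> subdegree (fps_of_poly (b (\<iota> 0)) * Gf)"
        unfolding GH using \<open>Hf \<noteq> 0\<close> p0 by simp
      also have "\<dots> = subdegree (fps_of_poly (b (\<iota> 0))) + subdegree Gf"
        using b0 \<open>Gf \<noteq> 0\<close> by simp
      also have "\<dots> \<le> m * (M + n * e) + c2"
      proof -
        have "subdegree (fps_of_poly (b (\<iota> 0))) \<le> degree (b (\<iota> 0))"
          using b0 by (intro subdegree_leI) simp
        then show ?thesis using bdeg \<open>subdegree Gf \<le> c2\<close> by linarith
      qed
      also have "\<dots> \<le> (n - 1) * M + n * (n * e) + c2"
      proof -
        have "m * M \<le> (n - 1) * M" by (rule mult_right_mono) (use mn in auto)
        moreover have "m * (n * e) \<le> n * (n * e)" by (rule mult_right_mono) (use mn in auto)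
        ultimately show ?thesis unfolding distrib_left by linarith
      qed
      finally show False using L by (simp add: c0_def)
    qed
    define W where "W = n * M + c0 - L"
    have dd: "degree (fdet n ?r) \<le> n * M + n * (n * e)"
      using degree_fdet_le[of n ?r "M + n * e"] rd by (simp add: distrib_left)
    \<comment> \<open>Cramer's rule writes the determinant times f 0 as a combination of the forms;
      division by f 0 loses its order s0.\<close>
    have ord0: "[:-0, 1:] ^ (L - n - s0) dvd fdet n ?r"
    proof (rule taylor_order_dvd)
      fix k assume k: "k < L - n - s0"
      show "fps_nth (taylor 0 (fdet n ?r)) k = 0"
      proof (rule ccontr)
        assume nz: "fps_nth (taylor 0 (fdet n ?r)) k \<noteq> 0"
        let ?g = "taylor 0 (fdet n ?r)"
        have "?g * f 0 = (\<Sum>j<n. fcof n (\<lambda>k i. fps_of_poly (?r k i)) j 0 * F j)"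
          using cramer_right[OF n, of "\<lambda>k i. fps_of_poly (?r k i)" f] fdet_taylor[of n 0 ?r] by (simp add: F_def taylor_zero_point)
        moreover have "fps_nth (\<Sum>j<n. fcof n (\<lambda>k i. fps_of_poly (?r k i)) j 0 * F j) j = 0" if "j < L - n" for j
          by (rule fps_low_sum, rule fps_low_mult[of "L - n"]) (use Flow that in auto)
        ultimately have low: "fps_nth (?g * f 0) j = 0" if "j < L - n" for j using that by simp
        have "subdegree (?g * f 0) = subdegree ?g + s0" using \<Delta> f0 by (simp add: s0_def)
        also have "\<dots> \<le> k + s0" using nz by (simp add: subdegree_leI)
        finally have "fps_nth (?g * f 0) (subdegree (?g * f 0)) = 0" using low k by simp
        then show False using \<Delta> f0 by simp
      qed
    qed
    show ?thesis
    proof (rule ccontr)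
      assume "\<not> (\<forall>i<n. v i = 0)"
      then obtain i0 where i0: "i0 < n" "v i0 \<noteq> 0" by blast
      have T0: "fps_nth (taylor \<xi> T) 0 \<noteq> 0" using T\<xi> by (simp add: taylor_nth_0)
      \<comment> \<open>The null vector v becomes the initial value of a formal solution at
        \<xi>.\<close>
      obtain y where y: "\<forall>i. fps_deriv (y i) = (\<Sum>j<n. (taylor \<xi> (B i j) * inverse (taylor \<xi> T)) * y j)" "\<forall>i. fps_nth (y i) 0 = v i"
        using fps_ode_exists[where n = n and A = "\<lambda>i j. taylor \<xi> (B i j) * inverse (taylor \<xi> T)" and v = v] by (elim exE conjE)
      have yT: "taylor \<xi> T * fps_deriv (y i) = (\<Sum>j<n. taylor \<xi> (B i j) * y j)" for i
      proof -
        have u: "taylor \<xi> T * inverse (taylor \<xi> T) = 1" using T0 by (rule inverse_mult_eq_1')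
        have "taylor \<xi> T * fps_deriv (y i) = (\<Sum>j<n. (taylor \<xi> T * inverse (taylor \<xi> T)) * (taylor \<xi> (B i j) * y j))"
          using y(1) by (simp add: sum_distrib_left mult_ac)
        then show ?thesis by (simp add: u)
      qed
      let ?F = "\<lambda>k. \<Sum>i<n. taylor \<xi> (?r k i) * y i"
      have Fl: "fps_nth (?F k) j = 0" if "j + k < W" for j k
        by (rule forms_order_at_point[OF T\<xi>, where W = W]) (use yT v y(2) that in \<open>auto simp: W_def\<close>)
      have "[:-\<xi>, 1:] ^ (W - n) dvd fdet n ?r"
      proof (rule taylor_order_dvd)
        let ?g = "taylor \<xi> (fdet n ?r)"
        fix k assume k: "k < W - n"
        have "?g * y i0 = (\<Sum>j<n. fcof n (\<lambda>k i. taylor \<xi> (?r k i)) j i0 * ?F j)"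
          using cramer_right[OF i0(1), of "\<lambda>k i. taylor \<xi> (?r k i)" y] fdet_taylor[of n \<xi> ?r] by simp
        moreover have "fps_nth (\<Sum>j<n. fcof n (\<lambda>k i. taylor \<xi> (?r k i)) j i0 * ?F j) j = 0" if "j < W - n" for j
          by (rule fps_low_sum, rule fps_low_mult[of "W - n"]) (use Fl that in auto)
        ultimately have low: "fps_nth (y i0 * ?g) j = 0" if "j < W - n" for j using that by (simp add: mult.commute)
        \<comment> \<open>Unlike f 0 at the origin, the component y i0 is a unit, so no order is
          lost in dividing by it.\<close>
        have u: "inverse (y i0) * y i0 = 1" using y(2) i0(2) by (intro inverse_mult_eq_1) simp
        have eq: "inverse (y i0) * (y i0 * ?g) = ?g" unfolding mult.assoc[symmetric] u by (rule mult_1)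
        have "fps_nth (inverse (y i0) * (y i0 * ?g)) k = 0"
          by (rule fps_low_mult[of "W - n"]) (use low k in auto)
        then show "fps_nth ?g k = 0" unfolding eq .
      qed
      from order_two_points[OF \<Delta> ord0 this] have "(L - n - s0) + (W - n) \<le> n * M + n * (n * e)"
        using \<xi> dd by simp
      then show False using L by (simp add: W_def c0_def)
    qed
  qed
  then show ?thesis by (intro exI[of _ c0]) blast
qed

section \<open>Growth rates and majorants\<close>

text \<open>Size at most that of the \<alpha>-th power of t factorial, up to a geometric factor. The
  final comparison depends on these exponents alone, so exponential constants need no
  tracking.\<close>

definition growth :: "nat \<Rightarrow> (nat \<Rightarrow> real) \<Rightarrow> bool" where
  "growth \<alpha> b \<longleftrightarrow> (\<exists>c\<ge>1. \<forall>t\<ge>1. 0 \<le> b t \<and> b t \<le> c ^ t * real t ^ (\<alpha> * t))"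

lemma growth_mult:
  assumes "growth \<alpha> b" "growth \<beta> b'"
  shows "growth (\<alpha> + \<beta>) (\<lambda>t. b t * b' t)"
proof -
  obtain c where c: "c \<ge> 1" "\<forall>t\<ge>1. 0 \<le> b t \<and> b t \<le> c ^ t * real t ^ (\<alpha> * t)" using assms(1) unfolding growth_def by blast
  obtain c' where c': "c' \<ge> 1" "\<forall>t\<ge>1. 0 \<le> b' t \<and> b' t \<le> c' ^ t * real t ^ (\<beta> * t)" using assms(2) unfolding growth_def by blast
  have "0 \<le> b t * b' t \<and> b t * b' t \<le> (c * c') ^ t * real t ^ ((\<alpha> + \<beta>) * t)" if t: "t \<ge> 1" for t
  proof -
    have "b t * b' t \<le> (c ^ t * real t ^ (\<alpha> * t)) * (c' ^ t * real t ^ (\<beta> * t))"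
      using c(2)[rule_format, OF t] c'(2)[rule_format, OF t] by (intro mult_mono) auto
    also have "\<dots> = (c * c') ^ t * real t ^ ((\<alpha> + \<beta>) * t)" by (simp only: power_mult_distrib power_add distrib_left distrib_right mult_ac)
    finally show ?thesis using c(2)[rule_format, OF t] c'(2)[rule_format, OF t] by simp
  qed
  moreover have "c * c' \<ge> 1" using c(1) c'(1) mult_mono[of 1 c 1 c'] by simp
  ultimately show ?thesis unfolding growth_def by blast
qed

lemma growth_const: "0 \<le> x \<Longrightarrow> growth 0 (\<lambda>t. x)"
  unfolding growth_def
proof (intro exI[of _ "max 1 x"] conjI allI impI)
  fix t :: nat assume t: "1 \<le> t" and x: "0 \<le> x"
  have "x \<le> max 1 x ^ 1" by simp
  also have "\<dots> \<le> max 1 x ^ t" using t by (intro power_increasing) auto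
  finally show "x \<le> max 1 x ^ t * real t ^ (0 * t)" by simp
qed auto

lemma growth_power_t: "0 \<le> x \<Longrightarrow> growth 0 (\<lambda>t. x ^ (m * t + k))"
  unfolding growth_def
proof (intro exI[of _ "max 1 x ^ (m + k)"] conjI allI impI)
  fix t :: nat assume t: "1 \<le> t" and x: "0 \<le> x"
  have "x ^ (m * t + k) \<le> max 1 x ^ (m * t + k)" using x by (intro power_mono) auto
  also have "\<dots> \<le> max 1 x ^ ((m + k) * t)" using t by (intro power_increasing) (auto simp: algebra_simps)
  finally show "x ^ (m * t + k) \<le> (max 1 x ^ (m + k)) ^ t * real t ^ (0 * t)" by (simp add: power_mult)
qed auto

lemma growth_linear: "0 \<le> x \<Longrightarrow> 0 \<le> y \<Longrightarrow> growth 0 (\<lambda>t. x * real t + y)"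
  unfolding growth_def
proof (intro exI[of _ "2 * (x + y + 1)"] conjI allI impI)
  fix t :: nat assume t: "1 \<le> t" and x: "0 \<le> x" "0 \<le> y"
  have p: "(x + y + 1) ^ 1 \<le> (x + y + 1) ^ t" using t x by (intro power_increasing) auto
  have "x * real t + y \<le> x * real t + y * real t" using t x mult_left_mono[of 1 "real t" y] by simp
  also have "\<dots> \<le> (x + y + 1) * real t" by (simp add: algebra_simps)
  also have "\<dots> \<le> (x + y + 1) ^ t * 2 ^ t" using p x by (intro mult_mono) (auto intro: less_imp_le)
  also have "\<dots> = (2 * (x + y + 1)) ^ t * real t ^ (0 * t)" by (simp only: power_mult_distrib) (simp add: mult.commute)
  finally show "x * real t + y \<le> (2 * (x + y + 1)) ^ t * real t ^ (0 * t)" .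
qed auto

lemma growth_power: "growth \<alpha> b \<Longrightarrow> growth (\<alpha> * m) (\<lambda>t. b t ^ m)"
proof (induction m)
  case 0 then show ?case using growth_const[of 1] by simp
next
  case (Suc m) then show ?case using growth_mult[OF Suc.prems Suc.IH[OF Suc.prems]] by simp
qed

text \<open>The part m t of the exponent contributes the growth exponent m; the fixed part k
  contributes a polynomial factor, which is absorbed.\<close>

lemma growth_linear_power:
  assumes "0 \<le> x" "0 \<le> y"
  shows "growth m (\<lambda>t. (x * real t + y) ^ (m * t + k))"
proof -
  have 1: "growth m (\<lambda>t. (x * real t + y) ^ (m * t))"
    unfolding growth_def
  proof (intro exI[of _ "(x + y + 1) ^ m"] conjI allI impI)
    fix t :: nat assume t: "1 \<le> t"
    have "x * real t + y \<le> x * real t + y * real t" using t assms mult_left_mono[of 1 "real t" y] by simp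
    also have "\<dots> \<le> (x + y + 1) * real t" by (simp add: algebra_simps)
    finally have "(x * real t + y) ^ (m * t) \<le> ((x + y + 1) * real t) ^ (m * t)" using assms by (intro power_mono) auto
    then show "(x * real t + y) ^ (m * t) \<le> ((x + y + 1) ^ m) ^ t * real t ^ (m * t)" by (simp add: power_mult_distrib power_mult)
  qed (use assms in auto)
  have 2: "growth 0 (\<lambda>t. (x * real t + y) ^ k)" using growth_power[OF growth_linear[OF assms], of k] by simp
  show ?thesis using growth_mult[OF 1 2] by (simp add: power_add)
qed

lemma growth_le:
  assumes "growth \<alpha> b" "\<And>t. t \<ge> 1 \<Longrightarrow> 0 \<le> b' t" "\<And>t. t \<ge> 1 \<Longrightarrow> b' t \<le> b t"
  shows "growth \<alpha> b'"
  using assms unfolding growth_def by (meson order_trans)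

lemma growth_fact: "growth m (\<lambda>t. fact (m * t))"
proof (rule growth_le[OF growth_linear_power[of "real m" 0 m 0]])
  fix t :: nat
  have "fact (m * t) \<le> real ((m * t) ^ (m * t))" using fact_le_power[of "m * t"] by (metis of_nat_fact of_nat_le_iff order_refl)
  then show "fact (m * t) \<le> (real m * real t + 0) ^ (m * t + 0)" by simp
qed auto

text \<open>A single term of the exponential series gives n^n <= e^n n! with n = m t, so the
  factorial of m t outgrows every exponent \<alpha> below m once t exceeds the geometric
  constant.\<close>

lemma growth_contradiction:
  assumes g: "growth \<alpha> b" and L: "\<alpha> < m" and ev: "\<And>t. t \<ge> t0 \<Longrightarrow> fact (m * t) \<le> b t"
  shows False
proof -
  obtain c where c: "c \<ge> 1" "\<forall>t\<ge>1. 0 \<le> b t \<and> b t \<le> c ^ t * real t ^ (\<alpha> * t)" using g unfolding growth_def by blast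
  \<comment> \<open>Beyond c e^m, so that t^t exceeds (c e^m)^t.\<close>
  define t where "t = max (max 1 t0) (nat \<lceil>c * exp (real m)\<rceil> + 1)"
  have t: "t \<ge> 1" "t \<ge> t0" by (auto simp: t_def)
  have "c * exp (real m) < real (nat \<lceil>c * exp (real m)\<rceil> + 1)" by linarith
  also have "\<dots> \<le> real t" by (simp add: t_def)
  finally have big: "c * exp (real m) < real t" .
  have m: "m > 0" using L by simp
  have "real (m * t) ^ (m * t) / fact (m * t) \<le> exp (real (m * t))"
  proof -
    have "(\<Sum>i\<in>{m * t}. real (m * t) ^ i /\<^sub>R fact i) \<le> suminf (\<lambda>i. real (m * t) ^ i /\<^sub>R fact i)"
      by (rule sum_le_suminf) (use summable_exp_generic[of "real (m * t)"] in auto)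
    then show ?thesis by (simp add: exp_def divide_inverse mult.commute)
  qed
  then have 1: "real (m * t) ^ (m * t) \<le> exp (real (m * t)) * fact (m * t)" by (simp add: field_simps)
  have "real t ^ (m * t) \<le> real (m * t) ^ (m * t)" using m mult_right_mono[of 1 "real m" "real t"] by (intro power_mono) auto
  also note 1
  also have "exp (real (m * t)) * fact (m * t) \<le> exp (real (m * t)) * (c ^ t * real t ^ (\<alpha> * t))"
    using ev[OF t(2)] c(2)[rule_format, OF t(1)] by (intro mult_left_mono) auto
  also have "exp (real (m * t)) = exp (real m) ^ t" by (simp add: exp_of_nat_mult[symmetric] mult.commute)
  finally have 2: "real t ^ (m * t) \<le> (c * exp (real m)) ^ t * real t ^ (\<alpha> * t)" by (simp add: power_mult_distrib mult_ac)
  have "real t ^ ((\<alpha> + 1) * t) \<le> real t ^ (m * t)" using L t(1) by (intro power_increasing mult_right_mono) auto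
  with 2 have "real t ^ t * real t ^ (\<alpha> * t) \<le> (c * exp (real m)) ^ t * real t ^ (\<alpha> * t)" by (simp add: power_add)
  then have "real t ^ t \<le> (c * exp (real m)) ^ t" using t(1) by simp
  moreover have "(c * exp (real m)) ^ t < real t ^ t" using big c(1) t(1) by (intro power_strict_mono) auto
  ultimately show False by simp
qed

text \<open>The sum of the absolute values of the terms on the circle of radius \<rho>, stated for
  partial sums so that convergence need not be supplied. It bounds values inside the circle and is
  stable under polynomial factors and, with a loss of radius, under derivation.\<close>

definition majorised :: "real \<Rightarrow> complex fps \<Rightarrow> real \<Rightarrow> bool" where
  "majorised \<rho> g V \<longleftrightarrow> (\<forall>N. (\<Sum>l<N. cmod (fps_nth g l) * \<rho> ^ l) \<le> V)"

lemma majorised_nonneg: "majorised \<rho> g V \<Longrightarrow> 0 \<le> V"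
  unfolding majorised_def by (drule spec[of _ 0]) simp

lemma majorised_mono: "majorised \<rho> g V \<Longrightarrow> V \<le> V' \<Longrightarrow> majorised \<rho> g V'"
  unfolding majorised_def by (meson order_trans)

lemma majorised_add: "0 \<le> \<rho> \<Longrightarrow> majorised \<rho> f V \<Longrightarrow> majorised \<rho> g V' \<Longrightarrow> majorised \<rho> (f + g) (V + V')"
  unfolding majorised_def
proof
  fix N assume \<rho>: "0 \<le> \<rho>" and 1: "\<forall>N. (\<Sum>l<N. cmod (fps_nth f l) * \<rho> ^ l) \<le> V" "\<forall>N. (\<Sum>l<N. cmod (fps_nth g l) * \<rho> ^ l) \<le> V'"
  have "(\<Sum>l<N. cmod (fps_nth (f + g) l) * \<rho> ^ l) \<le> (\<Sum>l<N. cmod (fps_nth f l) * \<rho> ^ l + cmod (fps_nth g l) * \<rho> ^ l)"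
    using \<rho> by (intro sum_mono) (auto simp: distrib_right[symmetric] intro!: mult_right_mono norm_triangle_ineq)
  also have "\<dots> \<le> V + V'" using 1[THEN spec, of N] by (simp add: sum.distrib)
  finally show "(\<Sum>l<N. cmod (fps_nth (f + g) l) * \<rho> ^ l) \<le> V + V'" .
qed

lemma majorised_const: "majorised \<rho> g V \<Longrightarrow> majorised \<rho> (fps_const c * g) (cmod c * V)"
  unfolding majorised_def by (auto simp: norm_mult mult.assoc sum_distrib_left[symmetric] intro!: mult_left_mono)

lemma majorised_X: "0 \<le> \<rho> \<Longrightarrow> majorised \<rho> g V \<Longrightarrow> majorised \<rho> (fps_X * g) (\<rho> * V)"
  unfolding majorised_def
proof
  fix N assume \<rho>: "0 \<le> \<rho>" and 1: "\<forall>N. (\<Sum>l<N. cmod (fps_nth g l) * \<rho> ^ l) \<le> V"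
  have V: "0 \<le> V" using 1[THEN spec, of 0] by simp
  show "(\<Sum>l<N. cmod (fps_nth (fps_X * g) l) * \<rho> ^ l) \<le> \<rho> * V"
  proof (cases N)
    case 0 then show ?thesis using \<rho> V by simp
  next
    case (Suc N')
    have "(\<Sum>l<N. cmod (fps_nth (fps_X * g) l) * \<rho> ^ l) = (\<Sum>l<N'. \<rho> * (cmod (fps_nth g l) * \<rho> ^ l))"
      unfolding Suc sum.lessThan_Suc_shift by (simp add: mult_ac)
    also have "\<dots> = \<rho> * (\<Sum>l<N'. cmod (fps_nth g l) * \<rho> ^ l)" by (simp add: sum_distrib_left)
    also have "\<dots> \<le> \<rho> * V" using 1 \<rho> by (intro mult_left_mono) auto
    finally show ?thesis .
  qed
qed

text \<open>The constant is uniform in the radius up to \<rho>1, because the radius will change from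
  one derivation to the next.\<close>

lemma majorised_poly: "\<exists>c\<ge>0. \<forall>\<rho> g V. 0 \<le> \<rho> \<longrightarrow> \<rho> \<le> \<rho>1 \<longrightarrow> majorised \<rho> g V \<longrightarrow> majorised \<rho> (fps_of_poly p * g) (c * V)"
proof (induction p)
  case 0
  show ?case by (intro exI[of _ 0]) (auto simp: majorised_def)
next
  case (pCons a p)
  then obtain c where c: "c \<ge> 0" "\<And>\<rho> g V. 0 \<le> \<rho> \<Longrightarrow> \<rho> \<le> \<rho>1 \<Longrightarrow> majorised \<rho> g V \<Longrightarrow> majorised \<rho> (fps_of_poly p * g) (c * V)" by blast
  have "majorised \<rho> (fps_of_poly (pCons a p) * g) ((cmod a + \<bar>\<rho>1\<bar> * c) * V)" if h: "0 \<le> \<rho>" "\<rho> \<le> \<rho>1" "majorised \<rho> g V" for \<rho> g V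
  proof -
    have e: "fps_of_poly (pCons a p) * g = fps_const a * g + fps_X * (fps_of_poly p * g)"
      by (simp add: fps_of_poly_pCons algebra_simps)
    have "majorised \<rho> (fps_of_poly (pCons a p) * g) (cmod a * V + \<rho> * (c * V))"
      unfolding e using h c(2) by (intro majorised_add majorised_const majorised_X) auto
    moreover have "cmod a * V + \<rho> * (c * V) \<le> (cmod a + \<bar>\<rho>1\<bar> * c) * V"
      using h c(1) majorised_nonneg[OF h(3)] by (auto simp: distrib_right mult.assoc intro!: mult_right_mono)
    ultimately show ?thesis by (rule majorised_mono)
  qed
  then show ?case using c(1) by (intro exI[of _ "cmod a + \<bar>\<rho>1\<bar> * c"]) auto
qed

lemma power_gap: "0 \<le> \<rho> \<Longrightarrow> \<rho> \<le> \<rho>' \<Longrightarrow> real (Suc l) * \<rho> ^ l * (\<rho>' - \<rho>) \<le> \<rho>' ^ Suc l"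
proof (induction l)
  case (Suc l)
  have "real (Suc (Suc l)) * \<rho> ^ Suc l * (\<rho>' - \<rho>) = \<rho> * (real (Suc l) * \<rho> ^ l * (\<rho>' - \<rho>)) + \<rho> ^ Suc l * (\<rho>' - \<rho>)"
    by (simp add: algebra_simps)
  also have "\<dots> \<le> \<rho> * \<rho>' ^ Suc l + \<rho>' ^ Suc l * (\<rho>' - \<rho>)"
    using Suc by (intro add_mono mult_left_mono mult_right_mono power_mono) auto
  also have "\<dots> = \<rho>' ^ Suc (Suc l)" by (simp add: algebra_simps)
  finally show ?case .
qed simp

text \<open>Cauchy's inequality for coefficient sums: by \<open>power_gap\<close> the factor l + 1
  that derivation produces is paid for by the gap between the radii.\<close>

lemma majorised_deriv:
  assumes "0 \<le> \<rho>" "\<rho> < \<rho>'" "majorised \<rho>' g V"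
  shows "majorised \<rho> (fps_deriv g) (V / (\<rho>' - \<rho>))"
  unfolding majorised_def
proof
  fix N
  have "(\<Sum>l<N. cmod (fps_nth (fps_deriv g) l) * \<rho> ^ l) * (\<rho>' - \<rho>) = (\<Sum>l<N. cmod (fps_nth g (Suc l)) * (real (Suc l) * \<rho> ^ l * (\<rho>' - \<rho>)))"
    unfolding sum_distrib_right by (rule sum.cong[OF refl]) (simp add: norm_mult mult_ac del: of_nat_Suc)
  also have "\<dots> \<le> (\<Sum>l<N. cmod (fps_nth g (Suc l)) * \<rho>' ^ Suc l)"
    using assms by (intro sum_mono mult_left_mono power_gap) auto
  also have "\<dots> \<le> (\<Sum>l<Suc N. cmod (fps_nth g l) * \<rho>' ^ l)" unfolding sum.lessThan_Suc_shift by simp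
  also have "\<dots> \<le> V" using assms(3) unfolding majorised_def by blast
  finally show "(\<Sum>l<N. cmod (fps_nth (fps_deriv g) l) * \<rho> ^ l) \<le> V / (\<rho>' - \<rho>)" using assms(2) by (simp add: field_simps)
qed

lemma majorised_sums:
  assumes "majorised (cmod \<xi>) g V" "(\<lambda>l. fps_nth g l * \<xi> ^ l) sums v"
  shows "cmod v \<le> V"
proof (rule LIMSEQ_le_const2)
  show "(\<lambda>N. cmod (\<Sum>l<N. fps_nth g l * \<xi> ^ l)) \<longlonglongrightarrow> cmod v"
    using assms(2) unfolding sums_def by (rule tendsto_norm)
  have "cmod (\<Sum>l<N. fps_nth g l * \<xi> ^ l) \<le> V" for N
  proof -
    have "cmod (\<Sum>l<N. fps_nth g l * \<xi> ^ l) \<le> (\<Sum>l<N. cmod (fps_nth g l) * cmod \<xi> ^ l)"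
      by (rule order_trans[OF norm_sum]) (simp add: norm_mult norm_power)
    also have "\<dots> \<le> V" using assms(1) unfolding majorised_def by blast
    finally show ?thesis .
  qed
  then show "\<exists>N. \<forall>n\<ge>N. cmod (\<Sum>l<n. fps_nth g l * \<xi> ^ l) \<le> V" by blast
qed

lemma fps_poly_sums:
  fixes f :: "complex fps"
  assumes "(\<lambda>l. fps_nth f l * \<xi> ^ l) sums v"
  shows "(\<lambda>l. fps_nth (fps_of_poly p * f) l * \<xi> ^ l) sums (poly p \<xi> * v)"
proof (induction p)
  case 0 then show ?case by simp
next
  case (pCons a p)
  have e: "fps_of_poly (pCons a p) * f = fps_const a * f + fps_X * (fps_of_poly p * f)"
    by (simp add: fps_of_poly_pCons algebra_simps)
  have 1: "(\<lambda>l. fps_nth (fps_const a * f) l * \<xi> ^ l) sums (a * v)"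
    using sums_mult[OF assms, of a] by (simp add: mult.assoc)
  have "(\<lambda>l. \<xi> * (fps_nth (fps_of_poly p * f) l * \<xi> ^ l)) sums (\<xi> * (poly p \<xi> * v))"
    by (rule sums_mult[OF pCons.IH])
  then have "(\<lambda>l. fps_nth (fps_X * (fps_of_poly p * f)) (Suc l) * \<xi> ^ Suc l) sums (\<xi> * (poly p \<xi> * v))"
    by (simp add: mult_ac)
  then have 2: "(\<lambda>l. fps_nth (fps_X * (fps_of_poly p * f)) l * \<xi> ^ l) sums (\<xi> * (poly p \<xi> * v))"
    by (subst (asm) sums_Suc_iff) simp
  show ?case using sums_add[OF 1 2] unfolding e by (simp add: algebra_simps)
qed

section \<open>Sizes of determinants and of polynomials over K\<close>

context sized_field begin

lemmas KS = is_subringD[OF number_field_subring[OF K]]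
lemmas Ksum = is_subring_sum[OF number_field_subring[OF K]]
lemmas Krat = number_field_of_rat[OF K]
lemmas Knat = is_subring_of_nat[OF number_field_subring[OF K]]
lemmas RS = is_subringD[OF R_subring]
lemmas Rnat = is_subring_of_nat[OF R_subring]

lemma RK: "x \<in> R \<Longrightarrow> x \<in> K" using R_sub by blast

lemma nrm_0 [simp]: "nrm 0 = 0" using nrm_scale[OF KS(1), of 0] by simp

lemma nrm_nat: "x \<in> K \<Longrightarrow> nrm (of_nat m * x) = real m * nrm x"
  using nrm_scale[of x "of_nat m"] by simp

lemma nrm_sum: "(\<And>i. i \<in> I \<Longrightarrow> f i \<in> K) \<Longrightarrow> nrm (sum f I) \<le> (\<Sum>i\<in>I. nrm (f i))"
proof (induction I rule: infinite_finite_induct)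
  case (insert i I)
  then have "nrm (f i + sum f I) \<le> nrm (f i) + nrm (sum f I)" by (intro nrm_add Ksum) auto
  then show ?case using insert by fastforce
qed auto

lemma nrm_prod: "(\<And>i. i \<in> I \<Longrightarrow> f i \<in> K) \<Longrightarrow> nrm (prod f I) \<le> nrm 1 * (\<Prod>i\<in>I. nrm (f i))"
proof (induction I rule: infinite_finite_induct)
  case (insert i I)
  have "nrm (f i * prod f I) \<le> nrm (f i) * nrm (prod f I)"
    using insert by (intro nrm_mult is_subring_prod[OF number_field_subring[OF K]]) auto
  also have "\<dots> \<le> nrm (f i) * (nrm 1 * (\<Prod>i\<in>I. nrm (f i)))" using insert by (intro mult_left_mono nrm_nonneg) auto
  finally show ?case using insert by (simp add: mult_ac)
qed auto

lemma nrm_one: "1 \<le> nrm 1" using cmod_le_nrm[OF KS(2)] by simp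

lemma nrm_fdet_le:
  assumes "\<And>i j. i < n \<Longrightarrow> j < n \<Longrightarrow> M i j \<in> K \<and> nrm (M i j) \<le> b"
  shows "nrm (fdet n M) \<le> nrm 1 * (fact n * b ^ n)"
proof -
  have sg: "nrm (signof p * x) = nrm x" if "x \<in> K" for p :: "nat \<Rightarrow> nat" and x
    using nrm_scale[OF that, of "-1"] by (simp add: sign_def)
  have pr: "(\<Prod>i = 0..<n. M i (p i)) \<in> K" if p: "p permutes {0..<n}" for p
    by (rule is_subring_prod[OF number_field_subring[OF K]]) (use assms permutes_less_upt[OF p] in auto)
  have "nrm (fdet n M) \<le> (\<Sum>p | p permutes {0..<n}. nrm (signof p * (\<Prod>i = 0..<n. M i (p i))))"
    unfolding fdet_sum
    by (rule nrm_sum) (use pr KS in \<open>auto simp: sign_def\<close>)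
  also have "\<dots> \<le> (\<Sum>p | p permutes {0..<n}. nrm 1 * b ^ n)"
  proof (rule sum_mono)
    fix p assume "p \<in> {p. p permutes {0..<n}}"
    then have p: "p permutes {0..<n}" by simp
    have "nrm (signof p * (\<Prod>i = 0..<n. M i (p i))) = nrm (\<Prod>i = 0..<n. M i (p i))" by (rule sg[OF pr[OF p]])
    also have "\<dots> \<le> nrm 1 * (\<Prod>i = 0..<n. nrm (M i (p i)))"
      by (rule nrm_prod) (use assms permutes_less_upt[OF p] in auto)
    also have "\<dots> \<le> nrm 1 * (\<Prod>i = 0..<n. b)"
      by (intro mult_left_mono prod_mono nrm_nonneg) (use assms permutes_less_upt[OF p] nrm_nonneg in auto)
    finally show "nrm (signof p * (\<Prod>i = 0..<n. M i (p i))) \<le> nrm 1 * b ^ n" by simp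
  qed
  also have "\<dots> = nrm 1 * (fact n * b ^ n)" by (simp add: card_permutations)
  finally show ?thesis .
qed

definition K_poly :: "complex poly \<Rightarrow> bool" where "K_poly p \<longleftrightarrow> (\<forall>i. coeff p i \<in> K)"
definition R_poly :: "complex poly \<Rightarrow> bool" where "R_poly p \<longleftrightarrow> (\<forall>i. coeff p i \<in> R)"

lemma R_K_poly: "R_poly p \<Longrightarrow> K_poly p" unfolding R_poly_def K_poly_def using RK by blast

lemma coeff_subring:
  assumes S: "is_subring (S :: complex set)"
  shows "is_subring {p. \<forall>i. coeff p i \<in> S}"
  unfolding is_subring_def
proof (intro conjI ballI)
  show "0 \<in> {p. \<forall>i. coeff p i \<in> S}" using is_subringD(1)[OF S] by simp
  show "1 \<in> {p. \<forall>i. coeff p i \<in> S}" using is_subringD(1,2)[OF S] by (auto simp: coeff_1)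
  fix x y assume "x \<in> {p. \<forall>i. coeff p i \<in> S}" "y \<in> {p. \<forall>i. coeff p i \<in> S}"
  then show "x + y \<in> {p. \<forall>i. coeff p i \<in> S}" "- x \<in> {p. \<forall>i. coeff p i \<in> S}"
    "x * y \<in> {p. \<forall>i. coeff p i \<in> S}"
    by (auto simp: coeff_mult intro!: is_subring_sum[OF S] is_subringD[OF S])
qed

lemmas K_poly_subring = coeff_subring[OF number_field_subring[OF K], folded K_poly_def]
lemmas R_poly_subring = coeff_subring[OF R_subring, folded R_poly_def]

lemma K_poly_pderiv: "K_poly p \<Longrightarrow> K_poly (pderiv p)"
  unfolding K_poly_def by (simp add: coeff_pderiv) (metis KS(4) Knat of_nat_Suc)

lemma R_poly_pderiv: "R_poly p \<Longrightarrow> R_poly (pderiv p)"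
  unfolding R_poly_def by (simp add: coeff_pderiv) (metis RS(4) Rnat of_nat_Suc)

text \<open>Summing the sizes of the coefficients, instead of taking their maximum, makes the size
  of a product at most the product of the sizes, with no factor from the degrees.\<close>

definition pnorm :: "complex poly \<Rightarrow> real" where "pnorm p = (\<Sum>c\<leftarrow>coeffs p. nrm c)"

lemma pnorm_0 [simp]: "pnorm 0 = 0" by (simp add: pnorm_def)
lemma pnorm_pCons [simp]: "pnorm (pCons a p) = nrm a + pnorm p"
  by (cases "a = 0 \<and> p = 0") (auto simp: pnorm_def cCons_def)
lemma pnorm_nonneg: "0 \<le> pnorm p" unfolding pnorm_def by (auto intro!: sum_list_nonneg nrm_nonneg)
lemma K_poly_pCons [simp]: "K_poly (pCons a p) \<longleftrightarrow> a \<in> K \<and> K_poly p"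
  unfolding K_poly_def by (auto simp: coeff_pCons split: nat.splits)

lemma pnorm_add: "K_poly p \<Longrightarrow> K_poly q \<Longrightarrow> pnorm (p + q) \<le> pnorm p + pnorm q"
proof (induction p q rule: poly_induct2)
  case (pCons a p b q)
  then show ?case using nrm_add[of a b] by simp
qed simp

lemma pnorm_smult: "a \<in> K \<Longrightarrow> K_poly p \<Longrightarrow> pnorm (Polynomial.smult a p) \<le> nrm a * pnorm p"
proof (induction p)
  case (pCons b p)
  then show ?case using nrm_mult[of a b] by (simp add: distrib_left)
qed simp

lemma pnorm_mult: "K_poly p \<Longrightarrow> K_poly q \<Longrightarrow> pnorm (p * q) \<le> pnorm p * pnorm q"
proof (induction p)
  case (pCons a p)
  have k: "K_poly (Polynomial.smult a q)" "K_poly (pCons 0 (p * q))"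
    using pCons.prems is_subringD(4)[OF K_poly_subring, of p q] KS unfolding K_poly_def by (auto simp: coeff_pCons split: nat.splits)
  have "pnorm (pCons a p * q) \<le> pnorm (Polynomial.smult a q) + pnorm (pCons 0 (p * q))"
    unfolding mult_pCons_left by (rule pnorm_add[OF k])
  also have "\<dots> \<le> nrm a * pnorm q + pnorm p * pnorm q" using pnorm_smult[of a q] pCons by (intro add_mono) auto
  finally show ?case by (simp add: distrib_right)
qed simp

lemma pnorm_sum: "(\<And>i. i \<in> I \<Longrightarrow> K_poly (f i)) \<Longrightarrow> pnorm (sum f I) \<le> (\<Sum>i\<in>I. pnorm (f i))"
proof (induction I rule: infinite_finite_induct)
  case (insert i I)
  have "K_poly (sum f I)" using is_subring_sum[OF K_poly_subring, of I f] insert by auto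
  then have "pnorm (f i + sum f I) \<le> pnorm (f i) + pnorm (sum f I)" using insert by (intro pnorm_add) auto
  then show ?case using insert by fastforce
qed auto

lemma pnorm_pderiv: "K_poly p \<Longrightarrow> pnorm (pderiv p) \<le> real (degree p) * pnorm p"
proof (induction p)
  case (pCons a p)
  show ?case
  proof (cases "p = 0")
    case True then show ?thesis by (simp add: pderiv_pCons)
  next
    case False
    have "pnorm (pderiv (pCons a p)) \<le> pnorm p + pnorm (pCons 0 (pderiv p))"
      unfolding pderiv_pCons by (rule pnorm_add) (use pCons.prems K_poly_pderiv KS in auto)
    also have "\<dots> \<le> pnorm p + real (degree p) * pnorm p" using pCons by simp
    also have "\<dots> \<le> real (degree (pCons a p)) * pnorm (pCons a p)"
      using False nrm_nonneg[of a] pnorm_nonneg[of p] by (simp add: algebra_simps)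
    finally show ?thesis .
  qed
qed simp

lemma nrm_poly_le:
  assumes x: "x \<in> K" "nrm x \<le> X" "1 \<le> X"
  shows "K_poly p \<Longrightarrow> degree p \<le> D \<Longrightarrow> nrm (poly p x) \<le> pnorm p * X ^ D"
proof (induction p arbitrary: D)
  case (pCons a p)
  have Kp: "poly p x \<in> K" if "K_poly p" for p
    using that x is_subring_power[OF number_field_subring[OF K]] unfolding poly_altdef K_poly_def by (intro Ksum KS(4)) auto
  have "nrm (poly (pCons a p) x) \<le> nrm a + nrm (x * poly p x)"
    using nrm_add[of a "x * poly p x"] pCons.prems Kp x KS by simp
  also have "\<dots> \<le> nrm a * X ^ D + pnorm p * X ^ D"
  proof (rule add_mono)
    show "nrm a \<le> nrm a * X ^ D" using mult_left_mono[of 1 "X ^ D" "nrm a"] x(3) nrm_nonneg by simp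
    show "nrm (x * poly p x) \<le> pnorm p * X ^ D"
    proof (cases "p = 0")
      case False
      then obtain D' where D: "D = Suc D'" "degree p \<le> D'" using pCons.prems(2) by (cases D) auto
      have "nrm (x * poly p x) \<le> nrm x * nrm (poly p x)" using pCons.prems Kp x by (intro nrm_mult) auto
      also have "\<dots> \<le> X * (pnorm p * X ^ D')" using pCons.IH[OF _ D(2)] pCons.prems x by (intro mult_mono nrm_nonneg) auto
      finally show ?thesis by (simp add: D mult_ac)
    qed simp
  qed
  finally show ?case by (simp add: distrib_right)
qed simp

lemma poly_denominator:
  assumes "R_poly p" "of_nat b * x \<in> R" "degree p \<le> D"
  shows "of_nat b ^ D * poly p x \<in> R"
proof -
  have "of_nat b ^ D * poly p x = (\<Sum>i\<le>degree p. coeff p i * (of_nat b ^ (D - i) * (of_nat b * x) ^ i))"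
    unfolding poly_altdef sum_distrib_left
  proof (rule sum.cong[OF refl])
    fix i assume "i \<in> {..degree p}"
    then have "D = (D - i) + i" using assms(3) by simp
    then have "of_nat b ^ D = (of_nat b ^ (D - i) * of_nat b ^ i :: complex)" by (metis power_add)
    then show "of_nat b ^ D * (coeff p i * x ^ i) = coeff p i * (of_nat b ^ (D - i) * (of_nat b * x) ^ i)"
      by (simp add: power_mult_distrib mult_ac)
  qed
  also have "\<dots> \<in> R" using assms Rnat is_subring_power[OF R_subring]
    by (intro is_subring_sum[OF R_subring] RS(4)) (auto simp: R_poly_def)
  finally show ?thesis .
qed

text \<open>Per step, the derivative term multiplies the size by at most H D, with D from the
  degree, and each of the n products with entries of B by at most H.\<close>

lemma rows_pnorm:
  assumes T: "K_poly T" "pnorm T \<le> H" and B: "\<And>i j. i < n \<Longrightarrow> j < n \<Longrightarrow> K_poly (B i j) \<and> pnorm (B i j) \<le> H" and H: "H \<ge> 0"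
    and P: "\<And>i. i < n \<Longrightarrow> K_poly (P i) \<and> pnorm (P i) \<le> Q"
    and d: "\<And>k i. k < k0 \<Longrightarrow> i < n \<Longrightarrow> degree (rows n T B P k i) \<le> D"
  shows "k \<le> k0 \<Longrightarrow> i < n \<Longrightarrow> pnorm (rows n T B P k i) \<le> Q * (H * (real D + real n)) ^ k"
proof (induction k arbitrary: i)
  case (Suc k)
  let ?r = "rows n T B P k" and ?b = "Q * (H * (real D + real n)) ^ k"
  have rK: "K_poly (?r i)" if "i < n" for i
    using rows_in_subring[OF K_poly_subring, of T n B P i k] T B P that K_poly_pderiv by auto
  have IH: "pnorm (?r i) \<le> ?b" if "i < n" for i using Suc.IH[of i] Suc.prems that by simp
  have b0: "0 \<le> ?b" using IH[OF Suc.prems(2)] pnorm_nonneg order_trans by blast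
  have "pnorm (rows n T B P (Suc k) i) \<le> pnorm (T * pderiv (?r i)) + pnorm (\<Sum>j<n. ?r j * B j i)"
    unfolding rows_Suc
  proof (rule pnorm_add)
    show "K_poly (T * pderiv (?r i))" using T rK Suc.prems K_poly_pderiv is_subringD(4)[OF K_poly_subring] by auto
    have "K_poly (?r j * B j i)" if "j \<in> {..<n}" for j
      using B rK Suc.prems that is_subringD(4)[OF K_poly_subring, of "?r j" "B j i"] by auto
    then show "K_poly (\<Sum>j<n. ?r j * B j i)"
      using is_subring_sum[OF K_poly_subring, of "{..<n}" "\<lambda>j. ?r j * B j i"] by auto
  qed
  also have "pnorm (T * pderiv (?r i)) \<le> H * (real D * ?b)"
  proof -
    have "pnorm (T * pderiv (?r i)) \<le> pnorm T * pnorm (pderiv (?r i))" using T rK Suc.prems K_poly_pderiv by (intro pnorm_mult) auto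
    also have "\<dots> \<le> H * (real (degree (?r i)) * pnorm (?r i))" using T H rK Suc.prems by (intro mult_mono pnorm_pderiv pnorm_nonneg) auto
    also have "\<dots> \<le> H * (real D * ?b)" using IH d[of k i] H Suc.prems by (intro mult_left_mono mult_mono) (auto simp: pnorm_nonneg)
    finally show ?thesis .
  qed
  also have "pnorm (\<Sum>j<n. ?r j * B j i) \<le> (\<Sum>j<n. ?b * H)"
  proof -
    have "pnorm (\<Sum>j<n. ?r j * B j i) \<le> (\<Sum>j<n. pnorm (?r j * B j i))"
      using B rK Suc.prems is_subringD(4)[OF K_poly_subring] by (intro pnorm_sum) auto
    also have "\<dots> \<le> (\<Sum>j<n. ?b * H)"
    proof (rule sum_mono)
      fix j assume "j \<in> {..<n}"
      then have j: "j < n" by simp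
      have "pnorm (?r j * B j i) \<le> pnorm (?r j) * pnorm (B j i)" using B rK Suc.prems j by (intro pnorm_mult) auto
      also have "\<dots> \<le> ?b * H" using IH[OF j] B[OF j Suc.prems(2)] b0 by (intro mult_mono pnorm_nonneg) auto
      finally show "pnorm (?r j * B j i) \<le> ?b * H" .
    qed
    finally show ?thesis .
  qed
  finally show ?case by (simp add: algebra_simps)
qed (use P in auto)

end

section \<open>Small linear forms in values of E-functions\<close>

text \<open>The coefficients of n polynomials of length M are numbered as u = i M + k; quotient and
  remainder by M undo the numbering.\<close>

lemma sum_div_mod:
  fixes F :: "nat \<Rightarrow> nat \<Rightarrow> 'a::comm_monoid_add"
  assumes "M > 0"
  shows "(\<Sum>u<n * M. F (u div M) (u mod M)) = (\<Sum>i<n. \<Sum>k<M. F i k)"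
proof -
  have "(\<Sum>u<n * M. F (u div M) (u mod M)) = (\<Sum>i<n. \<Sum>u\<in>{i * M..<i * M + M}. F (u div M) (u mod M))"
    by (rule sum.nat_group[symmetric])
  also have "\<dots> = (\<Sum>i<n. \<Sum>k<M. F i k)"
  proof (rule sum.cong[OF refl])
    fix i
    have "(\<Sum>u\<in>{0 + i * M..<M + i * M}. F (u div M) (u mod M)) = (\<Sum>k\<in>{0..<M}. F ((k + i * M) div M) ((k + i * M) mod M))"
      by (rule sum.shift_bounds_nat_ivl)
    also have "\<dots> = (\<Sum>k\<in>{0..<M}. F i k)" by (rule sum.cong[OF refl]) (use assms in auto)
    finally show "(\<Sum>u\<in>{i * M..<i * M + M}. F (u div M) (u mod M)) = (\<Sum>k<M. F i k)"
      by (simp add: lessThan_atLeast0 add.commute)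
  qed
  finally show ?thesis .
qed

text \<open>From L! j! <= (j + L)!, as a binomial coefficient is at least 1. The factor 1/L! is the
  source of the smallness of the linear forms.\<close>

lemma exp_tail_le:
  fixes z :: real
  assumes "z \<ge> 0"
  shows "(\<Sum>l<N. if l < L then 0 else z ^ l / fact l) \<le> z ^ L / fact L * exp z"
proof (cases "N \<le> L")
  case True
  then have "(\<Sum>l<N. if l < L then 0 else z ^ l / fact l) = 0" by (intro sum.neutral) auto
  then show ?thesis using assms by simp
next
  case False
  have "(\<Sum>l<N. if l < L then 0 else z ^ l / fact l) = (\<Sum>l\<in>{0 + L..<(N - L) + L}. z ^ l / fact l)"
    using False by (intro sum.mono_neutral_cong_right) auto
  also have "\<dots> = (\<Sum>j\<in>{0..<N - L}. z ^ (j + L) / fact (j + L))" by (rule sum.shift_bounds_nat_ivl)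
  also have "\<dots> \<le> (\<Sum>j\<in>{0..<N - L}. z ^ L / fact L * (z ^ j /\<^sub>R fact j))"
  proof (rule sum_mono)
    fix j
    have "fact L * fact j * ((j + L) choose L) = (fact (j + L) :: nat)" using binomial_fact_lemma[of L "j + L"] by simp
    moreover have "(j + L) choose L \<ge> 1" using zero_less_binomial[of L "j + L"] by (simp add: Suc_le_eq)
    ultimately have "fact L * fact j \<le> (fact (j + L) :: nat)" by (metis mult_le_mono2 mult.right_neutral)
    then have "real (fact L * fact j) \<le> real (fact (j + L))" by (simp only: of_nat_le_iff)
    then have "fact L * fact j \<le> (fact (j + L) :: real)" by (simp add: of_nat_fact)
    then have "z ^ (j + L) / fact (j + L) \<le> z ^ (j + L) / (fact L * fact j)"
      using assms by (intro divide_left_mono) auto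
    then show "z ^ (j + L) / fact (j + L) \<le> z ^ L / fact L * (z ^ j /\<^sub>R fact j)"
      by (simp add: power_add divide_inverse mult_ac)
  qed
  also have "\<dots> = z ^ L / fact L * (\<Sum>j\<in>{0..<N - L}. z ^ j /\<^sub>R fact j)" by (rule sum_distrib_left[symmetric])
  also have "\<dots> \<le> z ^ L / fact L * exp z"
    unfolding exp_def using assms by (intro mult_left_mono sum_le_suminf summable_exp_generic) auto
  finally show ?thesis .
qed

lemma majorised_radius_mono: "0 \<le> \<rho> \<Longrightarrow> \<rho> \<le> \<rho>' \<Longrightarrow> majorised \<rho>' g V \<Longrightarrow> majorised \<rho> g V"
  unfolding majorised_def
proof
  fix N assume h: "0 \<le> \<rho>" "\<rho> \<le> \<rho>'" "\<forall>N. (\<Sum>l<N. cmod (fps_nth g l) * \<rho>' ^ l) \<le> V"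
  have "(\<Sum>l<N. cmod (fps_nth g l) * \<rho> ^ l) \<le> (\<Sum>l<N. cmod (fps_nth g l) * \<rho>' ^ l)"
    using h by (intro sum_mono mult_left_mono power_mono) auto
  then show "(\<Sum>l<N. cmod (fps_nth g l) * \<rho> ^ l) \<le> V" using h(3) order_trans by blast
qed

text \<open>Cauchy estimates with a radius that shrinks by $1/k_0$ at every step.\<close>
lemma iterated_forms_majorised:
  assumes T: "\<And>\<rho> g V. 0 \<le> \<rho> \<Longrightarrow> \<rho> \<le> r + 1 \<Longrightarrow> majorised \<rho> g V \<Longrightarrow> majorised \<rho> (fps_of_poly T * g) (c * V)"
    and r: "0 \<le> r" and k0: "0 < k0" and G: "\<And>k. G (Suc k) = fps_of_poly T * fps_deriv (G k)" and G0: "majorised (r + 1) (G 0) V"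
  shows "k \<le> k0 \<Longrightarrow> majorised (r + 1 - real k / real k0) (G k) (V * (c * real k0) ^ k)"
proof (induction k)
  case 0 then show ?case using G0 by simp
next
  case (Suc k)
  have a: "real k / real k0 \<le> 1" "real (Suc k) / real k0 \<le> 1" "real (Suc k) / real k0 - real k / real k0 = 1 / real k0"
    using Suc.prems k0 by (auto simp: divide_simps)
  have "majorised (r + 1 - real (Suc k) / real k0) (fps_deriv (G k)) ((V * (c * real k0) ^ k) / ((r + 1 - real k / real k0) - (r + 1 - real (Suc k) / real k0)))"
  proof (rule majorised_deriv)
    show "0 \<le> r + 1 - real (Suc k) / real k0" using a(2) r by linarith
    have "0 < 1 / real k0" using k0 by simp
    then show "r + 1 - real (Suc k) / real k0 < r + 1 - real k / real k0" using a(3) by linarith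
    show "majorised (r + 1 - real k / real k0) (G k) (V * (c * real k0) ^ k)" using Suc by simp
  qed
  moreover have "(V * (c * real k0) ^ k) / ((r + 1 - real k / real k0) - (r + 1 - real (Suc k) / real k0)) = V * (c * real k0) ^ k * real k0"
  proof -
    have "(r + 1 - real k / real k0) - (r + 1 - real (Suc k) / real k0) = 1 / real k0" using a(3) by simp
    then show ?thesis by simp
  qed
  ultimately have "majorised (r + 1 - real (Suc k) / real k0) (fps_deriv (G k)) (V * (c * real k0) ^ k * real k0)" by simp
  then have "majorised (r + 1 - real (Suc k) / real k0) (fps_of_poly T * fps_deriv (G k)) (c * (V * (c * real k0) ^ k * real k0))"
  proof (intro T)
    show "0 \<le> r + 1 - real (Suc k) / real k0" using a(2) r by linarith
    show "r + 1 - real (Suc k) / real k0 \<le> r + 1" by simp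
  qed
  then show ?case unfolding G by (simp add: mult_ac)
qed

section \<open>The dimension bound for an independent system\<close>

context sized_field begin

text \<open>The conditions on the coefficients of an E-function, in terms of \<open>nrm\<close> and
  the order R. The exponent l + 1 in place of l leaves room for constant factors already at l =
  0.\<close>

definition E_seq :: "(nat \<Rightarrow> complex) \<Rightarrow> real \<Rightarrow> bool" where
  "E_seq a C \<longleftrightarrow> 1 \<le> C \<and> (\<forall>l. a l \<in> K \<and> nrm (a l) \<le> C ^ Suc l) \<and>
     (\<forall>l. \<exists>d::nat. d > 0 \<and> real d \<le> C ^ Suc l \<and> (\<forall>k\<le>l. of_nat d * a k \<in> R))"

lemma pnorm_monom: "pnorm (monom c k) = nrm c"
  by (induction k) (simp_all add: monom_0 monom_Suc)

text \<open>The n values are expressed by s numbers y through an injective matrix w. The forms in y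
  have coefficients of growth exponent q + 1 and values of growth exponent q + 1 divided by L!. A
  nonzero determinant of s of them has size of exponent (q + 1) s, and its absolute value carries
  the same exponent divided by L!. The Liouville inequality then requires (q + 1) s h >= n q - 1,
  which fails for the chosen q unless n <= s h.\<close>

theorem linear_forms_bound:
  fixes f :: "nat \<Rightarrow> complex fps" and a :: "nat \<Rightarrow> nat \<Rightarrow> complex" and w :: "nat \<Rightarrow> nat \<Rightarrow> complex"
  assumes n: "n > 0" and s: "s > 0" and \<xi>K: "\<xi> \<in> K" and \<xi>: "\<xi> \<noteq> 0" and T\<xi>: "poly T \<xi> \<noteq> 0"
    and TR: "R_poly T" and BR: "\<And>i j. i < n \<Longrightarrow> j < n \<Longrightarrow> R_poly (B i j)"
    and seq: "\<And>i. i < n \<Longrightarrow> E_seq (a i) C" and fa: "\<And>i. i < n \<Longrightarrow> f i = Abs_fps (\<lambda>l. a i l / fact l)"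
    and sys: "\<And>i. i < n \<Longrightarrow> fps_of_poly T * fps_deriv (f i) = (\<Sum>j<n. fps_of_poly (B i j) * f j)"
    and ind: "indep_over (fps_of_poly ` Collect K_poly) {..<n} f"
    and val: "\<And>i. i < n \<Longrightarrow> (\<lambda>l. fps_nth (f i) l * \<xi> ^ l) sums val i"
    and wR: "\<And>i k. i < n \<Longrightarrow> k < s \<Longrightarrow> w i k \<in> R" and d\<mu>: "d\<mu> > (0::nat)"
    and wy: "\<And>i. i < n \<Longrightarrow> of_nat d\<mu> * val i = (\<Sum>k<s. w i k * y k)"
    and wker: "\<And>x. (\<And>i. i < n \<Longrightarrow> (\<Sum>k<s. w i k * x k) = 0) \<Longrightarrow> \<forall>k<s. x k = 0"
    and y: "\<exists>k<s. y k \<noteq> 0"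
  shows "n \<le> s * h"
proof (rule ccontr)
  assume "\<not> n \<le> s * h"
  then have nsh: "n \<ge> s * h + 1" by simp
  \<comment> \<open>From (q + 1) s h < n q - 1, which for n = s h + 1 amounts to q > s h +
    1.\<close>
  define q where "q = s * h + 2"
  have q: "q \<ge> 2" by (simp add: q_def)
  obtain ky where ky: "ky < s" "y ky \<noteq> 0" using y by blast
  have C1: "C \<ge> 1" using seq[OF n] by (simp add: E_seq_def)
  have aK: "a i l \<in> K" "nrm (a i l) \<le> C ^ Suc l" if "i < n" for i l using seq[OF that] by (auto simp: E_seq_def)
  define e where "e = degree T + (\<Sum>i<n. \<Sum>j<n. degree (B i j))"
  have eT: "degree T \<le> e" by (simp add: e_def)
  have eB: "degree (B i j) \<le> e" if "i < n" "j < n" for i j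
  proof -
    have "degree (B i j) \<le> (\<Sum>j<n. degree (B i j))" by (rule member_le_sum) (use that in auto)
    also have "\<dots> \<le> (\<Sum>i<n. \<Sum>j<n. degree (B i j))"
      by (rule member_le_sum[where f = "\<lambda>i. \<Sum>j<n. degree (B i j)"]) (use that in auto)
    finally show ?thesis by (simp add: e_def)
  qed
  define H where "H = 1 + pnorm T + (\<Sum>i<n. \<Sum>j<n. pnorm (B i j))"
  have sB: "0 \<le> (\<Sum>i<n. \<Sum>j<n. pnorm (B i j))" by (intro sum_nonneg pnorm_nonneg)
  have H1: "H \<ge> 1" using sB pnorm_nonneg[of T] by (simp add: H_def)
  have HT: "pnorm T \<le> H" using sB by (simp add: H_def)
  have HB: "pnorm (B i j) \<le> H" if "i < n" "j < n" for i j
  proof -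
    have "pnorm (B i j) \<le> (\<Sum>j<n. pnorm (B i j))" by (rule member_le_sum) (use that pnorm_nonneg in auto)
    also have "\<dots> \<le> (\<Sum>i<n. \<Sum>j<n. pnorm (B i j))"
      by (rule member_le_sum[where f = "\<lambda>i. \<Sum>j<n. pnorm (B i j)"]) (use that in \<open>auto intro!: sum_nonneg pnorm_nonneg\<close>)
    finally show ?thesis using pnorm_nonneg[of T] by (simp add: H_def)
  qed
  obtain c0 where c0: "\<forall>P M L. (\<forall>i<n. P i \<in> Collect K_poly \<and> degree (P i) \<le> M) \<longrightarrow> (\<exists>i<n. P i \<noteq> 0) \<longrightarrow>
     (\<forall>k<L. fps_nth (\<Sum>i<n. fps_of_poly (P i) * f i) k = 0) \<longrightarrow> (n - 1) * M + c0 < L \<longrightarrow>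
     (\<forall>v. (\<forall>k<n * M + c0 - L. (\<Sum>i<n. poly (rows n T B P k i) \<xi> * v i) = 0) \<longrightarrow> (\<forall>i<n. v i = 0))"
  proof -
    have "\<exists>c0. \<forall>P M L. (\<forall>i<n. P i \<in> Collect K_poly \<and> degree (P i) \<le> M) \<longrightarrow> (\<exists>i<n. P i \<noteq> 0) \<longrightarrow>
     (\<forall>k<L. fps_nth (\<Sum>i<n. fps_of_poly (P i) * f i) k = 0) \<longrightarrow> (n - 1) * M + c0 < L \<longrightarrow>
     (\<forall>v. (\<forall>k<n * M + c0 - L. (\<Sum>i<n. poly (rows n T B P k i) \<xi> * v i) = 0) \<longrightarrow> (\<forall>i<n. v i = 0))"
      by (rule zero_estimate[OF n T\<xi> \<xi> sys K_poly_subring _ _ _ ind])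
         (use TR BR R_K_poly K_poly_pderiv in auto)
    then show ?thesis using that by (elim exE)
  qed
  obtain csg where csg: "csg \<ge> 1" "\<forall>L U q A a. 1 \<le> a \<longrightarrow> 1 \<le> q \<longrightarrow> L < U \<longrightarrow> L \<le> q * (U - L) \<longrightarrow>
    (\<forall>l<L. \<forall>u<U. A l u \<in> R \<and> nrm (A l u) \<le> a) \<longrightarrow>
    (\<exists>x. (\<forall>u<U. x u \<in> R) \<and> (\<exists>u<U. x u \<noteq> 0) \<and> (\<forall>u<U. nrm (x u) \<le> csg * (csg * real U * a) ^ q) \<and>
      (\<forall>l<L. (\<Sum>u<U. A l u * x u) = 0))" using siegel by (elim exE conjE)
  obtain cl where cl: "cl \<ge> 1" "\<forall>x\<in>R. x \<noteq> 0 \<longrightarrow> 1 \<le> cl * cmod x * nrm x ^ (h - 1)" using liouville by blast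
  define r where "r = cmod \<xi>"
  obtain cT0 where cT0: "cT0 \<ge> 0" "\<forall>\<rho> g V. 0 \<le> \<rho> \<longrightarrow> \<rho> \<le> r + 1 \<longrightarrow> majorised \<rho> g V \<longrightarrow> majorised \<rho> (fps_of_poly T * g) (cT0 * V)"
    using majorised_poly[of "r + 1" T] by blast
  \<comment> \<open>The added 1 keeps the base \<open>cT * real k0\<close> at least 1, so that its
    powers increase with the exponent.\<close>
  define cT where "cT = cT0 + 1"
  have cT1: "cT \<ge> 1" using cT0 by (simp add: cT_def)
  have cT: "majorised \<rho> (fps_of_poly T * g) (cT * V)" if "0 \<le> \<rho>" "\<rho> \<le> r + 1" "majorised \<rho> g V" for \<rho> g V
  proof -
    have "majorised \<rho> (fps_of_poly T * g) (cT0 * V)" using cT0(2) that by blast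
    moreover have "cT0 * V \<le> cT * V" unfolding cT_def using majorised_nonneg[OF that(3)] by (simp add: distrib_right)
    ultimately show ?thesis by (rule majorised_mono)
  qed
  obtain b where b: "b > 0" "of_nat b * \<xi> \<in> R" using denominator[OF \<xi>K] by blast
  define X where "X = max 1 (nrm \<xi>)"
  have X: "X \<ge> 1" "nrm \<xi> \<le> X" by (auto simp: X_def)
  define Wm where "Wm = (\<Sum>i<n. \<Sum>k<s. nrm (w i k))"
  have Wm0: "Wm \<ge> 0" unfolding Wm_def by (intro sum_nonneg nrm_nonneg)
  have Wm: "nrm (w i k) \<le> Wm" if "i < n" "k < s" for i k
  proof -
    have "nrm (w i k) \<le> (\<Sum>k<s. nrm (w i k))" by (rule member_le_sum) (use that nrm_nonneg in auto)
    also have "\<dots> \<le> Wm" unfolding Wm_def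
      by (rule member_le_sum[where f = "\<lambda>i. \<Sum>k<s. nrm (w i k)"]) (use that in \<open>auto intro!: sum_nonneg nrm_nonneg\<close>)
    finally show ?thesis .
  qed
  define z where "z = 2 * C * (r + 1)"
  have z0: "z \<ge> 0" using C1 by (simp add: z_def r_def)
  \<comment> \<open>L = m t vanishing conditions on n q t unknown coefficients leave a surplus of
    exactly t. The ratio of conditions to surplus is at most n q, so the exponent in Siegel's lemma
    does not depend on t.\<close>
  define m where "m = n * q - 1"
  have nq: "n * q \<ge> 2" using n q mult_le_mono[of 1 n 2 q] by simp
  have m1: "m \<ge> 1" using nq by (simp add: m_def)
  \<comment> \<open>From here to \<open>BB\<close>, the bounds of the construction as functions of
    t: entries of the Siegel system, its solution, the polynomials P, the degrees of their rows, the
    coefficients of the forms in y, the values times L!, and the bound for L! that Liouville's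
    inequality yields.\<close>
  define AA where "AA = (\<lambda>t::nat. (2 * C) ^ (((n + 1) * (n * q)) * t + (n + 1)))"
  define Xb where "Xb = (\<lambda>t::nat. csg * (csg * real (n * (q * t)) * AA t) ^ (n * q))"
  define Q where "Q = (\<lambda>t::nat. real (q * t) * (fact (q * t) * Xb t))"
  define D where "D = (\<lambda>t::nat. (q + e) * t + c0 * e)"
  define \<Theta> where "\<Theta> = (\<lambda>t::nat. real n * ((real b * X) ^ D t * (Q t * (H * (real (D t) + real n)) ^ (t + c0)) * Wm))"
  define V' where "V' = (\<lambda>t::nat. fact (q * t) * real (n * (q * t)) * Xb t * C * z ^ (m * t) * exp z * (cT * real (t + c0)) ^ (t + c0))"
  define BB where "BB = (\<lambda>t::nat. cl * (real s * (fact (s - 1) * \<Theta> t ^ (s - 1) * (real b ^ D t * real d\<mu> * V' t))) * (nrm 1 * (fact s * \<Theta> t ^ s)) ^ (h - 1) / cmod (y ky))"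
  have gAA: "growth 0 AA" unfolding AA_def using C1 by (intro growth_power_t) simp
  have gXb: "growth 0 Xb"
  proof -
    have 1: "growth 0 (\<lambda>t. csg * real (n * q) * real t + 0)" using csg by (intro growth_linear) auto
    have 2: "growth (0 + (0 + 0) * (n * q)) (\<lambda>t. csg * ((csg * real (n * q) * real t + 0) * AA t) ^ (n * q))"
      using csg by (intro growth_mult growth_const growth_power 1 gAA) auto
    then show ?thesis by (simp add: Xb_def mult_ac)
  qed
  have Xb0: "Xb t \<ge> 0" for t unfolding Xb_def AA_def using csg C1 by simp
  have gQ: "growth q Q"
  proof -
    have "growth (0 + (q + 0)) (\<lambda>t. (real q * real t + 0) * (fact (q * t) * Xb t))"
      by (intro growth_mult growth_linear growth_fact gXb) auto
    then show ?thesis by (simp add: Q_def mult_ac)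
  qed
  have Q0: "Q t \<ge> 0" for t using Xb0 by (simp add: Q_def)
  have gH: "growth 1 (\<lambda>t. (H * (real (D t) + real n)) ^ (t + c0))"
  proof -
    have "growth 1 (\<lambda>t. (H * real (q + e) * real t + H * (real (c0 * e) + real n)) ^ (1 * t + c0))"
      using H1 by (intro growth_linear_power) auto
    moreover have "H * real (q + e) * real t + H * (real (c0 * e) + real n) = H * (real (D t) + real n)" for t
      by (simp add: D_def algebra_simps)
    ultimately show ?thesis by simp
  qed
  have gT: "growth 1 (\<lambda>t. (cT * real (t + c0)) ^ (t + c0))"
  proof -
    have "growth 1 (\<lambda>t. (cT * real t + cT * real c0) ^ (1 * t + c0))"
      using cT1 by (intro growth_linear_power) auto
    then show ?thesis by (simp add: distrib_left)
  qed
  have g\<Theta>: "growth (q + 1) \<Theta>"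
  proof -
    have "growth (0 + (0 + (q + 1) + 0)) \<Theta>"
      unfolding \<Theta>_def D_def[THEN fun_cong]
      by (intro growth_mult growth_const growth_power_t gQ gH[unfolded D_def]) (use Wm0 X in auto)
    then show ?thesis by simp
  qed
  have gV: "growth (q + 1) V'"
  proof -
    have l: "growth 0 (\<lambda>t. real (n * (q * t)))"
      using growth_linear[of "real (n * q)" 0] by (simp add: mult_ac)
    have "growth (q + 0 + 0 + 0 + 0 + 0 + 1) V'"
      unfolding V'_def
      by (intro growth_mult growth_const growth_fact gXb gT l growth_power_t[of z m 0, simplified]) (use C1 z0 in auto)
    then show ?thesis by simp
  qed
  have gB: "growth ((q + 1) * (s - 1) + (q + 1) + ((q + 1) * s) * (h - 1)) BB"
  proof -
    have bb: "growth 0 (\<lambda>t. real b ^ D t)" unfolding D_def by (intro growth_power_t) simp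
    have "growth (0 + (0 + (0 + (q + 1) * (s - 1) + (0 + 0 + (q + 1)))) + (0 + (0 + (q + 1) * s)) * (h - 1) + 0) BB"
      unfolding BB_def divide_inverse
      by (intro growth_mult growth_const growth_power g\<Theta> gV bb) (use cl nrm_one in auto)
    then show ?thesis by (simp add: add_ac)
  qed
  show False
  proof (rule growth_contradiction[OF gB])
    have "(q + 1) * (s - 1) + (q + 1) + ((q + 1) * s) * (h - 1) = (q + 1) * (s * h)"
    proof -
      obtain s' h' where sh: "s = Suc s'" "h = Suc h'" using s h_pos by (metis gr0_implies_Suc)
      show ?thesis unfolding sh by (simp add: algebra_simps)
    qed
    moreover have "(q + 1) * (s * h) < m"
    proof -
      have "(s * h + 1) * q \<le> n * q" using nsh by (intro mult_le_mono1)
      moreover have "(q + 1) * (s * h) + 2 = (s * h + 1) * q" by (simp add: q_def algebra_simps)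
      ultimately have "(q + 1) * (s * h) + 2 \<le> n * q" by linarith
      then show ?thesis unfolding m_def by linarith
    qed
    ultimately show "(q + 1) * (s - 1) + (q + 1) + ((q + 1) * s) * (h - 1) < m" by simp
  next
    \<comment> \<open>Since L = n M - t and M >= 2 t, having t above c0 puts L beyond the threshold
      (n - 1) M + c0 of the zero estimate.\<close>
    fix t assume t0: "c0 + 1 \<le> t"
    then have t: "t \<ge> 1" by simp
    define M where "M = q * t"
    define U where "U = n * M"
    define L where "L = m * t"
    have M0: "M > 0" using t q by (simp add: M_def)
    have UL: "U = L + t"
    proof -
      have "n * q = Suc m" using nq by (simp add: m_def)
      then have "n * q * t = Suc m * t" by (rule arg_cong)
      then show ?thesis by (simp add: U_def M_def L_def mult_ac)
    qed
    have UA: "U = n * (q * t)" by (simp add: U_def M_def)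
    have "\<forall>i. \<exists>d::nat. i < n \<longrightarrow> d > 0 \<and> real d \<le> C ^ Suc L \<and> (\<forall>k\<le>L. of_nat d * a i k \<in> R)"
      using seq by (auto simp: E_seq_def)
    then obtain di where di: "\<And>i. i < n \<Longrightarrow> di i > 0 \<and> real (di i) \<le> C ^ Suc L \<and> (\<forall>k\<le>L. of_nat (di i) * a i k \<in> R)"
      by metis
    \<comment> \<open>A common denominator of the coefficients of all n series up to index L; the
      E-function condition keeps it exponential in t.\<close>
    define d where "d = (\<Prod>i<n. di i)"
    have d0: "d > 0" unfolding d_def using di by (intro prod_pos) auto
    have dC: "real d \<le> (C ^ Suc L) ^ n"
    proof -
      have "real d = (\<Prod>i<n. real (di i))" by (simp add: d_def)
      also have "\<dots> \<le> (\<Prod>i<n. C ^ Suc L)" using di by (intro prod_mono) auto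
      finally show ?thesis by simp
    qed
    have dR: "of_nat d * a i k \<in> R" if "i < n" "k \<le> L" for i k
    proof -
      have "d = (\<Prod>j\<in>{..<n} - {i}. di j) * di i" unfolding d_def using that by (subst prod.remove[of _ i]) auto
      then have "of_nat d * a i k = of_nat (\<Prod>j\<in>{..<n} - {i}. di j) * (of_nat (di i) * a i k)" by (simp add: mult_ac)
      then show ?thesis using RS(4)[OF Rnat] di that by metis
    qed
    \<comment> \<open>With the unknowns scaled by M!/k!, the l-th coefficient of the form is M!/l!
      times a combination with these entries. After removal of the factorials only binomials and the
      numbers a i remain, so the system is integral up to d and of exponential size.\<close>
    define A0 where "A0 = (\<lambda>l i k. if k \<le> l then of_nat (l choose k) * a i (l - k) else 0)"
    have A0K: "A0 l i k \<in> K" if "i < n" for l i k using KS Knat aK that by (auto simp: A0_def)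
    have A0n: "nrm (A0 l i k) \<le> 2 ^ l * C ^ Suc l" if "i < n" for l i k
    proof (cases "k \<le> l")
      case True
      have "nrm (A0 l i k) = real (l choose k) * nrm (a i (l - k))" using True nrm_nat aK that by (simp add: A0_def)
      also have "\<dots> \<le> 2 ^ l * C ^ Suc (l - k)"
      proof (intro mult_mono aK that nrm_nonneg)
        have "l choose k \<le> 2 ^ l" by (rule binomial_le_pow2)
        then have "real (l choose k) \<le> real (2 ^ l)" by (simp only: of_nat_le_iff)
        then show "real (l choose k) \<le> 2 ^ l" by simp
      qed auto
      also have "\<dots> \<le> 2 ^ l * C ^ Suc l" using C1 by (intro mult_left_mono power_increasing) auto
      finally show ?thesis .
    next
      case False then show ?thesis using C1 by (simp add: A0_def)
    qed
    define A where "A = (\<lambda>l u. of_nat d * A0 l (u div M) (u mod M))"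
    have udiv: "u div M < n" if "u < U" for u using that M0 by (simp add: U_def less_mult_imp_div_less)
    have AR: "A l u \<in> R \<and> nrm (A l u) \<le> AA t" if "l < L" "u < U" for l u
    proof
      let ?i = "u div M" and ?k = "u mod M"
      have i: "?i < n" using udiv that by simp
      show "A l u \<in> R"
      proof (cases "?k \<le> l")
        case True
        have "of_nat (l choose ?k) * (of_nat d * a ?i (l - ?k)) \<in> R" using RS(4)[OF Rnat] dR[OF i] that by simp
        then show ?thesis using True by (simp add: A_def A0_def mult_ac)
      next
        case False then show ?thesis using RS(1) by (simp add: A_def A0_def)
      qed
      have "nrm (A l u) = real d * nrm (A0 l ?i ?k)" unfolding A_def by (rule nrm_nat[OF A0K[OF i]])
      also have "\<dots> \<le> (C ^ Suc L) ^ n * (2 ^ l * C ^ Suc l)" using dC A0n[OF i] C1 by (intro mult_mono nrm_nonneg) auto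
      also have "\<dots> \<le> ((2 * C) ^ (n * q * t + 1)) ^ n * ((2 * C) ^ (n * q * t + 1))"
      proof (intro mult_mono power_mono)
        have Lq: "Suc L \<le> n * q * t + 1" using UL by (simp add: UA mult_ac)
        have "C ^ Suc L \<le> (2 * C) ^ Suc L" using C1 by (intro power_mono) auto
        also have "\<dots> \<le> (2 * C) ^ (n * q * t + 1)" using Lq C1 by (intro power_increasing) auto
        finally show "C ^ Suc L \<le> (2 * C) ^ (n * q * t + 1)" .
        have "2 ^ l * C ^ Suc l \<le> 2 ^ Suc l * C ^ Suc l" using C1 by (intro mult_right_mono power_increasing) auto
        also have "\<dots> = (2 * C) ^ Suc l" by (simp only: power_mult_distrib)
        also have "\<dots> \<le> (2 * C) ^ (n * q * t + 1)" using Lq that C1 by (intro power_increasing) auto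
        finally show "2 ^ l * C ^ Suc l \<le> (2 * C) ^ (n * q * t + 1)" .
      qed (use C1 in auto)
      also have "\<dots> = AA t"
      proof -
        have "(n * q * t + 1) * n + (n * q * t + 1) = ((n + 1) * (n * q)) * t + (n + 1)" by (simp add: algebra_simps)
        then show ?thesis unfolding AA_def by (simp only: power_mult[symmetric] power_add[symmetric])
      qed
      finally show "nrm (A l u) \<le> AA t" .
    qed
    have "\<exists>x. (\<forall>u<U. x u \<in> R) \<and> (\<exists>u<U. x u \<noteq> 0) \<and> (\<forall>u<U. nrm (x u) \<le> csg * (csg * real U * AA t) ^ (n * q)) \<and>
      (\<forall>l<L. (\<Sum>u<U. A l u * x u) = 0)"
    proof (rule csg(2)[THEN spec, of L, THEN spec, of U, THEN spec, of "n * q", THEN spec, of A, THEN spec, of "AA t", THEN mp, THEN mp, THEN mp, THEN mp, THEN mp])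
      show "1 \<le> AA t" unfolding AA_def using C1 by (intro one_le_power) simp
      show "1 \<le> n * q" using nq by linarith
      show "L < U" using UL t by simp
      show "L \<le> n * q * (U - L)" using UL by (simp add: UA mult_ac)
      show "\<forall>l<L. \<forall>u<U. A l u \<in> R \<and> nrm (A l u) \<le> AA t" using AR by blast
    qed
    then obtain x where x0: "(\<forall>u<U. x u \<in> R) \<and> (\<exists>u<U. x u \<noteq> 0) \<and> (\<forall>u<U. nrm (x u) \<le> csg * (csg * real U * AA t) ^ (n * q)) \<and>
      (\<forall>l<L. (\<Sum>u<U. A l u * x u) = 0)" ..
    note x = x0[THEN conjunct1] x0[THEN conjunct2, THEN conjunct1] x0[THEN conjunct2, THEN conjunct2, THEN conjunct1]
      x0[THEN conjunct2, THEN conjunct2, THEN conjunct2]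
    have xn: "nrm (x u) \<le> Xb t" if "u < U" for u using x(3) that unfolding Xb_def UA by blast
    \<comment> \<open>The integer M!/k!. It cancels the factorials in the expansions and raises the
      growth exponent of the polynomials to q.\<close>
    define g where "g = (\<lambda>k. fact M div fact k :: nat)"
    have g: "of_nat (g k) * fact k = (fact M :: complex)" "g k > 0" "g k \<le> fact M" if "k < M" for k
    proof -
      have dv: "fact k dvd (fact M :: nat)" using that by (intro fact_dvd) simp
      then have "g k * fact k = fact M" by (simp add: g_def)
      then have "of_nat (g k * fact k) = (of_nat (fact M) :: complex)" by (rule arg_cong)
      then show "of_nat (g k) * fact k = (fact M :: complex)" by simp
      show "g k > 0" unfolding g_def using dv by (simp add: div_greater_zero_iff dvd_imp_le)
      show "g k \<le> fact M" unfolding g_def by (rule div_le_dividend)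
    qed
    have iM: "i * M + k < U" if "i < n" "k < M" for i k
    proof -
      have "i * M + k < Suc i * M" using that by simp
      also have "\<dots> \<le> n * M" using that by (intro mult_le_mono1) simp
      finally show ?thesis by (simp add: U_def)
    qed
    define P where "P = (\<lambda>i. \<Sum>k<M. monom (of_nat (g k) * x (i * M + k)) k)"
    have cP: "coeff (P i) k = (if k < M then of_nat (g k) * x (i * M + k) else 0)" for i k
      unfolding P_def by (simp add: coeff_sum)
    have PR: "R_poly (P i)" if "i < n" for i
      unfolding R_poly_def cP using x(1) iM that RS(1) RS(4)[OF Rnat] by auto
    have PK: "K_poly (P i)" if "i < n" for i using PR[OF that] by (rule R_K_poly)
    have Pdeg: "degree (P i) \<le> M" for i
      by (intro degree_le) (simp add: cP)
    have Ppn: "pnorm (P i) \<le> Q t" if i: "i < n" for i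
    proof -
      have "pnorm (P i) \<le> (\<Sum>k<M. pnorm (monom (of_nat (g k) * x (i * M + k)) k))"
        unfolding P_def
      proof (rule pnorm_sum)
        fix k assume k: "k \<in> {..<M}"
        then have "of_nat (g k) * x (i * M + k) \<in> K" using x(1) iM[OF i] RK KS(4)[OF Knat] by auto
        then show "K_poly (monom (of_nat (g k) * x (i * M + k)) k)" using KS(1) by (simp add: K_poly_def)
      qed
      also have "\<dots> \<le> (\<Sum>k<M. fact M * Xb t)"
      proof (rule sum_mono)
        fix k assume "k \<in> {..<M}"
        then have k: "k < M" by simp
        have "pnorm (monom (of_nat (g k) * x (i * M + k)) k) = real (g k) * nrm (x (i * M + k))"
          using nrm_nat[OF RK] x(1) iM[OF i k] by (simp add: pnorm_monom)
        also have "\<dots> \<le> fact M * Xb t"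
        proof (intro mult_mono xn iM i k nrm_nonneg)
          have "real (g k) \<le> real (fact M)" using g(3)[OF k] by (simp only: of_nat_le_iff)
          then show "real (g k) \<le> fact M" by simp
        qed auto
        finally show "pnorm (monom (of_nat (g k) * x (i * M + k)) k) \<le> fact M * Xb t" .
      qed
      finally show ?thesis by (simp add: Q_def M_def)
    qed
    have Pnz: "\<exists>i<n. P i \<noteq> 0"
    proof -
      obtain u where u: "u < U" "x u \<noteq> 0" using x(2) by blast
      have um: "u mod M < M" using M0 by simp
      have "u div M * M + u mod M = u" by simp
      then have "coeff (P (u div M)) (u mod M) = of_nat (g (u mod M)) * x u" unfolding cP using um by simp
      then have "coeff (P (u div M)) (u mod M) \<noteq> 0" using u(2) g(2)[OF um] by simp
      then have "P (u div M) \<noteq> 0" by auto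
      then show ?thesis using udiv[OF u(1)] by blast
    qed
    define G where "G = (\<lambda>k. \<Sum>i<n. fps_of_poly (rows n T B P k i) * f i)"
    have GS: "G (Suc k) = fps_of_poly T * fps_deriv (G k)" for k
      unfolding G_def using form_deriv[of n 0 T f B P k] sys by (simp add: taylor_zero_point)
    have G0: "fps_nth (G 0) l = fact M / fact l * (\<Sum>u<U. A0 l (u div M) (u mod M) * x u)" for l
    proof -
      have "fps_nth (G 0) l = (\<Sum>i<n. \<Sum>k\<le>l. coeff (P i) k * (a i (l - k) / fact (l - k)))"
        by (simp add: G_def fps_sum_nth fps_mult_nth fa atLeast0AtMost)
      also have "\<dots> = (\<Sum>i<n. \<Sum>k<M. fact M / fact l * (A0 l i k * x (i * M + k)))"
      proof (rule sum.cong[OF refl])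
        fix i
        have "(\<Sum>k\<le>l. coeff (P i) k * (a i (l - k) / fact (l - k))) = (\<Sum>k\<in>{..l} \<inter> {..<M}. coeff (P i) k * (a i (l - k) / fact (l - k)))"
          by (rule sum.mono_neutral_right) (auto simp: cP)
        also have "\<dots> = (\<Sum>k\<in>{..l} \<inter> {..<M}. fact M / fact l * (A0 l i k * x (i * M + k)))"
        proof (rule sum.cong[OF refl])
          fix k assume "k \<in> {..l} \<inter> {..<M}"
          then have k: "k \<le> l" "k < M" by auto
          have "of_nat (l choose k) = (fact l / (fact k * fact (l - k)) :: complex)" by (rule binomial_fact[OF k(1)])
          moreover have "of_nat (g k) = (fact M / fact k :: complex)" using g(1)[OF k(2)] by (simp add: field_simps)
          ultimately show "coeff (P i) k * (a i (l - k) / fact (l - k)) = fact M / fact l * (A0 l i k * x (i * M + k))"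
            using k by (simp add: cP A0_def)
        qed
        also have "\<dots> = (\<Sum>k<M. fact M / fact l * (A0 l i k * x (i * M + k)))"
          by (rule sum.mono_neutral_left) (auto simp: A0_def)
        finally show "(\<Sum>k\<le>l. coeff (P i) k * (a i (l - k) / fact (l - k))) = (\<Sum>k<M. fact M / fact l * (A0 l i k * x (i * M + k)))" .
      qed
      also have "\<dots> = (\<Sum>u<n * M. fact M / fact l * (A0 l (u div M) (u mod M) * x (u div M * M + u mod M)))"
        by (rule sum_div_mod[OF M0, symmetric])
      finally show ?thesis by (simp add: sum_distrib_left U_def)
    qed
    have Glow: "fps_nth (G 0) l = 0" if "l < L" for l
    proof -
      have "of_nat d * (\<Sum>u<U. A0 l (u div M) (u mod M) * x u) = (\<Sum>u<U. A l u * x u)"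
        by (simp add: A_def sum_distrib_left mult_ac)
      also have "\<dots> = 0" using x(4) that by blast
      finally show ?thesis using d0 by (simp add: G0)
    qed
    \<comment> \<open>The terms below L vanish, so the coefficient sum is a tail of the exponential
      series at z = 2 C (r + 1): the factor 2 comes from binomials, C from the coefficients of the
      E-functions and r + 1 from the radius.\<close>
    define V0 where "V0 = fact M * real U * Xb t * C * (z ^ L / fact L * exp z)"
    have majG: "majorised (r + 1) (G 0) V0"
      unfolding majorised_def
    proof
      fix N
      have "(\<Sum>l<N. cmod (fps_nth (G 0) l) * (r + 1) ^ l) \<le> (\<Sum>l<N. (fact M * real U * Xb t * C) * (if l < L then 0 else z ^ l / fact l))"
      proof (rule sum_mono)
        fix l
        show "cmod (fps_nth (G 0) l) * (r + 1) ^ l \<le> (fact M * real U * Xb t * C) * (if l < L then 0 else z ^ l / fact l)"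
        proof (cases "l < L")
          case True then show ?thesis using Glow by simp
        next
          case False
          have "cmod (\<Sum>u<U. A0 l (u div M) (u mod M) * x u) \<le> (\<Sum>u<U. (2 ^ l * C ^ Suc l) * Xb t)"
          proof (intro order_trans[OF norm_sum] sum_mono)
            fix u assume "u \<in> {..<U}"
            then have u: "u < U" by simp
            have "cmod (A0 l (u div M) (u mod M)) \<le> 2 ^ l * C ^ Suc l"
              using cmod_le_nrm[OF A0K[OF udiv[OF u]]] A0n[OF udiv[OF u]] order_trans by blast
            moreover have "cmod (x u) \<le> Xb t" using cmod_le_nrm[OF RK] x(1) u xn[OF u] order_trans by blast
            ultimately show "cmod (A0 l (u div M) (u mod M) * x u) \<le> (2 ^ l * C ^ Suc l) * Xb t"
              unfolding norm_mult using C1 by (intro mult_mono) auto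
          qed
          then have "cmod (fps_nth (G 0) l) \<le> fact M / fact l * (real U * ((2 ^ l * C ^ Suc l) * Xb t))"
            unfolding G0 norm_mult by (intro mult_mono) (auto simp: norm_divide norm_fact)
          then have "cmod (fps_nth (G 0) l) * (r + 1) ^ l \<le> fact M / fact l * (real U * ((2 ^ l * C ^ Suc l) * Xb t)) * (r + 1) ^ l"
            by (intro mult_right_mono) (auto simp: r_def)
          also have "\<dots> = (fact M * real U * Xb t * C) * (z ^ l / fact l)"
            unfolding z_def by (simp add: power_mult_distrib)
          finally show ?thesis using False by simp
        qed
      qed
      also have "\<dots> = (fact M * real U * Xb t * C) * (\<Sum>l<N. if l < L then 0 else z ^ l / fact l)"
        by (rule sum_distrib_left[symmetric])
      also have "\<dots> \<le> V0" unfolding V0_def using C1 Xb0 z0 by (intro mult_left_mono exp_tail_le) auto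
      finally show "(\<Sum>l<N. cmod (fps_nth (G 0) l) * (r + 1) ^ l) \<le> V0" .
    qed
    have V00: "V0 \<ge> 0" using majorised_nonneg[OF majG] .
    \<comment> \<open>t + c0 equals n M + c0 - L, the number of rows in the zero estimate.\<close>
    define k0 where "k0 = t + c0"
    have k0: "k0 > 0" using t by (simp add: k0_def)
    have Gmaj: "majorised r (G k) (V' t / fact L)" if "k < k0" for k
    proof -
      have "majorised (r + 1 - real k / real k0) (G k) (V0 * (cT * real k0) ^ k)"
        by (rule iterated_forms_majorised[where T = T]) (use cT k0 GS majG that in \<open>auto simp: r_def\<close>)
      then have "majorised r (G k) (V0 * (cT * real k0) ^ k)"
      proof (rule majorised_radius_mono[rotated 2])
        have "real k / real k0 \<le> 1" using that k0 by simp
        then show "r \<le> r + 1 - real k / real k0" by linarith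
      qed (simp add: r_def)
      moreover have "V0 * (cT * real k0) ^ k \<le> V0 * (cT * real k0) ^ k0"
      proof (intro mult_left_mono power_increasing V00)
        show "1 \<le> cT * real k0" using cT1 k0 mult_mono[of 1 cT 1 "real k0"] by simp
      qed (use that in auto)
      moreover have "V0 * (cT * real k0) ^ k0 = V' t / fact L"
        by (simp add: V0_def V'_def k0_def UA M_def L_def)
      ultimately show ?thesis by (metis majorised_mono)
    qed
    have Gval: "(\<lambda>l. fps_nth (G k) l * \<xi> ^ l) sums (\<Sum>i<n. poly (rows n T B P k i) \<xi> * val i)" for k
    proof -
      have "(\<lambda>l. \<Sum>i<n. fps_nth (fps_of_poly (rows n T B P k i) * f i) l * \<xi> ^ l) sums (\<Sum>i<n. poly (rows n T B P k i) \<xi> * val i)"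
        by (intro sums_sum fps_poly_sums val) auto
      then show ?thesis by (simp add: G_def fps_sum_nth sum_distrib_right)
    qed
    have Gsmall: "cmod (\<Sum>i<n. poly (rows n T B P k i) \<xi> * val i) \<le> V' t / fact L" if "k < k0" for k
      by (rule majorised_sums[OF Gmaj[OF that, unfolded r_def] Gval])
    have rR: "R_poly (rows n T B P k i)" if "i < n" for k i
      using rows_in_subring[OF R_poly_subring, of T n B P i k] TR BR PR R_poly_pderiv that by auto
    have rdeg: "degree (rows n T B P k i) \<le> D t" if "i < n" "k \<le> k0" for k i
    proof -
      have "degree (rows n T B P k i) \<le> M + k * e" by (rule rows_degree) (use eT eB Pdeg that in auto)
      also have "\<dots> \<le> M + k0 * e" using that by simp
      also have "\<dots> = D t" by (simp add: M_def k0_def D_def algebra_simps)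
      finally show ?thesis .
    qed
    have rpn: "pnorm (rows n T B P k i) \<le> Q t * (H * (real (D t) + real n)) ^ k0" if i: "i < n" and k: "k < k0" for k i
    proof -
      have "pnorm (rows n T B P k i) \<le> Q t * (H * (real (D t) + real n)) ^ k"
        
      proof (rule rows_pnorm[of T H n B P "Q t" k0 "D t" k i])
        show "K_poly T" "pnorm T \<le> H" "0 \<le> H" "k \<le> k0" "i < n" using TR R_K_poly HT H1 i k by auto
        show "K_poly (B i j) \<and> pnorm (B i j) \<le> H" if "i < n" "j < n" for i j using BR R_K_poly HB that by auto
        show "K_poly (P i) \<and> pnorm (P i) \<le> Q t" if "i < n" for i using PK Ppn that by auto
        show "degree (rows n T B P k i) \<le> D t" if "k < k0" "i < n" for k i using rdeg that by simp
      qed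
      also have "\<dots> \<le> Q t * (H * (real (D t) + real n)) ^ k0"
      proof (intro mult_left_mono power_increasing Q0)
        show "1 \<le> H * (real (D t) + real n)" using H1 n mult_mono[of 1 H 1 "real (D t) + real n"] by simp
      qed (use k in auto)
      finally show ?thesis .
    qed
    \<comment> \<open>A single power of the denominator b of \<xi>, with the degree bound as
      exponent, brings all values of the rows at \<xi> into R.\<close>
    define \<pi> where "\<pi> = (\<lambda>k i. of_nat b ^ D t * poly (rows n T B P k i) \<xi>)"
    have \<pi>R: "\<pi> k i \<in> R" if "i < n" "k < k0" for k i
      unfolding \<pi>_def by (rule poly_denominator[OF rR b(2) rdeg]) (use that in auto)
    have \<pi>n: "nrm (\<pi> k i) \<le> (real b * X) ^ D t * (Q t * (H * (real (D t) + real n)) ^ (t + c0))" if "i < n" "k < k0" for k i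
    proof -
      have pK: "poly (rows n T B P k i) \<xi> \<in> K"
        unfolding poly_altdef using R_K_poly[OF rR[OF that(1)]] \<xi>K is_subring_power[OF number_field_subring[OF K]]
        by (intro Ksum KS(4)) (auto simp: K_poly_def)
      have "nrm (\<pi> k i) = real (b ^ D t) * nrm (poly (rows n T B P k i) \<xi>)"
        unfolding \<pi>_def using nrm_nat[OF pK, of "b ^ D t"] by simp
      also have "\<dots> \<le> real (b ^ D t) * (pnorm (rows n T B P k i) * X ^ D t)"
        using nrm_poly_le[OF \<xi>K X(2,1) R_K_poly[OF rR[OF that(1)]] rdeg[OF that(1)]] that by (intro mult_left_mono) auto
      also have "\<dots> \<le> real (b ^ D t) * ((Q t * (H * (real (D t) + real n)) ^ k0) * X ^ D t)"
        using rpn[OF that] X by (intro mult_left_mono mult_right_mono) auto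
      finally show ?thesis by (simp add: power_mult_distrib k0_def mult_ac)
    qed
    \<comment> \<open>The coefficients of the forms with respect to y, after the values have been
      expressed through w.\<close>
    define v where "v = (\<lambda>k j. \<Sum>i<n. \<pi> k i * w i j)"
    have vR: "v k j \<in> R" if "k < k0" "j < s" for k j
      unfolding v_def by (intro is_subring_sum[OF R_subring] RS(4)) (use \<pi>R wR that in auto)
    have vn: "nrm (v k j) \<le> \<Theta> t" if k: "k < k0" and j: "j < s" for k j
    proof -
      have "nrm (v k j) \<le> (\<Sum>i<n. nrm (\<pi> k i * w i j))"
        unfolding v_def by (rule nrm_sum) (use \<pi>R wR that RS(4) RK in auto)
      also have "\<dots> \<le> (\<Sum>i<n. (real b * X) ^ D t * (Q t * (H * (real (D t) + real n)) ^ (t + c0)) * Wm)"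
      proof (rule sum_mono)
        fix i assume "i \<in> {..<n}"
        then have i: "i < n" by simp
        have "nrm (\<pi> k i * w i j) \<le> nrm (\<pi> k i) * nrm (w i j)" using \<pi>R[OF i k] wR[OF i j] RK by (intro nrm_mult) auto
        also have "\<dots> \<le> (real b * X) ^ D t * (Q t * (H * (real (D t) + real n)) ^ (t + c0)) * Wm"
          using \<pi>n[OF i k] Wm[OF i j] X Q0 H1 by (intro mult_mono nrm_nonneg) auto
        finally show "nrm (\<pi> k i * w i j) \<le> (real b * X) ^ D t * (Q t * (H * (real (D t) + real n)) ^ (t + c0)) * Wm" .
      qed
      finally show ?thesis by (simp add: \<Theta>_def)
    qed
    have "\<exists>\<kappa>. (\<forall>j<s. \<kappa> j < k0) \<and> fdet s (\<lambda>j i. v (\<kappa> j) i) \<noteq> 0"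
    proof (rule select_rows)
      fix x' :: "nat \<Rightarrow> complex" and i' assume x': "\<And>k. k < k0 \<Longrightarrow> (\<Sum>j<s. v k j * x' j) = 0" and i': "i' < s"
      \<comment> \<open>The matrix w carries a null vector of these coefficients to a null vector of
        the rows at \<xi>. The zero estimate makes the latter vanish, and injectivity of w makes the
        former vanish.\<close>
      have ker: "(\<Sum>i<n. poly (rows n T B P k i) \<xi> * (\<Sum>j<s. w i j * x' j)) = 0" if k: "k < k0" for k
      proof -
        have "of_nat b ^ D t * (\<Sum>i<n. poly (rows n T B P k i) \<xi> * (\<Sum>j<s. w i j * x' j)) = (\<Sum>i<n. \<Sum>j<s. \<pi> k i * w i j * x' j)"
          by (simp add: \<pi>_def sum_distrib_left mult_ac)
        also have "\<dots> = (\<Sum>j<s. \<Sum>i<n. \<pi> k i * w i j * x' j)" by (rule sum.swap)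
        also have "\<dots> = (\<Sum>j<s. v k j * x' j)" by (simp add: v_def sum_distrib_right)
        finally show ?thesis using x'[OF k] b(1) by simp
      qed
      have "\<forall>i<n. (\<Sum>j<s. w i j * x' j) = 0"
      proof (rule c0[THEN spec, of P, THEN spec, of M, THEN spec, of L, THEN mp, THEN mp, THEN mp, THEN mp, THEN spec, of "\<lambda>i. \<Sum>j<s. w i j * x' j", THEN mp])
        show "\<forall>i<n. P i \<in> Collect K_poly \<and> degree (P i) \<le> M" using PK Pdeg by simp
        show "\<exists>i<n. P i \<noteq> 0" by (rule Pnz)
        show "\<forall>k<L. fps_nth (\<Sum>i<n. fps_of_poly (P i) * f i) k = 0" using Glow by (simp add: G_def)
        show "(n - 1) * M + c0 < L"
        proof -
          have "(n - 1) * M + M = U" using n by (cases n) (simp_all add: U_def)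
          moreover have "M \<ge> 2 * t" using q by (simp add: M_def)
          ultimately show ?thesis using UL t0 by linarith
        qed
        have "n * M + c0 - L = k0" using UL by (simp add: U_def[symmetric] k0_def)
        then show "\<forall>k<n * M + c0 - L. (\<Sum>i<n. poly (rows n T B P k i) \<xi> * (\<Sum>j<s. w i j * x' j)) = 0" using ker by simp
      qed
      then show "x' i' = 0" using wker[of x'] i' by blast
    qed
    then obtain \<kappa> where \<kappa>: "\<forall>j<s. \<kappa> j < k0" "fdet s (\<lambda>j i. v (\<kappa> j) i) \<noteq> 0" by blast
    define N where "N = (\<lambda>j i. v (\<kappa> j) i)"
    define \<delta> where "\<delta> = fdet s N"
    have NR: "N j i \<in> R" if "j < s" "i < s" for j i unfolding N_def using vR \<kappa> that by blast
    have Nn: "nrm (N j i) \<le> \<Theta> t" if "j < s" "i < s" for j i unfolding N_def using vn \<kappa> that by blast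
    have \<delta>R: "\<delta> \<in> R" unfolding \<delta>_def by (rule is_subring_fdet[OF R_subring NR])
    have \<delta>0: "\<delta> \<noteq> 0" using \<kappa>(2) by (simp add: \<delta>_def N_def)
    have \<delta>n: "nrm \<delta> \<le> nrm 1 * (fact s * \<Theta> t ^ s)" unfolding \<delta>_def by (rule nrm_fdet_le) (use NR RK Nn in blast)
    have \<Theta>0: "\<Theta> t \<ge> 0" using Nn[OF s s] nrm_nonneg order_trans by blast
    have Ny: "(\<Sum>i<s. N j i * y i) = of_nat b ^ D t * of_nat d\<mu> * (\<Sum>i<n. poly (rows n T B P (\<kappa> j) i) \<xi> * val i)" for j
    proof -
      have "(\<Sum>k<s. N j k * y k) = (\<Sum>k<s. \<Sum>i<n. \<pi> (\<kappa> j) i * (w i k * y k))" by (simp add: N_def v_def sum_distrib_left sum_distrib_right mult_ac)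
      also have "\<dots> = (\<Sum>i<n. \<Sum>k<s. \<pi> (\<kappa> j) i * (w i k * y k))" by (rule sum.swap)
      also have "\<dots> = (\<Sum>i<n. \<pi> (\<kappa> j) i * (of_nat d\<mu> * val i))"
        by (rule sum.cong[OF refl]) (simp add: wy sum_distrib_left)
      finally show ?thesis by (simp add: \<pi>_def sum_distrib_left mult_ac)
    qed
    \<comment> \<open>Cramer's rule at a nonzero coordinate of y: every term contains one small
      value of a form, so the factor 1/L! enters once.\<close>
    have "\<delta> * y ky = (\<Sum>j<s. fcof s N j ky * (\<Sum>i<s. N j i * y i))"
      unfolding \<delta>_def by (rule cramer_right[OF ky(1), symmetric])
    then have "cmod \<delta> * cmod (y ky) = cmod (\<Sum>j<s. fcof s N j ky * (\<Sum>i<s. N j i * y i))" by (metis norm_mult)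
    also have "\<dots> \<le> (\<Sum>j<s. fact (s - 1) * \<Theta> t ^ (s - 1) * (real b ^ D t * real d\<mu> * (V' t / fact L)))"
    proof (intro order_trans[OF norm_sum] sum_mono)
      fix j assume "j \<in> {..<s}"
      then have j: "j < s" by simp
      have "cmod (fcof s N j ky) \<le> fact (s - 1) * \<Theta> t ^ (s - 1)"
      proof (rule norm_fcof_le)
        fix i j assume "i < s" "j < s"
        then show "cmod (N i j) \<le> \<Theta> t" using cmod_le_nrm[OF RK[OF NR]] Nn order_trans by blast
      qed
      moreover have "cmod (\<Sum>i<s. N j i * y i) \<le> real b ^ D t * real d\<mu> * (V' t / fact L)"
      proof -
        have c: "cmod (of_nat b ^ D t * of_nat d\<mu>) = real b ^ D t * real d\<mu>" by (simp add: norm_mult norm_power)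
        show ?thesis unfolding Ny norm_mult[of "of_nat b ^ D t * of_nat d\<mu>"] c
          by (intro mult_left_mono Gsmall) (use \<kappa>(1) j in auto)
      qed
      ultimately show "cmod (fcof s N j ky * (\<Sum>i<s. N j i * y i)) \<le> fact (s - 1) * \<Theta> t ^ (s - 1) * (real b ^ D t * real d\<mu> * (V' t / fact L))"
        unfolding norm_mult using \<Theta>0 by (intro mult_mono) auto
    qed
    also have "\<dots> = (real s * (fact (s - 1) * \<Theta> t ^ (s - 1) * (real b ^ D t * real d\<mu> * V' t))) / fact L"
      by simp
    finally have up: "cmod \<delta> * cmod (y ky) \<le> (real s * (fact (s - 1) * \<Theta> t ^ (s - 1) * (real b ^ D t * real d\<mu> * V' t))) / fact L" .
    define E1 where "E1 = real s * (fact (s - 1) * \<Theta> t ^ (s - 1) * (real b ^ D t * real d\<mu> * V' t))"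
    define E2 where "E2 = (nrm 1 * (fact s * \<Theta> t ^ s)) ^ (h - 1)"
    have yp: "cmod (y ky) > 0" using ky by simp
    have \<delta>E: "cmod \<delta> \<le> E1 / fact L / cmod (y ky)" using up yp by (simp add: E1_def field_simps)
    \<comment> \<open>The nonzero element \<delta> of R is small by Cramer's rule and its size is
      controlled by \<Theta>; the Liouville inequality then bounds L! by
      \<open>BB t\<close>.\<close>
    have "1 \<le> cl * cmod \<delta> * nrm \<delta> ^ (h - 1)" using cl(2) \<delta>R \<delta>0 by blast
    also have "\<dots> \<le> cl * (E1 / fact L / cmod (y ky)) * E2"
      unfolding E2_def using cl(1) \<delta>E \<delta>n nrm_nonneg[of \<delta>] order_trans[OF norm_ge_zero \<delta>E]
      by (intro mult_mono power_mono mult_nonneg_nonneg) auto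
    also have "\<dots> = BB t / fact L" by (simp add: BB_def E1_def E2_def)
    finally have "fact L \<le> BB t" by (simp add: field_simps)
    then show "fact (m * t) \<le> BB t" by (simp add: L_def)
  qed
qed

end

section \<open>Elimination of relations\<close>

text \<open>All members are divided by z - \<xi> as long as they vanish at \<xi> simultaneously.
  Synthetic division by an element of S keeps the coefficients in S, and the sum of the degrees
  drops.\<close>

lemma common_root_factor:
  fixes c :: "'i \<Rightarrow> complex poly"
  assumes S: "is_subring S" "\<xi> \<in> S" and A: "finite A"
  shows "(\<forall>\<alpha>\<in>A. \<forall>i. coeff (c \<alpha>) i \<in> S) \<Longrightarrow> \<exists>\<alpha>\<in>A. c \<alpha> \<noteq> 0 \<Longrightarrow>
    \<exists>e c'. (\<forall>\<alpha>\<in>A. c \<alpha> = [:-\<xi>, 1:] ^ e * c' \<alpha> \<and> (\<forall>i. coeff (c' \<alpha>) i \<in> S)) \<and> (\<exists>\<alpha>\<in>A. poly (c' \<alpha>) \<xi> \<noteq> 0)"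
proof (induction "\<Sum>\<alpha>\<in>A. degree (c \<alpha>)" arbitrary: c rule: less_induct)
  case less
  show ?case
  proof (cases "\<exists>\<alpha>\<in>A. poly (c \<alpha>) \<xi> \<noteq> 0")
    case True
    then show ?thesis using less.prems by (intro exI[of _ 0] exI[of _ c]) auto
  next
    case False
    define c1 where "c1 = (\<lambda>\<alpha>. synthetic_div (c \<alpha>) \<xi>)"
    have e: "c \<alpha> = [:-\<xi>, 1:] * c1 \<alpha>" if "\<alpha> \<in> A" for \<alpha>
      using synthetic_div_correct'[of \<xi> "c \<alpha>"] False that by (simp add: c1_def)
    have "\<forall>i. coeff (synthetic_div p \<xi>) i \<in> S" if "\<forall>i. coeff p i \<in> S" for p
      using that
    proof (induction p)
      case 0 then show ?case using is_subringD(1)[OF S(1)] by simp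
    next
      case (pCons a p)
      have p: "coeff p i \<in> S" for i using pCons.prems[THEN spec, of "Suc i"] by simp
      then have "poly p \<xi> \<in> S" unfolding poly_altdef
        by (intro is_subring_sum[OF S(1)] is_subringD(4)[OF S(1)] is_subring_power[OF S(1)] S(2)) auto
      then show ?case using pCons.IH p by (auto simp: coeff_pCons split: nat.splits)
    qed
    then have c1S: "\<forall>\<alpha>\<in>A. \<forall>i. coeff (c1 \<alpha>) i \<in> S" using less.prems(1) by (simp add: c1_def)
    obtain \<alpha>0 where \<alpha>0: "\<alpha>0 \<in> A" "c \<alpha>0 \<noteq> 0" using less.prems(2) by blast
    have nz: "c1 \<alpha>0 \<noteq> 0" using e[OF \<alpha>0(1)] \<alpha>0(2) by auto
    have "(\<Sum>\<alpha>\<in>A. degree (c1 \<alpha>)) < (\<Sum>\<alpha>\<in>A. degree (c \<alpha>))"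
    proof (rule sum_strict_mono_ex1[OF A])
      show "\<forall>\<alpha>\<in>A. degree (c1 \<alpha>) \<le> degree (c \<alpha>)" by (simp add: c1_def degree_synthetic_div)
      have "degree (c \<alpha>0) = Suc (degree (c1 \<alpha>0))"
        unfolding e[OF \<alpha>0(1)] using degree_mult_eq[of "[:-\<xi>, 1:]" "c1 \<alpha>0"] nz by simp
      then show "\<exists>\<alpha>\<in>A. degree (c1 \<alpha>) < degree (c \<alpha>)" using \<alpha>0(1) by (intro bexI[of _ \<alpha>0]) auto
    qed
    from less.hyps[OF this c1S] nz \<alpha>0(1) obtain e' c' where
      c': "\<forall>\<alpha>\<in>A. c1 \<alpha> = [:-\<xi>, 1:] ^ e' * c' \<alpha> \<and> (\<forall>i. coeff (c' \<alpha>) i \<in> S)" "\<exists>\<alpha>\<in>A. poly (c' \<alpha>) \<xi> \<noteq> 0" by blast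
    have "\<forall>\<alpha>\<in>A. c \<alpha> = [:-\<xi>, 1:] ^ Suc e' * c' \<alpha> \<and> (\<forall>i. coeff (c' \<alpha>) i \<in> S)"
    proof
      fix \<alpha> assume a: "\<alpha> \<in> A"
      have "c \<alpha> = [:-\<xi>, 1:] * ([:-\<xi>, 1:] ^ e' * c' \<alpha>)" using e[OF a] c'(1) a by simp
      then show "c \<alpha> = [:-\<xi>, 1:] ^ Suc e' * c' \<alpha> \<and> (\<forall>i. coeff (c' \<alpha>) i \<in> S)"
        using c'(1) a by (simp only: power_Suc mult.assoc) simp
    qed
    then show ?thesis using c'(2) by (intro exI[of _ "Suc e'"] exI[of _ c']) simp
  qed
qed

section \<open>E-functions as formal power series\<close>

context sized_field begin

lemma E_seq_mono: "E_seq a C \<Longrightarrow> C \<le> C' \<Longrightarrow> E_seq a C'"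
proof -
  assume a: "E_seq a C" and C: "C \<le> C'"
  have p: "C ^ Suc l \<le> C' ^ Suc l" for l using a C by (intro power_mono) (auto simp: E_seq_def)
  show ?thesis
    using a C p unfolding E_seq_def by (meson order_trans)
qed

text \<open>An embedding of K is also an embedding of the smaller coefficient field, so the bounds
  on conjugates control \<open>nrm\<close>; a fixed factor D takes the algebraic integers of K into
  R.\<close>

lemma E_seq_of_E_function:
  assumes K': "K' \<subseteq> K" "\<And>n. a n \<in> K'" and C: "C > 0"
    and emb: "\<And>\<sigma> n. field_embedding K' \<sigma> \<Longrightarrow> cmod (\<sigma> (a n)) \<le> C ^ n"
    and den: "\<And>n. \<exists>d::nat. d > 0 \<and> real d \<le> C ^ n \<and> (\<forall>k\<le>n. algebraic_int (of_nat d * a k))"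
  shows "\<exists>C'. E_seq a C'"
proof -
  obtain c where c: "c \<ge> 1" "\<forall>x\<in>K. \<forall>X\<ge>0. (\<forall>\<sigma>. field_embedding K \<sigma> \<longrightarrow> cmod (\<sigma> x) \<le> X) \<longrightarrow> nrm x \<le> c * X"
    using nrm_le_house by blast
  obtain D :: nat where D: "D > 0" "\<forall>x\<in>K. algebraic_int x \<longrightarrow> of_nat D * x \<in> R" using algebraic_int_denominator by blast
  define C' where "C' = Max {c, C, real D}"
  have C': "c \<le> C'" "C \<le> C'" "real D \<le> C'" by (auto simp: C'_def)
  have "nrm (a l) \<le> C' ^ Suc l" for l
  proof -
    have "cmod (\<sigma> (a l)) \<le> C ^ l" if "field_embedding K \<sigma>" for \<sigma>
      using emb[of \<sigma> l] that K'(1) unfolding field_embedding_def by blast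
    then have "nrm (a l) \<le> c * C ^ l" using c(2) K' C by (meson less_imp_le subsetD zero_le_power)
    also have "\<dots> \<le> C' * C' ^ l" using C' c C by (intro mult_mono power_mono) auto
    finally show ?thesis by simp
  qed
  moreover have "\<exists>d::nat. d > 0 \<and> real d \<le> C' ^ Suc l \<and> (\<forall>k\<le>l. of_nat d * a k \<in> R)" for l
  proof -
    obtain d :: nat where d: "d > 0" "real d \<le> C ^ l" "\<forall>k\<le>l. algebraic_int (of_nat d * a k)" using den by blast
    have "real (D * d) \<le> C' * C' ^ l" using C' d(2) C order_trans[OF d(2) power_mono[OF C'(2)]] by (simp add: mult_mono)
    moreover have "of_nat (D * d) * a k \<in> R" if "k \<le> l" for k
    proof -
      have "of_nat d * a k \<in> K" using KS(4)[OF Knat] K' by blast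
      then have "of_nat D * (of_nat d * a k) \<in> R" using D(2) d(3) that by blast
      then show ?thesis by (simp add: mult_ac)
    qed
    ultimately show ?thesis using D(1) d(1) by (intro exI[of _ "D * d"]) auto
  qed
  ultimately show ?thesis unfolding E_seq_def using K' C' c by (intro exI[of _ C']) auto
qed

definition E_fps :: "complex fps \<Rightarrow> bool" where
  "E_fps g \<longleftrightarrow> (\<exists>a C. E_seq a C \<and> g = Abs_fps (\<lambda>l. a l / fact l))"

lemma E_fps_one: "E_fps 1"
proof -
  let ?a = "\<lambda>l::nat. if l = 0 then 1 else 0 :: complex"
  have "E_seq ?a (nrm 1)"
    unfolding E_seq_def
  proof (intro conjI allI)
    show "1 \<le> nrm 1" by (rule nrm_one)
    fix l
    show "?a l \<in> K" using KS by simp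
    show "nrm (?a l) \<le> nrm 1 ^ Suc l" using nrm_one nrm_nonneg by simp
    show "\<exists>d>0. real d \<le> nrm 1 ^ Suc l \<and> (\<forall>k\<le>l. of_nat d * ?a k \<in> R)"
      using RS one_le_power[OF nrm_one, of "Suc l"] by (intro exI[of _ 1]) (auto simp del: power_Suc)
  qed
  moreover have "1 = Abs_fps (\<lambda>l. ?a l / fact l)" by (rule fps_ext) (auto simp: fps_one_nth)
  ultimately show ?thesis unfolding E_fps_def by blast
qed

text \<open>After removal of factorials the coefficients of a product are binomial convolutions: the
  binomials of one row add up to 2^l, and the denominators of the factors multiply.\<close>

lemma E_fps_mult:
  assumes "E_fps f" "E_fps g"
  shows "E_fps (f * g)"
proof -
  obtain a C where a: "E_seq a C" "f = Abs_fps (\<lambda>l. a l / fact l)" using assms(1) unfolding E_fps_def by blast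
  obtain b C' where b: "E_seq b C'" "g = Abs_fps (\<lambda>l. b l / fact l)" using assms(2) unfolding E_fps_def by blast
  have C: "1 \<le> C" "1 \<le> C'" using a(1) b(1) by (auto simp: E_seq_def)
  define c where "c = (\<lambda>l. \<Sum>k\<le>l. of_nat (l choose k) * (a k * b (l - k)))"
  have abK: "a k \<in> K" "b k \<in> K" for k using a(1) b(1) by (auto simp: E_seq_def)
  have c1: "nrm (c l) \<le> (2 * C * C') ^ Suc l" for l
  proof -
    have "nrm (c l) \<le> (\<Sum>k\<le>l. nrm (of_nat (l choose k) * (a k * b (l - k))))"
      unfolding c_def by (rule nrm_sum) (use KS Knat abK in auto)
    also have "\<dots> \<le> (\<Sum>k\<le>l. real (l choose k) * (C * C') ^ Suc l)"
    proof (rule sum_mono)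
      fix k assume k: "k \<in> {..l}"
      have "nrm (a k * b (l - k)) \<le> nrm (a k) * nrm (b (l - k))" by (intro nrm_mult abK)
      also have "\<dots> \<le> C ^ Suc k * C' ^ Suc (l - k)" using a(1) b(1) C by (intro mult_mono nrm_nonneg) (auto simp: E_seq_def)
      also have "\<dots> \<le> C ^ Suc l * C' ^ Suc l" using C k by (intro mult_mono power_increasing) auto
      also have "\<dots> = (C * C') ^ Suc l" by (simp only: power_mult_distrib)
      finally have "nrm (a k * b (l - k)) \<le> (C * C') ^ Suc l" .
      then show "nrm (of_nat (l choose k) * (a k * b (l - k))) \<le> real (l choose k) * (C * C') ^ Suc l"
        unfolding nrm_nat[OF KS(4)[OF abK(1) abK(2)]] by (intro mult_left_mono) auto
    qed
    also have "\<dots> = real (\<Sum>k\<le>l. l choose k) * (C * C') ^ Suc l" by (simp add: sum_distrib_right)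
    also have "\<dots> = 2 ^ l * (C * C') ^ Suc l" by (simp add: choose_row_sum)
    also have "\<dots> \<le> 2 ^ Suc l * (C * C') ^ Suc l" using C by (intro mult_right_mono) auto
    finally show ?thesis by (simp add: power_mult_distrib mult.assoc del: power_Suc)
  qed
  have c2: "\<exists>d::nat. d > 0 \<and> real d \<le> (2 * C * C') ^ Suc l \<and> (\<forall>k\<le>l. of_nat d * c k \<in> R)" for l
  proof -
    obtain d1 :: nat where d1: "d1 > 0" "real d1 \<le> C ^ Suc l" "\<forall>k\<le>l. of_nat d1 * a k \<in> R"
      using a(1) unfolding E_seq_def by blast
    obtain d2 :: nat where d2: "d2 > 0" "real d2 \<le> C' ^ Suc l" "\<forall>k\<le>l. of_nat d2 * b k \<in> R"
      using b(1) unfolding E_seq_def by blast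
    have "real (d1 * d2) \<le> C ^ Suc l * C' ^ Suc l" using d1 d2 C by (simp add: mult_mono del: power_Suc)
    also have "\<dots> = (C * C') ^ Suc l" by (simp only: power_mult_distrib)
    also have "\<dots> \<le> (2 * C * C') ^ Suc l" using C by (intro power_mono) (auto simp: mult.assoc)
    finally have "real (d1 * d2) \<le> (2 * C * C') ^ Suc l" .
    moreover have "of_nat (d1 * d2) * c k \<in> R" if "k \<le> l" for k
    proof -
      have "of_nat (d1 * d2) * c k = (\<Sum>i\<le>k. of_nat (k choose i) * ((of_nat d1 * a i) * (of_nat d2 * b (k - i))))"
        by (simp add: c_def sum_distrib_left mult_ac)
      also have "\<dots> \<in> R"
      proof (rule is_subring_sum[OF R_subring], rule RS(4)[OF Rnat], rule RS(4))
        fix i assume "i \<in> {..k}"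
        then show "of_nat d1 * a i \<in> R" "of_nat d2 * b (k - i) \<in> R" using d1(3) d2(3) that by auto
      qed
      finally show ?thesis .
    qed
    ultimately show ?thesis using d1(1) d2(1) by (intro exI[of _ "d1 * d2"]) auto
  qed
  have c3: "c l \<in> K" for l unfolding c_def by (intro Ksum KS Knat abK)
  have c4: "1 \<le> 2 * C * C'" using C mult_mono[of 1 C 1 C'] by simp
  have "E_seq c (2 * C * C')" unfolding E_seq_def by (intro conjI allI c1 c2 c3 c4)
  moreover have "f * g = Abs_fps (\<lambda>l. c l / fact l)"
  proof (rule fps_ext)
    fix l
    have "fps_nth (f * g) l = (\<Sum>k\<le>l. (a k / fact k) * (b (l - k) / fact (l - k)))"
      by (simp add: a b fps_mult_nth atLeast0AtMost)
    also have "\<dots> = (\<Sum>k\<le>l. of_nat (l choose k) * (a k * b (l - k)) / fact l)"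
    proof (rule sum.cong[OF refl])
      fix k assume "k \<in> {..l}"
      then have "of_nat (l choose k) = (fact l / (fact k * fact (l - k)) :: complex)" by (intro binomial_fact) simp
      then show "(a k / fact k) * (b (l - k) / fact (l - k)) = of_nat (l choose k) * (a k * b (l - k)) / fact l" by simp
    qed
    finally show "fps_nth (f * g) l = fps_nth (Abs_fps (\<lambda>l. c l / fact l)) l" by (simp add: c_def sum_divide_distrib)
  qed
  ultimately show ?thesis unfolding E_fps_def by blast
qed

lemma E_fps_power: "E_fps f \<Longrightarrow> E_fps (f ^ n)"
  by (induction n) (auto intro: E_fps_one E_fps_mult)

lemma E_fps_prod: "(\<And>i. i \<in> I \<Longrightarrow> E_fps (f i)) \<Longrightarrow> E_fps (prod f I)"
  by (induction I rule: infinite_finite_induct) (auto intro: E_fps_one E_fps_mult)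

lemma E_fps_abs_summable:
  assumes "E_fps f"
  shows "summable (\<lambda>l. cmod (fps_nth f l * z ^ l))"
proof -
  obtain a C where a: "E_seq a C" "f = Abs_fps (\<lambda>l. a l / fact l)" using assms unfolding E_fps_def by blast
  have C: "1 \<le> C" using a(1) by (auto simp: E_seq_def)
  have sg: "summable (\<lambda>l. C * ((C * cmod z) ^ l /\<^sub>R fact l))" by (intro summable_mult summable_exp_generic)
  show ?thesis
  proof (rule summable_comparison_test'[OF sg, of 0])
    fix l :: nat
    have "cmod (a l) \<le> C ^ Suc l" using a(1) cmod_le_nrm order_trans unfolding E_seq_def by blast
    then have "cmod (a l) * cmod z ^ l / fact l \<le> C ^ Suc l * cmod z ^ l / fact l" by (intro divide_right_mono mult_right_mono) auto
    moreover have "norm (cmod (fps_nth f l * z ^ l)) = cmod (a l) * cmod z ^ l / fact l"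
      by (simp add: a norm_mult norm_divide norm_power norm_fact)
    moreover have "C * ((C * cmod z) ^ l /\<^sub>R fact l) = C ^ Suc l * cmod z ^ l / fact l"
      by (simp add: power_mult_distrib divide_inverse mult_ac)
    ultimately show "norm (cmod (fps_nth f l * z ^ l)) \<le> C * ((C * cmod z) ^ l /\<^sub>R fact l)" by (simp only:)
  qed
qed

definition fval :: "complex fps \<Rightarrow> complex \<Rightarrow> complex" where "fval f z = (\<Sum>l. fps_nth f l * z ^ l)"

lemma fval_sums: "E_fps f \<Longrightarrow> (\<lambda>l. fps_nth f l * z ^ l) sums fval f z"
  unfolding fval_def by (intro summable_sums summable_norm_cancel[OF E_fps_abs_summable])

lemma fval_one: "fval 1 z = 1"
proof -
  have "(\<lambda>l. fps_nth 1 l * z ^ l) sums (\<Sum>l\<in>{0}. fps_nth 1 l * z ^ l)" by (intro sums_finite) auto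
  then show ?thesis unfolding fval_def by (simp add: sums_iff)
qed

lemma fval_mult:
  assumes "E_fps f" "E_fps g"
  shows "fval (f * g) z = fval f z * fval g z"
proof -
  have "(\<lambda>l. \<Sum>i\<le>l. (fps_nth f i * z ^ i) * (fps_nth g (l - i) * z ^ (l - i))) sums (fval f z * fval g z)"
    unfolding fval_def by (intro Cauchy_product_sums E_fps_abs_summable assms)
  moreover have "(\<Sum>i\<le>l. (fps_nth f i * z ^ i) * (fps_nth g (l - i) * z ^ (l - i))) = fps_nth (f * g) l * z ^ l" for l
    unfolding fps_mult_nth sum_distrib_right atLeast0AtMost
  proof (rule sum.cong[OF refl])
    fix i assume "i \<in> {..l}"
    then have "z ^ l = z ^ i * z ^ (l - i)" by (simp flip: power_add)
    then show "(fps_nth f i * z ^ i) * (fps_nth g (l - i) * z ^ (l - i)) = fps_nth f i * fps_nth g (l - i) * z ^ l" by simp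
  qed
  ultimately show ?thesis unfolding fval_def[of "f * g"] by (simp add: sums_iff)
qed

lemma fval_power: "E_fps f \<Longrightarrow> fval (f ^ n) z = fval f z ^ n"
  by (induction n) (auto simp: fval_one fval_mult E_fps_power)

lemma fval_prod: "(\<And>i. i \<in> I \<Longrightarrow> E_fps (f i)) \<Longrightarrow> fval (prod f I) z = (\<Prod>i\<in>I. fval (f i) z)"
  by (induction I rule: infinite_finite_induct) (auto simp: fval_one fval_mult E_fps_prod)

text \<open>Evaluation is compatible with polynomial coefficients, so an identity between polynomial
  combinations of series specialises at z.\<close>

lemma fval_relation:
  assumes "\<And>j. j \<in> J \<Longrightarrow> E_fps (g j)" "(\<Sum>j\<in>J. fps_of_poly (c j) * g j) = fps_of_poly d * k" "E_fps k"
  shows "(\<Sum>j\<in>J. poly (c j) z * fval (g j) z) = poly d z * fval k z"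
proof -
  have "(\<lambda>l. \<Sum>j\<in>J. fps_nth (fps_of_poly (c j) * g j) l * z ^ l) sums (\<Sum>j\<in>J. poly (c j) z * fval (g j) z)"
    by (intro sums_sum fps_poly_sums fval_sums assms(1))
  moreover have "(\<Sum>j\<in>J. fps_nth (fps_of_poly (c j) * g j) l * z ^ l) = fps_nth (fps_of_poly d * k) l * z ^ l" for l
    unfolding assms(2)[symmetric] by (simp add: fps_sum_nth sum_distrib_right)
  ultimately have "(\<lambda>l. fps_nth (fps_of_poly d * k) l * z ^ l) sums (\<Sum>j\<in>J. poly (c j) z * fval (g j) z)" by simp
  moreover have "(\<lambda>l. fps_nth (fps_of_poly d * k) l * z ^ l) sums (poly d z * fval k z)"
    by (intro fps_poly_sums fval_sums assms)
  ultimately show ?thesis by (rule sums_unique2)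
qed

section \<open>Modules over K[z] inside power series\<close>

abbreviation KP :: "complex fps set" where "KP \<equiv> fps_of_poly ` Collect K_poly"

lemma KP_subring: "is_subring KP"
  unfolding is_subring_def
proof (intro conjI ballI)
  note KPS = is_subringD[OF K_poly_subring, unfolded mem_Collect_eq]
  show "0 \<in> KP" using KPS(1) by (intro image_eqI[of _ _ 0]) auto
  show "1 \<in> KP" using KPS(2) by (intro image_eqI[of _ _ 1]) auto
  fix x y assume "x \<in> KP" "y \<in> KP"
  then obtain p q where "x = fps_of_poly p" "y = fps_of_poly q" "K_poly p" "K_poly q" by auto
  then show "x + y \<in> KP" "x * y \<in> KP" "- x \<in> KP"
    using KPS by (auto intro!: image_eqI[of _ _ "p + q"] image_eqI[of _ _ "p * q"] image_eqI[of _ _ "- p"]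
      simp: fps_of_poly_add fps_of_poly_mult fps_of_poly_uminus)
qed

text \<open>The K[z]-module generated by M. Coefficients are indexed by the series themselves, so
  different monomials that give the same series count as one generator.\<close>

definition poly_span :: "complex fps set \<Rightarrow> complex fps set" where
  "poly_span M = {s. \<exists>c. (\<forall>g\<in>M. K_poly (c g)) \<and> s = (\<Sum>g\<in>M. fps_of_poly (c g) * g)}"

lemma poly_span_add: "s \<in> poly_span M \<Longrightarrow> s' \<in> poly_span M \<Longrightarrow> s + s' \<in> poly_span M"
proof -
  assume "s \<in> poly_span M" "s' \<in> poly_span M"
  then obtain c c' where "\<forall>g\<in>M. K_poly (c g)" "s = (\<Sum>g\<in>M. fps_of_poly (c g) * g)"
    "\<forall>g\<in>M. K_poly (c' g)" "s' = (\<Sum>g\<in>M. fps_of_poly (c' g) * g)" unfolding poly_span_def by auto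
  then show ?thesis unfolding poly_span_def using is_subringD(3)[OF K_poly_subring]
    by (intro CollectI exI[of _ "\<lambda>g. c g + c' g"]) (simp add: fps_of_poly_add distrib_right sum.distrib)
qed

lemma poly_span_scale: "K_poly p \<Longrightarrow> s \<in> poly_span M \<Longrightarrow> fps_of_poly p * s \<in> poly_span M"
proof -
  assume p: "K_poly p" and "s \<in> poly_span M"
  then obtain c where "\<forall>g\<in>M. K_poly (c g)" "s = (\<Sum>g\<in>M. fps_of_poly (c g) * g)" unfolding poly_span_def by auto
  then show ?thesis unfolding poly_span_def using p is_subringD(4)[OF K_poly_subring]
    by (intro CollectI exI[of _ "\<lambda>g. p * c g"]) (simp add: fps_of_poly_mult sum_distrib_left mult.assoc)
qed

lemma poly_span_zero: "0 \<in> poly_span M"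
  unfolding poly_span_def using is_subringD(1)[OF K_poly_subring] by (intro CollectI exI[of _ "\<lambda>_. 0"]) simp

lemma poly_span_sum: "(\<And>i. i \<in> I \<Longrightarrow> f i \<in> poly_span M) \<Longrightarrow> sum f I \<in> poly_span M"
  by (induction I rule: infinite_finite_induct) (auto intro: poly_span_zero poly_span_add)

lemma poly_span_base: "finite M \<Longrightarrow> g \<in> M \<Longrightarrow> g \<in> poly_span M"
  unfolding poly_span_def using is_subringD(1,2)[OF K_poly_subring]
  by (intro CollectI exI[of _ "\<lambda>k. if k = g then 1 else 0"])
     (simp add: if_distrib[of fps_of_poly] if_distrib[of "\<lambda>u. u * _"] cong: if_cong)

text \<open>A relation is normalised so that some coefficient p does not vanish at \<xi>. The
  generator g0 at this coefficient is removed at the price of replacing T by p T, which is still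
  nonzero at \<xi>. The process ends with an independent set J, and T' is the denominator with which
  members of M are recovered from it.\<close>

lemma eliminate_relations:
  assumes \<xi>K: "\<xi> \<in> K" and "finite M"
  shows "K_poly T \<Longrightarrow> poly T \<xi> \<noteq> 0 \<Longrightarrow> (\<forall>g\<in>M. fps_of_poly T * fps_deriv g \<in> poly_span M) \<Longrightarrow>
    \<exists>J T'. J \<subseteq> M \<and> K_poly T' \<and> poly T' \<xi> \<noteq> 0 \<and> indep_over KP J (\<lambda>g. g) \<and>
      (\<forall>g\<in>J. fps_of_poly T' * fps_deriv g \<in> poly_span J) \<and> (\<forall>g\<in>M. fps_of_poly T' * g \<in> poly_span J)"
  using assms(2)
proof (induction "card M" arbitrary: M T)
  case 0
  then have "M = {}" by simp
  then show ?case using "0.prems" by (intro exI[of _ "{}"] exI[of _ T]) (auto simp: indep_over_def)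
next
  case (Suc m)
  show ?case
  proof (cases "indep_over KP M (\<lambda>g. g)")
    case True
    then show ?thesis using Suc.prems by (intro exI[of _ M] exI[of _ T]) (auto intro: poly_span_scale poly_span_base)
  next
    case False
    then obtain c0 where c0: "\<forall>j\<in>M. c0 j \<in> KP" "(\<Sum>j\<in>M. c0 j * j) = 0" "\<exists>j\<in>M. c0 j \<noteq> 0"
      unfolding indep_over_def by auto
    have "\<forall>j. \<exists>p. j \<in> M \<longrightarrow> K_poly p \<and> c0 j = fps_of_poly p" using c0(1) by blast
    from choice[OF this] obtain c1 where c1: "\<And>j. j \<in> M \<Longrightarrow> K_poly (c1 j) \<and> c0 j = fps_of_poly (c1 j)" by auto
    have nz: "\<exists>j\<in>M. c1 j \<noteq> 0" using c0(3) c1 by fastforce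
    have "\<forall>j\<in>M. \<forall>i. coeff (c1 j) i \<in> K" using c1 by (auto simp: K_poly_def)
    from common_root_factor[OF number_field_subring[OF K] \<xi>K Suc.prems(4) this nz]
    obtain e c where c: "\<forall>j\<in>M. c1 j = [:-\<xi>, 1:] ^ e * c j \<and> (\<forall>i. coeff (c j) i \<in> K)" "\<exists>j\<in>M. poly (c j) \<xi> \<noteq> 0" by blast
    have cK: "K_poly (c j)" if "j \<in> M" for j using c(1) that by (auto simp: K_poly_def)
    have "fps_of_poly ([:-\<xi>, 1:] ^ e) * (\<Sum>j\<in>M. fps_of_poly (c j) * j) = (\<Sum>j\<in>M. c0 j * j)"
      unfolding sum_distrib_left
    proof (rule sum.cong[OF refl])
      fix j assume j: "j \<in> M"
      have "c0 j = fps_of_poly ([:-\<xi>, 1:] ^ e) * fps_of_poly (c j)"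
        using c1[OF j] c(1) j by (simp only: fps_of_poly_mult)
      then show "fps_of_poly ([:-\<xi>, 1:] ^ e) * (fps_of_poly (c j) * j) = c0 j * j" by (simp only: mult.assoc)
    qed
    moreover have "fps_of_poly ([:-\<xi>, 1:] ^ e) \<noteq> 0" by simp
    ultimately have rel: "(\<Sum>j\<in>M. fps_of_poly (c j) * j) = 0" using c0(2) by (metis mult_eq_0_iff)
    obtain g0 where g0: "g0 \<in> M" "poly (c g0) \<xi> \<noteq> 0" using c(2) by blast
    \<comment> \<open>The pivot has to be a coefficient that survives at \<xi>; any other would
      introduce a singularity there.\<close>
    define p where "p = c g0"
    let ?M = "M - {g0}"
    have finM: "finite ?M" using Suc.prems(4) by simp
    have pK: "K_poly p" using cK[OF g0(1)] by (simp add: p_def)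
    have pg0: "fps_of_poly p * g0 \<in> poly_span ?M"
    proof -
      have "fps_of_poly p * g0 + (\<Sum>j\<in>?M. fps_of_poly (c j) * j) = 0"
        using rel g0(1) Suc.prems(4) by (simp add: sum.remove p_def)
      then have "fps_of_poly p * g0 = (\<Sum>j\<in>?M. fps_of_poly (- c j) * j)"
        by (simp add: fps_of_poly_uminus sum_negf eq_neg_iff_add_eq_0)
      moreover have "\<forall>j\<in>?M. K_poly (- c j)" using cK is_subringD(5)[OF K_poly_subring] by auto
      ultimately show ?thesis unfolding poly_span_def by (intro CollectI exI[of _ "\<lambda>j. - c j"]) simp
    qed
    have pg: "fps_of_poly p * g \<in> poly_span ?M" if "g \<in> M" for g
      using pg0 poly_span_scale[OF pK poly_span_base[OF finM]] that by (cases "g = g0") auto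
    have psp: "fps_of_poly p * s \<in> poly_span ?M" if s: "s \<in> poly_span M" for s
    proof -
      obtain k where k: "\<forall>g\<in>M. K_poly (k g)" "s = (\<Sum>g\<in>M. fps_of_poly (k g) * g)" using s unfolding poly_span_def by auto
      have "fps_of_poly p * s = (\<Sum>g\<in>M. fps_of_poly (k g) * (fps_of_poly p * g))"
        by (simp add: k(2) sum_distrib_left mult_ac)
      also have "\<dots> \<in> poly_span ?M" by (rule poly_span_sum, rule poly_span_scale) (use k(1) pg in auto)
      finally show ?thesis .
    qed
    have "m = card ?M" using Suc.hyps(2) g0(1) Suc.prems(4) by simp
    moreover have "K_poly (p * T)" using pK Suc.prems(1) is_subringD(4)[OF K_poly_subring] by auto
    moreover have "poly (p * T) \<xi> \<noteq> 0" using g0(2) Suc.prems(2) by (simp add: p_def)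
    moreover have "\<forall>g\<in>?M. fps_of_poly (p * T) * fps_deriv g \<in> poly_span ?M"
      using psp Suc.prems(3) by (auto simp: fps_of_poly_mult mult.assoc)
    ultimately obtain J T' where J: "J \<subseteq> ?M" "K_poly T'" "poly T' \<xi> \<noteq> 0" "indep_over KP J (\<lambda>g. g)"
      "\<forall>g\<in>J. fps_of_poly T' * fps_deriv g \<in> poly_span J" "\<forall>g\<in>?M. fps_of_poly T' * g \<in> poly_span J"
      using Suc.hyps(1)[OF _ _ _ _ finM, of "p * T"] by blast
    have "fps_of_poly (p * T') * g \<in> poly_span J" if g: "g \<in> M" for g
    proof -
      obtain k where k: "\<forall>g\<in>?M. K_poly (k g)" "fps_of_poly p * g = (\<Sum>g\<in>?M. fps_of_poly (k g) * g)"
        using pg[OF g] unfolding poly_span_def by auto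
      have "fps_of_poly (p * T') * g = fps_of_poly T' * (fps_of_poly p * g)" by (simp add: fps_of_poly_mult mult_ac)
      also have "\<dots> = (\<Sum>g\<in>?M. fps_of_poly (k g) * (fps_of_poly T' * g))"
        unfolding k(2) by (simp add: sum_distrib_left mult_ac)
      also have "\<dots> \<in> poly_span J" by (rule poly_span_sum, rule poly_span_scale) (use k(1) J(6) in auto)
      finally show ?thesis .
    qed
    moreover have "fps_of_poly (p * T') * fps_deriv g \<in> poly_span J" if "g \<in> J" for g
      using poly_span_scale[OF pK] J(5) that by (auto simp: fps_of_poly_mult mult.assoc)
    moreover have "K_poly (p * T')" using pK J(2) is_subringD(4)[OF K_poly_subring] by auto
    moreover have "poly (p * T') \<xi> \<noteq> 0" using g0(2) J(3) by (simp add: p_def)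
    ultimately show ?thesis using J(1,4) by (intro exI[of _ J] exI[of _ "p * T'"]) auto
  qed
qed

end

lemma indep_over_reindex:
  assumes "indep_over S J \<phi>" "bij_betw \<gamma> I J"
  shows "indep_over S I (\<lambda>i. \<phi> (\<gamma> i))"
  unfolding indep_over_def
proof (intro allI impI)
  fix c assume c: "(\<forall>j\<in>I. c j \<in> S) \<and> (\<Sum>j\<in>I. c j * \<phi> (\<gamma> j)) = 0"
  let ?c = "\<lambda>j. c (inv_into I \<gamma> j)"
  have inv: "inv_into I \<gamma> (\<gamma> i) = i" if "i \<in> I" for i using assms(2) that by (simp add: bij_betw_def inv_into_f_f)
  have "(\<Sum>j\<in>J. ?c j * \<phi> j) = (\<Sum>i\<in>I. ?c (\<gamma> i) * \<phi> (\<gamma> i))" by (rule sum.reindex_bij_betw[OF assms(2), symmetric])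
  also have "\<dots> = (\<Sum>i\<in>I. c i * \<phi> (\<gamma> i))" by (rule sum.cong[OF refl]) (simp add: inv)
  also have "\<dots> = 0" using c by simp
  finally have z: "(\<Sum>j\<in>J. ?c j * \<phi> j) = 0" .
  have m: "?c j \<in> S" if "j \<in> J" for j
  proof -
    have "inv_into I \<gamma> j \<in> I" using that assms(2) by (metis bij_betw_imp_surj_on inv_into_into)
    then show ?thesis using c by blast
  qed
  show "\<forall>j\<in>I. c j = 0"
  proof
    fix i assume i: "i \<in> I"
    then have "\<gamma> i \<in> J" using assms(2) by (auto simp: bij_betw_def)
    from indep_overD[OF assms(1) m z this] show "c i = 0" using inv[OF i] by simp
  qed
qed

section \<open>The dimension bound for systems with relations\<close>

context sized_field begin

lemma common_denominator:
  "finite X \<Longrightarrow> X \<subseteq> K \<Longrightarrow> \<exists>d::nat. d > 0 \<and> (\<forall>x\<in>X. of_nat d * x \<in> R)"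
proof (induction X rule: finite_induct)
  case (insert x X)
  then obtain d :: nat where d: "d > 0" "\<forall>x\<in>X. of_nat d * x \<in> R" by auto
  obtain e :: nat where e: "e > 0" "of_nat e * x \<in> R" using denominator[of x] insert.prems by auto
  have "of_nat (d * e) * x \<in> R" using RS(4)[OF Rnat[of d] e(2)] by (simp add: mult.assoc)
  moreover have "of_nat (d * e) * u \<in> R" if "u \<in> X" for u
    using RS(4)[OF Rnat[of e], of "of_nat d * u"] d(2) that by (simp add: mult_ac)
  ultimately show ?case using d(1) e(1) by (intro exI[of _ "d * e"]) auto
qed (auto intro: exI[of _ 1])

lemma common_poly_denominator:
  assumes "finite F" "\<And>p. p \<in> F \<Longrightarrow> K_poly p"
  shows "\<exists>d::nat. d > 0 \<and> (\<forall>p\<in>F. R_poly (Polynomial.smult (of_nat d) p))"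
proof -
  define X where "X = (\<Union>p\<in>F. set (coeffs p))"
  have "finite X" using assms(1) by (simp add: X_def)
  moreover have "X \<subseteq> K" using assms(2) by (auto simp: X_def K_poly_def coeffs_def split: if_splits)
  ultimately obtain d :: nat where d: "d > 0" "\<forall>x\<in>X. of_nat d * x \<in> R" using common_denominator by blast
  have "of_nat d * coeff p i \<in> R" if "p \<in> F" for p i
  proof (cases "coeff p i = 0")
    case True then show ?thesis using RS(1) by simp
  next
    case False
    then have "coeff p i \<in> set (coeffs p)" using coeff_in_coeffs[of p i] le_degree[of p i] by fastforce
    then show ?thesis using d(2) that by (auto simp: X_def)
  qed
  then show ?thesis using d(1) by (intro exI[of _ d]) (auto simp: R_poly_def)
qed

text \<open>Elimination replaces M by an independent J that still has a nonzero value at \<xi>. The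
  series indexed by A lie in the span of J over K(z), and the values of J span a K-space of
  dimension at most \<open>card I\<close>, so the bound for independent systems gives the
  claim.\<close>

theorem independent_functions_bound:
  fixes M :: "complex fps set" and \<phi> :: "'a \<Rightarrow> complex fps" and \<psi> :: "'k \<Rightarrow> complex"
  assumes \<xi>K: "\<xi> \<in> K" and \<xi>: "\<xi> \<noteq> 0" and M: "finite M" "\<And>g. g \<in> M \<Longrightarrow> E_fps g"
    and T: "K_poly T" "poly T \<xi> \<noteq> 0" and closed: "\<And>g. g \<in> M \<Longrightarrow> fps_of_poly T * fps_deriv g \<in> poly_span M"
    and I: "finite I" and gen: "\<And>g. g \<in> M \<Longrightarrow> \<exists>c. (\<forall>k\<in>I. c k \<in> K) \<and> fval g \<xi> = (\<Sum>k\<in>I. c k * \<psi> k)"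
    and nz: "\<exists>g\<in>M. fval g \<xi> \<noteq> 0"
    and A: "finite A" "indep_over KP A \<phi>" "\<And>\<alpha>. \<alpha> \<in> A \<Longrightarrow> \<phi> \<alpha> \<in> M"
  shows "card A \<le> card I * h"
proof -
  have "\<exists>J T'. J \<subseteq> M \<and> K_poly T' \<and> poly T' \<xi> \<noteq> 0 \<and> indep_over KP J (\<lambda>g. g) \<and>
      (\<forall>g\<in>J. fps_of_poly T' * fps_deriv g \<in> poly_span J) \<and> (\<forall>g\<in>M. fps_of_poly T' * g \<in> poly_span J)"
    by (rule eliminate_relations[OF \<xi>K M(1) T]) (use closed in blast)
  then obtain J T' where J: "J \<subseteq> M" "K_poly T'" "poly T' \<xi> \<noteq> 0" "indep_over KP J (\<lambda>g. g)"
      "\<forall>g\<in>J. fps_of_poly T' * fps_deriv g \<in> poly_span J" "\<forall>g\<in>M. fps_of_poly T' * g \<in> poly_span J" by blast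
  have finJ: "finite J" using J(1) M(1) finite_subset by blast
  have T'0: "T' \<noteq> 0" using J(3) by auto
  have AJ: "card A \<le> card J"
  proof (rule card_indep_le[OF KP_subring A(1) finJ A(2), where \<psi> = "\<lambda>g. g"])
    fix \<alpha> assume "\<alpha> \<in> A"
    then have "fps_of_poly T' * \<phi> \<alpha> \<in> poly_span J" using A(3) J(6) by blast
    then obtain c where "\<forall>g\<in>J. K_poly (c g)" "fps_of_poly T' * \<phi> \<alpha> = (\<Sum>g\<in>J. fps_of_poly (c g) * g)" unfolding poly_span_def by auto
    then show "\<exists>d c. d \<in> KP \<and> d \<noteq> 0 \<and> (\<forall>k\<in>J. c k \<in> KP) \<and> d * \<phi> \<alpha> = (\<Sum>k\<in>J. c k * k)"
      using J(2) T'0 by (intro exI[of _ "fps_of_poly T'"] exI[of _ "\<lambda>g. fps_of_poly (c g)"]) auto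
  qed
  have EJ: "E_fps g" if "g \<in> J" for g using J(1) M(2) that by blast
  let ?v = "\<lambda>g. fval g \<xi>"
  \<comment> \<open>If all of J vanished at \<xi>, then so would T' g for every g in M, although T'
    does not vanish there.\<close>
  have nzJ: "\<exists>g\<in>J. ?v g \<noteq> 0"
  proof (rule ccontr)
    assume no: "\<not> ?thesis"
    obtain g where g: "g \<in> M" "?v g \<noteq> 0" using nz by blast
    have "fps_of_poly T' * g \<in> poly_span J" using J(6) g(1) by blast
    then obtain c where c: "\<forall>g\<in>J. K_poly (c g)" "fps_of_poly T' * g = (\<Sum>g\<in>J. fps_of_poly (c g) * g)" unfolding poly_span_def by auto
    have "(\<Sum>j\<in>J. poly (c j) \<xi> * ?v j) = poly T' \<xi> * ?v g"
      by (rule fval_relation) (use EJ c(2) M(2) g(1) in auto)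
    moreover have "(\<Sum>j\<in>J. poly (c j) \<xi> * ?v j) = 0" using no by (intro sum.neutral) auto
    ultimately show False using J(3) g(2) by simp
  qed
  have KSub: "is_subring K" using number_field_subring[OF K] .
  \<comment> \<open>A K-basis of the space of values; its size is at most that of any generating
    family.\<close>
  have "\<exists>J0\<subseteq>J. indep_over K J0 ?v \<and> (\<forall>j\<in>J. \<exists>d c. d \<in> K \<and> d \<noteq> 0 \<and> (\<forall>k\<in>J0. c k \<in> K) \<and> d * ?v j = (\<Sum>k\<in>J0. c k * ?v k))"
    by (rule max_indep_exists[OF KSub finJ])
  then obtain J0 where J0: "J0 \<subseteq> J" "indep_over K J0 ?v"
    "\<forall>j\<in>J. \<exists>d c. d \<in> K \<and> d \<noteq> 0 \<and> (\<forall>k\<in>J0. c k \<in> K) \<and> d * ?v j = (\<Sum>k\<in>J0. c k * ?v k)" by (elim exE conjE)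
  have finJ0: "finite J0" using J0(1) finJ finite_subset by blast
  have sI: "card J0 \<le> card I"
  proof (rule card_indep_le[OF KSub finJ0 I J0(2), where \<psi> = \<psi>])
    fix j assume "j \<in> J0"
    then have "j \<in> M" using J0(1) J(1) by blast
    then obtain c where "\<forall>k\<in>I. c k \<in> K" "?v j = (\<Sum>k\<in>I. c k * \<psi> k)" using gen by blast
    then show "\<exists>d c. d \<in> K \<and> d \<noteq> 0 \<and> (\<forall>k\<in>I. c k \<in> K) \<and> d * ?v j = (\<Sum>k\<in>I. c k * \<psi> k)"
      using KS(2) by (intro exI[of _ 1] exI[of _ c]) auto
  qed
  have J0ne: "J0 \<noteq> {}"
  proof
    assume e: "J0 = {}"
    have "?v j = 0" if "j \<in> J" for j using J0(3) that unfolding e by auto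
    then show False using nzJ by blast
  qed
  have J0nz: "?v k \<noteq> 0" if k: "k \<in> J0" for k
  proof
    assume z: "?v k = 0"
    have "(\<Sum>j\<in>J0. (if j = k then 1 else 0) * ?v j) = 0" using z by (intro sum.neutral) auto
    moreover have "(if j = k then 1 else 0) \<in> K" for j :: "complex fps" using KS by simp
    ultimately have "(if k = k then 1 else 0 :: complex) = 0"
      using indep_overD[OF J0(2), of "\<lambda>j. if j = k then 1 else 0" k] k by blast
    then show False by simp
  qed
  \<comment> \<open>Coordinates of the values in this basis. Unit vectors are prescribed for the
    members of J0, which makes the resulting matrix w injective.\<close>
  have "\<forall>j. \<exists>\<mu>. j \<in> J \<longrightarrow> (\<forall>k\<in>J0. \<mu> k \<in> K) \<and> ?v j = (\<Sum>k\<in>J0. \<mu> k * ?v k) \<and> (j \<in> J0 \<longrightarrow> (\<forall>k\<in>J0. \<mu> k = (if k = j then 1 else 0)))"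
  proof
    fix j
    show "\<exists>\<mu>. j \<in> J \<longrightarrow> (\<forall>k\<in>J0. \<mu> k \<in> K) \<and> ?v j = (\<Sum>k\<in>J0. \<mu> k * ?v k) \<and> (j \<in> J0 \<longrightarrow> (\<forall>k\<in>J0. \<mu> k = (if k = j then 1 else 0)))"
    proof (cases "j \<in> J0")
      case True
      have "?v j = (\<Sum>k\<in>J0. (if k = j then 1 else 0) * ?v k)"
        using True finJ0 by (simp add: if_distrib[of "\<lambda>u. u * _"] cong: if_cong)
      then show ?thesis using KS by (intro exI[of _ "\<lambda>k. if k = j then 1 else 0"]) auto
    next
      case False
      show ?thesis
      proof (cases "j \<in> J")
        case True
        obtain d c where dc: "d \<in> K" "d \<noteq> 0" "\<forall>k\<in>J0. c k \<in> K" "d * ?v j = (\<Sum>k\<in>J0. c k * ?v k)"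
          using J0(3) True by blast
        have "?v j = (\<Sum>k\<in>J0. c k * ?v k) / d" using dc(2,4) by (simp add: field_simps)
        then have "?v j = (\<Sum>k\<in>J0. c k / d * ?v k)" by (simp add: sum_divide_distrib)
        moreover have "\<forall>k\<in>J0. c k / d \<in> K" using dc number_field_divide[OF K] by blast
        ultimately show ?thesis using False by (intro exI[of _ "\<lambda>k. c k / d"]) auto
      qed auto
    qed
  qed
  from choice[OF this] obtain \<mu> where \<mu>: "\<And>j. j \<in> J \<Longrightarrow> (\<forall>k\<in>J0. \<mu> j k \<in> K) \<and> ?v j = (\<Sum>k\<in>J0. \<mu> j k * ?v k) \<and> (j \<in> J0 \<longrightarrow> (\<forall>k\<in>J0. \<mu> j k = (if k = j then 1 else 0)))"
    by auto
  have "finite ((\<lambda>(j,k). \<mu> j k) ` (J \<times> J0))" "(\<lambda>(j,k). \<mu> j k) ` (J \<times> J0) \<subseteq> K" using finJ finJ0 \<mu> by auto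
  from common_denominator[OF this] obtain d\<mu> :: nat where
    "d\<mu> > 0 \<and> (\<forall>x\<in>(\<lambda>(j,k). \<mu> j k) ` (J \<times> J0). of_nat d\<mu> * x \<in> R)" ..
  then have d\<mu>: "d\<mu> > 0" "\<And>j k. j \<in> J \<Longrightarrow> k \<in> J0 \<Longrightarrow> of_nat d\<mu> * \<mu> j k \<in> R" by auto
  have "\<forall>g. \<exists>c. g \<in> J \<longrightarrow> (\<forall>k\<in>J. K_poly (c k)) \<and> fps_of_poly T' * fps_deriv g = (\<Sum>k\<in>J. fps_of_poly (c k) * k)"
    using J(5) unfolding poly_span_def by auto
  from choice[OF this] obtain B0 where B0: "\<And>g. g \<in> J \<Longrightarrow> (\<forall>k\<in>J. K_poly (B0 g k)) \<and> fps_of_poly T' * fps_deriv g = (\<Sum>k\<in>J. fps_of_poly (B0 g k) * k)"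
    by auto
  have "finite (insert T' ((\<lambda>(j,k). B0 j k) ` (J \<times> J)))" using finJ by simp
  moreover have "K_poly p" if "p \<in> insert T' ((\<lambda>(j,k). B0 j k) ` (J \<times> J))" for p using that J(2) B0 by auto
  ultimately obtain d :: nat where "d > 0 \<and> (\<forall>p\<in>insert T' ((\<lambda>(j,k). B0 j k) ` (J \<times> J)). R_poly (Polynomial.smult (of_nat d) p))"
    using common_poly_denominator by blast
  then have d: "d > 0" "R_poly (Polynomial.smult (of_nat d) T')" "\<And>j k. j \<in> J \<Longrightarrow> k \<in> J \<Longrightarrow> R_poly (Polynomial.smult (of_nat d) (B0 j k))" by auto
  have "\<forall>g. \<exists>a. \<exists>C. g \<in> J \<longrightarrow> E_seq a C \<and> g = Abs_fps (\<lambda>l. a l / fact l)" using EJ unfolding E_fps_def by blast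
  from choice[OF this] obtain a where "\<forall>g. \<exists>C. g \<in> J \<longrightarrow> E_seq (a g) C \<and> g = Abs_fps (\<lambda>l. a g l / fact l)" ..
  from choice[OF this] obtain Cg where aC: "\<And>g. g \<in> J \<Longrightarrow> E_seq (a g) (Cg g) \<and> g = Abs_fps (\<lambda>l. a g l / fact l)" by auto
  \<comment> \<open>The individual constants are at least 1, so their sum is a common one.\<close>
  define C where "C = (\<Sum>g\<in>J. Cg g)"
  have aCC: "E_seq (a g) C" if g: "g \<in> J" for g
  proof (rule E_seq_mono)
    show "E_seq (a g) (Cg g)" using aC[OF g] by blast
    show "Cg g \<le> C" unfolding C_def by (rule member_le_sum[OF g _ finJ]) (use aC in \<open>auto simp: E_seq_def intro: order_trans[of 0 1]\<close>)
  qed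
  define n where "n = card J"
  define s where "s = card J0"
  obtain \<gamma> where \<gamma>: "bij_betw \<gamma> {..<n} J" using ex_bij_betw_nat_finite[OF finJ] unfolding n_def by (metis lessThan_atLeast0)
  obtain \<eta> where \<eta>: "bij_betw \<eta> {..<s} J0" using ex_bij_betw_nat_finite[OF finJ0] unfolding s_def by (metis lessThan_atLeast0)
  have \<gamma>J: "\<gamma> i \<in> J" if "i < n" for i using \<gamma> that by (auto simp: bij_betw_def)
  have \<eta>J: "\<eta> i \<in> J0" if "i < s" for i using \<eta> that by (auto simp: bij_betw_def)
  have s0: "s > 0" using J0ne finJ0 by (simp add: s_def card_gt_0_iff)
  have n0: "n > 0" using nzJ finJ by (auto simp: n_def card_gt_0_iff)
  have "n \<le> s * h"
  proof (rule linear_forms_bound[where f = \<gamma> and a = "\<lambda>i. a (\<gamma> i)" and C = C and T = "Polynomial.smult (of_nat d) T'"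
        and B = "\<lambda>i j. Polynomial.smult (of_nat d) (B0 (\<gamma> i) (\<gamma> j))" and val = "\<lambda>i. ?v (\<gamma> i)"
        and w = "\<lambda>i k. of_nat d\<mu> * \<mu> (\<gamma> i) (\<eta> k)" and y = "\<lambda>k. ?v (\<eta> k)" and d\<mu> = d\<mu>, OF n0 s0 \<xi>K \<xi>])
    show "poly (Polynomial.smult (of_nat d) T') \<xi> \<noteq> 0" using d(1) J(3) by simp
    show "R_poly (Polynomial.smult (of_nat d) T')" by (rule d(2))
    show "0 < d\<mu>" by (rule d\<mu>(1))
    show "R_poly (Polynomial.smult (of_nat d) (B0 (\<gamma> i) (\<gamma> j)))" if "i < n" "j < n" for i j using d(3) \<gamma>J that by blast
    show "E_seq (a (\<gamma> i)) C" if "i < n" for i using aCC \<gamma>J that by blast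
    show "\<gamma> i = Abs_fps (\<lambda>l. a (\<gamma> i) l / fact l)" if "i < n" for i using aC[OF \<gamma>J[OF that]] by blast
    show "indep_over KP {..<n} \<gamma>" by (rule indep_over_reindex[OF J(4) \<gamma>])
    show "(\<lambda>l. fps_nth (\<gamma> i) l * \<xi> ^ l) sums ?v (\<gamma> i)" if "i < n" for i using fval_sums EJ \<gamma>J that by blast
    show "of_nat d\<mu> * \<mu> (\<gamma> i) (\<eta> k) \<in> R" if "i < n" "k < s" for i k using d\<mu>(2) \<gamma>J \<eta>J that by blast
    show "fps_of_poly (Polynomial.smult (of_nat d) T') * fps_deriv (\<gamma> i) = (\<Sum>j<n. fps_of_poly (Polynomial.smult (of_nat d) (B0 (\<gamma> i) (\<gamma> j))) * \<gamma> j)"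
      if "i < n" for i
    proof -
      have "fps_of_poly (Polynomial.smult (of_nat d) T') * fps_deriv (\<gamma> i) = fps_const (of_nat d) * (fps_of_poly T' * fps_deriv (\<gamma> i))"
        by (simp add: fps_of_poly_smult mult.assoc)
      also have "\<dots> = fps_const (of_nat d) * (\<Sum>k\<in>J. fps_of_poly (B0 (\<gamma> i) k) * k)" using B0[OF \<gamma>J[OF that]] by simp
      also have "(\<Sum>k\<in>J. fps_of_poly (B0 (\<gamma> i) k) * k) = (\<Sum>j<n. fps_of_poly (B0 (\<gamma> i) (\<gamma> j)) * \<gamma> j)"
        by (rule sum.reindex_bij_betw[OF \<gamma>, symmetric])
      finally show ?thesis by (simp add: fps_of_poly_smult sum_distrib_left mult.assoc)
    qed
    show "of_nat d\<mu> * ?v (\<gamma> i) = (\<Sum>k<s. of_nat d\<mu> * \<mu> (\<gamma> i) (\<eta> k) * ?v (\<eta> k))" if "i < n" for i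
    proof -
      have "?v (\<gamma> i) = (\<Sum>k\<in>J0. \<mu> (\<gamma> i) k * ?v k)" using \<mu>[OF \<gamma>J[OF that]] by blast
      also have "\<dots> = (\<Sum>k<s. \<mu> (\<gamma> i) (\<eta> k) * ?v (\<eta> k))" by (rule sum.reindex_bij_betw[OF \<eta>, symmetric])
      finally have e: "?v (\<gamma> i) = (\<Sum>k<s. \<mu> (\<gamma> i) (\<eta> k) * ?v (\<eta> k))" .
      show ?thesis by (subst e) (simp add: sum_distrib_left mult.assoc)
    qed
    show "\<exists>k<s. ?v (\<eta> k) \<noteq> 0" using s0 \<eta>J J0nz by blast
    fix x assume x: "\<And>i. i < n \<Longrightarrow> (\<Sum>k<s. of_nat d\<mu> * \<mu> (\<gamma> i) (\<eta> k) * x k) = 0"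
    show "\<forall>k<s. x k = 0"
    proof (intro allI impI)
      fix k assume k: "k < s"
      have "\<eta> k \<in> J" using \<eta>J[OF k] J0(1) by blast
      then obtain i where i: "i < n" "\<gamma> i = \<eta> k" using \<gamma> by (metis bij_betw_imp_surj_on imageE lessThan_iff)
      have inj: "\<eta> k' = \<eta> k \<longleftrightarrow> k' = k" if "k' < s" for k' using \<eta> k that by (auto simp: bij_betw_def inj_on_def)
      have "\<mu> (\<gamma> i) (\<eta> k') = (if k' = k then 1 else 0)" if "k' < s" for k'
        using \<mu>[OF \<gamma>J[OF i(1)]] \<eta>J[OF that] \<eta>J[OF k] inj[OF that] unfolding i(2) by auto
      then have "(\<Sum>k'<s. of_nat d\<mu> * \<mu> (\<gamma> i) (\<eta> k') * x k') = (\<Sum>k'<s. (if k' = k then of_nat d\<mu> * x k' else 0))"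
        by (intro sum.cong) auto
      also have "\<dots> = of_nat d\<mu> * x k" using k by simp
      finally show "x k = 0" using x[OF i(1)] d\<mu>(1) by simp
    qed
  qed
  then have "card J \<le> card J0 * h" by (simp add: n_def s_def)
  also have "\<dots> \<le> card I * h" using sI by (rule mult_le_mono1)
  finally show ?thesis using AJ by simp
qed

end

section \<open>Regular systems at a point\<close>

text \<open>A nonzero power series without constant term has no further zeros near 0. Multiplication
  by z brings g into this situation even if its constant term is nonzero.\<close>

lemma fps_zero_of_sums:
  fixes g :: "complex fps"
  assumes s: "\<And>z. (\<lambda>l. fps_nth g l * z ^ l) sums D z" and Z: "finite Z" "\<And>z. z \<notin> Z \<Longrightarrow> D z = 0"
  shows "g = 0"
proof (rule ccontr)
  assume "g \<noteq> 0"
  then obtain m where m: "fps_nth g m \<noteq> 0" by (auto simp: fps_eq_iff)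
  have s': "(\<lambda>l. fps_nth (fps_X * g) l * (z - 0) ^ l) sums (z * D z)" for z
  proof -
    have "(\<lambda>l. fps_nth (fps_X * g) (Suc l) * z ^ Suc l) sums (z * D z)"
      using sums_mult[OF s[of z], of z] by (simp add: mult_ac)
    then show ?thesis by (subst (asm) sums_Suc_iff) simp
  qed
  obtain e where e: "0 < e" "\<And>z. z \<in> cball 0 e - {0} \<Longrightarrow> z * D z \<noteq> 0"
  proof (rule powser_0_nonzero[of 1 0 "fps_nth (fps_X * g)" "\<lambda>z. z * D z" "Suc m"])
    show "fps_nth (fps_X * g) (Suc m) \<noteq> 0" using m by simp
  qed (use s' in auto)
  have "cball 0 e - {0} \<subseteq> Z" using e(2) Z(2) by fastforce
  moreover have "infinite (cball (0::complex) e - {0})"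
  proof -
    have "\<not> finite (cball (0::complex) e)" using uncountable_cball[OF e(1), of "0::complex"] countable_finite by blast
    then show ?thesis by simp
  qed
  ultimately show False using Z(1) finite_subset by blast
qed

lemma fps_sums_deriv:
  fixes g :: "complex fps"
  assumes s: "\<And>z. (\<lambda>l. fps_nth g l * z ^ l) sums D z"
  shows "(D has_field_derivative deriv D z) (at z)" "(\<lambda>l. fps_nth (fps_deriv g) l * z ^ l) sums deriv D z"
proof -
  have sm: "summable (\<lambda>l. fps_nth g l * z ^ l)" for z using s sums_summable by blast
  have D: "D = (\<lambda>z. \<Sum>l. fps_nth g l * z ^ l)" using s by (auto simp: sums_iff)
  have d: "(D has_field_derivative (\<Sum>l. diffs (fps_nth g) l * z ^ l)) (at z)"
    unfolding D by (rule termdiffs_strong_converges_everywhere[OF sm])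
  then show "(D has_field_derivative deriv D z) (at z)" using DERIV_imp_deriv by metis
  have "summable (\<lambda>l. diffs (fps_nth g) l * z ^ l)" by (rule termdiff_converges_all[OF sm])
  then have "(\<lambda>l. diffs (fps_nth g) l * z ^ l) sums deriv D z" using DERIV_imp_deriv[OF d] by (simp add: summable_sums)
  then show "(\<lambda>l. fps_nth (fps_deriv g) l * z ^ l) sums deriv D z" by (simp add: diffs_def)
qed

text \<open>T is a common multiple of the denominators and B the cleared matrix. Away from the zeros
  of T the system holds as assumed; the difference of the two sides is an everywhere convergent
  series that vanishes off a finite set, hence zero. The cleared system therefore holds also at the
  singular points.\<close>

lemma system_fps:
  fixes F :: "nat \<Rightarrow> complex fps"
  assumes s: "\<And>i z. i < \<mu> \<Longrightarrow> (\<lambda>l. fps_nth (F i) l * z ^ l) sums E i z"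
    and T: "T \<noteq> 0" "\<And>i j. i < \<mu> \<Longrightarrow> j < \<mu> \<Longrightarrow> Q i j dvd T \<and> B i j * Q i j = T * P i j"
    and system: "\<forall>z. (\<forall>i<\<mu>. \<forall>j<\<mu>. poly (Q i j) z \<noteq> 0) \<longrightarrow>
        (\<forall>i<\<mu>. (E i has_field_derivative (\<Sum>j<\<mu>. poly (P i j) z / poly (Q i j) z * E j z)) (at z))"
    and i: "i < \<mu>"
  shows "fps_of_poly T * fps_deriv (F i) = (\<Sum>j<\<mu>. fps_of_poly (B i j) * F j)"
    "poly T z * deriv (E i) z = (\<Sum>j<\<mu>. poly (B i j) z * E j z)"
proof -
  define g where "g = fps_of_poly T * fps_deriv (F i) - (\<Sum>j<\<mu>. fps_of_poly (B i j) * F j)"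
  define D where "D = (\<lambda>z. poly T z * deriv (E i) z - (\<Sum>j<\<mu>. poly (B i j) z * E j z))"
  have sD: "(\<lambda>l. fps_nth g l * z ^ l) sums D z" for z
  proof -
    have 1: "(\<lambda>l. fps_nth (fps_of_poly T * fps_deriv (F i)) l * z ^ l) sums (poly T z * deriv (E i) z)"
      by (intro fps_poly_sums fps_sums_deriv(2) s i)
    have 2: "(\<lambda>l. \<Sum>j<\<mu>. fps_nth (fps_of_poly (B i j) * F j) l * z ^ l) sums (\<Sum>j<\<mu>. poly (B i j) z * E j z)"
      by (intro sums_sum fps_poly_sums s) auto
    show ?thesis using sums_diff[OF 1 2] by (simp add: g_def D_def fps_sum_nth left_diff_distrib sum_distrib_right)
  qed
  have g0: "g = 0"
  proof (rule fps_zero_of_sums[OF sD])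
    show "finite {z. poly T z = 0}" using T(1) by (rule poly_roots_finite)
    fix z assume "z \<notin> {z. poly T z = 0}"
    then have Tz: "poly T z \<noteq> 0" by simp
    have Qz: "poly (Q i j) z \<noteq> 0" if "i < \<mu>" "j < \<mu>" for i j
      using T(2)[OF that] Tz by (metis dvdE mult_zero_left poly_mult)
    then have "deriv (E i) z = (\<Sum>j<\<mu>. poly (P i j) z / poly (Q i j) z * E j z)"
      using system i DERIV_imp_deriv by blast
    then have "poly T z * deriv (E i) z = (\<Sum>j<\<mu>. poly T z * (poly (P i j) z / poly (Q i j) z * E j z))"
      by (simp add: sum_distrib_left)
    also have "\<dots> = (\<Sum>j<\<mu>. poly (B i j) z * E j z)"
    proof (rule sum.cong[OF refl])
      fix j assume "j \<in> {..<\<mu>}"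
      then have j: "j < \<mu>" by simp
      have "poly (B i j) z * poly (Q i j) z = poly T z * poly (P i j) z" using T(2)[OF i j] by (metis poly_mult)
      then show "poly T z * (poly (P i j) z / poly (Q i j) z * E j z) = poly (B i j) z * E j z"
        using Qz[OF i j] by (simp add: field_simps)
    qed
    finally show "D z = 0" by (simp add: D_def)
  qed
  then show "fps_of_poly T * fps_deriv (F i) = (\<Sum>j<\<mu>. fps_of_poly (B i j) * F j)" by (simp add: g_def)
  have "(\<lambda>l. fps_nth g l * z ^ l) sums 0" by (simp add: g0)
  then have "D z = 0" using sD sums_unique2 by blast
  then show "poly T z * deriv (E i) z = (\<Sum>j<\<mu>. poly (B i j) z * E j z)" by (simp add: D_def)
qed

text \<open>Uniqueness at a regular point: each coefficient is determined by the lower ones.\<close>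

lemma fps_ode_zero:
  fixes y :: "nat \<Rightarrow> complex fps"
  assumes y: "\<And>i. i < n \<Longrightarrow> taylor \<xi> T * fps_deriv (y i) = (\<Sum>j<n. taylor \<xi> (B i j) * y j)"
    and T: "poly T \<xi> \<noteq> 0" and 0: "\<And>i. i < n \<Longrightarrow> fps_nth (y i) 0 = 0" and i: "i < n"
  shows "y i = 0"
proof (rule fps_ext)
  fix k
  show "fps_nth (y i) k = fps_nth 0 k"
    using i
  proof (induction k arbitrary: i rule: less_induct)
    case (less k)
    show ?case
    proof (cases k)
      case 0 then show ?thesis using less.prems assms(3) by simp
    next
      case (Suc l)
      have T0: "fps_nth (taylor \<xi> T) 0 \<noteq> 0" using T by (simp add: taylor_nth_0)
      have "fps_deriv (y i) = inverse (taylor \<xi> T) * (\<Sum>j<n. taylor \<xi> (B i j) * y j)"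
        unfolding y[OF less.prems, symmetric] mult.assoc[symmetric] inverse_mult_eq_1[OF T0] by simp
      moreover have "fps_nth (inverse (taylor \<xi> T) * (\<Sum>j<n. taylor \<xi> (B i j) * y j)) l = 0"
      proof (rule fps_low_mult[of k])
        fix m assume "m < k"
        show "fps_nth (\<Sum>j<n. taylor \<xi> (B i j) * y j) m = 0"
          by (rule fps_low_sum, rule fps_low_mult[of k]) (use less.IH \<open>m < k\<close> in auto)
      qed (use Suc in simp)
      ultimately have "fps_nth (fps_deriv (y i)) l = 0" by simp
      then show ?thesis using Suc by (simp del: of_nat_Suc)
    qed
  qed
qed

lemma poly_shift_has_fps_expansion: "(\<lambda>w. poly p (\<xi> + w)) has_fps_expansion taylor \<xi> p"
  unfolding has_fps_expansion_def taylor_def by (simp add: poly_pcompose add.commute)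

text \<open>The Taylor series at \<xi> solve a regular system with zero initial vector, and the
  functions are entire. This excludes that all values at \<xi> vanish while some function does
  not.\<close>

lemma system_zero:
  fixes E :: "nat \<Rightarrow> complex \<Rightarrow> complex"
  assumes hol: "\<And>i z. i < \<mu> \<Longrightarrow> (E i has_field_derivative deriv (E i) z) (at z)"
    and sys: "\<And>i z. i < \<mu> \<Longrightarrow> poly T z * deriv (E i) z = (\<Sum>j<\<mu>. poly (B i j) z * E j z)"
    and T: "poly T \<xi> \<noteq> 0" and 0: "\<And>i. i < \<mu> \<Longrightarrow> E i \<xi> = 0" and i: "i < \<mu>"
  shows "E i z = 0"
proof -
  define G where "G = (\<lambda>i w. E i (\<xi> + w))"
  define e where "e = (\<lambda>i. fps_expansion (G i) 0)"
  have Gd: "(G i has_field_derivative deriv (E i) (\<xi> + w)) (at w)" if "i < \<mu>" for i w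
    unfolding G_def by (rule DERIV_chain2[OF hol[OF that], where g = "\<lambda>w. \<xi> + w" and Db = 1, simplified]) (auto intro!: derivative_eq_intros)
  have Ghol: "G i holomorphic_on UNIV" if "i < \<mu>" for i
    using Gd[OF that] by (auto simp: holomorphic_on_def field_differentiable_def)
  have exp: "G i has_fps_expansion e i" if "i < \<mu>" for i
    unfolding e_def by (rule has_fps_expansion_fps_expansion[OF open_UNIV _ Ghol[OF that]]) simp
  have "e i = 0" if i: "i < \<mu>" for i
  proof (rule fps_ode_zero[OF _ T _ i])
    fix i assume i: "i < \<mu>"
    have "(\<lambda>w. poly T (\<xi> + w) * deriv (G i) w) has_fps_expansion (taylor \<xi> T * fps_deriv (e i))"
      by (intro fps_expansion_intros poly_shift_has_fps_expansion exp i)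
    moreover have "(\<lambda>w. \<Sum>j<\<mu>. poly (B i j) (\<xi> + w) * G j w) has_fps_expansion (\<Sum>j<\<mu>. taylor \<xi> (B i j) * e j)"
      by (intro fps_expansion_intros poly_shift_has_fps_expansion exp) auto
    moreover have "poly T (\<xi> + w) * deriv (G i) w = (\<Sum>j<\<mu>. poly (B i j) (\<xi> + w) * G j w)" for w
      using sys[OF i, of "\<xi> + w"] DERIV_imp_deriv[OF Gd[OF i, of w]] by (simp add: G_def)
    ultimately show "taylor \<xi> T * fps_deriv (e i) = (\<Sum>j<\<mu>. taylor \<xi> (B i j) * e j)"
      by (simp add: fps_expansion_unique_complex)
    show "fps_nth (e i) 0 = 0" using fps_nth_fps_expansion[OF exp[OF i], of 0] 0[OF i] by (simp add: G_def)
  qed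
  then have "(deriv ^^ n) (G i) 0 = 0" for n using fps_nth_fps_expansion[OF exp[OF i], of n] i by simp
  then have "G i (z - \<xi>) = 0" by (intro holomorphic_fun_eq_0_on_connected[OF Ghol[OF i] open_UNIV]) auto
  then show ?thesis by (simp add: G_def)
qed

section \<open>Counting monomials\<close>

definition exponents :: "nat set \<Rightarrow> nat \<Rightarrow> (nat \<Rightarrow> nat) set" where
  "exponents S N = {\<alpha>. (\<forall>i. i \<notin> S \<longrightarrow> \<alpha> i = 0) \<and> (\<Sum>i\<in>S. \<alpha> i) = N}"

lemma finite_exponents:
  assumes "finite S" shows "finite (exponents S N)"
proof (rule finite_subset)
  show "exponents S N \<subseteq> {\<alpha>. \<forall>i. (i \<in> S \<longrightarrow> \<alpha> i \<in> {..N}) \<and> (i \<notin> S \<longrightarrow> \<alpha> i = 0)}"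
  proof
    fix \<alpha> assume a: "\<alpha> \<in> exponents S N"
    have "\<alpha> i \<le> N" if "i \<in> S" for i
    proof -
      have "\<alpha> i \<le> (\<Sum>i\<in>S. \<alpha> i)" by (rule member_le_sum) (use that assms in auto)
      then show ?thesis using a by (simp add: exponents_def)
    qed
    then show "\<alpha> \<in> {\<alpha>. \<forall>i. (i \<in> S \<longrightarrow> \<alpha> i \<in> {..N}) \<and> (i \<notin> S \<longrightarrow> \<alpha> i = 0)}" using a by (auto simp: exponents_def)
  qed
  show "finite {\<alpha>. \<forall>i. (i \<in> S \<longrightarrow> \<alpha> i \<in> {..N}) \<and> (i \<notin> S \<longrightarrow> \<alpha> i = (0::nat))}"
    by (rule finite_set_of_finite_funs[OF assms]) simp
qed

text \<open>All exponents but one range freely from 0 to u, and the remaining variable s0 fills up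
  the degree; r - 1 free exponents cannot exceed r u in sum.\<close>

lemma card_exponents_ge:
  assumes S: "finite S" "card S = r" "r \<ge> 1"
  shows "(u + 1) ^ (r - 1) \<le> card (exponents S (r * u))"
proof -
  obtain s0 where s0: "s0 \<in> S" using S by fastforce
  define S' where "S' = S - {s0}"
  have S': "finite S'" "card S' = r - 1" using S s0 by (auto simp: S'_def)
  define D where "D = S' \<rightarrow>\<^sub>E {..u}"
  define g where "g = (\<lambda>f i. if i \<in> S' then f i else if i = s0 then r * u - (\<Sum>j\<in>S'. f j) else (0::nat))"
  have "inj_on g D"
  proof (rule inj_onI)
    fix f f' assume f: "f \<in> D" "f' \<in> D" "g f = g f'"
    show "f = f'"
    proof (rule PiE_ext[OF f(1,2)[unfolded D_def]])
      fix i assume "i \<in> S'" then show "f i = f' i" using fun_cong[OF f(3), of i] by (simp add: g_def)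
    qed
  qed
  moreover have "g ` D \<subseteq> exponents S (r * u)"
  proof
    fix \<alpha> assume "\<alpha> \<in> g ` D"
    then obtain f where f: "f \<in> D" "\<alpha> = g f" by blast
    have "(\<Sum>j\<in>S'. f j) \<le> (\<Sum>j\<in>S'. u)" using f(1) by (intro sum_mono) (auto simp: D_def)
    also have "\<dots> \<le> r * u" using S'(2) by simp
    finally have le: "(\<Sum>j\<in>S'. f j) \<le> r * u" .
    have "(\<Sum>i\<in>S. \<alpha> i) = \<alpha> s0 + (\<Sum>i\<in>S'. \<alpha> i)" unfolding S'_def by (rule sum.remove[OF S(1) s0])
    also have "(\<Sum>i\<in>S'. \<alpha> i) = (\<Sum>j\<in>S'. f j)" by (rule sum.cong[OF refl]) (simp add: f(2) g_def)
    also have "\<alpha> s0 = r * u - (\<Sum>j\<in>S'. f j)" by (simp add: f(2) g_def S'_def)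
    finally have "(\<Sum>i\<in>S. \<alpha> i) = r * u" using le by simp
    moreover have "\<forall>i. i \<notin> S \<longrightarrow> \<alpha> i = 0" using s0 by (auto simp: f(2) g_def S'_def)
    ultimately show "\<alpha> \<in> exponents S (r * u)" by (simp add: exponents_def)
  qed
  ultimately have "card D \<le> card (exponents S (r * u))" by (rule card_inj_on_le) (rule finite_exponents[OF S(1)])
  then show ?thesis using S' by (simp add: D_def card_funcsetE)
qed

text \<open>Uniqueness of expansions in base B; it separates exponent vectors with entries below B
  by their weights.\<close>

lemma digits_unique:
  fixes B :: nat
  assumes "\<And>i. i < m \<Longrightarrow> \<alpha> i < B \<and> \<beta> i < B" "(\<Sum>i<m. \<alpha> i * B ^ i) = (\<Sum>i<m. \<beta> i * B ^ i)"
  shows "i < m \<Longrightarrow> \<alpha> i = \<beta> i"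
  using assms
proof (induction m arbitrary: \<alpha> \<beta> i)
  case (Suc m)
  have split_digit: "(\<Sum>i<Suc m. \<alpha> i * B ^ i) = \<alpha> 0 + B * (\<Sum>i<m. \<alpha> (Suc i) * B ^ i)" for \<alpha> :: "nat \<Rightarrow> nat"
    unfolding sum.lessThan_Suc_shift by (simp add: sum_distrib_left mult_ac)
  have B: "\<alpha> 0 < B" "\<beta> 0 < B" using Suc.prems(2)[of 0] by auto
  have e: "\<alpha> 0 + B * (\<Sum>i<m. \<alpha> (Suc i) * B ^ i) = \<beta> 0 + B * (\<Sum>i<m. \<beta> (Suc i) * B ^ i)"
    using Suc.prems(3) unfolding split_digit .
  then have "(\<alpha> 0 + B * (\<Sum>i<m. \<alpha> (Suc i) * B ^ i)) mod B = (\<beta> 0 + B * (\<Sum>i<m. \<beta> (Suc i) * B ^ i)) mod B" by simp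
  then have 0: "\<alpha> 0 = \<beta> 0" using B by simp
  then have "(\<Sum>i<m. \<alpha> (Suc i) * B ^ i) = (\<Sum>i<m. \<beta> (Suc i) * B ^ i)" using e B by simp
  then have "\<alpha> (Suc j) = \<beta> (Suc j)" if "j < m" for j
    using Suc.IH[of j "\<lambda>i. \<alpha> (Suc i)" "\<lambda>i. \<beta> (Suc i)"] Suc.prems(2) that by simp
  then show ?case using 0 Suc.prems(1) by (cases i) auto
qed simp

text \<open>The product runs over all \<mu> variables even for monomials in a subset, so monomials
  in different sets of variables share one indexing.\<close>

definition mono_val :: "nat \<Rightarrow> (nat \<Rightarrow> 'a::comm_monoid_mult) \<Rightarrow> (nat \<Rightarrow> nat) \<Rightarrow> 'a" where
  "mono_val \<mu> x \<alpha> = (\<Prod>i<\<mu>. x i ^ \<alpha> i)"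

lemma mono_val_add: "mono_val \<mu> x (\<lambda>i. \<alpha> i + \<beta> i) = mono_val \<mu> x \<alpha> * mono_val \<mu> x \<beta>"
  by (simp add: mono_val_def power_add prod.distrib)

lemma mono_val_support:
  assumes "S \<subseteq> {..<\<mu>}" "\<And>i. i \<notin> S \<Longrightarrow> \<alpha> i = 0"
  shows "(\<Prod>i\<in>S. x i ^ \<alpha> i) = mono_val \<mu> x \<alpha>"
  unfolding mono_val_def by (rule prod.mono_neutral_left) (use assms in auto)

lemma sum_support:
  fixes \<alpha> :: "nat \<Rightarrow> nat"
  assumes "S \<subseteq> {..<\<mu>}" "\<And>i. i \<notin> S \<Longrightarrow> \<alpha> i = 0"
  shows "(\<Sum>i\<in>S. \<alpha> i) = (\<Sum>i<\<mu>. \<alpha> i)"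
  by (rule sum.mono_neutral_left) (use assms in auto)

text \<open>The leading monomials of the relations (for a weight ordering) bound the number of monomials
  that are needed to span all monomials of a given degree.\<close>
lemma monomial_span_bound:
  fixes x :: "nat \<Rightarrow> complex"
  assumes K: "number_field K" and r: "r \<ge> 2"
    and rel: "\<And>T. T \<subseteq> {..<\<mu>} \<Longrightarrow> card T = r \<Longrightarrow>
      \<exists>c. hom_poly T c \<and> (\<forall>\<alpha>. c \<alpha> \<in> K) \<and> (\<Sum>\<alpha>\<in>{\<alpha>. c \<alpha> \<noteq> 0}. c \<alpha> * (\<Prod>i\<in>T. x i ^ \<alpha> i)) = 0"
  shows "\<exists>C. \<forall>N. \<exists>G. finite G \<and> card G \<le> C * (N + 1) ^ (r - 2) \<and>
    (\<forall>\<alpha>\<in>exponents {..<\<mu>} N. \<exists>c. (\<forall>\<gamma>\<in>G. c \<gamma> \<in> K) \<and> mono_val \<mu> x \<alpha> = (\<Sum>\<gamma>\<in>G. c \<gamma> * mono_val \<mu> x \<gamma>))"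
proof -
  note KS = is_subringD[OF number_field_subring[OF K]]
  define Sb where "Sb = {T. T \<subseteq> {..<\<mu>} \<and> card T = r}"
  have finSb: "finite Sb" unfolding Sb_def by (rule finite_subset[of _ "Pow {..<\<mu>}"]) auto
  have "\<forall>T. \<exists>c. T \<in> Sb \<longrightarrow> hom_poly T c \<and> (\<forall>\<alpha>. c \<alpha> \<in> K) \<and> (\<Sum>\<alpha>\<in>{\<alpha>. c \<alpha> \<noteq> 0}. c \<alpha> * (\<Prod>i\<in>T. x i ^ \<alpha> i)) = 0"
    using rel by (auto simp: Sb_def)
  from choice[OF this] obtain c where c: "\<And>T. T \<in> Sb \<Longrightarrow> hom_poly T (c T) \<and> (\<forall>\<alpha>. c T \<alpha> \<in> K) \<and>
    (\<Sum>\<alpha>\<in>{\<alpha>. c T \<alpha> \<noteq> 0}. c T \<alpha> * (\<Prod>i\<in>T. x i ^ \<alpha> i)) = 0" by auto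
  define supp where "supp = (\<lambda>T. {\<alpha>. c T \<alpha> \<noteq> 0})"
  have fs: "finite (supp T)" "supp T \<noteq> {}" if "T \<in> Sb" for T using c[OF that] by (auto simp: supp_def hom_poly_def)
  have out: "\<alpha> i = 0" if "T \<in> Sb" "\<alpha> \<in> supp T" "i \<notin> T" for T \<alpha> i
    using c[OF that(1)] that(2,3) by (auto simp: supp_def hom_poly_def)
  have "\<forall>T. \<exists>d. T \<in> Sb \<longrightarrow> (\<forall>\<alpha>\<in>supp T. (\<Sum>i\<in>T. \<alpha> i) = d)"
  proof
    fix T
    show "\<exists>d. T \<in> Sb \<longrightarrow> (\<forall>\<alpha>\<in>supp T. (\<Sum>i\<in>T. \<alpha> i) = d)"
    proof (cases "T \<in> Sb")
      case True
      have "\<exists>d. \<forall>\<alpha>. c T \<alpha> \<noteq> 0 \<longrightarrow> (\<Sum>i\<in>T. \<alpha> i) = d"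
        using conjunct1[OF c[OF True]] unfolding hom_poly_def by (elim conjE)
      then obtain d where "\<forall>\<alpha>. c T \<alpha> \<noteq> 0 \<longrightarrow> (\<Sum>i\<in>T. \<alpha> i) = d" ..
      then have "T \<in> Sb \<longrightarrow> (\<forall>\<alpha>\<in>supp T. (\<Sum>i\<in>T. \<alpha> i) = d)" by (simp add: supp_def)
      then show ?thesis ..
    qed simp
  qed
  from choice[OF this] obtain dg where dg0: "\<And>T. T \<in> Sb \<Longrightarrow> \<forall>\<alpha>\<in>supp T. (\<Sum>i\<in>T. \<alpha> i) = dg T" by auto
  have dg: "(\<Sum>i<\<mu>. \<alpha> i) = dg T" if "T \<in> Sb" "\<alpha> \<in> supp T" for T \<alpha>
    using dg0[OF that(1)] that(2) sum_support[of T \<mu> \<alpha>] out[OF that] that(1) by (simp add: Sb_def)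
  have rel0: "(\<Sum>\<alpha>\<in>supp T. c T \<alpha> * mono_val \<mu> x \<alpha>) = 0" if T: "T \<in> Sb" for T
  proof -
    have "(\<Sum>\<alpha>\<in>supp T. c T \<alpha> * mono_val \<mu> x \<alpha>) = (\<Sum>\<alpha>\<in>supp T. c T \<alpha> * (\<Prod>i\<in>T. x i ^ \<alpha> i))"
      by (rule sum.cong[OF refl]) (use mono_val_support[of T \<mu> _ x] out[OF T] T in \<open>auto simp: Sb_def\<close>)
    then show ?thesis using c[OF T] by (simp add: supp_def)
  qed
  \<comment> \<open>Above every exponent in the chosen relations. It makes the weight injective on
    each support and later separates small from large exponents.\<close>
  define Bd where "Bd = 1 + (\<Sum>T\<in>Sb. \<Sum>\<alpha>\<in>supp T. \<Sum>i<\<mu>. \<alpha> i)"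
  have Bd1: "Bd \<ge> 1" by (simp add: Bd_def)
  have Bd: "\<alpha> i < Bd" if "T \<in> Sb" "\<alpha> \<in> supp T" for T \<alpha> i
  proof (cases "i < \<mu>")
    case True
    have "\<alpha> i \<le> (\<Sum>i<\<mu>. \<alpha> i)" by (rule member_le_sum) (use True in auto)
    also have "\<dots> \<le> (\<Sum>\<alpha>\<in>supp T. \<Sum>i<\<mu>. \<alpha> i)"
      by (rule member_le_sum[where f = "\<lambda>\<alpha>. \<Sum>i<\<mu>. \<alpha> i"]) (use that fs in auto)
    also have "\<dots> \<le> (\<Sum>T\<in>Sb. \<Sum>\<alpha>\<in>supp T. \<Sum>i<\<mu>. \<alpha> i)"
      by (rule member_le_sum[where f = "\<lambda>T. \<Sum>\<alpha>\<in>supp T. \<Sum>i<\<mu>. \<alpha> i"]) (use that finSb in auto)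
    finally show ?thesis by (simp add: Bd_def)
  next
    case False
    then have "i \<notin> T" using that(1) by (auto simp: Sb_def)
    then show ?thesis using out[OF that] Bd1 by simp
  qed
  \<comment> \<open>Additive in the exponent vector, so multiplying a relation by a monomial
    preserves the order of its terms.\<close>
  define wt where "wt = (\<lambda>\<alpha>::nat \<Rightarrow> nat. \<Sum>i<\<mu>. \<alpha> i * Bd ^ i)"
  have wt_inj: "\<alpha> = \<alpha>'" if "T \<in> Sb" "\<alpha> \<in> supp T" "\<alpha>' \<in> supp T" "wt \<alpha> = wt \<alpha>'" for T \<alpha> \<alpha>'
  proof
    fix i
    show "\<alpha> i = \<alpha>' i"
    proof (cases "i < \<mu>")
      case True
      show ?thesis by (rule digits_unique[OF _ _ True, of \<alpha> Bd \<alpha>']) (use Bd that in \<open>auto simp: wt_def\<close>)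
    next
      case False
      then have "i \<notin> T" using that(1) by (auto simp: Sb_def)
      then show ?thesis using out that by metis
    qed
  qed
  have "\<forall>T. \<exists>\<beta>. T \<in> Sb \<longrightarrow> \<beta> \<in> supp T \<and> (\<forall>\<alpha>\<in>supp T. wt \<alpha> \<le> wt \<beta>)"
  proof
    fix T
    show "\<exists>\<beta>. T \<in> Sb \<longrightarrow> \<beta> \<in> supp T \<and> (\<forall>\<alpha>\<in>supp T. wt \<alpha> \<le> wt \<beta>)"
    proof (cases "T \<in> Sb")
      case True
      then have f: "finite (wt ` supp T)" "wt ` supp T \<noteq> {}" using fs by auto
      obtain \<beta> where "\<beta> \<in> supp T" "wt \<beta> = Max (wt ` supp T)" using Max_in[OF f] by auto
      then show ?thesis using Max_ge[OF f(1)] by auto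
    qed auto
  qed
  from choice[OF this] obtain \<beta> where \<beta>: "\<And>T. T \<in> Sb \<Longrightarrow> \<beta> T \<in> supp T \<and> (\<forall>\<alpha>\<in>supp T. wt \<alpha> \<le> wt (\<beta> T))" by auto
  \<comment> \<open>The standard monomials of degree N: no leading monomial \<beta> T divides
    them.\<close>
  define Nrm where "Nrm = (\<lambda>N. {\<alpha> \<in> exponents {..<\<mu>} N. \<forall>T\<in>Sb. \<not> (\<forall>i. \<beta> T i \<le> \<alpha> i)})"
  have finN: "finite (Nrm N)" for N unfolding Nrm_def using finite_exponents[of "{..<\<mu>}" N] by simp
  define ok where "ok = (\<lambda>N s. \<exists>k. (\<forall>\<gamma>\<in>Nrm N. k \<gamma> \<in> K) \<and> s = (\<Sum>\<gamma>\<in>Nrm N. k \<gamma> * mono_val \<mu> x \<gamma>))"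
  have ok_scale: "ok N (a * s)" if a: "a \<in> K" and s: "ok N s" for N a s
  proof -
    obtain k where "\<forall>\<gamma>\<in>Nrm N. k \<gamma> \<in> K" "s = (\<Sum>\<gamma>\<in>Nrm N. k \<gamma> * mono_val \<mu> x \<gamma>)" using s unfolding ok_def by (elim exE conjE)
    then show ?thesis unfolding ok_def using a KS(4)
      by (intro exI[of _ "\<lambda>\<gamma>. a * k \<gamma>"]) (simp add: sum_distrib_left mult_ac)
  qed
  have ok_sum: "ok N (sum f A)" if "\<And>a. a \<in> A \<Longrightarrow> ok N (f a)" for N and f :: "(nat \<Rightarrow> nat) \<Rightarrow> complex" and A
    using that
  proof (induction A rule: infinite_finite_induct)
    case (insert a A)
    obtain k where k: "\<forall>\<gamma>\<in>Nrm N. k \<gamma> \<in> K" "f a = (\<Sum>\<gamma>\<in>Nrm N. k \<gamma> * mono_val \<mu> x \<gamma>)"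
      using insert.prems[of a] unfolding ok_def by auto
    have "ok N (sum f A)" using insert by simp
    then obtain k' where k': "\<forall>\<gamma>\<in>Nrm N. k' \<gamma> \<in> K" "sum f A = (\<Sum>\<gamma>\<in>Nrm N. k' \<gamma> * mono_val \<mu> x \<gamma>)"
      unfolding ok_def by blast
    have "ok N (f a + sum f A)" unfolding ok_def using k k' KS(3)
      by (intro exI[of _ "\<lambda>\<gamma>. k \<gamma> + k' \<gamma>"]) (simp add: distrib_right sum.distrib)
    then show ?case using insert by simp
  qed (use KS in \<open>auto simp: ok_def intro!: exI[of _ "\<lambda>_. 0"]\<close>)
  \<comment> \<open>A monomial divisible by a leading one is rewritten by the relation times the
    quotient monomial. Homogeneity keeps the degree, and every new term has smaller weight.\<close>
  have red: "ok N (mono_val \<mu> x \<alpha>)" if "\<alpha> \<in> exponents {..<\<mu>} N" for N \<alpha>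
    using that
  proof (induction "wt \<alpha>" arbitrary: \<alpha> rule: less_induct)
    case less
    show ?case
    proof (cases "\<alpha> \<in> Nrm N")
      case True
      have "mono_val \<mu> x \<alpha> = (\<Sum>\<gamma>\<in>Nrm N. (if \<gamma> = \<alpha> then 1 else 0) * mono_val \<mu> x \<gamma>)"
        using True finN by (simp add: if_distrib[of "\<lambda>u. u * _"] cong: if_cong)
      then show ?thesis unfolding ok_def using KS by (intro exI[of _ "\<lambda>\<gamma>. if \<gamma> = \<alpha> then 1 else 0"]) auto
    next
      case False
      then obtain T where T: "T \<in> Sb" "\<forall>i. \<beta> T i \<le> \<alpha> i" using less.prems by (auto simp: Nrm_def)
      define \<gamma> where "\<gamma> = (\<lambda>i. \<alpha> i - \<beta> T i)"
      have \<alpha>: "\<alpha> = (\<lambda>i. \<beta> T i + \<gamma> i)" using T(2) by (auto simp: \<gamma>_def)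
      have \<beta>s: "\<beta> T \<in> supp T" using \<beta>[OF T(1)] by blast
      have c0: "c T (\<beta> T) \<noteq> 0" using \<beta>s by (simp add: supp_def)
      have ne: "ok N (mono_val \<mu> x (\<lambda>i. \<alpha>' i + \<gamma> i))" if a: "\<alpha>' \<in> supp T - {\<beta> T}" for \<alpha>'
      proof (rule less.hyps)
        have "wt \<alpha>' \<noteq> wt (\<beta> T)" using wt_inj[OF T(1) _ \<beta>s, of \<alpha>'] a by auto
        then have "wt \<alpha>' < wt (\<beta> T)" using \<beta>[OF T(1)] a by (metis DiffD1 le_neq_implies_less)
        moreover have "wt (\<lambda>i. \<delta> i + \<gamma> i) = wt \<delta> + wt \<gamma>" for \<delta> by (simp add: wt_def distrib_right sum.distrib)
        ultimately show "wt (\<lambda>i. \<alpha>' i + \<gamma> i) < wt \<alpha>" by (subst \<alpha>) simp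
        have "(\<Sum>i<\<mu>. \<alpha>' i + \<gamma> i) = dg T + (\<Sum>i<\<mu>. \<gamma> i)" using dg[OF T(1), of \<alpha>'] a by (simp add: sum.distrib)
        also have "\<dots> = (\<Sum>i<\<mu>. \<alpha> i)" using dg[OF T(1) \<beta>s] by (subst \<alpha>) (simp add: sum.distrib)
        also have "\<dots> = N" using less.prems by (simp add: exponents_def)
        finally have "(\<Sum>i<\<mu>. \<alpha>' i + \<gamma> i) = N" .
        moreover have "\<alpha>' i + \<gamma> i = 0" if "i \<notin> {..<\<mu>}" for i
        proof -
          have "i \<notin> T" using that T(1) by (auto simp: Sb_def)
          moreover have "\<alpha> i = 0" using less.prems that by (simp add: exponents_def)
          ultimately show ?thesis using out[OF T(1), of \<alpha>' i] a by (simp add: \<gamma>_def)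
        qed
        ultimately show "(\<lambda>i. \<alpha>' i + \<gamma> i) \<in> exponents {..<\<mu>} N" by (simp add: exponents_def)
      qed
      have "c T (\<beta> T) * mono_val \<mu> x (\<beta> T) = - (\<Sum>\<alpha>'\<in>supp T - {\<beta> T}. c T \<alpha>' * mono_val \<mu> x \<alpha>')"
        using rel0[OF T(1)] fs(1)[OF T(1)] \<beta>s by (simp add: sum.remove eq_neg_iff_add_eq_0)
      then have "mono_val \<mu> x (\<beta> T) = - (\<Sum>\<alpha>'\<in>supp T - {\<beta> T}. c T \<alpha>' * mono_val \<mu> x \<alpha>') / c T (\<beta> T)"
        using c0 by (simp add: field_simps)
      also have "\<dots> = (\<Sum>\<alpha>'\<in>supp T - {\<beta> T}. (- c T \<alpha>' / c T (\<beta> T)) * mono_val \<mu> x \<alpha>')"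
        by (simp add: sum_divide_distrib sum_negf)
      finally have "mono_val \<mu> x \<alpha> = (\<Sum>\<alpha>'\<in>supp T - {\<beta> T}. (- c T \<alpha>' / c T (\<beta> T)) * mono_val \<mu> x \<alpha>') * mono_val \<mu> x \<gamma>"
        by (subst \<alpha>) (simp only: mono_val_add)
      also have "\<dots> = (\<Sum>\<alpha>'\<in>supp T - {\<beta> T}. (- c T \<alpha>' / c T (\<beta> T)) * mono_val \<mu> x (\<lambda>i. \<alpha>' i + \<gamma> i))"
        unfolding sum_distrib_right mono_val_add by (simp only: mult.assoc)
      also have "ok N \<dots>"
      proof (rule ok_sum, rule ok_scale)
        fix \<alpha>' assume "\<alpha>' \<in> supp T - {\<beta> T}"
        then show "ok N (mono_val \<mu> x (\<lambda>i. \<alpha>' i + \<gamma> i))" by (rule ne)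
        show "- c T \<alpha>' / c T (\<beta> T) \<in> K" using c[OF T(1)] KS(5) number_field_divide[OF K] by blast
      qed
      finally show ?thesis .
    qed
  qed
  have cnt: "card (Nrm N) \<le> (2 ^ \<mu> * Bd ^ \<mu>) * (N + 1) ^ (r - 2)" for N
  proof -
    \<comment> \<open>Standard monomials are sorted by the set U of places with exponent at least
      Bd. If U contained r places, the leading monomial of the relation on them would
      divide.\<close>
    define NU where "NU = (\<lambda>U. {\<alpha> \<in> Nrm N. {i. i < \<mu> \<and> \<alpha> i \<ge> Bd} = U})"
    have "Nrm N \<subseteq> (\<Union>U\<in>Pow {..<\<mu>}. NU U)"
    proof
      fix \<alpha> assume "\<alpha> \<in> Nrm N"
      then have "\<alpha> \<in> NU {i. i < \<mu> \<and> \<alpha> i \<ge> Bd}" by (simp add: NU_def)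
      then show "\<alpha> \<in> (\<Union>U\<in>Pow {..<\<mu>}. NU U)" by (rule UN_I[rotated]) auto
    qed
    then have "card (Nrm N) \<le> card (\<Union>U\<in>Pow {..<\<mu>}. NU U)"
      by (rule card_mono[rotated]) (use finN[of N] in \<open>auto simp: NU_def\<close>)
    also have "\<dots> \<le> (\<Sum>U\<in>Pow {..<\<mu>}. card (NU U))" by (rule card_UN_le) simp
    also have "\<dots> \<le> (\<Sum>U\<in>Pow {..<\<mu>}. Bd ^ \<mu> * (N + 1) ^ (r - 2))"
    proof (rule sum_mono)
      fix U assume "U \<in> Pow {..<\<mu>}"
      then have U: "U \<subseteq> {..<\<mu>}" by simp
      have finU: "finite U" using U finite_subset by blast
      show "card (NU U) \<le> Bd ^ \<mu> * (N + 1) ^ (r - 2)"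
      proof (cases "card U \<ge> r")
        case True
        then obtain T where T: "T \<subseteq> U" "card T = r" by (meson obtain_subset_with_card_n)
        have TS: "T \<in> Sb" using T U by (auto simp: Sb_def)
        have "NU U = {}"
        proof (rule ccontr)
          assume "NU U \<noteq> {}"
          then obtain \<alpha> where \<alpha>: "\<alpha> \<in> Nrm N" "{i. i < \<mu> \<and> \<alpha> i \<ge> Bd} = U" by (auto simp: NU_def)
          have \<beta>s: "\<beta> T \<in> supp T" using \<beta>[OF TS] by blast
          have "\<beta> T i \<le> \<alpha> i" for i
          proof (cases "i \<in> T")
            case True
            then have "Bd \<le> \<alpha> i" using T(1) \<alpha>(2) by blast
            then show ?thesis using Bd[OF TS \<beta>s, of i] by simp
          next
            case False then show ?thesis using out[OF TS \<beta>s] by simp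
          qed
          then show False using \<alpha>(1) TS by (auto simp: Nrm_def)
        qed
        then show ?thesis by simp
      next
        case False
        \<comment> \<open>Of the at most r - 1 large exponents one, at the place
          \<open>Max U\<close>, is determined by the degree, so at most r - 2 range freely up to N.
          For empty U the set V is empty whatever \<open>Max U\<close> is.\<close>
        define V where "V = U - {Max U}"
        have cV: "card V \<le> r - 2"
        proof (cases "U = {}")
          case True then show ?thesis by (simp add: V_def)
        next
          case ne: False
          then have "card V = card U - 1" unfolding V_def using finU Max_in[OF finU ne] by simp
          then show ?thesis using False by simp
        qed
        define bs where "bs = (\<lambda>i. if i \<in> U then (if i = Max U then {0} else {..N}) else {..<Bd})"
        \<comment> \<open>The exponent at \<open>Max U\<close> is recorded as 0; injectivity holds
          because the degree N recovers it.\<close>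
        define g where "g = (\<lambda>\<alpha>::nat \<Rightarrow> nat. \<lambda>i\<in>{..<\<mu>}. if i \<in> U \<and> i = Max U then 0 else \<alpha> i)"
        have "card (NU U) \<le> card (PiE {..<\<mu>} bs)"
        proof (rule card_inj_on_le)
          show "finite (PiE {..<\<mu>} bs)" by (rule finite_PiE) (auto simp: bs_def)
          show "g ` NU U \<subseteq> PiE {..<\<mu>} bs"
          proof
            fix f assume "f \<in> g ` NU U"
            then obtain \<alpha> where \<alpha>: "\<alpha> \<in> Nrm N" "{i. i < \<mu> \<and> \<alpha> i \<ge> Bd} = U" "f = g \<alpha>" by (auto simp: NU_def)
            have N: "\<alpha> i \<le> N" if "i < \<mu>" for i
            proof -
              have "\<alpha> i \<le> (\<Sum>i<\<mu>. \<alpha> i)" by (rule member_le_sum) (use that in auto)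
              then show ?thesis using \<alpha>(1) by (simp add: Nrm_def exponents_def)
            qed
            show "f \<in> PiE {..<\<mu>} bs"
              unfolding \<alpha>(3) g_def PiE_iff bs_def using N \<alpha>(2) by (auto simp: not_le)
          qed
          show "inj_on g (NU U)"
          proof (rule inj_onI)
            fix \<alpha> \<alpha>' assume a: "\<alpha> \<in> NU U" "\<alpha>' \<in> NU U" "g \<alpha> = g \<alpha>'"
            have E: "\<alpha> \<in> exponents {..<\<mu>} N" "\<alpha>' \<in> exponents {..<\<mu>} N" using a by (auto simp: NU_def Nrm_def)
            have eq: "\<alpha> i = \<alpha>' i" if "i < \<mu>" "\<not> (i \<in> U \<and> i = Max U)" for i
              using fun_cong[OF a(3), of i] that by (auto simp: g_def)
            show "\<alpha> = \<alpha>'"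
            proof
              fix i
              show "\<alpha> i = \<alpha>' i"
              proof (cases "i < \<mu>")
                case True
                show ?thesis
                proof (cases "i \<in> U \<and> i = Max U")
                  case M: True
                  have "\<alpha> i + (\<Sum>j\<in>{..<\<mu>} - {i}. \<alpha> j) = (\<Sum>j<\<mu>. \<alpha> j)" using True by (simp add: sum.remove)
                  also have "\<dots> = (\<Sum>j<\<mu>. \<alpha>' j)" using E by (simp add: exponents_def)
                  also have "\<dots> = \<alpha>' i + (\<Sum>j\<in>{..<\<mu>} - {i}. \<alpha>' j)" using True by (simp add: sum.remove)
                  also have "(\<Sum>j\<in>{..<\<mu>} - {i}. \<alpha>' j) = (\<Sum>j\<in>{..<\<mu>} - {i}. \<alpha> j)"
                    by (rule sum.cong[OF refl]) (use eq M in auto)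
                  finally show ?thesis by simp
                qed (use eq True in auto)
              qed (use E in \<open>auto simp: exponents_def\<close>)
            qed
          qed
        qed
        also have "\<dots> = (\<Prod>i<\<mu>. card (bs i))" by (simp add: card_PiE)
        also have "\<dots> \<le> (\<Prod>i<\<mu>. (if i \<in> V then N + 1 else 1) * Bd)"
          by (rule prod_mono) (use Bd1 mult_le_mono2[OF Bd1, of "N + 1"] in \<open>auto simp: bs_def V_def\<close>)
        also have "\<dots> = (\<Prod>i<\<mu>. if i \<in> V then N + 1 else 1) * Bd ^ \<mu>" by (simp add: prod.distrib)
        also have "(\<Prod>i<\<mu>. if i \<in> V then N + 1 else 1) = (N + 1) ^ card V"
        proof -
          have "{..<\<mu>} \<inter> V = V" using U by (auto simp: V_def)
          then show ?thesis by (simp add: prod.If_cases)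
        qed
        also have "(N + 1) ^ card V * Bd ^ \<mu> \<le> (N + 1) ^ (r - 2) * Bd ^ \<mu>"
          using cV by (intro mult_right_mono power_increasing) auto
        finally show ?thesis by (simp add: mult.commute)
      qed
    qed
    also have "\<dots> = (2 ^ \<mu> * Bd ^ \<mu>) * (N + 1) ^ (r - 2)" by (simp add: card_Pow)
    finally show ?thesis .
  qed
  show ?thesis
  proof (intro exI[of _ "2 ^ \<mu> * Bd ^ \<mu>"] allI)
    fix N
    have "\<forall>\<alpha>\<in>exponents {..<\<mu>} N. \<exists>c. (\<forall>\<gamma>\<in>Nrm N. c \<gamma> \<in> K) \<and> mono_val \<mu> x \<alpha> = (\<Sum>\<gamma>\<in>Nrm N. c \<gamma> * mono_val \<mu> x \<gamma>)"
      using red[of _ N] unfolding ok_def by (rule ballI)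
    then show "\<exists>G. finite G \<and> card G \<le> 2 ^ \<mu> * Bd ^ \<mu> * (N + 1) ^ (r - 2) \<and>
      (\<forall>\<alpha>\<in>exponents {..<\<mu>} N. \<exists>c. (\<forall>\<gamma>\<in>G. c \<gamma> \<in> K) \<and> mono_val \<mu> x \<alpha> = (\<Sum>\<gamma>\<in>G. c \<gamma> * mono_val \<mu> x \<gamma>))"
      using finN[of N] cnt[of N] by (intro exI[of _ "Nrm N"] conjI)
  qed
qed

section \<open>Comparison of the ranks\<close>

lemma mono_val_upd: "i < \<mu> \<Longrightarrow> mono_val \<mu> x (\<alpha>(i := Suc (\<alpha> i))) = x i * mono_val \<mu> x \<alpha>"
proof -
  assume i: "i < \<mu>"
  have "(\<Prod>j\<in>{..<\<mu>} - {i}. x j ^ (\<alpha>(i := Suc (\<alpha> i))) j) = (\<Prod>j\<in>{..<\<mu>} - {i}. x j ^ \<alpha> j)"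
    by (rule prod.cong[OF refl]) simp
  then show ?thesis unfolding mono_val_def using i by (simp add: prod.remove[of "{..<\<mu>}" i] mult_ac)
qed

lemma exponents_upd:
  assumes "finite S" "i \<in> S" "\<alpha> \<in> exponents S N"
  shows "\<alpha>(i := Suc (\<alpha> i)) \<in> exponents S (Suc N)"
proof -
  have "(\<Sum>j\<in>S - {i}. (\<alpha>(i := Suc (\<alpha> i))) j) = (\<Sum>j\<in>S - {i}. \<alpha> j)" by (rule sum.cong[OF refl]) simp
  then show ?thesis using assms by (auto simp: exponents_def sum.remove[of S i])
qed

lemma exponents_Suc_cases:
  assumes S: "finite S" and \<alpha>: "\<alpha> \<in> exponents S (Suc N)"
  obtains i \<beta> where "i \<in> S" "\<beta> \<in> exponents S N" "\<alpha> = \<beta>(i := Suc (\<beta> i))"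
proof -
  have "\<exists>i\<in>S. \<alpha> i \<noteq> 0" using \<alpha> by (auto simp: exponents_def intro: ccontr)
  then obtain i where i: "i \<in> S" "\<alpha> i \<noteq> 0" by blast
  define \<beta> where "\<beta> = \<alpha>(i := \<alpha> i - 1)"
  have "(\<Sum>j\<in>S - {i}. \<beta> j) = (\<Sum>j\<in>S - {i}. \<alpha> j)" by (rule sum.cong[OF refl]) (simp add: \<beta>_def)
  then have "\<beta> \<in> exponents S N" using \<alpha> i S by (auto simp: exponents_def sum.remove[of S i] \<beta>_def)
  then show ?thesis using i by (intro that[of i \<beta>]) (auto simp: \<beta>_def)
qed

lemma exponents_monomial: "finite S \<Longrightarrow> i \<in> S \<Longrightarrow> (\<lambda>j. if j = i then N else 0) \<in> exponents S N"
  by (auto simp: exponents_def)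

lemma exponents_sub: "finite U \<Longrightarrow> S \<subseteq> U \<Longrightarrow> exponents S N \<subseteq> exponents U N"
proof
  fix \<alpha> assume U: "finite U" "S \<subseteq> U" and \<alpha>: "\<alpha> \<in> exponents S N"
  have "(\<Sum>i\<in>S. \<alpha> i) = (\<Sum>i\<in>U. \<alpha> i)" by (rule sum.mono_neutral_left) (use U \<alpha> in \<open>auto simp: exponents_def\<close>)
  then show "\<alpha> \<in> exponents U N" using U \<alpha> by (auto simp: exponents_def)
qed

text \<open>The comparison of ranks works with one degree h, so coefficient fields, numbers and
  polynomial coefficients are placed in a single field.\<close>

lemma number_field_coeffs:
  assumes F: "finite F" "\<And>L. L \<in> F \<Longrightarrow> number_field L" and X: "finite X" "\<And>x. x \<in> X \<Longrightarrow> algebraic x"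
    and Y: "finite Y" "\<And>p. p \<in> Y \<Longrightarrow> alg_poly p"
  shows "\<exists>K. number_field K \<and> \<Union>F \<subseteq> K \<and> X \<subseteq> K \<and> (\<forall>p\<in>Y. \<forall>i. coeff p i \<in> K)"
proof -
  define Z where "Z = X \<union> (\<Union>p\<in>Y. coeff p ` {..degree p})"
  have Z: "finite Z" "\<And>x. x \<in> Z \<Longrightarrow> algebraic x" using X Y by (auto simp: Z_def alg_poly_def)
  obtain K where K: "number_field K" "\<Union>F \<subseteq> K" "Z \<subseteq> K" using number_field_common[OF F Z] by auto
  have "coeff p i \<in> K" if "p \<in> Y" for p i
  proof (cases "i \<le> degree p")
    case True then show ?thesis using that K(3) by (auto simp: Z_def)
  next
    case False
    then show ?thesis using is_subringD(1)[OF number_field_subring[OF K(1)]] by (simp add: coeff_eq_0)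
  qed
  then show ?thesis using K by (intro exI[of _ K]) (auto simp: Z_def)
qed

text \<open>The divided relation is known only at points other than \<xi>; continuity of the
  functions carries it to \<xi>.\<close>

lemma hom_indep_fun_of_num:
  assumes S: "finite S" and ind: "hom_indep_num S (\<lambda>i. E i \<xi>)" and \<xi>: "algebraic \<xi>"
    and cont: "\<And>i z. i \<in> S \<Longrightarrow> isCont (E i) z"
  shows "hom_indep_fun S E"
  unfolding hom_indep_fun_def
proof
  assume "\<exists>c. hom_poly S c \<and> (\<forall>\<alpha>. alg_poly (c \<alpha>)) \<and>
    (\<forall>z. (\<Sum>\<alpha>\<in>{\<alpha>. c \<alpha> \<noteq> 0}. poly (c \<alpha>) z * (\<Prod>i\<in>S. E i z ^ \<alpha> i)) = 0)"
  then obtain c where c: "hom_poly S c" "\<And>\<alpha>. alg_poly (c \<alpha>)"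
    "\<And>z. (\<Sum>\<alpha>\<in>{\<alpha>. c \<alpha> \<noteq> 0}. poly (c \<alpha>) z * (\<Prod>i\<in>S. E i z ^ \<alpha> i)) = 0" by (elim exE conjE) simp
  define A where "A = {\<alpha>. c \<alpha> \<noteq> 0}"
  have A: "finite A" "\<exists>\<alpha>\<in>A. c \<alpha> \<noteq> 0" using c(1) by (auto simp: A_def hom_poly_def)
  obtain K where K: "number_field K" "\<xi> \<in> K" "\<forall>p\<in>c ` A. \<forall>i. coeff p i \<in> K"
    using number_field_coeffs[of "{}" "{\<xi>}" "c ` A"] A(1) \<xi> c(2) by auto
  note KS = number_field_subring[OF K(1)]
  have "\<exists>e c'. (\<forall>\<alpha>\<in>A. c \<alpha> = [:-\<xi>, 1:] ^ e * c' \<alpha> \<and> (\<forall>i. coeff (c' \<alpha>) i \<in> K)) \<and> (\<exists>\<alpha>\<in>A. poly (c' \<alpha>) \<xi> \<noteq> 0)"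
    by (rule common_root_factor[OF KS K(2) A(1) _ A(2)]) (use K(3) in simp)
  then obtain e c' where ec: "\<forall>\<alpha>\<in>A. c \<alpha> = [:-\<xi>, 1:] ^ e * c' \<alpha> \<and> (\<forall>i. coeff (c' \<alpha>) i \<in> K)"
    "\<exists>\<alpha>\<in>A. poly (c' \<alpha>) \<xi> \<noteq> 0" by (elim exE conjE)
  then have c': "\<And>\<alpha>. \<alpha> \<in> A \<Longrightarrow> c \<alpha> = [:-\<xi>, 1:] ^ e * c' \<alpha>" "\<And>\<alpha> i. \<alpha> \<in> A \<Longrightarrow> coeff (c' \<alpha>) i \<in> K"
    "\<exists>\<alpha>\<in>A. poly (c' \<alpha>) \<xi> \<noteq> 0" by simp_all
  define H where "H = (\<lambda>z. \<Sum>\<alpha>\<in>A. poly (c' \<alpha>) z * (\<Prod>i\<in>S. E i z ^ \<alpha> i))"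
  have H0: "H z = 0" if "z \<noteq> \<xi>" for z
  proof -
    have "(z - \<xi>) ^ e * H z = (\<Sum>\<alpha>\<in>A. poly (c \<alpha>) z * (\<Prod>i\<in>S. E i z ^ \<alpha> i))"
      unfolding H_def sum_distrib_left by (rule sum.cong[OF refl]) (simp add: c'(1) mult_ac)
    also have "\<dots> = 0" using c(3)[of z] by (simp add: A_def)
    finally show ?thesis using that by simp
  qed
  have "isCont H \<xi>" unfolding H_def
    by (intro continuous_intros cont) auto
  then have "(H \<longlongrightarrow> H \<xi>) (at \<xi>)" by (simp add: isCont_def)
  moreover have "(H \<longlongrightarrow> 0) (at \<xi>)"
    by (rule tendsto_eventually) (use H0 in \<open>auto simp: eventually_at_filter\<close>)
  ultimately have H\<xi>: "H \<xi> = 0" using tendsto_unique[OF trivial_limit_at] by blast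
  define k where "k = (\<lambda>\<alpha>. if \<alpha> \<in> A then poly (c' \<alpha>) \<xi> else 0)"
  have sub: "{\<alpha>. k \<alpha> \<noteq> 0} \<subseteq> A" by (auto simp: k_def)
  have "(\<Sum>\<alpha>\<in>{\<alpha>. k \<alpha> \<noteq> 0}. k \<alpha> * (\<Prod>i\<in>S. E i \<xi> ^ \<alpha> i)) = (\<Sum>\<alpha>\<in>A. k \<alpha> * (\<Prod>i\<in>S. E i \<xi> ^ \<alpha> i))"
    by (rule sum.mono_neutral_left) (use A(1) sub in auto)
  also have "\<dots> = H \<xi>" by (simp add: H_def k_def)
  finally have rel: "(\<Sum>\<alpha>\<in>{\<alpha>. k \<alpha> \<noteq> 0}. k \<alpha> * (\<Prod>i\<in>S. E i \<xi> ^ \<alpha> i)) = 0" using H\<xi> by simp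
  have alg: "algebraic (k \<alpha>)" for \<alpha>
  proof (cases "\<alpha> \<in> A")
    case True
    have "poly (c' \<alpha>) \<xi> \<in> K" unfolding poly_altdef
      by (intro is_subring_sum[OF KS] is_subringD(4)[OF KS] is_subring_power[OF KS] c'(2)[OF True] K(2))
    then obtain R nrm h where "sized_field K R nrm h" "k \<alpha> \<in> K"
      using number_field_sized[OF K(1)] True by (auto simp: k_def)
    then show ?thesis using sized_field.K_algebraic by blast
  qed (simp add: k_def)
  have "hom_poly S k" unfolding hom_poly_def
  proof (intro conjI)
    show "finite {\<alpha>. k \<alpha> \<noteq> 0}" using sub A(1) finite_subset by blast
    show "\<exists>\<alpha>. k \<alpha> \<noteq> 0" using c'(3) by (auto simp: k_def)
    show "\<forall>\<alpha>. k \<alpha> \<noteq> 0 \<longrightarrow> (\<forall>i. i \<notin> S \<longrightarrow> \<alpha> i = 0)" using c(1) sub by (auto simp: hom_poly_def A_def)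
    obtain d where "\<forall>\<alpha>. c \<alpha> \<noteq> 0 \<longrightarrow> (\<Sum>i\<in>S. \<alpha> i) = d" using c(1) unfolding hom_poly_def by (elim conjE exE)
    then show "\<exists>d. \<forall>\<alpha>. k \<alpha> \<noteq> 0 \<longrightarrow> (\<Sum>i\<in>S. \<alpha> i) = d" using sub by (intro exI[of _ d]) (auto simp: A_def)
  qed
  then have "\<exists>k. hom_poly S k \<and> (\<forall>\<alpha>. algebraic (k \<alpha>)) \<and>
    (\<Sum>\<alpha>\<in>{\<alpha>. k \<alpha> \<noteq> 0}. k \<alpha> * (\<Prod>i\<in>S. E i \<xi> ^ \<alpha> i)) = 0" using alg rel by (intro exI[of _ k] conjI allI)
  then show False using ind unfolding hom_indep_num_def by (elim notE)
qed

section \<open>The system satisfied by the monomials of a fixed degree\<close>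

context sized_field
begin

lemma mono_val_E_fps: "(\<And>i. i < \<mu> \<Longrightarrow> E_fps (F i)) \<Longrightarrow> E_fps (mono_val \<mu> F \<alpha>)"
  unfolding mono_val_def by (intro E_fps_prod E_fps_power) simp

lemma mono_val_fval: "(\<And>i. i < \<mu> \<Longrightarrow> E_fps (F i)) \<Longrightarrow> fval (mono_val \<mu> F \<alpha>) z = mono_val \<mu> (\<lambda>i. fval (F i) z) \<alpha>"
  unfolding mono_val_def by (subst fval_prod) (auto simp: fval_power E_fps_power)

text \<open>The system is linear and homogeneous, so by the Leibniz rule T d/dz maps monomials of
  degree N to combinations of monomials of degree N. The same T serves every N, so \<xi> remains a
  regular point.\<close>

lemma mono_val_system:
  fixes F :: "nat \<Rightarrow> complex fps"
  assumes B: "\<And>i j. i < \<mu> \<Longrightarrow> j < \<mu> \<Longrightarrow> K_poly (B i j)"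
    and sys: "\<And>i. i < \<mu> \<Longrightarrow> fps_of_poly T * fps_deriv (F i) = (\<Sum>j<\<mu>. fps_of_poly (B i j) * F j)"
    and \<alpha>: "\<alpha> \<in> exponents {..<\<mu>} N"
  shows "fps_of_poly T * fps_deriv (mono_val \<mu> F \<alpha>) \<in> poly_span (mono_val \<mu> F ` exponents {..<\<mu>} N)"
  using \<alpha>
proof (induction N arbitrary: \<alpha>)
  case 0
  then have "\<alpha> i = 0" for i by (cases "i < \<mu>") (auto simp: exponents_def)
  then have "mono_val \<mu> F \<alpha> = 1" by (simp add: mono_val_def)
  then show ?case using poly_span_zero by simp
next
  case (Suc N)
  obtain i \<beta> where i: "i < \<mu>" and \<beta>: "\<beta> \<in> exponents {..<\<mu>} N" "\<alpha> = \<beta>(i := Suc (\<beta> i))"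
    using exponents_Suc_cases[OF _ Suc.prems] by auto
  define M where "M = mono_val \<mu> F ` exponents {..<\<mu>} (Suc N)"
  have finM: "finite M" unfolding M_def by (intro finite_imageI finite_exponents) simp
  have step: "F j * mono_val \<mu> F \<gamma> \<in> poly_span M" if "j < \<mu>" "\<gamma> \<in> exponents {..<\<mu>} N" for j \<gamma>
  proof (rule poly_span_base[OF finM])
    have "mono_val \<mu> F (\<gamma>(j := Suc (\<gamma> j))) \<in> M" unfolding M_def by (intro imageI exponents_upd) (use that in auto)
    then show "F j * mono_val \<mu> F \<gamma> \<in> M" by (simp add: mono_val_upd that)
  qed
  have lift: "F i * s \<in> poly_span M" if s: "s \<in> poly_span (mono_val \<mu> F ` exponents {..<\<mu>} N)" for s
  proof -
    obtain c where c: "\<forall>g\<in>mono_val \<mu> F ` exponents {..<\<mu>} N. K_poly (c g)" "s = (\<Sum>g\<in>mono_val \<mu> F ` exponents {..<\<mu>} N. fps_of_poly (c g) * g)"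
      using s unfolding poly_span_def by auto
    have "F i * s = (\<Sum>g\<in>mono_val \<mu> F ` exponents {..<\<mu>} N. fps_of_poly (c g) * (F i * g))"
      unfolding c(2) by (simp add: sum_distrib_left mult_ac)
    also have "\<dots> \<in> poly_span M" by (intro poly_span_sum poly_span_scale) (use c(1) step i in auto)
    finally show ?thesis .
  qed
  have "fps_of_poly T * fps_deriv (mono_val \<mu> F \<alpha>) =
      (fps_of_poly T * fps_deriv (F i)) * mono_val \<mu> F \<beta> + F i * (fps_of_poly T * fps_deriv (mono_val \<mu> F \<beta>))"
    unfolding \<beta>(2) mono_val_upd[OF i] by (simp add: algebra_simps)
  also have "(fps_of_poly T * fps_deriv (F i)) * mono_val \<mu> F \<beta> = (\<Sum>j<\<mu>. fps_of_poly (B i j) * (F j * mono_val \<mu> F \<beta>))"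
    unfolding sys[OF i] by (simp only: sum_distrib_right mult.assoc)
  finally have eq: "fps_of_poly T * fps_deriv (mono_val \<mu> F \<alpha>) =
      (\<Sum>j<\<mu>. fps_of_poly (B i j) * (F j * mono_val \<mu> F \<beta>)) + F i * (fps_of_poly T * fps_deriv (mono_val \<mu> F \<beta>))" .
  show ?case unfolding eq M_def[symmetric]
    by (intro poly_span_add poly_span_sum poly_span_scale lift Suc.IH) (use B i step \<beta>(1) in auto)
qed

text \<open>A linear relation between monomials of one degree is a homogeneous relation between the
  functions, once the identity of series is evaluated at every z.\<close>

lemma mono_val_indep_over:
  assumes S: "S \<subseteq> {..<\<mu>}" and F: "\<And>i. i < \<mu> \<Longrightarrow> E_fps (F i)" and E: "\<And>i z. i < \<mu> \<Longrightarrow> E i z = fval (F i) z"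
    and ind: "hom_indep_fun S E"
  shows "indep_over KP (exponents S N) (mono_val \<mu> F)"
  unfolding indep_over_def
proof (intro allI impI ballI, rule ccontr)
  fix c \<alpha>0 assume c: "(\<forall>\<alpha>\<in>exponents S N. c \<alpha> \<in> KP) \<and> (\<Sum>\<alpha>\<in>exponents S N. c \<alpha> * mono_val \<mu> F \<alpha>) = 0" and \<alpha>0: "\<alpha>0 \<in> exponents S N" "c \<alpha>0 \<noteq> 0"
  have finS: "finite S" using S finite_subset by blast
  note fin = finite_exponents[OF finS, of N]
  have "\<forall>\<alpha>\<in>exponents S N. \<exists>p. K_poly p \<and> c \<alpha> = fps_of_poly p" using c by auto
  from bchoice[OF this] obtain p where p: "\<forall>\<alpha>\<in>exponents S N. K_poly (p \<alpha>) \<and> c \<alpha> = fps_of_poly (p \<alpha>)" ..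
  define q where "q = (\<lambda>\<alpha>. if \<alpha> \<in> exponents S N then p \<alpha> else 0)"
  have sub: "{\<alpha>. q \<alpha> \<noteq> 0} \<subseteq> exponents S N" by (auto simp: q_def)
  have "hom_poly S q" unfolding hom_poly_def
  proof (intro conjI)
    show "finite {\<alpha>. q \<alpha> \<noteq> 0}" using sub fin finite_subset by blast
    have "q \<alpha>0 \<noteq> 0" using \<alpha>0 p by (auto simp: q_def)
    then show "\<exists>\<alpha>. q \<alpha> \<noteq> 0" by (rule exI[of _ \<alpha>0])
    show "\<forall>\<alpha>. q \<alpha> \<noteq> 0 \<longrightarrow> (\<forall>i. i \<notin> S \<longrightarrow> \<alpha> i = 0)" using sub by (auto simp: exponents_def)
    show "\<exists>d. \<forall>\<alpha>. q \<alpha> \<noteq> 0 \<longrightarrow> (\<Sum>i\<in>S. \<alpha> i) = d" using sub by (intro exI[of _ N]) (auto simp: exponents_def)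
  qed
  moreover have "alg_poly (q \<alpha>)" for \<alpha>
    using p K_algebraic is_subringD(1)[OF number_field_subring[OF K]] by (auto simp: q_def alg_poly_def K_poly_def)
  moreover have "(\<Sum>\<alpha>\<in>{\<alpha>. q \<alpha> \<noteq> 0}. poly (q \<alpha>) z * (\<Prod>i\<in>S. E i z ^ \<alpha> i)) = 0" for z
  proof -
    have "(\<Sum>\<alpha>\<in>exponents S N. fps_of_poly (p \<alpha>) * mono_val \<mu> F \<alpha>) = (\<Sum>\<alpha>\<in>exponents S N. c \<alpha> * mono_val \<mu> F \<alpha>)"
      by (rule sum.cong[OF refl]) (use p in simp)
    then have "(\<Sum>\<alpha>\<in>exponents S N. fps_of_poly (p \<alpha>) * mono_val \<mu> F \<alpha>) = fps_of_poly 0 * 1" using c by simp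
    from fval_relation[OF _ this E_fps_one] have v: "(\<Sum>\<alpha>\<in>exponents S N. poly (p \<alpha>) z * fval (mono_val \<mu> F \<alpha>) z) = 0"
      using mono_val_E_fps[of \<mu> F, OF F] by simp
    have "(\<Sum>\<alpha>\<in>{\<alpha>. q \<alpha> \<noteq> 0}. poly (q \<alpha>) z * (\<Prod>i\<in>S. E i z ^ \<alpha> i)) = (\<Sum>\<alpha>\<in>exponents S N. poly (q \<alpha>) z * (\<Prod>i\<in>S. E i z ^ \<alpha> i))"
      by (rule sum.mono_neutral_left) (use fin sub in auto)
    also have "\<dots> = (\<Sum>\<alpha>\<in>exponents S N. poly (p \<alpha>) z * fval (mono_val \<mu> F \<alpha>) z)"
    proof (rule sum.cong[OF refl])
      fix \<alpha> assume \<alpha>: "\<alpha> \<in> exponents S N"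
      have "(\<Prod>i\<in>S. E i z ^ \<alpha> i) = (\<Prod>i\<in>S. fval (F i) z ^ \<alpha> i)" by (rule prod.cong[OF refl]) (use E S in auto)
      also have "\<dots> = mono_val \<mu> (\<lambda>i. fval (F i) z) \<alpha>" by (rule mono_val_support[OF S]) (use \<alpha> in \<open>simp add: exponents_def\<close>)
      finally show "poly (q \<alpha>) z * (\<Prod>i\<in>S. E i z ^ \<alpha> i) = poly (p \<alpha>) z * fval (mono_val \<mu> F \<alpha>) z"
        using \<alpha> by (simp add: q_def mono_val_fval[OF F])
    qed
    finally show ?thesis using v by simp
  qed
  ultimately have "\<exists>q. hom_poly S q \<and> (\<forall>\<alpha>. alg_poly (q \<alpha>)) \<and>
    (\<forall>z. (\<Sum>\<alpha>\<in>{\<alpha>. q \<alpha> \<noteq> 0}. poly (q \<alpha>) z * (\<Prod>i\<in>S. E i z ^ \<alpha> i)) = 0)" by (intro exI[of _ q] conjI allI)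
  then show False using ind unfolding hom_indep_fun_def by (elim notE)
qed

text \<open>In degree N = r u the monomials in S give at least (u + 1)^(r - 1) independent series,
  while C (N + 1)^(r - 2) numbers generate all values; the linear bound compares the two up to the
  factor h.\<close>

lemma rank_drop_impossible:
  fixes F :: "nat \<Rightarrow> complex fps"
  assumes \<xi>: "\<xi> \<in> K" "\<xi> \<noteq> 0" and F: "\<And>i. i < \<mu> \<Longrightarrow> E_fps (F i)" and E: "\<And>i z. i < \<mu> \<Longrightarrow> E i z = fval (F i) z"
    and T: "K_poly T" "poly T \<xi> \<noteq> 0" and B: "\<And>i j. i < \<mu> \<Longrightarrow> j < \<mu> \<Longrightarrow> K_poly (B i j)"
    and sys: "\<And>i. i < \<mu> \<Longrightarrow> fps_of_poly T * fps_deriv (F i) = (\<Sum>j<\<mu>. fps_of_poly (B i j) * F j)"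
    and nz: "i0 < \<mu>" "E i0 \<xi> \<noteq> 0"
    and S: "S \<subseteq> {..<\<mu>}" "card S = r" "r \<ge> 2" "hom_indep_fun S E"
    and rel: "\<And>U. U \<subseteq> {..<\<mu>} \<Longrightarrow> card U = r \<Longrightarrow>
      \<exists>c. hom_poly U c \<and> (\<forall>\<alpha>. c \<alpha> \<in> K) \<and> (\<Sum>\<alpha>\<in>{\<alpha>. c \<alpha> \<noteq> 0}. c \<alpha> * (\<Prod>i\<in>U. E i \<xi> ^ \<alpha> i)) = 0"
  shows False
proof -
  have finS: "finite S" using S finite_subset by blast
  have "\<exists>C. \<forall>N. \<exists>G. finite G \<and> card G \<le> C * (N + 1) ^ (r - 2) \<and>
    (\<forall>\<alpha>\<in>exponents {..<\<mu>} N. \<exists>c. (\<forall>\<gamma>\<in>G. c \<gamma> \<in> K) \<and> mono_val \<mu> (\<lambda>i. E i \<xi>) \<alpha> = (\<Sum>\<gamma>\<in>G. c \<gamma> * mono_val \<mu> (\<lambda>i. E i \<xi>) \<gamma>))"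
    by (rule monomial_span_bound[OF K S(3)]) (rule rel)
  then obtain C where C: "\<forall>N. \<exists>G. finite G \<and> card G \<le> C * (N + 1) ^ (r - 2) \<and>
    (\<forall>\<alpha>\<in>exponents {..<\<mu>} N. \<exists>c. (\<forall>\<gamma>\<in>G. c \<gamma> \<in> K) \<and> mono_val \<mu> (\<lambda>i. E i \<xi>) \<alpha> = (\<Sum>\<gamma>\<in>G. c \<gamma> * mono_val \<mu> (\<lambda>i. E i \<xi>) \<gamma>))" ..
  \<comment> \<open>Chosen so that C h (r (u + 1))^(r - 2) equals u (u + 1)^(r - 2), which is just
    below (u + 1)^(r - 1).\<close>
  define u where "u = h * C * r ^ (r - 2)"
  define N where "N = r * u"
  obtain G where G: "finite G" "card G \<le> C * (N + 1) ^ (r - 2)"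
    "\<forall>\<alpha>\<in>exponents {..<\<mu>} N. \<exists>c. (\<forall>\<gamma>\<in>G. c \<gamma> \<in> K) \<and> mono_val \<mu> (\<lambda>i. E i \<xi>) \<alpha> = (\<Sum>\<gamma>\<in>G. c \<gamma> * mono_val \<mu> (\<lambda>i. E i \<xi>) \<gamma>)"
    using C[THEN spec, of N] by (elim exE conjE)
  define M where "M = mono_val \<mu> F ` exponents {..<\<mu>} N"
  have val: "fval (mono_val \<mu> F \<alpha>) \<xi> = mono_val \<mu> (\<lambda>i. E i \<xi>) \<alpha>" for \<alpha>
  proof -
    have "fval (mono_val \<mu> F \<alpha>) \<xi> = mono_val \<mu> (\<lambda>i. fval (F i) \<xi>) \<alpha>" by (rule mono_val_fval) (rule F)
    also have "\<dots> = mono_val \<mu> (\<lambda>i. E i \<xi>) \<alpha>" unfolding mono_val_def by (rule prod.cong[OF refl]) (simp add: E)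
    finally show ?thesis .
  qed
  have "card (exponents S N) \<le> card G * h"
  proof (rule independent_functions_bound[OF \<xi> _ _ T _ G(1)])
    show "finite M" unfolding M_def by (intro finite_imageI finite_exponents) simp
    show "E_fps g" if "g \<in> M" for g using that mono_val_E_fps[of \<mu> F, OF F] by (auto simp: M_def)
    show "fps_of_poly T * fps_deriv g \<in> poly_span M" if "g \<in> M" for g
      using that mono_val_system[OF B sys] by (auto simp: M_def)
    show "\<exists>c. (\<forall>k\<in>G. c k \<in> K) \<and> fval g \<xi> = (\<Sum>k\<in>G. c k * mono_val \<mu> (\<lambda>i. E i \<xi>) k)" if g: "g \<in> M" for g
    proof -
      obtain \<alpha> where "\<alpha> \<in> exponents {..<\<mu>} N" "g = mono_val \<mu> F \<alpha>" using g unfolding M_def by blast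
      then show ?thesis using G(3) by (simp add: val)
    qed
    \<comment> \<open>The N-th power of the function that does not vanish at \<xi> is a monomial of
      degree N with a nonzero value.\<close>
    have "mono_val \<mu> (\<lambda>i. E i \<xi>) (\<lambda>j. if j = i0 then N else 0) \<noteq> 0"
      unfolding mono_val_def using nz(2) by simp
    moreover have "mono_val \<mu> F (\<lambda>j. if j = i0 then N else 0) \<in> M"
      unfolding M_def by (intro imageI exponents_monomial) (use nz in auto)
    ultimately show "\<exists>g\<in>M. fval g \<xi> \<noteq> 0" using val by metis
    show "finite (exponents S N)" by (rule finite_exponents[OF finS])
    show "indep_over KP (exponents S N) (mono_val \<mu> F)" by (rule mono_val_indep_over[OF S(1) F E S(4)])
    show "mono_val \<mu> F \<alpha> \<in> M" if "\<alpha> \<in> exponents S N" for \<alpha>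
      unfolding M_def using that exponents_sub[OF _ S(1), of N] by auto
  qed
  moreover have "(u + 1) ^ (r - 1) \<le> card (exponents S N)" unfolding N_def by (rule card_exponents_ge[OF finS S(2)]) (use S(3) in simp)
  ultimately have "(u + 1) ^ (r - 1) \<le> card G * h" by simp
  also have "\<dots> \<le> C * (N + 1) ^ (r - 2) * h" using G(2) by simp
  also have "\<dots> \<le> C * (r * (u + 1)) ^ (r - 2) * h"
    by (intro mult_right_mono mult_left_mono power_mono) (use S(3) in \<open>auto simp: N_def\<close>)
  also have "\<dots> = u * (u + 1) ^ (r - 2)" by (simp only: u_def power_mult_distrib mult_ac)
  also have "\<dots> < (u + 1) * (u + 1) ^ (r - 2)" by simp
  also have "\<dots> = (u + 1) ^ (r - 1)" using S(3) by (simp flip: power_Suc add: Suc_diff_Suc numeral_2_eq_2)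
  finally show False by simp
qed

end

text \<open>In at most one variable a nonzero homogeneous polynomial is a single monomial.\<close>

lemma hom_indep_num_small:
  assumes U: "finite U" "card U \<le> 1" and x: "\<And>i. i \<in> U \<Longrightarrow> x i \<noteq> 0"
  shows "hom_indep_num U x"
  unfolding hom_indep_num_def
proof
  assume "\<exists>c. hom_poly U c \<and> (\<forall>\<alpha>. algebraic (c \<alpha>)) \<and> (\<Sum>\<alpha>\<in>{\<alpha>. c \<alpha> \<noteq> 0}. c \<alpha> * (\<Prod>i\<in>U. x i ^ \<alpha> i)) = 0"
  then obtain c where c: "hom_poly U c" "(\<Sum>\<alpha>\<in>{\<alpha>. c \<alpha> \<noteq> 0}. c \<alpha> * (\<Prod>i\<in>U. x i ^ \<alpha> i)) = 0" by (elim exE conjE)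
  obtain \<beta> where \<beta>: "c \<beta> \<noteq> 0" using c(1) by (auto simp: hom_poly_def)
  obtain d where d: "\<forall>\<alpha>. c \<alpha> \<noteq> 0 \<longrightarrow> (\<Sum>i\<in>U. \<alpha> i) = d" using c(1) unfolding hom_poly_def by (elim conjE exE)
  have "\<alpha> = \<beta>" if \<alpha>: "c \<alpha> \<noteq> 0" for \<alpha>
  proof
    fix i
    show "\<alpha> i = \<beta> i"
    proof (cases "i \<in> U")
      case True
      have "\<forall>j\<in>U. \<forall>k\<in>U. j = k" using card_le_Suc0_iff_eq[OF U(1)] U(2) by simp
      then have "U = {i}" using True by auto
      then show ?thesis using d[THEN spec, of \<alpha>] d[THEN spec, of \<beta>] \<alpha> \<beta> by simp
    next
      case False
      have o: "\<forall>\<alpha>. c \<alpha> \<noteq> 0 \<longrightarrow> (\<forall>i. i \<notin> U \<longrightarrow> \<alpha> i = 0)" using c(1) unfolding hom_poly_def by (elim conjE)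
      show ?thesis using o[THEN spec, THEN mp, OF \<alpha>] o[THEN spec, THEN mp, OF \<beta>] False by simp
    qed
  qed
  then have "{\<alpha>. c \<alpha> \<noteq> 0} \<subseteq> {\<beta>}" by (intro subsetI) simp
  then have "{\<alpha>. c \<alpha> \<noteq> 0} = {\<beta>}" using \<beta> by (intro equalityI) simp_all
  then show False using c(2) \<beta> x U(1) by simp
qed

text \<open>A function that vanishes identically satisfies the linear relation given by its own
  variable.\<close>

lemma hom_indep_fun_nonzero:
  assumes U: "finite U" and ind: "hom_indep_fun U E" and i: "i \<in> U"
  shows "\<exists>z. E i z \<noteq> 0"
proof (rule ccontr)
  assume "\<not> (\<exists>z. E i z \<noteq> 0)"
  then have E: "E i z = 0" for z by simp
  define \<delta> :: "nat \<Rightarrow> nat" where "\<delta> = (\<lambda>j. if j = i then 1 else 0)"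
  define c :: "(nat \<Rightarrow> nat) \<Rightarrow> complex poly" where "c = (\<lambda>\<alpha>. if \<alpha> = \<delta> then 1 else 0)"
  have supp: "{\<alpha>. c \<alpha> \<noteq> 0} = {\<delta>}" by (auto simp: c_def)
  have "hom_poly U c" unfolding hom_poly_def supp using i by (auto simp: c_def \<delta>_def)
  moreover have "alg_poly (c \<alpha>)" for \<alpha> by (simp add: c_def alg_poly_def if_distrib[of "\<lambda>p. coeff p _"] one_poly_eq_simps(1)[symmetric] coeff_pCons split: nat.split)
  moreover have "(\<Sum>\<alpha>\<in>{\<alpha>. c \<alpha> \<noteq> 0}. poly (c \<alpha>) z * (\<Prod>j\<in>U. E j z ^ \<alpha> j)) = 0" for z
  proof -
    have "(\<Prod>j\<in>U. E j z ^ \<delta> j) = 0" by (rule prod_zero[OF U]) (use i E in \<open>auto simp: \<delta>_def intro!: bexI[of _ i]\<close>)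
    then show ?thesis unfolding supp by simp
  qed
  ultimately have "\<exists>c. hom_poly U c \<and> (\<forall>\<alpha>. alg_poly (c \<alpha>)) \<and>
    (\<forall>z. (\<Sum>\<alpha>\<in>{\<alpha>. c \<alpha> \<noteq> 0}. poly (c \<alpha>) z * (\<Prod>i\<in>U. E i z ^ \<alpha> i)) = 0)" by (intro exI[of _ c] conjI allI)
  then show False using ind unfolding hom_indep_fun_def by (elim notE)
qed

text \<open>The entries of the system are quotients P/Q in lowest terms, so their poles are the
  zeros of Q, and the differential equations are assumed where no Q vanishes. For \<mu> = 0 both
  sides are -1.\<close>

theorem theorem2p3p1:
  fixes \<mu> :: nat
    and E :: "nat \<Rightarrow> complex \<Rightarrow> complex"
    and P Q :: "nat \<Rightarrow> nat \<Rightarrow> complex poly"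
    and \<xi> :: complex
  assumes Efun: "\<forall>i<\<mu>. E_function (E i)"
    and coeffs: "\<forall>i<\<mu>. \<forall>j<\<mu>. alg_poly (P i j) \<and> alg_poly (Q i j) \<and> Q i j \<noteq> 0 \<and> coprime (P i j) (Q i j)"
    and system: "\<forall>z. (\<forall>i<\<mu>. \<forall>j<\<mu>. poly (Q i j) z \<noteq> 0) \<longrightarrow>
        (\<forall>i<\<mu>. (E i has_field_derivative
                  (\<Sum>j<\<mu>. poly (P i j) z / poly (Q i j) z * E j z)) (at z))"
    and alg: "algebraic \<xi>"
    and nz: "\<xi> \<noteq> 0"
    and nopole: "\<forall>i<\<mu>. \<forall>j<\<mu>. poly (Q i j) \<xi> \<noteq> 0"
  shows "hom_trdeg_num \<mu> (\<lambda>i. E i \<xi>) = hom_trdeg_fun \<mu> E"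
proof -
  define Dt where "Dt = (\<lambda>i a L C. number_field L \<and> (\<forall>n. a n \<in> L) \<and> C > (0::real) \<and>
        (\<forall>\<sigma> n. field_embedding L \<sigma> \<longrightarrow> cmod (\<sigma> (a n)) \<le> C ^ n) \<and>
        (\<forall>n. \<exists>d::nat. d > 0 \<and> real d \<le> C ^ n \<and> (\<forall>k\<le>n. algebraic_int (of_nat d * a k))) \<and>
        (\<forall>z. (\<lambda>n. a n / of_nat (fact n) * z ^ n) sums E i z))"
  have "\<forall>i. \<exists>a. i < \<mu> \<longrightarrow> (\<exists>L C. Dt i a L C)"
  proof
    fix i
    show "\<exists>a. i < \<mu> \<longrightarrow> (\<exists>L C. Dt i a L C)"
    proof (cases "i < \<mu>")
      case True
      then have "E_function (E i)" using Efun by simp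
      then obtain a L C where "Dt i a L C" unfolding E_function_def Dt_def by (elim exE conjE) simp
      then show ?thesis by (intro exI[of _ a] impI exI[of _ L] exI[of _ C])
    qed simp
  qed
  from choice[OF this] obtain a where a0: "\<forall>i. i < \<mu> \<longrightarrow> (\<exists>L C. Dt i (a i) L C)" ..
  then have "\<forall>i. \<exists>L. i < \<mu> \<longrightarrow> (\<exists>C. Dt i (a i) L C)" by simp
  from choice[OF this] obtain L where L0: "\<forall>i. i < \<mu> \<longrightarrow> (\<exists>C. Dt i (a i) (L i) C)" ..
  then have "\<forall>i. \<exists>C. i < \<mu> \<longrightarrow> Dt i (a i) (L i) C" by simp
  from choice[OF this] obtain C where Dt: "\<forall>i. i < \<mu> \<longrightarrow> Dt i (a i) (L i) (C i)" ..
  define F where "F = (\<lambda>i. Abs_fps (\<lambda>l. a i l / fact l))"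
  have Fs: "(\<lambda>l. fps_nth (F i) l * z ^ l) sums E i z" if "i < \<mu>" for i z
    using Dt[THEN spec, THEN mp, OF that] by (simp add: Dt_def F_def)
  define Ix where "Ix = {..<\<mu>} \<times> {..<\<mu>}"
  have finIx: "finite Ix" by (simp add: Ix_def)
  \<comment> \<open>The product of all denominators. \<open>B i j\<close> is formed by omitting the
    factor Q i j, so no polynomial division occurs.\<close>
  define T where "T = (\<Prod>(k,l)\<in>Ix. Q k l)"
  define B where "B = (\<lambda>i j. P i j * (\<Prod>(k,l)\<in>Ix - {(i,j)}. Q k l))"
  have TB: "Q i j dvd T \<and> B i j * Q i j = T * P i j" if "i < \<mu>" "j < \<mu>" for i j
  proof -
    have "T = Q i j * (\<Prod>(k,l)\<in>Ix - {(i,j)}. Q k l)"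
      unfolding T_def using that finIx by (subst prod.remove[of _ "(i, j)"]) (auto simp: Ix_def)
    then show ?thesis by (simp add: B_def mult_ac)
  qed
  have T0: "poly T \<xi> \<noteq> 0" using nopole finIx by (auto simp: T_def poly_prod Ix_def)
  then have "T \<noteq> 0" by auto
  note sys = system_fps[OF Fs this TB system]
  have num_fun: "hom_indep_fun S E" if "S \<subseteq> {..<\<mu>}" "hom_indep_num S (\<lambda>i. E i \<xi>)" for S
  proof (rule hom_indep_fun_of_num[of S E \<xi>, OF _ that(2) alg])
    show "finite S" using that(1) finite_subset by blast
    show "isCont (E i) z" if "i \<in> S" for i z
      by (rule DERIV_isCont[OF fps_sums_deriv(1)[OF Fs]]) (use that \<open>S \<subseteq> _\<close> in auto)
  qed
  define N1 where "N1 = {card S | S. S \<subseteq> {..<\<mu>} \<and> hom_indep_num S (\<lambda>i. E i \<xi>)}"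
  define N2 where "N2 = {card S | S. S \<subseteq> {..<\<mu>} \<and> hom_indep_fun S E}"
  have sub: "N1 \<subseteq> N2" unfolding N1_def N2_def using num_fun by auto
  have "N2 \<subseteq> card ` Pow {..<\<mu>}" by (auto simp: N2_def)
  then have fin: "finite N2" by (rule finite_subset) simp
  have "hom_indep_num {} (\<lambda>i. E i \<xi>)" by (rule hom_indep_num_small) auto
  then have "card ({} :: nat set) \<in> N1" unfolding N1_def by (intro CollectI exI[of _ "{}"]) simp
  then have ne: "N1 \<noteq> {}" "N2 \<noteq> {}" using sub by auto
  define r where "r = Max N2"
  have "r \<in> N2" unfolding r_def by (rule Max_in[OF fin ne(2)])
  then obtain S where S: "S \<subseteq> {..<\<mu>}" "card S = r" "hom_indep_fun S E" unfolding N2_def by auto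
  have finS: "finite S" using S(1) finite_subset by blast
  \<comment> \<open>Independence of values implies independence of functions, so the maxima agree
    once some r of the values are independent.\<close>
  have "r \<in> N1"
  proof (rule ccontr)
    assume "r \<notin> N1"
    then have dep: "\<not> hom_indep_num U (\<lambda>i. E i \<xi>)" if "U \<subseteq> {..<\<mu>}" "card U = r" for U
      using that unfolding N1_def by auto
    have "r \<noteq> 0" using dep[of "{}"] \<open>hom_indep_num {} (\<lambda>i. E i \<xi>)\<close> by auto
    then obtain s where s: "s \<in> S" using S(2) by fastforce
    \<comment> \<open>r is positive, so some function is not identically zero, and by uniqueness at
      the regular point not all values vanish.\<close>
    have "\<exists>i<\<mu>. E i \<xi> \<noteq> 0"
    proof (rule ccontr)
      assume "\<not> (\<exists>i<\<mu>. E i \<xi> \<noteq> 0)"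
      then have z: "E i \<xi> = 0" if "i < \<mu>" for i using that by simp
      have "E s z = 0" for z
        by (rule system_zero[OF fps_sums_deriv(1)[OF Fs] sys(2) T0 z]) (use s S(1) in auto)
      then show False using hom_indep_fun_nonzero[OF finS S(3) s] by simp
    qed
    then obtain i0 where i0: "i0 < \<mu>" "E i0 \<xi> \<noteq> 0" by blast
    \<comment> \<open>One nonvanishing value already gives an independent set with one
      element.\<close>
    have "r \<noteq> 1"
    proof
      assume "r = 1"
      moreover have "hom_indep_num {i0} (\<lambda>i. E i \<xi>)" by (rule hom_indep_num_small) (use i0 in auto)
      ultimately show False using dep[of "{i0}"] i0 by simp
    qed
    then have r2: "r \<ge> 2" using \<open>r \<noteq> 0\<close> by simp
    define Sb where "Sb = {U. U \<subseteq> {..<\<mu>} \<and> card U = r}"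
    have finSb: "finite Sb" unfolding Sb_def by (rule finite_subset[of _ "Pow {..<\<mu>}"]) auto
    have "\<forall>U\<in>Sb. \<exists>c. hom_poly U c \<and> (\<forall>\<alpha>. algebraic (c \<alpha>)) \<and>
        (\<Sum>\<alpha>\<in>{\<alpha>. c \<alpha> \<noteq> 0}. c \<alpha> * (\<Prod>i\<in>U. E i \<xi> ^ \<alpha> i)) = 0"
    proof
      fix U assume "U \<in> Sb"
      then have "\<not> hom_indep_num U (\<lambda>i. E i \<xi>)" by (intro dep) (auto simp: Sb_def)
      then show "\<exists>c. hom_poly U c \<and> (\<forall>\<alpha>. algebraic (c \<alpha>)) \<and>
        (\<Sum>\<alpha>\<in>{\<alpha>. c \<alpha> \<noteq> 0}. c \<alpha> * (\<Prod>i\<in>U. E i \<xi> ^ \<alpha> i)) = 0" unfolding hom_indep_num_def not_not .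
    qed
    from bchoice[OF this] obtain c where c: "\<forall>U\<in>Sb. hom_poly U (c U) \<and> (\<forall>\<alpha>. algebraic (c U \<alpha>)) \<and>
        (\<Sum>\<alpha>\<in>{\<alpha>. c U \<alpha> \<noteq> 0}. c U \<alpha> * (\<Prod>i\<in>U. E i \<xi> ^ \<alpha> i)) = 0" ..
    \<comment> \<open>One relation for each r-subset, hence finitely many coefficients: they fit
      into a number field K that is fixed before any degree N is chosen.\<close>
    define X where "X = insert \<xi> (\<Union>U\<in>Sb. c U ` {\<alpha>. c U \<alpha> \<noteq> 0})"
    have X: "finite X" "\<And>x. x \<in> X \<Longrightarrow> algebraic x" using finSb c alg by (auto simp: X_def hom_poly_def)
    define Y where "Y = (\<lambda>(i,j). P i j) ` Ix \<union> (\<lambda>(i,j). Q i j) ` Ix"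
    have Y: "finite Y" "\<And>p. p \<in> Y \<Longrightarrow> alg_poly p" using finIx coeffs by (auto simp: Y_def Ix_def)
    have Lnf: "number_field A" if "A \<in> L ` {..<\<mu>}" for A using that Dt by (auto simp: Dt_def)
    have "\<exists>K. number_field K \<and> \<Union>(L ` {..<\<mu>}) \<subseteq> K \<and> X \<subseteq> K \<and> (\<forall>p\<in>Y. \<forall>i. coeff p i \<in> K)"
      by (rule number_field_coeffs[OF _ Lnf X Y]) auto
    then obtain K where Kf: "number_field K" "\<Union>(L ` {..<\<mu>}) \<subseteq> K" "X \<subseteq> K" "\<forall>p\<in>Y. \<forall>i. coeff p i \<in> K"
      by (elim exE conjE)
    obtain R nrm h where "sized_field K R nrm h" using number_field_sized[OF Kf(1)] by (elim exE)
    then interpret sized_field K R nrm h .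
    have FE: "E_fps (F i)" if i: "i < \<mu>" for i
    proof -
      have "\<exists>C'. E_seq (a i) C'"
        by (rule E_seq_of_E_function[of "L i" _ "C i"]) (use Dt[THEN spec, THEN mp, OF i] Kf(2) i in \<open>auto simp: Dt_def\<close>)
      then show ?thesis unfolding E_fps_def F_def by auto
    qed
    have EF: "E i z = fval (F i) z" if "i < \<mu>" for i z
      using sums_unique2[OF Fs[OF that] fval_sums[OF FE[OF that]]] .
    have PQ: "K_poly (P i j)" "K_poly (Q i j)" if "i < \<mu>" "j < \<mu>" for i j
    proof -
      have "P i j \<in> Y" "Q i j \<in> Y" using that by (auto simp: Y_def Ix_def)
      then show "K_poly (P i j)" "K_poly (Q i j)" using Kf(4) by (auto simp: K_poly_def)
    qed
    have prods: "K_poly (\<Prod>(k,l)\<in>J. Q k l)" if "J \<subseteq> Ix" for J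
    proof -
      have "(case x of (k, l) \<Rightarrow> Q k l) \<in> Collect K_poly" if "x \<in> J" for x
        using that \<open>J \<subseteq> Ix\<close> PQ(2) by (auto simp: Ix_def)
      then show ?thesis using is_subring_prod[OF K_poly_subring, of J "\<lambda>(k,l). Q k l"] by simp
    qed
    have KT: "K_poly T" unfolding T_def by (rule prods) simp
    have KB: "K_poly (B i j)" if "i < \<mu>" "j < \<mu>" for i j
      using is_subringD(4)[OF K_poly_subring, of "P i j"] PQ(1)[OF that] prods[of "Ix - {(i, j)}"]
      by (auto simp: B_def)
    show False
    proof (rule rank_drop_impossible[OF _ nz FE EF KT T0 KB sys(1) i0 S(1,2) r2 S(3)])
      show "\<xi> \<in> K" using Kf(3) by (simp add: X_def)
      fix U assume "U \<subseteq> {..<\<mu>}" "card U = r"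
      then have U: "U \<in> Sb" by (simp add: Sb_def)
      have "c U \<alpha> \<in> K" for \<alpha>
      proof (cases "c U \<alpha> = 0")
        case True
        then show ?thesis using is_subringD(1)[OF number_field_subring[OF Kf(1)]] by simp
      next
        case False
        then have "c U \<alpha> \<in> X" unfolding X_def using U by auto
        then show ?thesis using Kf(3) by blast
      qed
      then show "\<exists>c. hom_poly U c \<and> (\<forall>\<alpha>. c \<alpha> \<in> K) \<and> (\<Sum>\<alpha>\<in>{\<alpha>. c \<alpha> \<noteq> 0}. c \<alpha> * (\<Prod>i\<in>U. E i \<xi> ^ \<alpha> i)) = 0"
        using c[THEN bspec, OF U] by (intro exI[of _ "c U"] conjI allI) simp_all
    qed auto
  qed
  then have "r \<le> Max N1" using finite_subset[OF sub fin] by simp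
  moreover have "Max N1 \<le> r" unfolding r_def by (rule Max_mono[OF sub ne(1) fin])
  ultimately show ?thesis unfolding hom_trdeg_num_def hom_trdeg_fun_def N1_def[symmetric] N2_def[symmetric] r_def by simp
qed

end
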